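(* The assignment of jet bundles to line bundles, $L\mapsto J^1L$ with its canonical contact structure, and of jet lifts to factors, $(B:L_1\to L_2)\mapsto(J^1B:J^1L_2\dashrightarrow J^1L_1)$, is a contravariant functor $J^1:\mathsf{Line}_{\mathsf{Man}}\to\mathsf{Cont}_{\mathsf{Man}}$. That is: each $J^1B$ is a Legendrian relation; the identity factor $\mathrm{id}_L$ is sent to the diagonal relation on $J^1L$; and for all composable factors $B:L_1\to L_2$, $B':L_2\to L_3$ one has $J^1(B'\circ B)=J^1B\circ J^1B'$ as composition of relations.
   Context: $\mathsf{Line}_{\mathsf{Man}}$: objects are line bundles (real vector bundles of rank 1 over smooth manifolds), morphisms are factors: vector bundle morphisms $B$ covering a smooth map $b$ and restricting to linear isomorphisms $B_x$ on fibres. Pull-back of sections: $(B^*s)(x)=B_x^{-1}(s(b(x)))$. Line product: for line bundles $L_i\to M_i$, the base product $M_1\underline{\times}M_2$ is the manifold of all linear isomorphisms $C_{x_1x_2}:(L_1)_{x_1}\to(L_2)_{x_2}$, with projections $p_i$ to $M_i$; $L_1\overline{\times}L_2:=p_1^*L_1$, with projection factors $P_1(C,l)=l$, $P_2(C,l)=C(l)$. Der and jet bundles: $D_xL$ is the space of $\mathbb{R}$-linear $a_x:\Gamma(L)\to L_x$ with $a_x(fs)=f(x)a_x(s)+\delta(a_x)[f]s(x)$ for some $\delta(a_x)\in T_xQ$; sections of $DL$ are derivations with the commutator bracket. $\pi:J^1L=(DL)^*\otimes L\to Q$, $J^1_xL=\mathrm{Hom}(D_xL,L_x)$, $j^1_xs(a)=a(s)$;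 $L_{J^1L}:=\pi^*L$. For a factor $B$, $(D_xB\,a)(s)=B_x(a(B^*s))$. Jet lift: $J^1B\subset J^1L_1\underline{\times}J^1L_2$ (base product of $L_{J^1L_1}$ and $L_{J^1L_2}$) is the set of $C_{\alpha\beta}:(L_1)_{q_1}\to(L_2)_{q_2}$, $\alpha\in J^1_{q_1}L_1$, $\beta\in J^1_{q_2}L_2$, with $q_2=b(q_1)$, $\alpha=B_{q_1}^{-1}\circ\beta\circ D_{q_1}B$, $C_{\alpha\beta}=B_{q_1}$. It is regarded as a relation $J^1L_2\dashrightarrow J^1L_1$. The composition $J^1B\circ J^1B'$ consists of all $C'_{\beta\gamma}\circ C_{\alpha\beta}\in J^1L_1\underline{\times}J^1L_3$ with $C_{\alpha\beta}\in J^1B$ and $C'_{\beta\gamma}\in J^1B'$. The diagonal relation on $J^1L$ is the set of fibre-wise identity maps $\{\mathrm{id}:(L_{J^1L})_\alpha\to(L_{J^1L})_\alpha\}\subset J^1L\underline{\times}J^1L$. Jacobi structures: a Jacobi structure on $L\to M$ is a Lie bracket on $\Gamma(L)$ that is a first-order differential operator in each argument; then $\{s,fr\}=f\{s,r\}+X_s[f]r$; $\Pi^\sharp:J^1L\to DL$, $\Pi^\sharp(j^1s)=\{s,\cdot\}$; $\Lambda^\sharp(df\otimes s)=X_{fs}-fX_s$. It is non-degenerate if $\Pi^\sharp$ is an isomorphism; this is equivalent to a contact structure, with hyperplane distribution $H=\Lambda^\sharp(T^*M\otimes L)$. $L^{\mathrm{op}}$ denotes $L$ with bracket $-\{\cdot,\cdot\}$.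 The canonical contact (non-degenerate Jacobi) structure on $L_{J^1L}$ is the unique Jacobi structure with $\{l_a,l_b\}=l_{[a,b]}$, $\{l_a,\pi^*s\}=\pi^*(a[s])$, $\{\pi^*s,\pi^*r\}=0$, where $l_a(\alpha_q)=\alpha_q(a(q))$. The product Jacobi structure on $L_1\overline{\times}L_2$ is the unique one with $\{P_i^*s_i,P_i^*s_i'\}=P_i^*\{s_i,s_i'\}_i$ and $\{P_1^*s_1,P_2^*s_2\}=0$. A submanifold $S$ is Legendrian if $TS\subset H$ and it is coisotropic, i.e. for all $x\in S$, $\Pi^\sharp_x$ maps $\{\alpha\in J^1_xL:\alpha|_{D_x(L|_S)}=0\}$ into $D_x(L|_S)$. $\mathsf{Cont}_{\mathsf{Man}}$ has contact manifolds (equivalently non-degenerate Jacobi structures) as objects and, as morphisms, Legendrian relations: Legendrian submanifolds of base products $M_1\underline{\times}M_2$ for the product Jacobi structure on $L_1\overline{\times}L_2^{\mathrm{op}}$ (composition being only partially defined in general, as in the Weinstein symplectic category, due to clean-intersection issues). *)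

theory Defs
  imports "HOL-Analysis.Analysis"
begin

section \<open>Model spaces and smooth maps between them\<close>

text \<open>Finite-dimensional inner product spaces are the model spaces of manifolds. In contrast to
  \<^class>\<open>euclidean_space\<close>, dimension 0 is allowed. The dimension of a manifold is that of its
  model type. (\<^const>\<open>span\<close> cannot be used within the class specification.)\<close>

class findim = real_inner +
  assumes finitely_generated: "\<exists>B. finite B \<and>
    (\<forall>S. B \<subseteq> S \<and> 0 \<in> S \<and> (\<forall>x\<in>S. \<forall>y\<in>S. x + y \<in> S) \<and> (\<forall>c. \<forall>x\<in>S. c *\<^sub>R x \<in> S) \<longrightarrow> S = UNIV)"

lemma finite_spanning: "\<exists>B::'a::findim set. finite B \<and> span B = UNIV"
proof -
  obtain B :: "'a set" where B: "finite B"
    "\<And>S. B \<subseteq> S \<Longrightarrow> 0 \<in> S \<Longrightarrow> \<forall>x\<in>S. \<forall>y\<in>S. x + y \<in> S \<Longrightarrow> \<forall>c. \<forall>x\<in>S. c *\<^sub>R x \<in> S \<Longrightarrow> S = UNIV"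
    using finitely_generated by metis
  have "span B = UNIV"
    by (rule B(2)) (auto simp: span_base span_zero span_add span_scale)
  with B(1) show ?thesis by blast
qed

lemma findim_intro:
  assumes "finite B" "span B = (UNIV :: 'a::real_inner set)"
  shows "\<exists>B::'a set. finite B \<and>
    (\<forall>S. B \<subseteq> S \<and> 0 \<in> S \<and> (\<forall>x\<in>S. \<forall>y\<in>S. x + y \<in> S) \<and> (\<forall>c. \<forall>x\<in>S. c *\<^sub>R x \<in> S) \<longrightarrow> S = UNIV)"
proof (intro exI[of _ B] conjI allI impI)
  fix S :: "'a set"
  assume S: "B \<subseteq> S \<and> 0 \<in> S \<and> (\<forall>x\<in>S. \<forall>y\<in>S. x + y \<in> S) \<and> (\<forall>c. \<forall>x\<in>S. c *\<^sub>R x \<in> S)"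
  then have "subspace S" by (auto simp: subspace_def)
  with S have "span B \<subseteq> S" by (auto intro: span_minimal[THEN subsetD])
  with assms show "S = UNIV" by auto
qed (rule assms(1))

instance euclidean_space \<subseteq> findim
  by standard (rule findim_intro[OF finite_Basis span_Basis])

instance prod :: (findim, findim) findim
proof
  obtain A :: "'a set" where A: "finite A" "span A = UNIV"
    using finite_spanning by blast
  obtain B :: "'b set" where B: "finite B" "span B = UNIV"
    using finite_spanning by blast
  let ?C = "(\<lambda>a. (a, 0)) ` A \<union> (\<lambda>b. (0, b)) ` B"
  have lA: "linear (\<lambda>a::'a. (a, 0::'b))" and lB: "linear (\<lambda>b::'b. (0::'a, b))"
    by (auto intro!: linearI)
  have "(a, b) \<in> span ?C" for a b
  proof -
    have "(a, 0) \<in> span ?C"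
      using linear_span_image[OF lA, of A] A span_mono[of "(\<lambda>a. (a, 0)) ` A" ?C] by auto
    moreover have "(0, b) \<in> span ?C"
      using linear_span_image[OF lB, of B] B span_mono[of "(\<lambda>b. (0, b)) ` B" ?C] by auto
    ultimately have "(a, 0) + (0, b) \<in> span ?C"
      by (rule span_add)
    then show ?thesis by simp
  qed
  then have "span ?C = UNIV" by auto
  with A(1) B(1) show "\<exists>B::('a \<times> 'b) set. finite B \<and>
    (\<forall>S. B \<subseteq> S \<and> 0 \<in> S \<and> (\<forall>x\<in>S. \<forall>y\<in>S. x + y \<in> S) \<and> (\<forall>c. \<forall>x\<in>S. c *\<^sub>R x \<in> S) \<longrightarrow> S = UNIV)"
    by (intro findim_intro[of ?C]) auto
qed

text \<open>The type \<^typ>\<open>unit\<close> serves as the model space of dimension 0.\<close>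

instantiation unit :: real_inner
begin
definition plus_unit :: "unit \<Rightarrow> unit \<Rightarrow> unit" where "plus_unit x y = ()"
definition minus_unit :: "unit \<Rightarrow> unit \<Rightarrow> unit" where "minus_unit x y = ()"
definition uminus_unit :: "unit \<Rightarrow> unit" where "uminus_unit x = ()"
definition zero_unit :: unit where "zero_unit = ()"
definition scaleR_unit :: "real \<Rightarrow> unit \<Rightarrow> unit" where "scaleR_unit c x = ()"
definition norm_unit :: "unit \<Rightarrow> real" where "norm_unit x = 0"
definition sgn_unit :: "unit \<Rightarrow> unit" where "sgn_unit x = ()"
definition dist_unit :: "unit \<Rightarrow> unit \<Rightarrow> real" where "dist_unit x y = 0"
definition inner_unit :: "unit \<Rightarrow> unit \<Rightarrow> real" where "inner_unit x y = 0"
definition uniformity_unit :: "(unit \<times> unit) filter"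
  where "uniformity_unit = (INF e\<in>{0<..}. principal {(x, y). dist x y < e})"
definition open_unit :: "unit set \<Rightarrow> bool"
  where "open_unit U \<longleftrightarrow> (\<forall>x\<in>U. \<forall>\<^sub>F (x', y) in uniformity. x' = x \<longrightarrow> y \<in> U)"
instance
  by standard
    (auto simp: norm_unit_def dist_unit_def inner_unit_def uniformity_unit_def open_unit_def)
end

instance unit :: findim
  by standard (rule exI[of _ "{}"], auto)

primrec ck_on :: "nat \<Rightarrow> 'a::findim set \<Rightarrow> ('a \<Rightarrow> 'b::real_normed_vector) \<Rightarrow> bool" where
  "ck_on 0 S f \<longleftrightarrow> continuous_on S f"
| "ck_on (Suc k) S f \<longleftrightarrow>
     (\<forall>x\<in>S. f differentiable (at x)) \<and> (\<forall>v. ck_on k S (\<lambda>x. frechet_derivative f (at x) v))"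

text \<open>To be used on open sets only.\<close>

definition smooth_on :: "'a::findim set \<Rightarrow> ('a \<Rightarrow> 'b::real_normed_vector) \<Rightarrow> bool" where
  "smooth_on S f \<longleftrightarrow> (\<forall>k. ck_on k S f)"


section \<open>Smooth manifolds\<close>

text \<open>A manifold is a set of points with a (not necessarily maximal) smooth atlas. Charts are pairs of
  a domain and a coordinate map; the topology is the one induced by the atlas.\<close>

record ('m, 'e) manifold =
  pts :: "'m set"
  charts :: "('m set \<times> ('m \<Rightarrow> 'e)) set"

definition mtop :: "('m, 'e::findim) manifold \<Rightarrow> 'm topology" where
  "mtop M = topology (\<lambda>W. W \<subseteq> pts M \<and> (\<forall>(U, \<phi>)\<in>charts M. open (\<phi> ` (U \<inter> W))))"

definition compatible :: "'m set \<times> ('m \<Rightarrow> 'e::findim) \<Rightarrow> 'm set \<times> ('m \<Rightarrow> 'e) \<Rightarrow> bool" where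
  "compatible c d \<longleftrightarrow> (case (c, d) of ((U, \<phi>), (V, \<psi>)) \<Rightarrow>
     open (\<phi> ` (U \<inter> V)) \<and> open (\<psi> ` (U \<inter> V)) \<and>
     smooth_on (\<phi> ` (U \<inter> V)) (\<psi> \<circ> inv_into U \<phi>) \<and>
     smooth_on (\<psi> ` (U \<inter> V)) (\<phi> \<circ> inv_into V \<psi>))"

text \<open>The charts of the maximal atlas.\<close>

definition smooth_chart :: "('m, 'e::findim) manifold \<Rightarrow> 'm set \<times> ('m \<Rightarrow> 'e) \<Rightarrow> bool" where
  "smooth_chart M c \<longleftrightarrow> (case c of (U, \<phi>) \<Rightarrow>
     U \<subseteq> pts M \<and> inj_on \<phi> U \<and> open (\<phi> ` U) \<and> (\<forall>d\<in>charts M. compatible c d))"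

definition smooth_manifold :: "('m, 'e::findim) manifold \<Rightarrow> bool" where
  "smooth_manifold M \<longleftrightarrow>
     (\<forall>c\<in>charts M. smooth_chart M c) \<and> pts M = (\<Union>(U, \<phi>)\<in>charts M. U) \<and>
     Hausdorff_space (mtop M) \<and> second_countable (mtop M)"

definition smooth_fun_on :: "('m, 'e::findim) manifold \<Rightarrow> 'm set \<Rightarrow> ('m \<Rightarrow> real) \<Rightarrow> bool" where
  "smooth_fun_on M W f \<longleftrightarrow> (\<forall>(U, \<phi>)\<in>charts M. smooth_on (\<phi> ` (U \<inter> W)) (f \<circ> inv_into U \<phi>))"

definition smooth_map :: "('m, 'e::findim) manifold \<Rightarrow> ('n, 'f::findim) manifold \<Rightarrow> ('m \<Rightarrow> 'n) \<Rightarrow> bool"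
  where "smooth_map M N b \<longleftrightarrow> b ` pts M \<subseteq> pts N \<and>
    (\<forall>(U, \<phi>)\<in>charts M. \<forall>(V, \<psi>)\<in>charts N.
       open (\<phi> ` (U \<inter> b -` V)) \<and> smooth_on (\<phi> ` (U \<inter> b -` V)) (\<psi> \<circ> b \<circ> inv_into U \<phi>))"

text \<open>Functions, sections and functionals that are only meaningful on a given set are
  made extensional by the value 0 outside it, so that they form vector spaces under pointwise
  operations.\<close>

definition restrict0 :: "'a set \<Rightarrow> ('a \<Rightarrow> 'b::zero) \<Rightarrow> 'a \<Rightarrow> 'b" where
  "restrict0 A f = (\<lambda>x. if x \<in> A then f x else 0)"

definition zero_off :: "'a set \<Rightarrow> ('a \<Rightarrow> 'b::zero) \<Rightarrow> bool" where
  "zero_off A f \<longleftrightarrow> (\<forall>x. x \<notin> A \<longrightarrow> f x = 0)"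

definition Cinf :: "('m, 'e::findim) manifold \<Rightarrow> ('m \<Rightarrow> real) set" where
  "Cinf M = {f. zero_off (pts M) f \<and> smooth_fun_on M (pts M) f}"

text \<open>Linearity of a map defined on a vector space of vector-valued functions.\<close>

definition linear_funct :: "('i \<Rightarrow> 'v::real_vector) set \<Rightarrow> (('i \<Rightarrow> 'v) \<Rightarrow> 'w::real_vector) \<Rightarrow> bool" where
  "linear_funct A T \<longleftrightarrow>
     (\<forall>f\<in>A. \<forall>g\<in>A. T (\<lambda>y. f y + g y) = T f + T g) \<and>
     (\<forall>c. \<forall>f\<in>A. T (\<lambda>y. c *\<^sub>R f y) = c *\<^sub>R T f)"

text \<open>Tangent vectors at \<^term>\<open>x\<close> are the point derivations of an algebra \<^term>\<open>F\<close> of smooth functions.\<close>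

definition point_derivations :: "('m \<Rightarrow> real) set \<Rightarrow> 'm \<Rightarrow> (('m \<Rightarrow> real) \<Rightarrow> real) set" where
  "point_derivations F x = {\<delta>. zero_off F \<delta> \<and> linear_funct F \<delta> \<and>
     (\<forall>f\<in>F. \<forall>g\<in>F. \<delta> (\<lambda>y. f y * g y) = f x * \<delta> g + \<delta> f * g x)}"

definition tangent :: "('m, 'e::findim) manifold \<Rightarrow> 'm \<Rightarrow> (('m \<Rightarrow> real) \<Rightarrow> real) set" where
  "tangent M x = point_derivations (Cinf M) x"

text \<open>Embedded submanifolds, by slice charts.\<close>

definition submanifold :: "('m, 'e::findim) manifold \<Rightarrow> 'm set \<Rightarrow> bool" where
  "submanifold M S \<longleftrightarrow> S \<subseteq> pts M \<and>
     (\<exists>k. \<forall>x\<in>S. \<exists>W \<psi> V. smooth_chart M (W, \<psi>) \<and> x \<in> W \<and> subspace V \<and> dim V = k \<and>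
        \<psi> ` (S \<inter> W) = \<psi> ` W \<inter> V)"

definition Cinf_sub :: "('m, 'e::findim) manifold \<Rightarrow> 'm set \<Rightarrow> ('m \<Rightarrow> real) set" where
  "Cinf_sub M S = {f. zero_off S f \<and>
     (\<forall>x\<in>S. \<exists>W g. openin (mtop M) W \<and> x \<in> W \<and> smooth_fun_on M W g \<and> (\<forall>y\<in>S \<inter> W. f y = g y))}"

text \<open>The tangent space of a submanifold, as the image of the differential of its inclusion.\<close>

definition tangent_sub :: "('m, 'e::findim) manifold \<Rightarrow> 'm set \<Rightarrow> 'm \<Rightarrow> (('m \<Rightarrow> real) \<Rightarrow> real) set" where
  "tangent_sub M S x =
     {restrict0 (Cinf M) (\<lambda>f. \<delta> (restrict0 S f)) | \<delta>. \<delta> \<in> point_derivations (Cinf_sub M S) x}"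


section \<open>Line bundles and factors\<close>

text \<open>A line bundle is a family of 1-dimensional real vector spaces over the points of a manifold,
  with smoothly related local frames. The fibres are taken to be subspaces of some real vector space
  without topology, which is no restriction (any family of vector spaces embeds in its direct sum).
  Fibres over different points need not be disjoint: points of the total space are
  pairs \<open>(x, l)\<close> with \<open>l \<in> fibre L x\<close>, and the fibres of a pull-back are literally the original ones.\<close>

record ('m, 'e, 'l) line_bundle =
  base :: "('m, 'e) manifold"
  fibre :: "'m \<Rightarrow> 'l set"
  frames :: "('m set \<times> ('m \<Rightarrow> 'l)) set"

definition line_bundle :: "('m, 'e::findim, 'l::real_vector) line_bundle \<Rightarrow> bool" where
  "line_bundle L \<longleftrightarrow> smooth_manifold (base L) \<and>
     (\<forall>x\<in>pts (base L). subspace (fibre L x) \<and> dim (fibre L x) = 1) \<and>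
     pts (base L) = (\<Union>(U, e)\<in>frames L. U) \<and>
     (\<forall>(U, e)\<in>frames L. openin (mtop (base L)) U \<and> (\<forall>x\<in>U. e x \<in> fibre L x \<and> e x \<noteq> 0)) \<and>
     (\<forall>(U, e)\<in>frames L. \<forall>(V, e')\<in>frames L.
        \<exists>g. smooth_fun_on (base L) (U \<inter> V) g \<and> (\<forall>x\<in>U \<inter> V. e' x = g x *\<^sub>R e x))"

definition smooth_section_on ::
  "('m, 'e::findim, 'l::real_vector) line_bundle \<Rightarrow> 'm set \<Rightarrow> ('m \<Rightarrow> 'l) \<Rightarrow> bool" where
  "smooth_section_on L W s \<longleftrightarrow> (\<forall>x\<in>W. s x \<in> fibre L x) \<and>
     (\<forall>(U, e)\<in>frames L. \<exists>g. smooth_fun_on (base L) (U \<inter> W) g \<and> (\<forall>x\<in>U \<inter> W. s x = g x *\<^sub>R e x))"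

definition sections :: "('m, 'e::findim, 'l::real_vector) line_bundle \<Rightarrow> ('m \<Rightarrow> 'l) set" where
  "sections L = {s. zero_off (pts (base L)) s \<and> smooth_section_on L (pts (base L)) s}"

definition linear_iso_on :: "'v::real_vector set \<Rightarrow> 'w::real_vector set \<Rightarrow> ('v \<Rightarrow> 'w) \<Rightarrow> bool" where
  "linear_iso_on V W C \<longleftrightarrow> bij_betw C V W \<and>
     (\<forall>u\<in>V. \<forall>v\<in>V. C (u + v) = C u + C v) \<and> (\<forall>c. \<forall>v\<in>V. C (c *\<^sub>R v) = c *\<^sub>R C v)"

text \<open>A bundle map is given by the base map \<open>b\<close> and the family of fibre maps \<open>B\<^sub>x\<close>.\<close>

type_synonym ('m, 'l, 'n, 'k) bundle_map = "('m \<Rightarrow> 'n) \<times> ('m \<Rightarrow> 'l \<Rightarrow> 'k)"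

definition factor ::
  "('m, 'e::findim, 'l::real_vector) line_bundle \<Rightarrow> ('n, 'f::findim, 'k::real_vector) line_bundle \<Rightarrow>
   ('m, 'l, 'n, 'k) bundle_map \<Rightarrow> bool" where
  "factor L\<^sub>1 L\<^sub>2 bB \<longleftrightarrow> (case bB of (b, B) \<Rightarrow>
     smooth_map (base L\<^sub>1) (base L\<^sub>2) b \<and>
     (\<forall>x\<in>pts (base L\<^sub>1). linear_iso_on (fibre L\<^sub>1 x) (fibre L\<^sub>2 (b x)) (B x)) \<and>
     (\<forall>(U, e)\<in>frames L\<^sub>1. \<forall>(V, e')\<in>frames L\<^sub>2.
        \<exists>g. smooth_fun_on (base L\<^sub>1) (U \<inter> b -` V) g \<and>
            (\<forall>x\<in>U \<inter> b -` V. B x (e x) = g x *\<^sub>R e' (b x))))"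

definition id_factor :: "('m, 'l, 'm, 'l) bundle_map" where
  "id_factor = (\<lambda>x. x, \<lambda>x l. l)"

definition comp_factor ::
  "('n, 'k, 'p, 'j) bundle_map \<Rightarrow> ('m, 'l, 'n, 'k) bundle_map \<Rightarrow> ('m, 'l, 'p, 'j) bundle_map" where
  "comp_factor B' B = (fst B' \<circ> fst B, \<lambda>x. snd B' (fst B x) \<circ> snd B x)"

text \<open>The pull-back of sections \<open>B\<^sup>* s\<close> along a factor \<open>B\<close> with domain \<open>L\<^sub>1\<close>.\<close>

definition pull_section ::
  "('m, 'e::findim, 'l::real_vector) line_bundle \<Rightarrow> ('m, 'l, 'n, 'k) bundle_map \<Rightarrow>
   ('n \<Rightarrow> 'k) \<Rightarrow> 'm \<Rightarrow> 'l" where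
  "pull_section L\<^sub>1 B s =
     restrict0 (pts (base L\<^sub>1)) (\<lambda>x. inv_into (fibre L\<^sub>1 x) (snd B x) (s (fst B x)))"

definition pull_bundle ::
  "('n, 'f::findim) manifold \<Rightarrow> ('n \<Rightarrow> 'm) \<Rightarrow> ('m, 'e::findim, 'l::real_vector) line_bundle \<Rightarrow>
   ('n, 'f, 'l) line_bundle" where
  "pull_bundle N b L = \<lparr>base = N, fibre = fibre L \<circ> b,
     frames = {(pts N \<inter> b -` U, e \<circ> b) | U e. (U, e) \<in> frames L}\<rparr>"

text \<open>For \<open>u \<noteq> 0\<close> spanning a line containing \<open>v\<close>: the coordinate of \<open>v\<close> with respect to \<open>u\<close>.\<close>

definition coord :: "'v::real_vector \<Rightarrow> 'v \<Rightarrow> real" where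
  "coord u v = (THE c. v = c *\<^sub>R u)"


section \<open>The line product\<close>

text \<open>A linear isomorphism \<open>C\<close> from the fibre over \<open>x\<^sub>1\<close> to the fibre over \<open>x\<^sub>2\<close> is encoded
  as \<open>(x\<^sub>1, x\<^sub>2, C)\<close>. Local coordinates are those of \<open>x\<^sub>1\<close> and \<open>x\<^sub>2\<close> and the matrix entry
  of \<open>C\<close> in local frames.\<close>

definition base_product ::
  "('m, 'e::findim, 'l::real_vector) line_bundle \<Rightarrow> ('n, 'f::findim, 'k::real_vector) line_bundle \<Rightarrow>
   ('m \<times> 'n \<times> ('l \<Rightarrow> 'k), 'e \<times> 'f \<times> real) manifold" where
  "base_product L\<^sub>1 L\<^sub>2 = (let P = {(x\<^sub>1, x\<^sub>2, C). x\<^sub>1 \<in> pts (base L\<^sub>1) \<and> x\<^sub>2 \<in> pts (base L\<^sub>2) \<and>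
         zero_off (fibre L\<^sub>1 x\<^sub>1) C \<and> linear_iso_on (fibre L\<^sub>1 x\<^sub>1) (fibre L\<^sub>2 x\<^sub>2) C}
     in \<lparr>pts = P,
         charts = {(P \<inter> {(x\<^sub>1, x\<^sub>2, C). x\<^sub>1 \<in> U\<^sub>1 \<inter> V\<^sub>1 \<and> x\<^sub>2 \<in> U\<^sub>2 \<inter> V\<^sub>2},
                    \<lambda>(x\<^sub>1, x\<^sub>2, C). (\<phi>\<^sub>1 x\<^sub>1, \<phi>\<^sub>2 x\<^sub>2, coord (e\<^sub>2 x\<^sub>2) (C (e\<^sub>1 x\<^sub>1)))) | U\<^sub>1 \<phi>\<^sub>1 V\<^sub>1 e\<^sub>1 U\<^sub>2 \<phi>\<^sub>2 V\<^sub>2 e\<^sub>2.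
                   (U\<^sub>1, \<phi>\<^sub>1) \<in> charts (base L\<^sub>1) \<and> (V\<^sub>1, e\<^sub>1) \<in> frames L\<^sub>1 \<and>
                   (U\<^sub>2, \<phi>\<^sub>2) \<in> charts (base L\<^sub>2) \<and> (V\<^sub>2, e\<^sub>2) \<in> frames L\<^sub>2}\<rparr>)"

definition line_product ::
  "('m, 'e::findim, 'l::real_vector) line_bundle \<Rightarrow> ('n, 'f::findim, 'k::real_vector) line_bundle \<Rightarrow>
   ('m \<times> 'n \<times> ('l \<Rightarrow> 'k), 'e \<times> 'f \<times> real, 'l) line_bundle" where
  "line_product L\<^sub>1 L\<^sub>2 = pull_bundle (base_product L\<^sub>1 L\<^sub>2) fst L\<^sub>1"

definition proj1 :: "('m \<times> 'n \<times> ('l \<Rightarrow> 'k), 'l, 'm, 'l) bundle_map" where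
  "proj1 = (\<lambda>(x\<^sub>1, x\<^sub>2, C). x\<^sub>1, \<lambda>(x\<^sub>1, x\<^sub>2, C) l. l)"

definition proj2 :: "('m \<times> 'n \<times> ('l \<Rightarrow> 'k), 'l, 'n, 'k) bundle_map" where
  "proj2 = (\<lambda>(x\<^sub>1, x\<^sub>2, C). x\<^sub>2, \<lambda>(x\<^sub>1, x\<^sub>2, C) l. C l)"


section \<open>Derivations and jets\<close>

text \<open>The derivations at \<open>x\<close>, with values in \<open>V\<close>, of a module \<open>G\<close> of sections over an algebra
  \<open>F\<close> of functions.\<close>

definition section_derivations ::
  "('m \<Rightarrow> real) set \<Rightarrow> ('m \<Rightarrow> 'l::real_vector) set \<Rightarrow> 'l set \<Rightarrow> 'm \<Rightarrow> (('m \<Rightarrow> 'l) \<Rightarrow> 'l) set" where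
  "section_derivations F G V x = {a. zero_off G a \<and> (\<forall>s\<in>G. a s \<in> V) \<and> linear_funct G a \<and>
     (\<exists>\<delta>\<in>point_derivations F x. \<forall>f\<in>F. \<forall>s\<in>G. a (\<lambda>y. f y *\<^sub>R s y) = f x *\<^sub>R a s + \<delta> f *\<^sub>R s x)}"

definition Der :: "('m, 'e::findim, 'l::real_vector) line_bundle \<Rightarrow> 'm \<Rightarrow> (('m \<Rightarrow> 'l) \<Rightarrow> 'l) set" where
  "Der L x = section_derivations (Cinf (base L)) (sections L) (fibre L x) x"

definition symbol ::
  "('m, 'e::findim, 'l::real_vector) line_bundle \<Rightarrow> 'm \<Rightarrow> (('m \<Rightarrow> 'l) \<Rightarrow> 'l) \<Rightarrow> ('m \<Rightarrow> real) \<Rightarrow> real" where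
  "symbol L x a = (THE \<delta>. \<delta> \<in> tangent (base L) x \<and> (\<forall>f\<in>Cinf (base L). \<forall>s\<in>sections L.
     a (\<lambda>y. f y *\<^sub>R s y) = f x *\<^sub>R a s + \<delta> f *\<^sub>R s x))"

definition Der_map ::
  "('m, 'e::findim, 'l::real_vector) line_bundle \<Rightarrow> ('n, 'f::findim, 'k::real_vector) line_bundle \<Rightarrow>
   ('m, 'l, 'n, 'k) bundle_map \<Rightarrow> 'm \<Rightarrow> (('m \<Rightarrow> 'l) \<Rightarrow> 'l) \<Rightarrow> ('n \<Rightarrow> 'k) \<Rightarrow> 'k" where
  "Der_map L\<^sub>1 L\<^sub>2 B x a = restrict0 (sections L\<^sub>2) (\<lambda>s. snd B x (a (pull_section L\<^sub>1 B s)))"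

text \<open>Global derivations are operators on sections; they are the smooth sections of the bundle of
  derivations.\<close>

definition derivations ::
  "('m, 'e::findim, 'l::real_vector) line_bundle \<Rightarrow> (('m \<Rightarrow> 'l) \<Rightarrow> 'm \<Rightarrow> 'l) set" where
  "derivations L = {a. (\<forall>s\<in>sections L. a s \<in> sections L) \<and> (\<forall>s. s \<notin> sections L \<longrightarrow> a s = (\<lambda>x. 0)) \<and>
     (\<forall>x\<in>pts (base L). (\<lambda>s. a s x) \<in> Der L x)}"

definition commutator ::
  "(('m \<Rightarrow> 'l::real_vector) \<Rightarrow> 'm \<Rightarrow> 'l) \<Rightarrow> (('m \<Rightarrow> 'l) \<Rightarrow> 'm \<Rightarrow> 'l) \<Rightarrow> ('m \<Rightarrow> 'l) \<Rightarrow> 'm \<Rightarrow> 'l" where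
  "commutator a b = (\<lambda>s x. a (b s) x - b (a s) x)"

definition Jet ::
  "('m, 'e::findim, 'l::real_vector) line_bundle \<Rightarrow> 'm \<Rightarrow> ((('m \<Rightarrow> 'l) \<Rightarrow> 'l) \<Rightarrow> 'l) set" where
  "Jet L x = {\<alpha>. zero_off (Der L x) \<alpha> \<and> (\<forall>a\<in>Der L x. \<alpha> a \<in> fibre L x) \<and> linear_funct (Der L x) \<alpha>}"

definition jet ::
  "('m, 'e::findim, 'l::real_vector) line_bundle \<Rightarrow> ('m \<Rightarrow> 'l) \<Rightarrow> 'm \<Rightarrow> (('m \<Rightarrow> 'l) \<Rightarrow> 'l) \<Rightarrow> 'l" where
  "jet L s x = restrict0 (Der L x) (\<lambda>a. a s)"

text \<open>A chart \<open>(U, \<phi>)\<close> of the base and a local frame \<open>(V, e)\<close> determine a local frame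
  of the bundle of derivations: the derivations \<open>f e \<mapsto> (\<partial>\<^sub>v f) e\<close>, for \<open>v\<close> in the model
  space, and the identity \<open>f e \<mapsto> f e\<close>. The bundle charts of the jet bundle are given by the
  components with respect to the dual frame, where the components \<open>v \<mapsto> \<alpha> (\<partial>\<^sub>v)\<close> are
  collected in a vector \<open>p\<close> by means of the inner product.\<close>

definition partial_der ::
  "('m, 'e::findim, 'l::real_vector) line_bundle \<Rightarrow> 'm set \<times> ('m \<Rightarrow> 'e) \<Rightarrow> ('m \<Rightarrow> 'l) \<Rightarrow> 'm \<Rightarrow> 'e \<Rightarrow>
   ('m \<Rightarrow> 'l) \<Rightarrow> 'l" where
  "partial_der L c e q v = restrict0 (sections L) (\<lambda>s. frechet_derivative
     ((\<lambda>y. coord (e y) (s y)) \<circ> inv_into (fst c) (snd c)) (at (snd c q)) v *\<^sub>R e q)"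

definition id_der ::
  "('m, 'e::findim, 'l::real_vector) line_bundle \<Rightarrow> 'm \<Rightarrow> ('m \<Rightarrow> 'l) \<Rightarrow> 'l" where
  "id_der L q = restrict0 (sections L) (\<lambda>s. s q)"

type_synonym ('m, 'l) jet_pt = "'m \<times> ((('m \<Rightarrow> 'l) \<Rightarrow> 'l) \<Rightarrow> 'l)"

definition jet_chart ::
  "('m, 'e::findim, 'l::real_vector) line_bundle \<Rightarrow> 'm set \<times> ('m \<Rightarrow> 'e) \<Rightarrow> ('m \<Rightarrow> 'l) \<Rightarrow>
   ('m, 'l) jet_pt \<Rightarrow> 'e \<times> 'e \<times> real" where
  "jet_chart L c e = (\<lambda>(q, \<alpha>). (snd c q,
     THE p. \<forall>v. inner p v = coord (e q) (\<alpha> (partial_der L c e q v)),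
     coord (e q) (\<alpha> (id_der L q))))"

definition jet_manifold ::
  "('m, 'e::findim, 'l::real_vector) line_bundle \<Rightarrow> (('m, 'l) jet_pt, 'e \<times> 'e \<times> real) manifold" where
  "jet_manifold L = \<lparr>pts = {(q, \<alpha>). q \<in> pts (base L) \<and> \<alpha> \<in> Jet L q},
     charts = {({(q, \<alpha>). q \<in> U \<inter> V \<and> \<alpha> \<in> Jet L q}, jet_chart L (U, \<phi>) e) | U \<phi> V e.
       (U, \<phi>) \<in> charts (base L) \<and> (V, e) \<in> frames L}\<rparr>"

definition jet_line_bundle ::
  "('m, 'e::findim, 'l::real_vector) line_bundle \<Rightarrow> (('m, 'l) jet_pt, 'e \<times> 'e \<times> real, 'l) line_bundle" where
  "jet_line_bundle L = pull_bundle (jet_manifold L) fst L"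

definition jet_pull_section ::
  "('m, 'e::findim, 'l::real_vector) line_bundle \<Rightarrow> ('m \<Rightarrow> 'l) \<Rightarrow> ('m, 'l) jet_pt \<Rightarrow> 'l" where
  "jet_pull_section L s = restrict0 (pts (jet_manifold L)) (\<lambda>(q, \<alpha>). s q)"

definition jet_linear_section ::
  "('m, 'e::findim, 'l::real_vector) line_bundle \<Rightarrow> (('m \<Rightarrow> 'l) \<Rightarrow> 'm \<Rightarrow> 'l) \<Rightarrow> ('m, 'l) jet_pt \<Rightarrow> 'l" where
  "jet_linear_section L a = restrict0 (pts (jet_manifold L)) (\<lambda>(q, \<alpha>). \<alpha> (\<lambda>s. a s q))"


section \<open>Jacobi structures\<close>

type_synonym ('m, 'l) bracket = "('m \<Rightarrow> 'l) \<Rightarrow> ('m \<Rightarrow> 'l) \<Rightarrow> 'm \<Rightarrow> 'l"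

text \<open>Linear differential operators of order at most \<open>k\<close> on sections: those whose commutators with
  multiplications by functions have order at most \<open>k - 1\<close>.\<close>

primrec diff_op ::
  "nat \<Rightarrow> ('m, 'e::findim, 'l::real_vector) line_bundle \<Rightarrow> (('m \<Rightarrow> 'l) \<Rightarrow> 'm \<Rightarrow> 'l) \<Rightarrow> bool" where
  "diff_op 0 L \<Delta> \<longleftrightarrow> (\<forall>s\<in>sections L. \<Delta> s \<in> sections L) \<and>
     (\<forall>x. linear_funct (sections L) (\<lambda>s. \<Delta> s x)) \<and>
     (\<forall>f\<in>Cinf (base L). \<forall>s\<in>sections L. \<forall>x. \<Delta> (\<lambda>y. f y *\<^sub>R s y) x = f x *\<^sub>R \<Delta> s x)"
| "diff_op (Suc k) L \<Delta> \<longleftrightarrow> (\<forall>s\<in>sections L. \<Delta> s \<in> sections L) \<and>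
     (\<forall>x. linear_funct (sections L) (\<lambda>s. \<Delta> s x)) \<and>
     (\<forall>f\<in>Cinf (base L). diff_op k L (\<lambda>s x. \<Delta> (\<lambda>y. f y *\<^sub>R s y) x - f x *\<^sub>R \<Delta> s x))"

definition jacobi :: "('m, 'e::findim, 'l::real_vector) line_bundle \<Rightarrow> ('m, 'l) bracket \<Rightarrow> bool" where
  "jacobi L br \<longleftrightarrow>
     (\<forall>s r. s \<notin> sections L \<or> r \<notin> sections L \<longrightarrow> br s r = (\<lambda>x. 0)) \<and>
     (\<forall>s\<in>sections L. diff_op 1 L (br s) \<and> diff_op 1 L (\<lambda>r. br r s)) \<and>
     (\<forall>s\<in>sections L. br s s = (\<lambda>x. 0)) \<and>
     (\<forall>s\<in>sections L. \<forall>r\<in>sections L. \<forall>t\<in>sections L. \<forall>x.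
        br s (br r t) x + br r (br t s) x + br t (br s r) x = 0)"

definition op_bracket :: "('m, 'l::real_vector) bracket \<Rightarrow> ('m, 'l) bracket" where
  "op_bracket br = (\<lambda>s r x. - br s r x)"

definition Pi_sharp ::
  "('m, 'e::findim, 'l::real_vector) line_bundle \<Rightarrow> ('m, 'l) bracket \<Rightarrow> 'm \<Rightarrow>
   ((('m \<Rightarrow> 'l) \<Rightarrow> 'l) \<Rightarrow> 'l) \<Rightarrow> ('m \<Rightarrow> 'l) \<Rightarrow> 'l" where
  "Pi_sharp L br x \<alpha> = (THE a. \<exists>s\<in>sections L. jet L s x = \<alpha> \<and> a = (\<lambda>r. br s r x))"

definition nondegenerate :: "('m, 'e::findim, 'l::real_vector) line_bundle \<Rightarrow> ('m, 'l) bracket \<Rightarrow> bool" where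
  "nondegenerate L br \<longleftrightarrow> (\<forall>x\<in>pts (base L). bij_betw (Pi_sharp L br x) (Jet L x) (Der L x))"

definition contact_object :: "('m, 'e::findim, 'l::real_vector) line_bundle \<Rightarrow> ('m, 'l) bracket \<Rightarrow> bool" where
  "contact_object L br \<longleftrightarrow> line_bundle L \<and> jacobi L br \<and> nondegenerate L br"

definition ham_field ::
  "('m, 'e::findim, 'l::real_vector) line_bundle \<Rightarrow> ('m, 'l) bracket \<Rightarrow> ('m \<Rightarrow> 'l) \<Rightarrow> 'm \<Rightarrow>
   ('m \<Rightarrow> real) \<Rightarrow> real" where
  "ham_field L br s x = symbol L x (\<lambda>r. br s r x)"

text \<open>The image of \<open>\<Lambda>\<^sup>\<sharp>\<close> at \<open>x\<close>; as \<open>L\<close> has rank 1, all elements of \<open>T\<^sup>*\<^sub>x M \<otimes> L\<^sub>x\<close>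
  are of the form \<open>df \<otimes> s\<close>.\<close>

definition hyperplane ::
  "('m, 'e::findim, 'l::real_vector) line_bundle \<Rightarrow> ('m, 'l) bracket \<Rightarrow> 'm \<Rightarrow> (('m \<Rightarrow> real) \<Rightarrow> real) set" where
  "hyperplane L br x =
     {\<lambda>g. ham_field L br (\<lambda>y. f y *\<^sub>R s y) x g - f x * ham_field L br s x g | f s.
        f \<in> Cinf (base L) \<and> s \<in> sections L}"

text \<open>\<open>D\<^sub>x(L|\<^sub>S)\<close> as a subspace of \<open>D\<^sub>x L\<close>, by means of the inclusion factor of \<open>L|\<^sub>S\<close> in \<open>L\<close>.\<close>

definition sections_sub ::
  "('m, 'e::findim, 'l::real_vector) line_bundle \<Rightarrow> 'm set \<Rightarrow> ('m \<Rightarrow> 'l) set" where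
  "sections_sub L S = {s. zero_off S s \<and>
     (\<forall>x\<in>S. \<exists>W t. openin (mtop (base L)) W \<and> x \<in> W \<and> smooth_section_on L W t \<and> (\<forall>y\<in>S \<inter> W. s y = t y))}"

definition Der_sub ::
  "('m, 'e::findim, 'l::real_vector) line_bundle \<Rightarrow> 'm set \<Rightarrow> 'm \<Rightarrow> (('m \<Rightarrow> 'l) \<Rightarrow> 'l) set" where
  "Der_sub L S x = {restrict0 (sections L) (\<lambda>s. a (restrict0 S s)) | a.
     a \<in> section_derivations (Cinf_sub (base L) S) (sections_sub L S) (fibre L x) x}"

definition coisotropic ::
  "('m, 'e::findim, 'l::real_vector) line_bundle \<Rightarrow> ('m, 'l) bracket \<Rightarrow> 'm set \<Rightarrow> bool" where
  "coisotropic L br S \<longleftrightarrow>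
     (\<forall>x\<in>S. Pi_sharp L br x ` {\<alpha> \<in> Jet L x. \<forall>a\<in>Der_sub L S x. \<alpha> a = 0} \<subseteq> Der_sub L S x)"

definition legendrian ::
  "('m, 'e::findim, 'l::real_vector) line_bundle \<Rightarrow> ('m, 'l) bracket \<Rightarrow> 'm set \<Rightarrow> bool" where
  "legendrian L br S \<longleftrightarrow> submanifold (base L) S \<and>
     (\<forall>x\<in>S. tangent_sub (base L) S x \<subseteq> hyperplane L br x) \<and> coisotropic L br S"

definition canonical_bracket ::
  "('m, 'e::findim, 'l::real_vector) line_bundle \<Rightarrow> (('m, 'l) jet_pt, 'l) bracket" where
  "canonical_bracket L = (THE br. jacobi (jet_line_bundle L) br \<and>
     (\<forall>a\<in>derivations L. \<forall>b\<in>derivations L.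
        br (jet_linear_section L a) (jet_linear_section L b) = jet_linear_section L (commutator a b)) \<and>
     (\<forall>a\<in>derivations L. \<forall>s\<in>sections L.
        br (jet_linear_section L a) (jet_pull_section L s) = jet_pull_section L (a s)) \<and>
     (\<forall>s\<in>sections L. \<forall>r\<in>sections L.
        br (jet_pull_section L s) (jet_pull_section L r) = (\<lambda>x. 0)))"

definition product_bracket ::
  "('m, 'e::findim, 'l::real_vector) line_bundle \<Rightarrow> ('m, 'l) bracket \<Rightarrow>
   ('n, 'f::findim, 'k::real_vector) line_bundle \<Rightarrow> ('n, 'k) bracket \<Rightarrow>
   ('m \<times> 'n \<times> ('l \<Rightarrow> 'k), 'l) bracket" where
  "product_bracket L\<^sub>1 br\<^sub>1 L\<^sub>2 br\<^sub>2 = (let L = line_product L\<^sub>1 L\<^sub>2 in THE br. jacobi L br \<and>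
     (\<forall>s\<in>sections L\<^sub>1. \<forall>s'\<in>sections L\<^sub>1.
        br (pull_section L proj1 s) (pull_section L proj1 s') = pull_section L proj1 (br\<^sub>1 s s')) \<and>
     (\<forall>s\<in>sections L\<^sub>2. \<forall>s'\<in>sections L\<^sub>2.
        br (pull_section L proj2 s) (pull_section L proj2 s') = pull_section L proj2 (br\<^sub>2 s s')) \<and>
     (\<forall>s\<in>sections L\<^sub>1. \<forall>s'\<in>sections L\<^sub>2.
        br (pull_section L proj1 s) (pull_section L proj2 s') = (\<lambda>x. 0)))"


section \<open>Relations and the jet lift\<close>

text \<open>A relation between line bundles \<open>L\<^sub>1\<close> and \<open>L\<^sub>2\<close> is a subset of their base product. Legendrian
  relations, the morphisms between non-degenerate Jacobi structures, are Legendrian in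
  the line product of the first with the opposite of the second.\<close>

definition legendrian_relation ::
  "('m, 'e::findim, 'l::real_vector) line_bundle \<Rightarrow> ('m, 'l) bracket \<Rightarrow>
   ('n, 'f::findim, 'k::real_vector) line_bundle \<Rightarrow> ('n, 'k) bracket \<Rightarrow>
   ('m \<times> 'n \<times> ('l \<Rightarrow> 'k)) set \<Rightarrow> bool" where
  "legendrian_relation L\<^sub>1 br\<^sub>1 L\<^sub>2 br\<^sub>2 R \<longleftrightarrow>
     contact_object L\<^sub>1 br\<^sub>1 \<and> contact_object L\<^sub>2 br\<^sub>2 \<and>
     legendrian (line_product L\<^sub>1 L\<^sub>2) (product_bracket L\<^sub>1 br\<^sub>1 L\<^sub>2 (op_bracket br\<^sub>2)) R"

definition diagonal_relation ::
  "('m, 'e::findim, 'l::real_vector) line_bundle \<Rightarrow> ('m \<times> 'm \<times> ('l \<Rightarrow> 'l)) set" where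
  "diagonal_relation L = {(x, x, restrict0 (fibre L x) (\<lambda>l. l)) | x. x \<in> pts (base L)}"

definition relation_comp ::
  "('m \<times> 'n \<times> ('l \<Rightarrow> 'k)) set \<Rightarrow> ('n \<times> 'p \<times> ('k \<Rightarrow> 'j)) set \<Rightarrow> ('m \<times> 'p \<times> ('l \<Rightarrow> 'j)) set" where
  "relation_comp R R' = {(x, z, C' \<circ> C) | x y z C C'. (x, y, C) \<in> R \<and> (y, z, C') \<in> R'}"

definition jet_lift ::
  "('m, 'e::findim, 'l::real_vector) line_bundle \<Rightarrow> ('n, 'f::findim, 'k::real_vector) line_bundle \<Rightarrow>
   ('m, 'l, 'n, 'k) bundle_map \<Rightarrow> (('m, 'l) jet_pt \<times> ('n, 'k) jet_pt \<times> ('l \<Rightarrow> 'k)) set" where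
  "jet_lift L\<^sub>1 L\<^sub>2 B =
     {((q\<^sub>1, \<alpha>), (q\<^sub>2, \<beta>), C) | q\<^sub>1 \<alpha> q\<^sub>2 \<beta> C.
        (q\<^sub>1, \<alpha>) \<in> pts (jet_manifold L\<^sub>1) \<and> (q\<^sub>2, \<beta>) \<in> pts (jet_manifold L\<^sub>2) \<and> q\<^sub>2 = fst B q\<^sub>1 \<and>
        (\<forall>a\<in>Der L\<^sub>1 q\<^sub>1. \<alpha> a = inv_into (fibre L\<^sub>1 q\<^sub>1) (snd B q\<^sub>1) (\<beta> (Der_map L\<^sub>1 L\<^sub>2 B q\<^sub>1 a))) \<and>
        C = restrict0 (fibre L\<^sub>1 q\<^sub>1) (snd B q\<^sub>1)}"

end

theory Submission
 imports Defs
begin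

text \<open>A bracket that is a derivation in each argument is determined by its values on sections whose 1-jets
  span all jets (linear and basic sections for the jet bundle, pull-backs along both projections for
  the line product), and the Jacobi identity needs to be checked only on these. Existence is local: in
  coordinates the canonical bracket is the Lagrange bracket of 1-jets.

  The graph of \<open>J\<^sup>1B\<close> in the line product is cut out by the sections
  \<open>P\<^sub>1\<^sup>*\<pi>\<^sup>*B\<^sup>*r - P\<^sub>2\<^sup>*\<pi>\<^sup>*r\<close> and \<open>P\<^sub>1\<^sup>*l\<^sub>A - \<Sum> f\<^sub>c P\<^sub>2\<^sup>*l\<^sub>b\<close>, where
  \<open>A (B\<^sup>*r) = \<Sum> f\<^sub>c B\<^sup>*(b\<^sub>c r)\<close> for all \<open>r\<close>. A derivation at a point of the graph that kills these
  sections is tangent to the graph, and their mutual brackets vanish on the graph; together with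
  skew symmetry this gives coisotropy. A tangent vector of the graph is the symbol of some
  \<open>{s, _}\<close> killing every section that vanishes on the graph; one such section \<open>k\<close> satisfies
  \<open>{k, _} = id\<close> at the point, so \<open>s\<close> vanishes there and the vector lies in the hyperplane.\<close>

text \<open>Both brackets are definite descriptions, so nothing can be computed with them before
  existence and uniqueness are settled. Prescribed values on generators do not yet give a bracket,
  since generators satisfy relations with function coefficients. Coordinates supply local
  candidates, and uniqueness makes them fit together. At a point given by jets \<alpha>, \<beta>
  over q1, q2 and an isomorphism C, the first family of equations says that C and B pull section
  values back to the same vector, which amounts to q2 = b(q1) and C = B there. The second says that
  \<alpha> agrees with the pull-back of \<beta> on the derivation A. The coefficients f_c are forced
  by the generality of b: without a rank condition A need not descend to L2, but A after pull-back
  is a combination, with functions on the source as coefficients, of pull-backs of derivations of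
  L2. The Legendrian property is tested on sections and involves no dimension count. The explicit
  graph coordinates enter where a derivation that kills all equations is shown to be
  tangent.\<close>

abbreviation (input) JL where "JL == jet_line_bundle"
abbreviation (input) JM where "JM == jet_manifold"

section \<open>Calculus on model spaces\<close>

lemma orthonormal_spanning:
 assumes "finite S"
 shows "\<exists>B::'a::real_inner set. finite B & span B = span S & (ALL b:B. b\<bullet>b = 1) \<and>
  (ALL b:B. ALL c:B. b ~= c --> b\<bullet>c = 0)"
proof -
 obtain C where C: "finite C" "span C = span S" "pairwise orthogonal C" using basis_orthogonal[OF assms] by blast
 define B where "B = (%c. (1 / norm c) *\<^sub>R c) ` (C - {0})"
 have "span B = span C"
 proof (rule antisym)
  show "span B \<subseteq> span C" by (rule span_minimal) (auto simp: B_def span_base span_scale)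
  have "c\<in>span B" if "c\<in>C" for c
  proof (cases "c = 0")
   case False
   hence "(1 / norm c) *\<^sub>R c\<in>span B" using that by (intro span_base) (auto simp: B_def)
   from span_scale[OF this, of "norm c"] show ?thesis using False by simp
  qed (auto simp: span_zero)
  thus "span C \<subseteq> span B" by (intro span_minimal) auto
 qed
 moreover have "ALL b:B. b\<bullet>b = 1" by (auto simp: B_def power2_norm_eq_inner[symmetric] power2_eq_square)
 moreover have "ALL b:B. ALL c:B. b ~= c --> b\<bullet>c = 0" using C(3) by (auto simp: B_def pairwise_def orthogonal_def)
 ultimately show ?thesis using C by (intro exI[of _ B]) (auto simp: B_def)
qed

text \<open>An orthonormal basis fixed once for each model type. It plays the part that
  \<open>Basis\<close> has for euclidean spaces; in dimension 0 it is empty.\<close>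

definition onb :: "'a::findim set" where
 "onb = (SOME B. finite B & span B = UNIV & (ALL b:B. b\<bullet>b = 1) \<and>
  (ALL b:B. ALL c:B. b ~= c --> b\<bullet>c = 0))"

lemma onb: "finite (onb::'a::findim set)" "span (onb::'a set) = UNIV"
 "!!b c::'a. b\<in>onb ==> c\<in>onb ==> b\<bullet>c = (if b = c then 1 else 0)"
proof -
 obtain S :: "'a set" where "finite S" "span S = UNIV" using finite_spanning by blast
 hence "\<exists>B::'a set. finite B & span B = UNIV & (ALL b:B. b\<bullet>b = 1) \<and>
  (ALL b:B. ALL c:B. b ~= c --> b\<bullet>c = 0)" using orthonormal_spanning[of S] by simp
 hence "finite (onb::'a set) & span (onb::'a set) = UNIV & (ALL b:onb. (b::'a)\<bullet>b = 1) \<and>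
  (ALL b:onb. ALL c:onb. (b::'a) ~= c --> b\<bullet>c = 0)" unfolding onb_def by (rule someI_ex)
 thus "finite (onb::'a set)" "span (onb::'a set) = UNIV"
  "!!b c::'a. b\<in>onb ==> c\<in>onb ==> b\<bullet>c = (if b = c then 1 else 0)" by auto
qed

lemma orthonormal_expand:
 assumes "finite B" "x\<in>span B" "!!b c. b\<in>B ==> c\<in>B ==> b\<bullet>c = (if b = c then 1 else 0)"
 shows "(\<Sum>b\<in>B. (x\<bullet>b) *\<^sub>R b) = (x::'a::real_inner)" using assms(2)
proof (induction rule: span_induct_alt)
 case base thus ?case by simp
next
 case (step c b y)
 have "(\<Sum>d\<in>B. (b\<bullet>d) *\<^sub>R d) = b"
  using assms(1,3) step(1) by (subst sum.remove[of B b]) (auto intro!: sum.neutral split: if_splits)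
 thus ?case using step by (simp add: inner_add_left scaleR_add_left sum.distrib scaleR_sum_right[symmetric]
    flip: scaleR_scaleR)
qed

lemma onb_expand: "(\<Sum>b\<in>onb. (x\<bullet>b) *\<^sub>R b) = (x::'a::findim)" by (rule orthonormal_expand) (simp_all add: onb)

lemma onb_sum_inner: "c\<in>onb ==> (\<Sum>b\<in>onb. f b *\<^sub>R b)\<bullet>c = f (c::'a::findim)"
 by (simp add: inner_sum_left onb(3) onb(1) if_distrib[of "%x. _ * x"] cong: if_cong)

lemma onb_eqI: "(!!b. b\<in>onb ==> x\<bullet>b = y\<bullet>b) ==> x = (y::'a::findim)"
proof -
 assume "!!b. b\<in>onb ==> x\<bullet>b = y\<bullet>b"
 hence "(\<Sum>b\<in>onb. (x\<bullet>b) *\<^sub>R b) = (\<Sum>b\<in>onb. (y\<bullet>b) *\<^sub>R b)" by simp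
 thus ?thesis by (simp only: onb_expand)
qed

lemma inner_onb: "(\<Sum>b\<in>onb. (x\<bullet>b) * (y\<bullet>b)) = x\<bullet>(y::'a::findim)"
proof -
 have "x\<bullet>y = (\<Sum>b\<in>onb. (x\<bullet>b) *\<^sub>R b)\<bullet>y" by (simp only: onb_expand)
 also have "\<dots> = (\<Sum>b\<in>onb. (x\<bullet>b) * (b\<bullet>y))" by (simp add: inner_sum_left)
 finally show ?thesis by (metis (no_types, lifting) inner_commute sum.cong)
qed

lemma linear_onb: "linear f ==> f x = (\<Sum>b\<in>onb. (x\<bullet>b) *\<^sub>R f (b::'a::findim))"
proof -
 assume f: "linear f"
 have "f x = f (\<Sum>b\<in>onb. (x\<bullet>b) *\<^sub>R b)" by (simp only: onb_expand)
 also have "\<dots> = (\<Sum>b\<in>onb. (x\<bullet>b) *\<^sub>R f b)" by (simp add: linear_sum[OF f] linear_scale[OF f])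
 finally show ?thesis .
qed

lemma linear_bounded_linear: "linear f ==> bounded_linear (f::'a::findim => 'b::real_normed_vector)"
proof -
 assume "linear f"
 hence "f = (%x. \<Sum>b\<in>onb. (x\<bullet>b) *\<^sub>R f b)" by (intro ext linear_onb)
 moreover have "bounded_linear (%x. \<Sum>b\<in>onb. (x\<bullet>b) *\<^sub>R f b)"
  by (intro bounded_linear_sum bounded_linear_scaleR_const bounded_linear_inner_left)
 ultimately show ?thesis by simp
qed

text \<open>Coordinates reduce this to bounded real sequences. It serves two purposes: closed balls
  are compact, which will make supports of bump functions closed, and model spaces are complete, as
  integrals with parameters require.\<close>

instance findim \<subseteq> heine_borel
proof
 fix f :: "nat => 'a"
 assume f: "bounded (range f)"
 have "\<forall>de\<subseteq>onb. \<exists>l::'a. \<exists> r. strict_mono r \<and>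
   (\<forall>\<epsilon>>0. eventually (%n. ALL i:de. dist (f (r n)\<bullet>i) (l\<bullet>i) < \<epsilon>) sequentially)"
  by (rule compact_lemma_general[where proj="%x b. x\<bullet>b" and unproj="%e. \<Sum>b\<in>onb. e b *\<^sub>R b"])
   (auto simp: onb onb_sum_inner onb_expand intro!: bounded_linear_image[OF f bounded_linear_inner_left])
 then obtain l :: 'a and r where r: "strict_mono r"
  and l: "!!\<epsilon>. \<epsilon>>0 ==> eventually (%n. ALL i:onb. dist (f (r n)\<bullet>i) (l\<bullet>i) < \<epsilon>) sequentially" by blast
 have "(%n. \<Sum>b\<in>onb. (f (r n)\<bullet>b) *\<^sub>R b) \<longlonglongrightarrow> (\<Sum>b\<in>onb. (l\<bullet>b) *\<^sub>R b)"
 proof (intro tendsto_sum tendsto_scaleR tendsto_const)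
  fix b :: 'a assume b: "b\<in>onb"
  show "(%n. f (r n)\<bullet>b) \<longlonglongrightarrow> l\<bullet>b" unfolding tendsto_iff using l b by (blast intro: eventually_mono)
 qed
 hence "(f \<circ> r) \<longlonglongrightarrow> l" by (simp add: onb_expand o_def)
 with r show "\<exists>l r. strict_mono r & (f \<circ> r) \<longlonglongrightarrow> l" by blast
qed

instance findim \<subseteq> banach ..

text \<open>Rational combinations of \<open>onb\<close> are dense. A countable basis of the model
  space is what countable atlases pass on to the manifold.\<close>

instance findim \<subseteq> second_countable_topology
proof
 define D :: "'a set" where "D = (%q. \<Sum>b\<in>onb. q b *\<^sub>R b) ` (onb \<rightarrow>\<^sub>E \<rat>)"
 have cD: "countable D" unfolding D_def by (intro countable_image countable_PiE onb countable_rat)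
 have dense: "EX d:D. dist d x < e" if "e > 0" for x :: 'a and e
 proof -
  \<comment> \<open>The summand 1 keeps \<open>n\<close> positive in dimension 0 and makes the final
    estimate strict.\<close>
  define n where "n = real (card (onb::'a set)) + 1"
  have n: "n > 0" by (simp add: n_def)
  have "EX q:\<rat>. \<bar>q - x\<bullet>b\<bar> < e / n" for b
  proof -
   have "x\<bullet>b < x\<bullet>b + e / n" using that n by simp
   from Rats_dense_in_real[OF this] obtain q where "q\<in>\<rat>" "x\<bullet>b < q" "q < x\<bullet>b + e / n" by blast
   thus ?thesis by (intro bexI[of _ q]) auto
  qed
  then obtain q where q: "!!b. q b\<in>\<rat>" "!!b. \<bar>q b - x\<bullet>b\<bar> < e / n" by metis
  have "norm ((\<Sum>b\<in>onb. q b *\<^sub>R b) - x) = norm (\<Sum>b\<in>onb. (q b - x\<bullet>b) *\<^sub>R b)"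
   by (subst (2) onb_expand[symmetric]) (simp add: scaleR_diff_left sum_subtractf)
  also have "\<dots> \<le> (\<Sum>b\<in>(onb::'a set). e / n)"
   using q(2) onb(3) by (intro sum_norm_le) (force simp: norm_eq_sqrt_inner intro: less_imp_le)
  also have "\<dots> < e" using that n by (simp add: n_def field_simps)
  finally have "dist (\<Sum>b\<in>onb. restrict q onb b *\<^sub>R b) x < e" by (simp add: dist_norm)
  moreover have "(\<Sum>b\<in>onb. restrict q onb b *\<^sub>R b)\<in>D" unfolding D_def using q(1) by (intro imageI) auto
  ultimately show ?thesis by blast
 qed
 let ?B = "(%(d, r). ball d r) ` (D \<times> (\<rat> Int {0<..}))"
 have "topological_basis ?B"
 proof (rule topological_basisI)
  fix O' :: "'a set" and x assume "open O'" "x\<in>O'"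
  then obtain e where e: "e > 0" "ball x e \<subseteq> O'" using openE by blast
  obtain r where r: "r\<in>\<rat>" "0 < r" "r < e / 2" using Rats_dense_in_real[of 0 "e / 2"] e by auto
  obtain d where d: "d\<in>D" "dist d x < r" using dense r by blast
  have "ball d r \<subseteq> ball x e"
  proof
   fix y assume "y\<in>ball d r"
   thus "y\<in>ball x e" using d(2) r(3) dist_triangle[of x y d] by (auto simp: dist_commute)
  qed
  thus "EX B':?B. x\<in>B' & B' \<subseteq> O'" using d r e by (intro bexI[of _ "ball d r"]) auto
 qed auto
 thus "\<exists>B::'a set set. countable B & open = generate_topology B"
  using cD countable_rat by (intro exI[of _ ?B] conjI topological_basis_imp_subbasis) (auto intro!: countable_image countable_SIGMA)
qed

section \<open>Smooth maps on open sets\<close>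

lemma frechet_cong_open:
 assumes "open S" "x\<in>S" "!!y. y\<in>S ==> f y = g y"
 shows "frechet_derivative f (at x) = frechet_derivative g (at x)"
proof -
 have "(f has_derivative D) (at x) \<longleftrightarrow> (g has_derivative D) (at x)" for D
  using has_derivative_transform_within_open[of f D x UNIV S g]
   has_derivative_transform_within_open[of g D x UNIV S f] assms by auto
 thus ?thesis by (simp add: frechet_derivative_def)
qed

lemma diffble_cong_open:
 assumes "open S" "x\<in>S" "!!y. y\<in>S ==> f y = g y" "f differentiable (at x)"
 shows "g differentiable (at x)" using has_derivative_transform_within_open[of f _ x UNIV S g] assms unfolding differentiable_def by blast

lemma frechet_eq: "(f has_derivative D) (at x) ==> frechet_derivative f (at x) = D" by (metis frechet_derivative_at)

lemma ck_on_subset: "ck_on k S f ==> T \<subseteq> S ==> ck_on k T f" by (induction k arbitrary: f) (auto intro: continuous_on_subset)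

lemma ck_on_cong:
 assumes "open S" "!!x. x\<in>S ==> f x = g x" "ck_on k S f"
 shows "ck_on k S g" using assms(2,3)
proof (induction k arbitrary: f g)
 case 0 thus ?case using continuous_on_cong[of S S f g] by simp
next
 case (Suc k)
 have "ck_on k S (%x. frechet_derivative g (at x) v)" for v
 proof (rule Suc.IH)
  show "frechet_derivative f (at x) v = frechet_derivative g (at x) v" if "x\<in>S" for x
   using frechet_cong_open[of S x f g] Suc.prems assms(1) that by auto
  show "ck_on k S (%x. frechet_derivative f (at x) v)" using Suc.prems by simp
 qed
 thus ?case using Suc.prems diffble_cong_open[OF assms(1), of _ f g] by auto
qed

text \<open>Lets the induction steps exhibit a derivative \<open>D\<close> instead of handling the
  chosen one.\<close>

lemma ck_on_Suc_I:
 assumes "open S" "!!x. x\<in>S ==> (f has_derivative D x) (at x)" "!!v. ck_on k S (%x. D x v)"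
 shows "ck_on (Suc k) S f"
proof -
 have "ck_on k S (%x. frechet_derivative f (at x) v)" for v
  by (rule ck_on_cong[OF assms(1) _ assms(3)[of v]]) (use assms(2) frechet_eq in metis)
 thus ?thesis using assms(2) by (auto simp: differentiable_def)
qed

lemma ck_on_Suc_has_der:
 "ck_on (Suc k) S f ==> x\<in>S ==> (f has_derivative frechet_derivative f (at x)) (at x)" by (simp add: frechet_derivative_works)

lemma ck_on_SucD: "ck_on (Suc k) S f ==> ck_on k S f"
proof (induction k arbitrary: f)
 case 0 thus ?case by (auto intro!: continuous_at_imp_continuous_on differentiable_imp_continuous_within)
qed auto

lemma ck_on_const: "ck_on k S (%x. c)" by (induction k arbitrary: c) (auto simp: frechet_derivative_const)

lemma ck_on_add:
 assumes "open S" "ck_on k S f" "ck_on k S g"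
 shows "ck_on k S (%x. f x + g x)" using assms(2,3)
proof (induction k arbitrary: f g)
 case (Suc k)
 show ?case by (rule ck_on_Suc_I[OF assms(1) has_derivative_add[OF
    ck_on_Suc_has_der[OF Suc.prems(1)] ck_on_Suc_has_der[OF Suc.prems(2)]]])
   (use Suc in auto)
qed (auto intro: continuous_intros)

lemma ck_on_linear_comp:
 assumes "open S" "bounded_linear h" "ck_on k S f"
 shows "ck_on k S (%x. h (f x))" using assms(3)
proof (induction k arbitrary: f)
 case (Suc k)
 show ?case by (rule ck_on_Suc_I[OF assms(1) bounded_linear.has_derivative[OF assms(2)
    ck_on_Suc_has_der[OF Suc.prems(1)]]]) (use Suc in auto)
qed (auto intro: bounded_linear.continuous_on[OF assms(2)])

text \<open>One induction covers products, scalar multiples and inner products, because the product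
  rule yields a sum of two expressions of the same kind with one order less.\<close>

lemma ck_on_bilinear:
 assumes "open S" "bounded_bilinear p" "ck_on k S f" "ck_on k S g"
 shows "ck_on k S (%x. p (f x) (g x))" using assms(3,4)
proof (induction k arbitrary: f g)
 case (Suc k)
 have "ck_on k S f" "ck_on k S g" using Suc.prems ck_on_SucD by blast+
 thus ?case by (intro ck_on_Suc_I[OF assms(1) bounded_bilinear.FDERIV[OF assms(2)
    ck_on_Suc_has_der[OF Suc.prems(1)] ck_on_Suc_has_der[OF Suc.prems(2)]]]
    ck_on_add Suc.IH assms(1))
   (use Suc.prems in auto)
qed (auto intro: bounded_bilinear.continuous_on[OF assms(2)])

lemma ck_on_sum:
 assumes "open S" "!!i. i\<in>I ==> ck_on k S (f i)"
 shows "ck_on k S (%x. \<Sum>i\<in>I. f i x)"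
 using assms(2) by (induction I rule: infinite_finite_induct) (auto simp: ck_on_const intro!: ck_on_add assms(1))

lemma ck_on_inverse:
 assumes "open S" "ck_on k S f" "!!x. x\<in>S ==> f x ~= (0::real)"
 shows "ck_on k S (%x. inverse (f x))" using assms(2)
proof (induction k)
 case (Suc k)
 hence ih: "ck_on k S (%x. inverse (f x))" using ck_on_SucD by blast
 have "ck_on k S (%x. (-1) * (inverse (f x) * frechet_derivative f (at x) v * inverse (f x)))" for v
  by (intro ck_on_bilinear[OF assms(1) bounded_bilinear_mult] ih ck_on_const) (use Suc.prems in auto)
 thus ?case by (intro ck_on_Suc_I[OF assms(1) Deriv.has_derivative_inverse[OF assms(3)
    ck_on_Suc_has_der[OF Suc.prems]]]) simp_all
qed (auto intro!: continuous_on_inverse assms(3))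

named_theorems smooth_intros

lemma smooth_subset: "smooth_on S f ==> T \<subseteq> S ==> smooth_on T f" using ck_on_subset unfolding smooth_on_def by blast

lemma smooth_cong: "smooth_on S f ==> open S ==> (!!x. x\<in>S ==> f x = g x) ==> smooth_on S g"
 using ck_on_cong[of S f g] unfolding smooth_on_def by blast

lemma smooth_diffble: "smooth_on S f ==> x\<in>S ==> f differentiable (at x)" using ck_on.simps(2) unfolding smooth_on_def by blast

lemma smooth_has_der:
 "smooth_on S f ==> x\<in>S ==> (f has_derivative frechet_derivative f (at x)) (at x)"
 using smooth_diffble frechet_derivative_works by blast

lemma smooth_frechet: "smooth_on S f ==> smooth_on S (%x. frechet_derivative f (at x) v)" using ck_on.simps(2) unfolding smooth_on_def by blast

lemma smooth_continuous: "smooth_on S f ==> continuous_on S f" using ck_on.simps(1) unfolding smooth_on_def by blast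

lemma smooth_const[smooth_intros]: "smooth_on S (%x. c)" by (simp add: smooth_on_def ck_on_const)

lemma smooth_add[smooth_intros]:
 "open S ==> smooth_on S f ==> smooth_on S g ==> smooth_on S (%x. f x + g x)" by (simp add: smooth_on_def ck_on_add)

lemma smooth_linear_comp:
 "open S ==> bounded_linear h ==> smooth_on S f ==> smooth_on S (%x. h (f x))" by (simp add: smooth_on_def ck_on_linear_comp)

lemma smooth_bilinear:
 "open S ==> bounded_bilinear p ==> smooth_on S f ==> smooth_on S g ==> smooth_on S (%x. p (f x) (g x))" by (simp add: smooth_on_def ck_on_bilinear)

lemma smooth_sum[smooth_intros]:
 "open S ==> (!!i. i\<in>I ==> smooth_on S (f i)) ==> smooth_on S (%x. \<Sum>i\<in>I. f i x)" by (simp add: smooth_on_def ck_on_sum)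

lemma smooth_inverse[smooth_intros]:
 "open S ==> smooth_on S f ==> (!!x. x\<in>S ==> f x ~= (0::real)) ==> smooth_on S (%x. inverse (f x))" by (simp add: smooth_on_def ck_on_inverse)

lemmas smooth_on_mult[smooth_intros] = smooth_bilinear[OF _ bounded_bilinear_mult]
 and smooth_on_scaleR[smooth_intros] = smooth_bilinear[OF _ bounded_bilinear_scaleR]
 and smooth_on_inner[smooth_intros] = smooth_bilinear[OF _ bounded_bilinear_inner]
 and smooth_on_minus[smooth_intros] = smooth_linear_comp[OF _ bounded_linear_minus[OF bounded_linear_ident]]
 and smooth_on_fst[smooth_intros] = smooth_linear_comp[OF _ bounded_linear_fst]
 and smooth_on_snd[smooth_intros] = smooth_linear_comp[OF _ bounded_linear_snd]

lemma smooth_diff[smooth_intros]: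
 "open S ==> smooth_on S f ==> smooth_on S g ==> smooth_on S (%x. f x - g x)" using smooth_add[OF _ _ smooth_on_minus, of S f g] by simp

lemma smooth_divide[smooth_intros]:
 "open S ==> smooth_on S f ==> smooth_on S g ==> (!!x. x\<in>S ==> g x ~= (0::real)) ==> smooth_on S (%x. f x / g x)"
 using smooth_on_mult[OF _ _ smooth_inverse, of S f g] by (simp add: divide_inverse)

lemma smooth_Pair[smooth_intros]:
 assumes "open S" "smooth_on S f" "smooth_on S g"
 shows "smooth_on S (%x. (f x, g x))"
proof -
 have "smooth_on S (%x. (f x, 0) + (0, g x))"
  by (intro smooth_add smooth_linear_comp[of S "%a. (a, 0)"] smooth_linear_comp[of S "%a. (0, a)"]
    bounded_linear_Pair bounded_linear_ident bounded_linear_zero assms)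
 thus ?thesis by simp
qed

lemma smooth_linear:
 assumes "bounded_linear f" shows "smooth_on S f"
proof -
 have "ck_on k UNIV f" for k
 proof (cases k)
  case 0 thus ?thesis using linear_continuous_on assms by auto
 next
  case (Suc j) thus ?thesis by (simp only:) (rule ck_on_Suc_I[where D="%x. f"],
    simp_all add: bounded_linear_imp_has_derivative[OF assms] ck_on_const)
 qed
 thus ?thesis unfolding smooth_on_def using ck_on_subset by blast
qed

lemma smooth_ident[smooth_intros]: "smooth_on S (%x. x)" by (rule smooth_linear) (rule bounded_linear_ident)

text \<open>By the chain rule the derivative of \<open>g\<close> is applied to a vector that varies
  with the point. Expanding this vector in \<open>onb\<close> leaves derivatives of \<open>g\<close>
  in fixed directions only, and these are covered by the induction hypothesis.\<close>

lemma ck_on_compose: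
 fixes f :: "'a::findim => 'b::findim"
 assumes "open S" "open T" "smooth_on S f" "f ` S \<subseteq> T" "ck_on k T g"
 shows "ck_on k S (%x. g (f x))" using assms(5)
proof (induction k arbitrary: g)
 case 0 thus ?case using continuous_on_compose2[of T g S f] assms smooth_continuous by auto
next
 case (Suc k)
 have d: "((%x. g (f x)) has_derivative (%v. \<Sum>b\<in>onb. (frechet_derivative f (at x) v\<bullet>b) *\<^sub>R
   frechet_derivative g (at (f x)) b)) (at x)" if x: "x\<in>S" for x
 proof -
  let ?D = "frechet_derivative g (at (f x))"
  have g: "(g has_derivative ?D) (at (f x))" using ck_on_Suc_has_der[OF Suc.prems] x assms(4) by blast
  have "?D w = (\<Sum>b\<in>onb. (w\<bullet>b) *\<^sub>R ?D b)" for w using linear_onb[OF has_derivative_linear[OF g]] .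
  hence "(%v. ?D (frechet_derivative f (at x) v)) =
   (%v. \<Sum>b\<in>onb. (frechet_derivative f (at x) v\<bullet>b) *\<^sub>R ?D b)" by (intro ext)
  thus ?thesis using has_derivative_compose[OF smooth_has_der[OF assms(3) x] g] by (simp only:)
 qed
 show ?case
 proof (rule ck_on_Suc_I[OF assms(1) d])
  fix v
  have "ck_on k S (%x. frechet_derivative f (at x) v\<bullet>b)" for b
   using smooth_on_inner[OF assms(1) smooth_frechet[OF assms(3)] smooth_const, of v b] by (simp add: smooth_on_def)
  moreover have "ck_on k S (%x. frechet_derivative g (at (f x)) b)" for b by (rule Suc.IH) (use Suc.prems in simp)
  ultimately show "ck_on k S (%x. \<Sum>b\<in>onb. (frechet_derivative f (at x) v\<bullet>b) *\<^sub>R frechet_derivative g (at (f x)) b)"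
   by (intro ck_on_sum ck_on_bilinear[OF _ bounded_bilinear_scaleR] assms(1))
 qed
qed

lemma smooth_comp:
 fixes f :: "'a::findim => 'b::findim"
 shows "open S ==> open T ==> smooth_on S f ==> f ` S \<subseteq> T ==> smooth_on T g ==> smooth_on S (%x. g (f x))"
 using ck_on_compose[of S T f _ g] by (simp add: smooth_on_def)

lemma smooth_local:
 assumes "!!x. x\<in>S ==> \<exists>T. open T & x\<in>T & smooth_on T f"
 shows "smooth_on S f" unfolding smooth_on_def
proof
 fix k
 have "!!x. x\<in>S ==> \<exists>T. open T & x\<in>T & ck_on k T f" using assms unfolding smooth_on_def by blast
 thus "ck_on k S f"
 proof (induction k arbitrary: f)
  case 0
  have "isCont f x" if "x\<in>S" for x using 0[OF that] by (auto simp: continuous_on_eq_continuous_at)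
  thus ?case by (auto intro!: continuous_at_imp_continuous_on)
 next
  case (Suc k)
  have *: "\<exists>T. open T & x\<in>T & (ALL x:T. f differentiable (at x)) \<and>
    (\<forall>v. ck_on k T (%x. frechet_derivative f (at x) v))" if "x\<in>S" for x using Suc.prems[OF that] by simp
  have "ck_on k S (%x. frechet_derivative f (at x) v)" for v by (rule Suc.IH) (use * in blast)
  thus ?case using * by (simp, blast)
 qed
qed

section \<open>Gradients and 1-jets of functions\<close>

definition grad :: "('a::findim => real) => 'a => 'a" where
 "grad h y = (\<Sum>b\<in>onb. frechet_derivative h (at y) b *\<^sub>R b)"

text \<open>A 1-jet is a single vector of an inner product space, gradient first and value last, so
  that first-order operators become inner products with it.\<close>

definition jet1 :: "('a::findim => real) => 'a => 'a \<times> real" where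
 "jet1 h y = (grad h y, h y)"

lemma frechet_grad:
 assumes "h differentiable (at y)" shows "frechet_derivative h (at y) v = grad h y\<bullet>v"
proof -
 have "linear (frechet_derivative h (at y))" using assms has_derivative_linear frechet_derivative_works by blast
 from linear_onb[OF this, of v] show ?thesis by (simp add: grad_def inner_sum_left inner_commute[of v] mult.commute)
qed

lemma has_grad:
 "h differentiable (at y) ==> (h has_derivative (%v. grad h y\<bullet>v)) (at y)"
proof -
 assume h: "h differentiable (at y)"
 hence "frechet_derivative h (at y) = (%v. grad h y\<bullet>v)" by (intro ext frechet_grad)
 thus ?thesis using h by (simp add: frechet_derivative_works)
qed

lemma grad_eqI: "(h has_derivative (%v. c\<bullet>v)) (at y) ==> grad h y = c"
 by (rule onb_eqI) (simp add: grad_def onb_sum_inner frechet_eq)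

lemma smooth_grad[smooth_intros]: "open S ==> smooth_on S h ==> smooth_on S (grad h)"
 unfolding grad_def[abs_def] by (intro smooth_intros smooth_frechet)

lemma smooth_jet1[smooth_intros]: "open S ==> smooth_on S h ==> smooth_on S (jet1 h)" unfolding jet1_def[abs_def] by (intro smooth_intros)

lemma grad_cong: "open S ==> y\<in>S ==> (!!x. x\<in>S ==> f x = g x) ==> grad f y = grad g y"
 unfolding grad_def using frechet_cong_open[of S y f g] by simp

lemma jet1_cong: "open S ==> y\<in>S ==> (!!x. x\<in>S ==> f x = g x) ==> jet1 f y = jet1 g y" unfolding jet1_def using grad_cong[of S y f g] by simp

section \<open>Bump functions\<close>

text \<open>The classical function exp(-1/x), extended by 0, together with its multiples by powers
  of 1/x. Derivatives stay in the span of this family, so one induction gives smoothness of every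
  order.\<close>

definition flat :: "nat => real => real" where
 "flat n x = (if x > 0 then exp (- inverse x) * inverse x ^ n else 0)"

lemma flat_tendsto: "(flat n \<longlongrightarrow> 0) (at 0)"
proof -
 have "((%x. inverse x ^ n / exp (inverse x)) \<longlongrightarrow> 0) (at_right (0::real))"
  by (rule filterlim_compose[OF tendsto_power_div_exp_0 filterlim_inverse_at_top_right])
 moreover have "\<forall>\<^sub>F x in at_right (0::real). inverse x ^ n / exp (inverse x) = flat n x" using eventually_at_right_less[of "0::real"]
  by (auto elim!: eventually_mono simp: flat_def exp_minus field_simps)
 ultimately have "(flat n \<longlongrightarrow> 0) (at_right 0)" by (rule Lim_transform_eventually)
 moreover have "\<forall>\<^sub>F x in at_left (0::real). 0 = flat n x" by (auto simp: flat_def eventually_at_filter)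
 hence "(flat n \<longlongrightarrow> 0) (at_left 0)" by (rule Lim_transform_eventually[OF tendsto_const])
 ultimately show ?thesis using filterlim_split_at by blast
qed

lemma flat_derivative:
 "(flat n has_real_derivative flat (n + 2) x - real n * flat (n + 1) x) (at x)"
proof -
 consider "x > 0" | "x < 0" | "x = 0" by linarith
 thus ?thesis
 proof cases
  case 1
  have i: "(inverse has_real_derivative - (inverse x * inverse x)) (at x)" using DERIV_inverse[of x UNIV] 1 by (simp add: power2_eq_square)
  have "((%x. exp (- inverse x) * inverse x ^ n) has_real_derivative
    exp (- inverse x) * (real n * inverse x ^ (n - Suc 0) * (- (inverse x * inverse x))) +
    exp (- inverse x) * (- (- (inverse x * inverse x))) * inverse x ^ n) (at x)"
   by (rule DERIV_mult'[OF DERIV_fun_exp[OF DERIV_minus[OF i]] DERIV_power[OF i], THEN DERIV_cong])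
    (simp add: algebra_simps)
  moreover have "exp (- inverse x) * (real n * inverse x ^ (n - Suc 0) * (- (inverse x * inverse x))) +
    exp (- inverse x) * (- (- (inverse x * inverse x))) * inverse x ^ n
    = flat (n + 2) x - real n * flat (n + 1) x" using 1 by (cases n) (simp_all add: flat_def algebra_simps)
  ultimately have "((%x. exp (- inverse x) * inverse x ^ n) has_real_derivative
    flat (n + 2) x - real n * flat (n + 1) x) (at x)" by simp
  thus ?thesis using has_field_derivative_transform_within_open[of _ _ x "{0<..}" "flat n"] 1 by (auto simp: flat_def)
 next
  case 2
  have "((%x. 0) has_real_derivative flat (n + 2) x - real n * flat (n + 1) x) (at x)" using 2 by (auto simp: flat_def)
  from has_field_derivative_transform_within_open[OF this, of "{..<0}" "flat n"] 2
  show ?thesis by (auto simp: flat_def)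
 next
  case 3
  \<comment> \<open>At 0 the difference quotient is again a member of the family, so its limit is
    already known.\<close>
  have e: "(flat n (0 + h) - flat n 0) / h = flat (Suc n) h" for h by (simp add: flat_def field_simps)
  have z: "flat (n + 2) (0::real) - real n * flat (n + 1) 0 = 0" by (simp add: flat_def)
  show ?thesis unfolding DERIV_def 3 e z by (rule flat_tendsto)
 qed
qed

lemma smooth_flat: "smooth_on UNIV (flat n)"
proof -
 have "ck_on k UNIV (flat n)" for k
 proof (induction k arbitrary: n)
  case 0 show ?case using DERIV_isCont[OF flat_derivative] by (auto intro!: continuous_at_imp_continuous_on)
 next
  case (Suc k)
  have "ck_on k UNIV (%x. v * (flat (n + 2) x + (- real n) * flat (n + 1) x))" for v
   by (intro ck_on_bilinear[OF _ bounded_bilinear_mult] ck_on_add ck_on_const Suc.IH open_UNIV)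
  hence "ck_on k UNIV (%x. (flat (n + 2) x - real n * flat (n + 1) x) * v)" for v by (simp add: mult.commute)
  thus ?case by (intro ck_on_Suc_I[where D="%x v. (flat (n + 2) x - real n * flat (n + 1) x) * v"])
    (use flat_derivative[of n] in \<open>auto simp: has_field_derivative_def\<close>)
 qed
 thus ?thesis by (simp add: smooth_on_def)
qed

lemma bump_function:
 fixes a :: "'a::findim"
 assumes "0 < r" "r < R"
 shows "\<exists>\<rho>::'a => real. smooth_on UNIV \<rho> & (ALL x:ball a r. \<rho> x = 1) & (\<forall>x. x \<notin> ball a R --> \<rho> x = 0)"
proof -
 define t where "t = (%x::'a. (x - a)\<bullet>(x - a))"
 have t: "t x = (dist a x)\<^sup>2" for x by (simp add: t_def dist_norm dot_square_norm norm_minus_commute)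
 have sm: "smooth_on UNIV t" unfolding t_def by (intro smooth_intros) auto
 have rR: "r\<^sup>2 < R\<^sup>2" using assms by (simp add: power_strict_mono)
 have pos: "flat 0 (R\<^sup>2 - s) + flat 0 (s - r\<^sup>2) > 0" for s using rR by (auto simp: flat_def add_pos_nonneg add_nonneg_pos)
 \<comment> \<open>The first term of the denominator vanishes outside the ball of radius
   \<open>R\<close>, the second inside the ball of radius \<open>r\<close>; as \<open>r < R\<close>
   they never vanish together. The squared distance is used because it is smooth at the
   centre.\<close>
 define \<rho> where "\<rho> = (%x. flat 0 (R\<^sup>2 - t x) / (flat 0 (R\<^sup>2 - t x) + flat 0 (t x - r\<^sup>2)))"
 have "smooth_on UNIV (%x. flat 0 (R\<^sup>2 - t x))" "smooth_on UNIV (%x. flat 0 (t x - r\<^sup>2))"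
  by (auto intro!: smooth_comp[OF _ _ _ _ smooth_flat] smooth_intros sm)
 hence "smooth_on UNIV \<rho>" unfolding \<rho>_def using pos by (intro smooth_intros) (auto simp: less_imp_neq[THEN not_sym])
 moreover have "\<rho> x = 1" if "x\<in>ball a r" for x
 proof -
  have "t x < r\<^sup>2" using that assms by (simp add: t power_strict_mono)
  hence "flat 0 (t x - r\<^sup>2) = 0" by (simp add: flat_def)
  thus ?thesis using pos[of "t x"] by (simp add: \<rho>_def)
 qed
 moreover have "\<rho> x = 0" if "x \<notin> ball a R" for x
 proof -
  have "R\<^sup>2 \<le> t x" using that assms by (simp add: t power_mono)
  thus ?thesis by (simp add: \<rho>_def flat_def)
 qed
 ultimately show ?thesis by blast
qed

section \<open>Hadamard's lemma\<close>

text \<open>Differentiation under the integral replaces \<open>h\<close> by a directional derivative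
  and raises the weight \<open>t ^ k\<close> by one power of \<open>t\<close>. The induction on the
  order of smoothness therefore runs over all \<open>k\<close> and \<open>h\<close> at once.\<close>

lemma smooth_ray_integral:
 fixes h :: "'a::findim => real"
 assumes h: "smooth_on (ball a r) h"
 shows "smooth_on (ball a r) (%y. integral {0..1} (%t. t ^ k * h (a + t *\<^sub>R (y - a))))"
proof -
 let ?S = "ball a r"
 have S: "a + t *\<^sub>R (y - a)\<in>?S" if "y\<in>?S" "0 \<le> t" "t \<le> 1" for y t
 proof -
  have "dist a (a + t *\<^sub>R (y - a)) = t * dist a y" using that by (simp add: dist_norm norm_minus_commute[of y a])
  also have "\<dots> \<le> dist a y" using that by (simp add: mult_left_le_one_le)
  finally show ?thesis using that by simp
 qed
 have cont: "continuous_on (?S \<times> cbox 0 1) (%(y, t). t ^ k * f (a + t *\<^sub>R (y - a)))"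
  if "continuous_on ?S f" for f :: "'a => real" and k unfolding case_prod_unfold
  by (intro continuous_intros continuous_on_compose2[OF that]) (auto simp: S simp del: mem_ball)
 have d: "((%y. integral {0..1} (%t. t ^ k * f (a + t *\<^sub>R (y - a)))) has_derivative
   (%v. integral {0..1} (%t. t ^ Suc k * frechet_derivative f (at (a + t *\<^sub>R (y - a))) v))) (at y)"
  if f: "smooth_on ?S f" and y: "y\<in>?S" for f :: "'a => real" and k y
 proof -
  \<comment> \<open>The derivative of the integrand as a bounded linear map, the form in which the
    Leibniz rule for parameter integrals takes it.\<close>
  define G where "G = (%y t. t ^ Suc k *\<^sub>R blinfun_inner_right (grad f (a + t *\<^sub>R (y - a))))"
  have df: "f differentiable (at (a + t *\<^sub>R (y - a)))" if "y\<in>?S" "t\<in>cbox 0 1" for y t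
   using smooth_diffble[OF f] S that by simp
  have 1: "((%y. t ^ k * f (a + t *\<^sub>R (y - a))) has_derivative blinfun_apply (G y t)) (at y within ?S)"
   if "y\<in>?S" "t\<in>cbox 0 1" for y t
  proof -
   have "((%y. a + t *\<^sub>R (y - a)) has_derivative (%v. t *\<^sub>R v)) (at y within ?S)" by (auto intro!: derivative_eq_intros)
   from has_derivative_compose[OF this has_grad[OF df[OF that]]]
   have "((%y. t ^ k * f (a + t *\<^sub>R (y - a))) has_derivative
     (%v. t ^ k * (grad f (a + t *\<^sub>R (y - a))\<bullet>t *\<^sub>R v))) (at y within ?S)" by (intro has_derivative_mult_right)
   moreover have "(%v. t ^ k * (grad f (a + t *\<^sub>R (y - a))\<bullet>t *\<^sub>R v)) = blinfun_apply (G y t)"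
    by (auto simp: G_def blinfun.scaleR_left)
   ultimately show ?thesis by (simp only:)
  qed
  have 2: "continuous_on (?S \<times> cbox 0 1) (%(y, t). G y t)" unfolding case_prod_unfold G_def
   by (intro continuous_intros continuous_on_compose2[OF smooth_continuous[OF smooth_grad[OF _ f]]]
     bounded_linear.continuous_on[OF bounded_linear_blinfun_inner_right]) (auto simp: S simp del: mem_ball)
  have G: "G y integrable_on cbox 0 1" by (intro integrable_continuous continuous_on_compose2[OF 2, of _ "%t. (y, t)", simplified])
    (auto intro!: continuous_intros y)
  have fint: "(%t. t ^ k * f (a + t *\<^sub>R (y - a))) integrable_on cbox 0 1" if "y\<in>?S" for y
   by (intro integrable_continuous continuous_on_compose2[OF cont[OF smooth_continuous[OF f]], of _ "%t. (y, t)", simplified])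
    (auto intro!: continuous_intros that)
  have "((%y. integral (cbox 0 1) (%t. t ^ k * f (a + t *\<^sub>R (y - a)))) has_derivative
    blinfun_apply (integral (cbox 0 1) (G y))) (at y within ?S)" using leibniz_rule[OF 1 fint 2 y convex_ball] by simp
  moreover have "blinfun_apply (integral (cbox 0 1) (G y)) =
    (%v. integral {0..1} (%t. t ^ Suc k * frechet_derivative f (at (a + t *\<^sub>R (y - a))) v))"
  proof
   fix v
   have "integral {0..1} (%t. t ^ Suc k * frechet_derivative f (at (a + t *\<^sub>R (y - a))) v) =
     integral {0..1} (%t. t ^ Suc k * (grad f (a + t *\<^sub>R (y - a))\<bullet>v))" using df[OF y] by (intro integral_cong) (simp add: frechet_grad)
   thus "blinfun_apply (integral (cbox 0 1) (G y)) v =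
     integral {0..1} (%t. t ^ Suc k * frechet_derivative f (at (a + t *\<^sub>R (y - a))) v)"
    using blinfun_apply_integral[OF G, of v] by (simp add: G_def blinfun.scaleR_left)
  qed
  ultimately show ?thesis using y by (simp only: at_within_open[OF _ open_ball] cbox_interval)
 qed
 have "ck_on n ?S (%y. integral {0..1} (%t. t ^ k * f (a + t *\<^sub>R (y - a))))" if "smooth_on ?S f" for n k f using that
 proof (induction n arbitrary: k f)
  case 0
  thus ?case using d[THEN has_derivative_continuous] by (auto intro!: continuous_at_imp_continuous_on)
 next
  case (Suc n)
  show ?case by (rule ck_on_Suc_I[OF open_ball d]) (use Suc smooth_frechet in blast)+
 qed
 thus ?thesis using h by (simp add: smooth_on_def)
qed

text \<open>Integrates the derivative along the ray from \<open>a\<close>. A first-order expansion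
  with smooth coefficients is what allows a purely algebraic point derivation to be evaluated in
  coordinates.\<close>

lemma hadamard:
 fixes h :: "'a::findim => real"
 assumes h: "smooth_on (ball a r) h" and r: "r > 0"
 shows "\<exists>g. ALL b:onb. smooth_on (ball a r) (g b) & g b a = grad h a\<bullet>b \<and>
  (ALL y:ball a r. h y = h a + (\<Sum>b\<in>onb. ((y - a)\<bullet>b) * g b y))"
proof -
 let ?S = "ball a r"
 \<comment> \<open>The factor \<open>t ^ 0\<close> only gives the integrand the shape that
   \<open>smooth_ray_integral\<close> treats.\<close>
 define g where "g = (%b y. integral {0..1} (%t. t ^ 0 * frechet_derivative h (at (a + t *\<^sub>R (y - a))) b))"
 have S: "a + t *\<^sub>R (y - a)\<in>?S" if "y\<in>?S" "0 \<le> t" "t \<le> 1" for y t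
 proof -
  have "dist a (a + t *\<^sub>R (y - a)) = t * dist a y" using that by (simp add: dist_norm norm_minus_commute[of y a])
  also have "\<dots> \<le> dist a y" using that by (simp add: mult_left_le_one_le)
  finally show ?thesis using that by simp
 qed
 have "smooth_on ?S (g b)" for b unfolding g_def by (rule smooth_ray_integral[OF smooth_frechet[OF h]])
 moreover have "g b a = grad h a\<bullet>b" for b using smooth_diffble[OF h, of a] r by (simp add: g_def frechet_grad)
 moreover have "h y = h a + (\<Sum>b\<in>onb. ((y - a)\<bullet>b) * g b y)" if y: "y\<in>?S" for y
 proof -
  let ?c = "%t. a + t *\<^sub>R (y - a)"
  have df: "h differentiable (at (?c t))" if "t\<in>{0..1}" for t using smooth_diffble[OF h] S that y by simp
  have "((%t. h (?c t)) has_vector_derivative (\<Sum>b\<in>onb. ((y - a)\<bullet>b) * frechet_derivative h (at (?c t)) b))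
    (at t within {0..1})" if t: "t\<in>{0..1}" for t
  proof -
   have "((%t. h (?c t)) has_derivative (%s. grad h (?c t)\<bullet>(s *\<^sub>R (y - a)))) (at t within {0..1})"
   proof -
    have "((%t. ?c t) has_derivative (%s. s *\<^sub>R (y - a))) (at t within {0..1})" by (auto intro!: derivative_eq_intros)
    from has_derivative_compose[OF this has_grad[OF df[OF t]]] show ?thesis .
   qed
   moreover have "grad h (?c t)\<bullet>(y - a) = (\<Sum>b\<in>onb. ((y - a)\<bullet>b) * frechet_derivative h (at (?c t)) b)"
    by (simp only: frechet_grad[OF df[OF t]] inner_onb) (rule inner_commute)
   ultimately show ?thesis by (simp add: has_vector_derivative_def)
  qed
  hence 1: "((%t. \<Sum>b\<in>onb. ((y - a)\<bullet>b) * frechet_derivative h (at (?c t)) b) has_integral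
    h (?c 1) - h (?c 0)) {0..1}" by (intro fundamental_theorem_of_calculus) auto
  have "(%t. frechet_derivative h (at (?c t)) b) integrable_on {0..1}" for b by (intro integrable_continuous_real
     continuous_on_compose2[OF smooth_continuous[OF smooth_frechet[OF h]]])
    (auto intro!: continuous_intros S y simp del: mem_ball)
  hence "((%t. \<Sum>b\<in>onb. ((y - a)\<bullet>b) * frechet_derivative h (at (?c t)) b) has_integral
    (\<Sum>b\<in>onb. ((y - a)\<bullet>b) * g b y)) {0..1}"
   by (intro has_integral_sum onb(1) has_integral_mult_right) (simp add: g_def integrable_integral)
  from has_integral_unique[OF 1 this] show ?thesis by simp
 qed
 ultimately show ?thesis by blast
qed

section \<open>Rules for 1-jets and their transport under coordinate changes\<close>

lemma jet1_eqI: "(h has_derivative (%v. c\<bullet>v)) (at y) ==> h y = d ==> jet1 h y = (c, d)" by (simp add: jet1_def grad_eqI)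

lemma snd_jet1[simp]: "snd (jet1 h y) = h y" and fst_jet1[simp]: "fst (jet1 h y) = grad h y" by (simp_all add: jet1_def)

lemma jet1_const: "jet1 (%x. c) y = (0, c)" by (rule jet1_eqI) (auto intro!: derivative_eq_intros)

lemma jet1_affine: "jet1 (%x. c\<bullet>x + d) y = (c, c\<bullet>y + d)" by (rule jet1_eqI) (auto intro!: derivative_eq_intros)

lemma jet1_add:
 assumes "f differentiable (at y)" "g differentiable (at y)"
 shows "jet1 (%x. f x + g x) y = jet1 f y + jet1 g y"
proof -
 have "jet1 (%x. f x + g x) y = (grad f y + grad g y, f y + g y)"
  by (rule jet1_eqI) (auto intro!: derivative_eq_intros has_grad assms simp: inner_add_left)
 thus ?thesis by (simp add: jet1_def)
qed

lemma jet1_mult: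
 assumes "f differentiable (at y)" "g differentiable (at y)"
 shows "jet1 (%x. f x * g x) y = f y *\<^sub>R jet1 g y + (g y *\<^sub>R grad f y, 0)"
proof -
 have "jet1 (%x. f x * g x) y = (f y *\<^sub>R grad g y + g y *\<^sub>R grad f y, f y * g y)"
  by (rule jet1_eqI) (auto intro!: derivative_eq_intros has_grad assms simp: inner_add_left)
 thus ?thesis by (simp add: jet1_def)
qed

lemma jet1_scale: "f differentiable (at y) ==> jet1 (%x. c * f x) y = c *\<^sub>R jet1 f y"
 using jet1_mult[of "%x. c" y f] by (simp add: zero_prod_def[symmetric] grad_eqI[of _ 0])

text \<open>The effect on 1-jets of \<open>f \<mapsto> H \<cdot> (f \<circ> \<tau>)\<close>.\<close>

definition jet_pull :: "('a::findim => real) => ('a => 'b::findim) => 'a => 'b \<times> real => 'a \<times> real" where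
 "jet_pull H \<tau> y w =
  ((\<Sum>b\<in>onb. (H y * (fst w\<bullet>frechet_derivative \<tau> (at y) b)) *\<^sub>R b) + snd w *\<^sub>R grad H y, H y * snd w)"

lemma jet1_pull:
 assumes H: "H differentiable (at y)" and \<tau>: "\<tau> differentiable (at y)" and f: "f differentiable (at (\<tau> y))"
 shows "jet1 (%x. H x * f (\<tau> x)) y = jet_pull H \<tau> y (jet1 f (\<tau> y))"
proof -
 let ?D = "frechet_derivative \<tau> (at y)"
 have D: "(\<tau> has_derivative ?D) (at y)" using \<tau> frechet_derivative_works by blast
 define c where "c = (\<Sum>b\<in>onb. (H y * (grad f (\<tau> y)\<bullet>?D b)) *\<^sub>R b)"
 have *: "H y * (grad f (\<tau> y)\<bullet>?D v) = c\<bullet>v" for v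
 proof -
  have "grad f (\<tau> y)\<bullet>?D v = grad f (\<tau> y)\<bullet>(\<Sum>b\<in>onb. (v\<bullet>b) *\<^sub>R ?D b)"
   by (rule arg_cong[OF linear_onb[OF has_derivative_linear[OF D]]])
  thus ?thesis by (simp add: c_def inner_sum_left inner_sum_right inner_commute[of v] sum_distrib_left algebra_simps)
 qed
 have "((%x. H x * f (\<tau> x)) has_derivative
   (%v. H y * (grad f (\<tau> y)\<bullet>?D v) + (grad H y\<bullet>v) * f (\<tau> y))) (at y)"
  by (intro has_derivative_mult has_grad H has_derivative_compose[OF D] f)
 moreover have "(%v. H y * (grad f (\<tau> y)\<bullet>?D v) + (grad H y\<bullet>v) * f (\<tau> y)) =
   (%v. (c + f (\<tau> y) *\<^sub>R grad H y)\<bullet>v)" by (simp add: * inner_add_left mult.commute)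
 ultimately have "jet1 (%x. H x * f (\<tau> x)) y = (c + f (\<tau> y) *\<^sub>R grad H y, H y * f (\<tau> y))" by (intro jet1_eqI) simp_all
 thus ?thesis by (simp add: c_def jet_pull_def)
qed

lemma smooth_jet_pull:
 assumes "open S" "smooth_on S H" "smooth_on S \<tau>"
 shows "smooth_on (S \<times> UNIV) (%z. jet_pull H \<tau> (fst z) (snd z))"
proof -
 have S: "open (S \<times> UNIV)" using assms(1) by (simp add: open_Times)
 have c: "smooth_on (S \<times> UNIV) (%z. f (fst z))" if "smooth_on S f" for f :: "'a => 'c::real_normed_vector"
  by (rule smooth_comp[OF S assms(1) _ _ that]) (auto intro!: smooth_intros S)
 show ?thesis unfolding jet_pull_def by (intro smooth_intros S c[OF assms(2)] c[OF smooth_frechet[OF assms(3)]]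
   c[OF smooth_grad[OF assms(1,2)]])
qed

section \<open>Manifolds\<close>

text \<open>\<open>smooth_manifold\<close> without the Hausdorff and countability axioms. Topology
  and smooth maps have to be available while these axioms are still being proved for jet bundles and
  line products.\<close>

definition atlas :: "('m, 'e::findim) manifold => bool" where
 "atlas M \<longleftrightarrow> (ALL c:charts M. smooth_chart M c) & pts M = (\<Union>(U, ph)\<in>charts M. U)"

lemma mfd_atlas: "smooth_manifold M ==> atlas M" by (simp add: smooth_manifold_def atlas_def)

lemma atlas_ch: "atlas M ==> c\<in>charts M ==> smooth_chart M c" by (simp add: atlas_def)

lemma atlas_obtain:
 assumes "atlas M" "x\<in>pts M" obtains U ph where "(U, ph)\<in>charts M" "x\<in>U" using assms by (auto simp: atlas_def)

lemma chartD:
 assumes "smooth_chart M (U, ph)"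
 shows "U \<subseteq> pts M" "inj_on ph U" "open (ph ` U)"
  "!!V ps. (V, ps)\<in>charts M ==> open (ph ` (U Int V))"
  "!!V ps. (V, ps)\<in>charts M ==> open (ps ` (U Int V))"
  "!!V ps. (V, ps)\<in>charts M ==> smooth_on (ph ` (U Int V)) (%y. ps (inv_into U ph y))"
  "!!V ps. (V, ps)\<in>charts M ==> smooth_on (ps ` (U Int V)) (%y. ph (inv_into V ps y))"
 using assms by (auto simp: smooth_chart_def compatible_def o_def)

text \<open>The defining predicate of \<open>mtop\<close> has to be recognised as a topology first;
  intersections are the point where injectivity of the charts enters.\<close>

lemma opn_mtop:
 assumes "atlas M"
 shows "openin (mtop M) W \<longleftrightarrow> W \<subseteq> pts M & (ALL (U, ph):charts M. open (ph ` (U Int W)))"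
proof -
 let ?P = "%W. W \<subseteq> pts M & (ALL (U, ph):charts M. open (ph ` (U Int W)))"
 have "istopology ?P" unfolding istopology_def
 proof (intro conjI allI impI)
  fix S T assume S: "?P S" and T: "?P T"
  have "open (ph ` (U Int (S Int T)))" if c: "(U, ph)\<in>charts M" for U ph
  proof -
   have "ph ` (U Int (S Int T)) = ph ` (U Int S) Int ph ` (U Int T)" using chartD(2)[OF atlas_ch[OF assms c]] by (fastforce dest: inj_onD)
   thus ?thesis using S T c by auto
  qed
  thus "S Int T \<subseteq> pts M" "ALL (U, ph):charts M. open (ph ` (U Int (S Int T)))" using S by auto
 next
  fix K assume K: "ALL S:K. ?P S"
  have "open (ph ` (U Int \<Union> K))" if c: "(U, ph)\<in>charts M" for U ph
  proof -
   have "ph ` (U Int \<Union> K) = (\<Union>S\<in>K. ph ` (U Int S))" by auto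
   moreover have "open (ph ` (U Int S))" if "S\<in>K" for S using K c that by fastforce
   ultimately show ?thesis by auto
  qed
  thus "\<Union> K \<subseteq> pts M" "ALL (U, ph):charts M. open (ph ` (U Int \<Union> K))" using K by auto
 qed
 thus ?thesis by (simp add: mtop_def topology_inverse')
qed

lemma opn_subset_pts: "atlas M ==> openin (mtop M) W ==> W \<subseteq> pts M" by (simp add: opn_mtop)

lemma chart_openin:
 assumes "atlas M" "smooth_chart M (U, ph)" "open T"
 shows "openin (mtop M) (U Int ph -` T)" unfolding opn_mtop[OF assms(1)]
proof (intro conjI ballI, goal_cases)
 case 1 show ?case using chartD(1)[OF assms(2)] by auto
next
 case (2 c)
 obtain V ps where c: "c = (V, ps)" "(V, ps)\<in>charts M" using 2 by (cases c) auto
 have inj: "inj_on ps V" using chartD(2)[OF atlas_ch[OF assms(1) c(2)]] .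
 note cd = chartD[OF assms(2)]
 have "ps ` (V Int (U Int ph -` T)) = ps ` (U Int V) Int (%y. ph (inv_into V ps y)) -` T" using inj by (auto simp: inv_into_f_f)
 moreover have "open \<dots>" by (rule continuous_open_preimage[OF smooth_continuous[OF cd(7)[OF c(2)]] cd(5)[OF c(2)] assms(3)])
 ultimately show ?case by (simp add: c)
qed

lemma chart_dom: "atlas M ==> smooth_chart M (U, ph) ==> openin (mtop M) U" using chart_openin[of M U ph UNIV] by simp

lemma chart_image:
 assumes "atlas M" "(U, ph)\<in>charts M" "openin (mtop M) W" shows "open (ph ` (U Int W))" using assms opn_mtop[OF assms(1)] by auto

lemma topspace_mtop:
 assumes "atlas M" shows "topspace (mtop M) = pts M"
proof
 show "topspace (mtop M) \<subseteq> pts M" using opn_subset_pts[OF assms] by (auto simp: topspace_def)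
 have "pts M = (\<Union>c\<in>charts M. fst c)" using assms by (auto simp: atlas_def)
 moreover have "openin (mtop M) (\<Union>c\<in>charts M. fst c)" using chart_dom[OF assms atlas_ch[OF assms]] by (intro openin_Union) auto
 ultimately show "pts M \<subseteq> topspace (mtop M)" using openin_subset by metis
qed

lemma opn_pts: "atlas M ==> openin (mtop M) (pts M)" using topspace_mtop openin_topspace by metis

text \<open>Carries compact subsets of the model space to compact subsets of the manifold.\<close>

lemma chart_continuous_inv:
 assumes "atlas M" "(U, ph)\<in>charts M"
 shows "continuous_map (top_of_set (ph ` U)) (mtop M) (inv_into U ph)"
proof -
 note cd = chartD[OF atlas_ch[OF assms]]
 have "openin (top_of_set (ph ` U)) {y\<in>ph ` U. inv_into U ph y\<in>T}" if "openin (mtop M) T" for T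
 proof -
  have "{y\<in>ph ` U. inv_into U ph y\<in>T} = ph ` (U Int T)" using cd(2) by (auto simp: inv_into_f_f)
  thus ?thesis using chart_image[OF assms that] cd(3) by (auto simp: openin_open_eq)
 qed
 thus ?thesis using cd(1,2) by (auto simp: continuous_map_def topspace_mtop[OF assms(1)] inv_into_f_f)
qed

section \<open>Smooth functions and smooth maps\<close>

lemma smooth_fun_onD:
 "smooth_fun_on M W f ==> (U, ph)\<in>charts M ==> smooth_on (ph ` (U Int W)) (%y. f (inv_into U ph y))" by (auto simp: smooth_fun_on_def o_def)

lemma sfun_local:
 assumes "atlas M" "!!x. x\<in>W ==> \<exists>T. openin (mtop M) T & x\<in>T & smooth_fun_on M T f"
 shows "smooth_fun_on M W f" unfolding smooth_fun_on_def
proof safe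
 fix U ph assume c: "(U, ph)\<in>charts M"
 show "smooth_on (ph ` (U Int W)) (f \<circ> inv_into U ph)"
 proof (rule smooth_local)
  fix y assume "y\<in>ph ` (U Int W)"
  then obtain x where x: "y = ph x" "x\<in>U" "x\<in>W" by auto
  obtain T where T: "openin (mtop M) T" "x\<in>T" "smooth_fun_on M T f" using assms(2)[OF x(3)] by auto
  show "\<exists>T. open T & y\<in>T & smooth_on T (f \<circ> inv_into U ph)"
   using chart_image[OF assms(1) c T(1)] smooth_fun_onD[OF T(3) c] x T(2) by (intro exI[of _ "ph ` (U Int T)"]) (auto simp: o_def)
 qed
qed

lemma sfun_subset:
 "smooth_fun_on M W f ==> V \<subseteq> W ==> smooth_fun_on M V f"
 unfolding smooth_fun_on_def by (blast intro: smooth_subset[OF _ image_mono[OF Int_mono[OF subset_refl]]])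

lemma sfun_cong:
 assumes "atlas M" "openin (mtop M) W" "smooth_fun_on M W f" "!!x. x\<in>W ==> f x = g x"
 shows "smooth_fun_on M W g" unfolding smooth_fun_on_def
proof safe
 fix U ph assume c: "(U, ph)\<in>charts M"
 note cd = chartD[OF atlas_ch[OF assms(1) c]]
 show "smooth_on (ph ` (U Int W)) (g \<circ> inv_into U ph)"
  by (rule smooth_cong[OF smooth_fun_onD[OF assms(3) c] chart_image[OF assms(1) c assms(2)]])
   (use assms(4) cd(2) in \<open>auto simp: inv_into_f_f\<close>)
qed

text \<open>A single chart, possibly only from the maximal atlas, decides smoothness, since
  compatibility transports the coordinate formula \<open>h\<close> to all charts of the
  atlas.\<close>

lemma sfun_chart:
 assumes "atlas M" "smooth_chart M (U, ph)" "openin (mtop M) T" "T \<subseteq> U"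
  and h: "open S" "smooth_on S h" "!!x. x\<in>T ==> ph x\<in>S & f x = h (ph x)"
 shows "smooth_fun_on M T f" unfolding smooth_fun_on_def
proof safe
 fix V ps assume c: "(V, ps)\<in>charts M"
 note cd = chartD[OF assms(2)] and cd' = chartD[OF atlas_ch[OF assms(1) c]]
 have o: "open (ps ` (V Int T))" using chart_image[OF assms(1) c assms(3)] .
 have s: "smooth_on (ps ` (V Int T)) (%y. ph (inv_into V ps y))" by (rule smooth_subset[OF cd(7)[OF c]]) (use assms(4) in auto)
 have "smooth_on (ps ` (V Int T)) (%y. h (ph (inv_into V ps y)))"
  by (rule smooth_comp[OF o h(1) s _ h(2)]) (use h(3) cd'(2) in \<open>auto simp: inv_into_f_f\<close>)
 thus "smooth_on (ps ` (V Int T)) (f \<circ> inv_into V ps)"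
  by (rule smooth_cong[OF _ o]) (use h(3) cd'(2) in \<open>auto simp: inv_into_f_f\<close>)
qed

lemma sfun_op2:
 assumes "atlas M" "openin (mtop M) W" "smooth_fun_on M W f" "smooth_fun_on M W g"
  and "!!S (f::'e => real) g. open S ==> smooth_on S f ==> smooth_on S g ==> smooth_on S (%x. p (f x) (g x))"
 shows "smooth_fun_on (M::('m, 'e::findim) manifold) W (%x. p (f x) (g x))" unfolding smooth_fun_on_def o_def
 using assms(5)[OF chart_image[OF assms(1) _ assms(2)] smooth_fun_onD[OF assms(3)] smooth_fun_onD[OF assms(4)]] by blast

lemma sfun_add: "atlas M ==> openin (mtop M) W ==> smooth_fun_on M W f ==> smooth_fun_on M W g ==>
  smooth_fun_on M W (%x. f x + g x)" by (rule sfun_op2[where p="(+)"]) (auto intro: smooth_add)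

lemma sfun_mult: "atlas M ==> openin (mtop M) W ==> smooth_fun_on M W f ==> smooth_fun_on M W g ==>
  smooth_fun_on M W (%x. f x * g x)" by (rule sfun_op2[where p="(*)"]) (auto intro: smooth_on_mult)

lemma sfun_const: "smooth_fun_on M W (%x. c)" by (auto simp: smooth_fun_on_def o_def intro: smooth_const)

lemma smooth_mapD:
 assumes "smooth_map M N b"
 shows "x\<in>pts M ==> b x\<in>pts N"
  "(U, ph)\<in>charts M ==> (V, ps)\<in>charts N ==> open (ph ` (U Int b -` V))"
  "(U, ph)\<in>charts M ==> (V, ps)\<in>charts N ==>
   smooth_on (ph ` (U Int b -` V)) (%y. ps (b (inv_into U ph y)))" using assms by (auto simp: smooth_map_def o_def)

lemma smap_openin:
 assumes "atlas M" "atlas N" "smooth_map M N b" "openin (mtop N) W"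
 shows "openin (mtop M) (pts M Int b -` W)" unfolding opn_mtop[OF assms(1)]
proof safe
 fix U ph assume c: "(U, ph)\<in>charts M"
 note cd = chartD[OF atlas_ch[OF assms(1) c]]
 have "ph ` (U Int (pts M Int b -` W)) =
   (\<Union>(V, ps)\<in>charts N. ph ` (U Int b -` V) Int (%y. ps (b (inv_into U ph y))) -` (ps ` (V Int W)))"
  (is "?A = ?B")
 proof (intro equalityI subsetI)
  fix y assume "y\<in>?A"
  then obtain x where x: "y = ph x" "x\<in>U" "x\<in>pts M" "b x\<in>W" by auto
  obtain V ps where "(V, ps)\<in>charts N" "b x\<in>V" using atlas_obtain[OF assms(2) smooth_mapD(1)[OF assms(3) x(3)]] .
  thus "y\<in>?B" using x cd(2) by (auto intro!: bexI[of _ "(V, ps)"] simp: inv_into_f_f)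
 next
  fix y assume "y\<in>?B"
  then obtain V ps x where x: "(V, ps)\<in>charts N" "y = ph x" "x\<in>U" "b x\<in>V" "ps (b x)\<in>ps ` (V Int W)"
   using cd(2) by (auto simp: inv_into_f_f)
  have "b x\<in>W" using chartD(2)[OF atlas_ch[OF assms(2) x(1)]] x(4,5) by (auto dest: inj_onD)
  thus "y\<in>?A" using x cd(1) by auto
 qed
 moreover have "open (ph ` (U Int b -` V) Int (%y. ps (b (inv_into U ph y))) -` (ps ` (V Int W)))"
  if d: "(V, ps)\<in>charts N" for V ps by (rule continuous_open_preimage[OF smooth_continuous[OF smooth_mapD(3)[OF assms(3) c d]]
   smooth_mapD(2)[OF assms(3) c d] chart_image[OF assms(2) d assms(4)]])
 ultimately show "open (ph ` (U Int (pts M Int b -` W)))" by auto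
qed

text \<open>Near each point one pair of charts and one formula \<open>h\<close> are enough. Openness
  of the coordinate domains and smoothness in arbitrary charts are obtained together in
  \<open>main\<close>.\<close>

lemma smooth_mapI:
 assumes M: "atlas M" and N: "atlas N" and b: "!!x. x\<in>pts M ==> b x\<in>pts N"
  and l: "!!x. x\<in>pts M ==> \<exists>U ph V ps T S h. (U, ph)\<in>charts M & (V, ps)\<in>charts N & openin (mtop M) T \<and>
   x\<in>T & T \<subseteq> U & b ` T \<subseteq> V & open S & smooth_on S h & (ALL z:T. ph z\<in>S & ps (b z) = h (ph z))"
 shows "smooth_map M N b"
proof -
 have main: "\<exists>R. open R & y\<in>R & R \<subseteq> ph' ` (U' Int b -` V') & smooth_on R (%y. ps' (b (inv_into U' ph' y)))"
  if c: "(U', ph')\<in>charts M" and d: "(V', ps')\<in>charts N" and y: "y\<in>ph' ` (U' Int b -` V')"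
  for U' ph' V' ps' y
 proof -
  obtain x where x: "x\<in>U'" "b x\<in>V'" "y = ph' x" using y by auto
  note cd' = chartD[OF atlas_ch[OF M c]] and dd' = chartD[OF atlas_ch[OF N d]]
  have "x\<in>pts M" using x(1) cd'(1) by blast
  from l[OF this] obtain U ph V ps T S h where **: "(U, ph)\<in>charts M & (V, ps)\<in>charts N & openin (mtop M) T \<and>
   x\<in>T & T \<subseteq> U & b ` T \<subseteq> V & open S & smooth_on S h & (ALL z:T. ph z\<in>S & ps (b z) = h (ph z))" by (elim exE) (rule that)
  hence *: "(U, ph)\<in>charts M" "(V, ps)\<in>charts N" "openin (mtop M) T"
   "x\<in>T" "T \<subseteq> U" "b ` T \<subseteq> V" "open S" "smooth_on S h" "!!z. z\<in>T ==> ph z\<in>S & ps (b z) = h (ph z)" by simp_all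
  note cd = chartD[OF atlas_ch[OF M *(1)]] and dd = chartD[OF atlas_ch[OF N *(2)]]
  define P where "P = ps ` (V Int V')"
  have P: "open P" using dd(4)[OF d] by (simp add: P_def)
  define S' where "S' = S Int h -` P"
  have S': "open S'" using continuous_open_preimage[OF smooth_continuous[OF *(8)] *(7) P] by (simp only: S'_def)
  define T' where "T' = T Int (U Int ph -` S')"
  have T': "openin (mtop M) T'" unfolding T'_def by (intro openin_Int *(3) chart_openin[OF M atlas_ch[OF M *(1)] S'])
  have T'V: "b z\<in>V'" if "z\<in>T'" for z
  proof -
   have z: "z\<in>T" "h (ph z)\<in>P" using that by (simp_all add: T'_def S'_def)
   hence "b z\<in>V" "ps (b z)\<in>P" using *(6) *(9)[OF z(1)] by auto
   then obtain v where "ps (b z) = ps v" "v\<in>V" "v\<in>V'" by (auto simp: P_def)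
   thus ?thesis using inj_onD[OF dd(2), of "b z" v] \<open>b z\<in>V\<close> by simp
  qed
  have "b x\<in>V" "ph x\<in>S" "h (ph x) = ps (b x)" using *(4,6,9) by auto
  moreover from this have "ps (b x)\<in>P" unfolding P_def using x(2) by blast
  ultimately have xT': "x\<in>T'" using *(4,5) by (simp add: T'_def S'_def subsetD)
  let ?R = "ph' ` (U' Int T')"
  have R: "open ?R" using chart_image[OF M c T'] .
  have 1: "smooth_on ?R (%y. ph (inv_into U' ph' y))" by (rule smooth_subset[OF cd(7)[OF c]]) (use *(5) in \<open>auto simp: T'_def\<close>)
  have 2: "smooth_on ?R (%y. h (ph (inv_into U' ph' y)))" by (rule smooth_comp[OF R *(7) 1 _ *(8)])
    (use cd'(2) in \<open>auto simp: inv_into_f_f T'_def S'_def\<close>)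
  have 3: "smooth_on ?R (%y. ps' (inv_into V ps (h (ph (inv_into U' ph' y)))))" by (rule smooth_comp[OF R P 2 _ dd(6)[OF d, folded P_def]])
    (use cd'(2) in \<open>auto simp: inv_into_f_f T'_def S'_def\<close>)
  have "smooth_on ?R (%y. ps' (b (inv_into U' ph' y)))"
  proof (rule smooth_cong[OF 3 R])
   fix y assume "y\<in>?R"
   then obtain z where z: "z\<in>U'" "z\<in>T'" "y = ph' z" by auto
   hence "b z\<in>V" "h (ph z) = ps (b z)" using *(6) *(9)[of z] by (auto simp: T'_def)
   thus "ps' (inv_into V ps (h (ph (inv_into U' ph' y)))) = ps' (b (inv_into U' ph' y))" using z dd(2) cd'(2) by (simp add: inv_into_f_f)
  qed
  moreover have "?R \<subseteq> ph' ` (U' Int b -` V')" using T'V by auto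
  moreover have "y\<in>?R" using x xT' by blast
  ultimately show ?thesis using R by (intro exI[of _ ?R] conjI)
 qed
 have fin: "open (ph ` (U Int b -` V)) & smooth_on (ph ` (U Int b -` V)) (%x. ps (b (inv_into U ph x)))"
  if cd: "(U, ph)\<in>charts M" "(V, ps)\<in>charts N" for U ph V ps
 proof
  show "open (ph ` (U Int b -` V))" by (rule Topological_Spaces.openI, drule main[OF cd], elim exE conjE, intro exI conjI; assumption)
  show "smooth_on (ph ` (U Int b -` V)) (%x. ps (b (inv_into U ph x)))"
   by (rule smooth_local, drule main[OF cd], elim exE conjE, intro exI conjI; assumption)
 qed
 have "b ` pts M \<subseteq> pts N" using b by blast
 thus ?thesis unfolding smooth_map_def o_def using fin by blast
qed

lemma smap_local:
 assumes M: "atlas M" and N: "atlas N" and b: "smooth_map M N b"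
  and c: "(U, ph)\<in>charts M" and d: "(V, ps)\<in>charts N"
 shows "openin (mtop M) (U Int b -` V)"
proof -
 have "openin (mtop M) (U Int (pts M Int b -` V))" by (intro openin_Int chart_dom[OF M atlas_ch[OF M c]] smap_openin[OF M N b]
   chart_dom[OF N atlas_ch[OF N d]])
 moreover have "U Int (pts M Int b -` V) = U Int b -` V" using chartD(1)[OF atlas_ch[OF M c]] by auto
 ultimately show ?thesis by simp
qed

lemma smap_id: "atlas M ==> smooth_map M M (%x. x)"
proof (rule smooth_mapI)
 fix x assume M: "atlas M" and x: "x\<in>pts M"
 obtain U ph where c: "(U, ph)\<in>charts M" "x\<in>U" using atlas_obtain[OF M x] .
 thus "\<exists>U ph V ps T S h. (U, ph)\<in>charts M & (V, ps)\<in>charts M & openin (mtop M) T \<and>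
   x\<in>T & T \<subseteq> U & (%x. x) ` T \<subseteq> V & open S & smooth_on S h & (ALL z:T. ph z\<in>S & ps z = h (ph z))"
  using chart_dom[OF M atlas_ch[OF M c(1)]]
  by (intro exI[of _ U] exI[of _ ph] exI[of _ U] exI[of _ ph] exI[of _ U] exI[of _ UNIV] exI[of _ "%x. x"])
   (auto intro: smooth_ident)
qed auto

lemma smap_comp:
 assumes M: "atlas M" and N: "atlas N" and P: "atlas P"
  and b: "smooth_map M N b" and b': "smooth_map N P b'"
 shows "smooth_map M P (%x. b' (b x))"
proof (rule smooth_mapI[OF M P])
 show "b' (b x)\<in>pts P" if "x\<in>pts M" for x using that smooth_mapD(1)[OF b] smooth_mapD(1)[OF b'] by blast
 fix x assume x: "x\<in>pts M"
 obtain U ph where c: "(U, ph)\<in>charts M" "x\<in>U" using atlas_obtain[OF M x] .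
 obtain V ps where d: "(V, ps)\<in>charts N" "b x\<in>V" using atlas_obtain[OF N smooth_mapD(1)[OF b x]] .
 obtain W ka where e: "(W, ka)\<in>charts P" "b' (b x)\<in>W" using atlas_obtain[OF P smooth_mapD(1)[OF b' smooth_mapD(1)[OF b x]]] .
 note cd = chartD[OF atlas_ch[OF M c(1)]] and dd = chartD[OF atlas_ch[OF N d(1)]]
 define T where "T = U Int (pts M Int b -` (V Int b' -` W))"
 have T: "openin (mtop M) T" unfolding T_def by (intro openin_Int chart_dom[OF M atlas_ch[OF M c(1)]] smap_openin[OF M N b]
   smap_local[OF N P b' d(1) e(1)])
 have o: "open (ph ` (U Int T))" using chart_image[OF M c(1) T] .
 have s: "smooth_on (ph ` (U Int T)) (%y. ps (b (inv_into U ph y)))" by (rule smooth_subset[OF smooth_mapD(3)[OF b c(1) d(1)]]) (auto simp: T_def)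
 have s': "smooth_on (ph ` (U Int T)) (%y. ka (b' (inv_into V ps (ps (b (inv_into U ph y))))))"
  by (rule smooth_comp[OF o smooth_mapD(2)[OF b' d(1) e(1)] s _ smooth_mapD(3)[OF b' d(1) e(1)]])
   (use cd(2) in \<open>auto simp: T_def inv_into_f_f\<close>)
 have 1: "x\<in>T" using x c(2) d(2) e(2) by (simp add: T_def)
 have 2: "T \<subseteq> U" "(%x. b' (b x)) ` T \<subseteq> W" by (auto simp: T_def)
 have 3: "ALL z:T. ph z\<in>ph ` (U Int T) & ka (b' (b z)) = ka (b' (inv_into V ps (ps (b (inv_into U ph (ph z))))))"
 proof
  fix z assume z: "z\<in>T"
  hence "z\<in>U" "b z\<in>V" by (auto simp: T_def)
  thus "ph z\<in>ph ` (U Int T) & ka (b' (b z)) = ka (b' (inv_into V ps (ps (b (inv_into U ph (ph z))))))" using z cd(2) dd(2) by simp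
 qed
 show "\<exists>U ph V ps T S h. (U, ph)\<in>charts M & (V, ps)\<in>charts P & openin (mtop M) T \<and>
   x\<in>T & T \<subseteq> U & (%x. b' (b x)) ` T \<subseteq> V & open S & smooth_on S h & (ALL z:T. ph z\<in>S & ps (b' (b z)) = h (ph z))"
  by (intro exI conjI) (fact c(1) e(1) T 1 2 o s' 3)+
qed

lemma sfun_comp:
 assumes M: "atlas M" and N: "atlas N" and b: "smooth_map M N b" and W: "openin (mtop N) W"
  and f: "smooth_fun_on N W f"
 shows "smooth_fun_on M (pts M Int b -` W) (%x. f (b x))"
proof (rule sfun_local[OF M])
 fix x assume x: "x\<in>pts M Int b -` W"
 obtain U ph where c: "(U, ph)\<in>charts M" "x\<in>U" using atlas_obtain[OF M] x by blast
 obtain V ps where d: "(V, ps)\<in>charts N" "b x\<in>V" using atlas_obtain[OF N smooth_mapD(1)[OF b]] x by blast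
 note cd = chartD[OF atlas_ch[OF M c(1)]] and dd = chartD[OF atlas_ch[OF N d(1)]]
 define T where "T = (U Int b -` V) Int (pts M Int b -` W)"
 have T: "openin (mtop M) T" unfolding T_def by (intro openin_Int smap_local[OF M N b c(1) d(1)] smap_openin[OF M N b] W)
 have o: "open (ph ` (U Int T))" using chart_image[OF M c(1) T] .
 have s: "smooth_on (ph ` (U Int T)) (%y. ps (b (inv_into U ph y)))" by (rule smooth_subset[OF smooth_mapD(3)[OF b c(1) d(1)]]) (auto simp: T_def)
 have *: "smooth_on (ph ` (U Int T)) (%y. f (inv_into V ps (ps (b (inv_into U ph y)))))"
  by (rule smooth_comp[OF o chart_image[OF N d(1) W] s _ smooth_fun_onD[OF f d(1)]])
   (use cd(2) in \<open>auto simp: T_def inv_into_f_f\<close>)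
 have "smooth_fun_on M T (%x. f (b x))" by (rule sfun_chart[OF M atlas_ch[OF M c(1)] T _ o *])
   (use cd(2) dd(2) in \<open>auto simp: T_def inv_into_f_f\<close>)
 thus "\<exists>T. openin (mtop M) T & x\<in>T & smooth_fun_on M T (%x. f (b x))" using T x c d by (intro exI[of _ T]) (auto simp: T_def)
qed

section \<open>Countability, separation and global extension\<close>

text \<open>The preimages of a countable basis of the model space under countably many covering
  charts form a basis.\<close>

lemma cble_mtopI:
 assumes M: "atlas M" and C: "countable C" "C \<subseteq> charts M" "pts M \<subseteq> (\<Union>(U, ph)\<in>C. U)"
 shows "second_countable (mtop (M::('m, 'e::findim) manifold))"
proof -
 obtain B :: "'e set set" where B: "countable B" "topological_basis B" using ex_countable_basis by blast
 let ?D = "(%((U, ph), S). U Int ph -` S) ` (C \<times> B)"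
 have 1: "countable ?D" using B C by auto
 have 2: "openin (mtop M) V" if V: "V\<in>?D" for V
 proof -
  obtain c S where "c\<in>C" "S\<in>B" "V = (%((U, ph), S). U Int ph -` S) (c, S)" using V by blast
  then obtain U ph where "(U, ph)\<in>C" "S\<in>B" "V = U Int ph -` S" by (cases c) auto
  thus ?thesis using chart_openin[OF M atlas_ch[OF M]] C(2) topological_basis_open[OF B(2)] by blast
 qed
 have 3: "EX V:?D. x\<in>V & V \<subseteq> W" if W: "openin (mtop M) W" "x\<in>W" for W x
 proof -
  have "x\<in>pts M" using opn_subset_pts[OF M W(1)] W(2) by blast
  then obtain U ph where c: "(U, ph)\<in>C" "x\<in>U" using C(3) by auto
  have "open (ph ` (U Int W))" using chart_image[OF M _ W(1)] c C(2) by blast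
  then obtain S where S: "S\<in>B" "ph x\<in>S" "S \<subseteq> ph ` (U Int W)" using topological_basisE[OF B(2)] c W(2) by (metis IntI imageI)
  have inj: "inj_on ph U" using chartD(2)[OF atlas_ch[OF M]] c C(2) by blast
  have "U Int ph -` S \<subseteq> W"
  proof
   fix z assume z: "z\<in>U Int ph -` S"
   then obtain z' where "z'\<in>U" "z'\<in>W" "ph z = ph z'" using S(3) by blast
   thus "z\<in>W" using inj_onD[OF inj, of z z'] z by auto
  qed
  thus ?thesis using S c by (intro bexI[of _ "U Int ph -` S"] image_eqI[of _ _ "((U, ph), S)"]) auto
 qed
 show ?thesis unfolding second_countable_def by (rule exI[of _ ?D]) (intro conjI allI impI ballI 1, fact 2, use 3 in blast)
qed

lemma cble_subcover:
 assumes M: "atlas M" and sc: "second_countable (mtop M)"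
  and C: "!!x. x\<in>pts M ==> EX i:I. x\<in>f i" "!!i. i\<in>I ==> openin (mtop M) (f i)"
 shows "\<exists>J\<subseteq>I. countable J & pts M \<subseteq> (\<Union>i\<in>J. f i)"
proof -
 have "Lindelof_space (mtop M)" using sc second_countable_imp_Lindelof_space by blast
 moreover have "\<Union>(f ` I) = topspace (mtop M)" using C opn_subset_pts[OF M] by (auto simp: topspace_mtop[OF M])
 ultimately obtain V where V: "countable V" "V \<subseteq> f ` I" "\<Union> V = topspace (mtop M)"
  using C(2) unfolding Lindelof_space_def by (metis (no_types, lifting) imageE)
 then obtain J where J: "J \<subseteq> I" "countable J" "V = f ` J" using countable_subset_image[of V f I] by auto
 hence "pts M \<subseteq> (\<Union>i\<in>J. f i)" using V(3) topspace_mtop[OF M] by simp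
 thus ?thesis using J by blast
qed

text \<open>Two points in a common chart are separated inside it. For bundles the second alternative
  takes care of points over different base points, which are separated in the base.\<close>

lemma Hausdorff_mtopI:
 assumes M: "atlas M"
  and "!!x y. x\<in>pts M ==> y\<in>pts M ==> x ~= y ==>
   (EX (U, ph):charts M. x\<in>U & y\<in>U) \<or>
   (\<exists>V W. openin (mtop M) V & openin (mtop M) W & x\<in>V & y\<in>W & V Int W = {})"
 shows "Hausdorff_space (mtop (M::('m, 'e::findim) manifold))" unfolding Hausdorff_space_def topspace_mtop[OF M] disjnt_def
proof (intro allI impI)
 fix x y assume xy: "x\<in>pts M & y\<in>pts M & x ~= y"
 then consider U ph where "(U, ph)\<in>charts M" "x\<in>U" "y\<in>U"
  | "\<exists>V W. openin (mtop M) V & openin (mtop M) W & x\<in>V & y\<in>W & V Int W = {}" using assms(2)[of x y] by auto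
 thus "\<exists>V W. openin (mtop M) V & openin (mtop M) W & x\<in>V & y\<in>W & V Int W = {}"
 proof cases
  case 1
  note cd = chartD[OF atlas_ch[OF M 1(1)]]
  have "ph x ~= ph y" using cd(2) 1 xy by (auto dest: inj_onD)
  then obtain S T where S: "open S" "open T" "ph x\<in>S" "ph y\<in>T" "S Int T = {}" using hausdorff[of "ph x" "ph y"] by blast
  thus ?thesis using 1 chart_openin[OF M atlas_ch[OF M 1(1)]] by (intro exI[of _ "U Int ph -` S"] exI[of _ "U Int ph -` T"]) auto
 qed
qed

text \<open>The open set \<open>Z\<close>, on which the function vanishes and which together with
  \<open>W\<close> covers the manifold, is what makes later extensions by 0 smooth. Its complement
  is the image of a closed ball, compact and therefore closed by the Hausdorff axiom.\<close>

lemma manifold_bump: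
 assumes M: "smooth_manifold M" and W: "openin (mtop M) W" "x\<in>W"
 shows "EX ka:Cinf M. \<exists>W' Z. openin (mtop M) W' & x\<in>W' & W' \<subseteq> W & (ALL y:W'. ka y = 1) \<and>
  openin (mtop M) Z & W Un Z = pts M & (ALL y:Z. ka y = 0)"
proof -
 have A: "atlas M" using M mfd_atlas by blast
 have WM: "W \<subseteq> pts M" using opn_subset_pts[OF A W(1)] .
 obtain U ph where c: "(U, ph)\<in>charts M" "x\<in>U" using atlas_obtain[OF A] W(2) WM by blast
 note cd = chartD[OF atlas_ch[OF A c(1)]]
 have "open (ph ` (U Int W))" using chart_image[OF A c(1) W(1)] .
 then obtain R where R: "R > 0" "cball (ph x) R \<subseteq> ph ` (U Int W)" using open_contains_cball c W(2) by (metis IntI imageI)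
 obtain \<rho> where \<rho>: "smooth_on UNIV \<rho>" "!!y. y\<in>ball (ph x) (R / 2) ==> \<rho> y = (1::real)"
  "!!y. y \<notin> ball (ph x) R ==> \<rho> y = 0" using bump_function[of "R / 2" R "ph x"] R by auto
 define ka where "ka y = (if y\<in>U then \<rho> (ph y) else 0)" for y
 define K where "K = inv_into U ph ` cball (ph x) R"
 have KW: "K \<subseteq> W" using R(2) cd(2) by (auto simp: K_def inv_into_f_f dest!: subsetD)
 have "compactin (top_of_set (ph ` U)) (cball (ph x) R)" using R(2) by (auto simp: compactin_subtopology compactin_euclidean_iff)
 hence "compactin (mtop M) K" unfolding K_def using image_compactin chart_continuous_inv[OF A c(1)] by blast
 hence "closedin (mtop M) K" using M compactin_imp_closedin by (auto simp: smooth_manifold_def)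
 hence Z: "openin (mtop M) (pts M - K)" using topspace_mtop[OF A] by (metis openin_diff openin_topspace)
 have z: "ka y = 0" if "y\<in>pts M - K" for y
 proof (cases "y\<in>U")
  case True
  have "ph y \<notin> cball (ph x) R"
  proof
   assume "ph y\<in>cball (ph x) R"
   hence "inv_into U ph (ph y)\<in>K" unfolding K_def by blast
   thus False using that True cd(2) by (simp add: inv_into_f_f)
  qed
  thus ?thesis using \<rho>(3) by (simp add: ka_def)
 qed (simp add: ka_def)
 have UW: "openin (mtop M) (U Int W)" using chart_dom[OF A atlas_ch[OF A c(1)]] W(1) by blast
 have s: "smooth_fun_on M (pts M) ka"
 proof (rule sfun_local[OF A])
  fix y assume y: "y\<in>pts M"
  show "\<exists>T. openin (mtop M) T & y\<in>T & smooth_fun_on M T ka"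
  proof (cases "y\<in>K")
   case True
   hence "y\<in>U Int W" using KW R(2) cd(2) by (auto simp: K_def inv_into_f_f dest!: subsetD)
   moreover have "smooth_fun_on M (U Int W) ka"
    by (rule sfun_chart[OF A atlas_ch[OF A c(1)] UW _ open_UNIV \<rho>(1)]) (auto simp: ka_def)
   ultimately show ?thesis using UW by blast
  next
   case False
   have "smooth_fun_on M (pts M - K) ka" by (rule sfun_cong[OF A Z sfun_const[of _ _ 0]]) (simp add: z)
   thus ?thesis using Z False y by blast
  qed
 qed
 have "ka\<in>Cinf M" using s cd(1) by (auto simp: Cinf_def zero_off_def ka_def)
 moreover have "openin (mtop M) (U Int W Int (U Int ph -` ball (ph x) (R / 2)))"
  by (intro openin_Int UW chart_openin[OF A atlas_ch[OF A c(1)]] open_ball)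
   (use chart_dom[OF A atlas_ch[OF A c(1)]] W(1) in auto)
 ultimately show ?thesis using \<rho>(2) R(1) W(2) c Z z WM KW
  by (intro bexI[of _ ka] exI[of _ "U Int W Int (U Int ph -` ball (ph x) (R / 2))"] exI[of _ "pts M - K"])
   (auto simp: ka_def)
qed

lemma CinfD: "f\<in>Cinf M ==> smooth_fun_on M (pts M) f" "f\<in>Cinf M ==> x \<notin> pts M ==> f x = 0" by (auto simp: Cinf_def zero_off_def)

lemma Cinf_mult: "atlas M ==> f\<in>Cinf M ==> g\<in>Cinf M ==> (%x. f x * g x)\<in>Cinf M"
 by (auto simp: Cinf_def zero_off_def intro: sfun_mult opn_pts)

lemma Cinf_add: "atlas M ==> f\<in>Cinf M ==> g\<in>Cinf M ==> (%x. f x + g x)\<in>Cinf M"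
 by (auto simp: Cinf_def zero_off_def intro: sfun_add opn_pts)

lemma Cinf_scale: "atlas M ==> f\<in>Cinf M ==> (%x. c * f x)\<in>Cinf M"
 by (auto simp: Cinf_def zero_off_def intro: sfun_mult sfun_const opn_pts)

lemma Cinf_one: "atlas M ==> restrict0 (pts M) (%x. c)\<in>Cinf M"
 by (auto simp: Cinf_def zero_off_def restrict0_def intro: sfun_cong[OF _ opn_pts sfun_const])

text \<open>On \<open>W\<close> this is a product of smooth functions and on \<open>Z\<close> it is
  0, whatever values \<open>g\<close> has outside \<open>W\<close>.\<close>

lemma cutoff_smooth:
 assumes M: "atlas M" and ka: "ka\<in>Cinf M" and W: "openin (mtop M) W" "openin (mtop M) Z" "W Un Z = pts M"
  "!!y. y\<in>Z ==> ka y = 0" and g: "smooth_fun_on M W g"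
 shows "(%x. ka x * g x)\<in>Cinf M"
proof -
 have "smooth_fun_on M (pts M) (%x. ka x * g x)"
 proof (rule sfun_local[OF M])
  fix y assume y: "y\<in>pts M"
  have "smooth_fun_on M W (%x. ka x * g x)" by (intro sfun_mult M W g sfun_subset[OF CinfD(1)[OF ka]]) (use W in auto)
  moreover have "smooth_fun_on M Z (%x. ka x * g x)" by (rule sfun_cong[OF M W(2) sfun_const[of _ _ 0]]) (simp add: W(4))
  ultimately show "\<exists>T. openin (mtop M) T & y\<in>T & smooth_fun_on M T (%x. ka x * g x)" using W y by blast
 qed
 thus ?thesis using CinfD(2)[OF ka] by (auto simp: Cinf_def zero_off_def)
qed

lemma Cinf_extend:
 assumes M: "smooth_manifold M" and W: "openin (mtop M) W" "x\<in>W" "smooth_fun_on M W g"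
 shows "EX f:Cinf M. \<exists>W'. openin (mtop M) W' & x\<in>W' & W' \<subseteq> W & (ALL y:W'. f y = g y)"
proof -
 obtain ka W' Z where "ka\<in>Cinf M" "openin (mtop M) W'" "x\<in>W'" "W' \<subseteq> W" "!!y. y\<in>W' ==> ka y = 1"
  "openin (mtop M) Z" "W Un Z = pts M" "!!y. y\<in>Z ==> ka y = 0" using manifold_bump[OF M W(1,2)] by metis
 thus ?thesis using cutoff_smooth[OF mfd_atlas[OF M], of ka W Z g] W by (intro bexI[of _ "%x. ka x * g x"] exI[of _ W']) auto
qed

section \<open>Line bundles, derivations and jets\<close>

lemma coord_scale[simp]: "u ~= 0 ==> coord u (c *\<^sub>R u) = c" unfolding coord_def by (rule the_equality) auto

lemma coord_self[simp]: "u ~= 0 ==> coord u u = 1" using coord_scale[of u 1] by simp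

lemma coord_zero[simp]: "u ~= 0 ==> coord u 0 = 0" using coord_scale[of u 0] by simp

lemma dim_1_coord:
 assumes "subspace V" "dim V = 1" "u\<in>V" "u ~= 0" "v\<in>V"
 shows "v = coord u v *\<^sub>R u"
proof -
 obtain B where B: "B \<subseteq> V" "independent B" "V \<subseteq> span B" "card B = dim V" using basis_exists by blast
 then obtain b where b: "B = {b}" using assms(2) by (auto simp: card_1_singleton_iff)
 hence "u\<in>range (%k. k *\<^sub>R b)" "v\<in>range (%k. k *\<^sub>R b)" using B(3) assms(3,5) by (auto simp: span_singleton)
 then obtain c d where "u = c *\<^sub>R b" "v = d *\<^sub>R b" by auto
 hence "v = (d / c) *\<^sub>R u" using assms(4) by auto
 thus ?thesis using assms(4) by auto
qed

lemma lbD: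
 assumes "line_bundle L"
 shows "smooth_manifold (base L)" "atlas (base L)"
  "x\<in>pts (base L) ==> subspace (fibre L x)" "x\<in>pts (base L) ==> dim (fibre L x) = 1"
  "(V, e)\<in>frames L ==> openin (mtop (base L)) V" "(V, e)\<in>frames L ==> V \<subseteq> pts (base L)"
  "(V, e)\<in>frames L ==> x\<in>V ==> e x\<in>fibre L x" "(V, e)\<in>frames L ==> x\<in>V ==> e x ~= 0"
  "(V, e)\<in>frames L ==> (V', e')\<in>frames L ==>
   \<exists>g. smooth_fun_on (base L) (V Int V') g & (ALL x:V Int V'. e' x = g x *\<^sub>R e x)"
 using assms mfd_atlas by (auto simp: line_bundle_def)

lemma frame_obtain:
 assumes "line_bundle L" "x\<in>pts (base L)" obtains V e where "(V, e)\<in>frames L" "x\<in>V" using assms by (auto simp: line_bundle_def)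

lemma frame_coord:
 assumes "line_bundle L" "(V, e)\<in>frames L" "x\<in>V" "v\<in>fibre L x"
 shows "v = coord (e x) v *\<^sub>R e x"
proof -
 have x: "x\<in>pts (base L)" using lbD(6)[OF assms(1,2)] assms(3) by blast
 show ?thesis by (rule dim_1_coord[OF lbD(3)[OF assms(1) x] lbD(4)[OF assms(1) x]
   lbD(7)[OF assms(1-3)] lbD(8)[OF assms(1-3)] assms(4)])
qed

text \<open>Frames do not vanish, so the coefficient function in the definition of smoothness is
  determined and can be named by \<open>coord\<close>.\<close>

lemma ssec_iff:
 assumes "line_bundle L" "openin (mtop (base L)) W"
 shows "smooth_section_on L W s \<longleftrightarrow> (ALL x:W. s x\<in>fibre L x) \<and>
  (ALL (V, e):frames L. smooth_fun_on (base L) (V Int W) (%x. coord (e x) (s x)))"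
proof -
 have "(\<exists>g. smooth_fun_on (base L) (V Int W) g & (ALL x:V Int W. s x = g x *\<^sub>R e x)) \<longleftrightarrow>
   smooth_fun_on (base L) (V Int W) (%x. coord (e x) (s x))"
  if e: "(V, e)\<in>frames L" and s: "ALL x:W. s x\<in>fibre L x" for V e
 proof
  assume "\<exists>g. smooth_fun_on (base L) (V Int W) g & (ALL x:V Int W. s x = g x *\<^sub>R e x)"
  then obtain g where g: "smooth_fun_on (base L) (V Int W) g" "!!x. x\<in>V Int W ==> s x = g x *\<^sub>R e x" by blast
  show "smooth_fun_on (base L) (V Int W) (%x. coord (e x) (s x))" by (rule sfun_cong[OF lbD(2)[OF assms(1)] _ g(1)])
    (use g(2) lbD(5,8)[OF assms(1) e] assms(2) in auto)
 next
  assume "smooth_fun_on (base L) (V Int W) (%x. coord (e x) (s x))"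
  thus "\<exists>g. smooth_fun_on (base L) (V Int W) g & (ALL x:V Int W. s x = g x *\<^sub>R e x)" using frame_coord[OF assms(1) e] s by blast
 qed
 thus ?thesis unfolding smooth_section_on_def by blast
qed

text \<open>One frame decides: the transition functions supply the coefficients in every other
  frame.\<close>

lemma ssec_frame:
 assumes L: "line_bundle L" and e: "(V, e)\<in>frames L" and T: "openin (mtop (base L)) T" "T \<subseteq> V"
  and f: "smooth_fun_on (base L) T f" "!!x. x\<in>T ==> s x = f x *\<^sub>R e x"
 shows "smooth_section_on L T s" unfolding smooth_section_on_def
proof (intro conjI ballI)
 show "s x\<in>fibre L x" if "x\<in>T" for x using f(2) that T lbD(7)[OF L e] lbD(3)[OF L] lbD(6)[OF L e]
  by (auto intro!: subspace_scale)
 fix c assume "c\<in>frames L"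
 then obtain V' e' where e': "c = (V', e')" "(V', e')\<in>frames L" by (cases c) auto
 obtain g where g: "smooth_fun_on (base L) (V' Int V) g" "!!x. x\<in>V' Int V ==> e x = g x *\<^sub>R e' x"
  using lbD(9)[OF L e'(2) e] by blast
 have "smooth_fun_on (base L) (V' Int T) (%x. f x * g x)"
  by (intro sfun_mult lbD(2)[OF L] openin_Int lbD(5)[OF L e'(2)] T(1)
    sfun_subset[OF f(1)] sfun_subset[OF g(1)]) (use T in auto)
 moreover have "ALL x:V' Int T. s x = (f x * g x) *\<^sub>R e' x" using f(2) g(2) T(2) by auto
 ultimately show "case c of (V, e) => \<exists>g. smooth_fun_on (base L) (V Int T) g & (ALL x:V Int T. s x = g x *\<^sub>R e x)" unfolding e' by auto
qed

lemma ssec_local: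
 assumes L: "line_bundle L" and W: "openin (mtop (base L)) W"
  and l: "!!x. x\<in>W ==> \<exists>T. openin (mtop (base L)) T & x\<in>T & smooth_section_on L T s"
 shows "smooth_section_on L W s" unfolding ssec_iff[OF L W]
proof (intro conjI ballI)
 show "s x\<in>fibre L x" if "x\<in>W" for x using l[OF that] by (auto simp: smooth_section_on_def)
 fix c assume "c\<in>frames L"
 then obtain V e where e: "c = (V, e)" "(V, e)\<in>frames L" by (cases c) auto
 have "smooth_fun_on (base L) (V Int W) (%x. coord (e x) (s x))"
 proof (rule sfun_local[OF lbD(2)[OF L]])
  fix x assume x: "x\<in>V Int W"
  then obtain T where T: "openin (mtop (base L)) T" "x\<in>T" "smooth_section_on L T s" using l by blast
  hence "smooth_fun_on (base L) (V Int T) (%x. coord (e x) (s x))" using ssec_iff[OF L T(1)] e(2) by blast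
  thus "\<exists>T. openin (mtop (base L)) T & x\<in>T & smooth_fun_on (base L) T (%x. coord (e x) (s x))"
   using T x lbD(5)[OF L e(2)] by (intro exI[of _ "V Int T"]) auto
 qed
 thus "case c of (V, e) => smooth_fun_on (base L) (V Int W) (%x. coord (e x) (s x))" by (simp add: e)
qed

lemma ssec_subset:
 "smooth_section_on L W s ==> T \<subseteq> W ==> smooth_section_on L T s"
proof -
 assume s: "smooth_section_on L W s" and T: "T \<subseteq> W"
 have "\<exists>g. smooth_fun_on (base L) (U Int T) g & (ALL x:U Int T. s x = g x *\<^sub>R e x)" if "(U, e)\<in>frames L" for U e
 proof -
  obtain g where "smooth_fun_on (base L) (U Int W) g" "ALL x:U Int W. s x = g x *\<^sub>R e x"
   using s \<open>(U, e)\<in>frames L\<close> unfolding smooth_section_on_def by blast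
  thus ?thesis using T sfun_subset[of "base L" "U Int W" g "U Int T"] by blast
 qed
 thus ?thesis using s T unfolding smooth_section_on_def by blast
qed

lemma ssec_cong:
 "smooth_section_on L W s ==> (!!x. x\<in>W ==> s x = t x) ==> smooth_section_on L W t" unfolding smooth_section_on_def by fastforce

lemma ssec_add:
 assumes L: "line_bundle L" and W: "openin (mtop (base L)) W"
  and "smooth_section_on L W s" "smooth_section_on L W t"
 shows "smooth_section_on L W (%x. s x + t x)" unfolding smooth_section_on_def
proof (intro conjI ballI)
 show "s x + t x\<in>fibre L x" if "x\<in>W" for x using assms that lbD(3)[OF L] opn_subset_pts[OF lbD(2)[OF L] W]
  by (auto simp: smooth_section_on_def intro!: subspace_add)
 fix c assume "c\<in>frames L"
 then obtain V e where e: "c = (V, e)" "(V, e)\<in>frames L" by (cases c) auto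
 obtain f where f: "smooth_fun_on (base L) (V Int W) f" "!!x. x\<in>V Int W ==> s x = f x *\<^sub>R e x"
  using assms(3) e(2) unfolding smooth_section_on_def by blast
 obtain g where g: "smooth_fun_on (base L) (V Int W) g" "!!x. x\<in>V Int W ==> t x = g x *\<^sub>R e x"
  using assms(4) e(2) unfolding smooth_section_on_def by blast
 have "smooth_fun_on (base L) (V Int W) (%x. f x + g x)"
  by (intro sfun_add lbD(2)[OF L] openin_Int lbD(5)[OF L e(2)] W f(1) g(1))
 moreover have "ALL x:V Int W. s x + t x = (f x + g x) *\<^sub>R e x" using f(2) g(2) by (auto simp: scaleR_add_left)
 ultimately show "case c of (V, e) => \<exists>g. smooth_fun_on (base L) (V Int W) g & (ALL x:V Int W. s x + t x = g x *\<^sub>R e x)"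
  unfolding e by auto
qed

lemma ssec_scale:
 assumes L: "line_bundle L" and W: "openin (mtop (base L)) W"
  and h: "smooth_fun_on (base L) W h" and "smooth_section_on L W s"
 shows "smooth_section_on L W (%x. h x *\<^sub>R s x)" unfolding smooth_section_on_def
proof (intro conjI ballI)
 show "h x *\<^sub>R s x\<in>fibre L x" if "x\<in>W" for x using assms that lbD(3)[OF L] opn_subset_pts[OF lbD(2)[OF L] W]
  by (auto simp: smooth_section_on_def intro!: subspace_scale)
 fix c assume "c\<in>frames L"
 then obtain V e where e: "c = (V, e)" "(V, e)\<in>frames L" by (cases c) auto
 obtain f where f: "smooth_fun_on (base L) (V Int W) f" "!!x. x\<in>V Int W ==> s x = f x *\<^sub>R e x"
  using assms(4) e(2) unfolding smooth_section_on_def by blast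
 have "smooth_fun_on (base L) (V Int W) (%x. h x * f x)"
  by (intro sfun_mult lbD(2)[OF L] openin_Int lbD(5)[OF L e(2)] W f(1)
   sfun_subset[OF h]) auto
 moreover have "ALL x:V Int W. h x *\<^sub>R s x = (h x * f x) *\<^sub>R e x" using f(2) by auto
 ultimately show "case c of (V, e) => \<exists>g. smooth_fun_on (base L) (V Int W) g & (ALL x:V Int W. h x *\<^sub>R s x = g x *\<^sub>R e x)"
  unfolding e by auto
qed

lemma sectionsD:
 "s\<in>sections L ==> smooth_section_on L (pts (base L)) s"
 "s\<in>sections L ==> x\<in>pts (base L) ==> s x\<in>fibre L x"
 "s\<in>sections L ==> x \<notin> pts (base L) ==> s x = 0" by (auto simp: sections_def smooth_section_on_def zero_off_def)

context
 fixes L :: "('m, 'e::findim, 'l::real_vector) line_bundle"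
 assumes L: "line_bundle L"
begin

lemma secs_add: "s\<in>sections L ==> t\<in>sections L ==> (%x. s x + t x)\<in>sections L"
 using ssec_add[OF L opn_pts[OF lbD(2)[OF L]]] by (auto simp: sections_def zero_off_def)

lemma secs_mult: "f\<in>Cinf (base L) ==> s\<in>sections L ==> (%x. f x *\<^sub>R s x)\<in>sections L"
 using ssec_scale[OF L opn_pts[OF lbD(2)[OF L]]] by (auto simp: sections_def zero_off_def Cinf_def)

lemma secs_scale: "s\<in>sections L ==> (%x. c *\<^sub>R s x)\<in>sections L"
 using ssec_scale[OF L opn_pts[OF lbD(2)[OF L]] sfun_const] by (auto simp: sections_def zero_off_def)

lemma secs_minus: "s\<in>sections L ==> (%x. - s x)\<in>sections L" using secs_scale[of s "-1"] by simp

lemma secs_diff: "s\<in>sections L ==> t\<in>sections L ==> (%x. s x - t x)\<in>sections L"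
 using secs_add[OF _ secs_minus, of s t] by simp

lemma secs_zero: "(%x. 0)\<in>sections L"
proof -
 have "smooth_section_on L (pts (base L)) (%x. 0)" unfolding ssec_iff[OF L opn_pts[OF lbD(2)[OF L]]]
 proof (intro conjI ballI)
  show "0\<in>fibre L x" if "x\<in>pts (base L)" for x using lbD(3)[OF L that] by (rule subspace_0)
  fix c assume "c\<in>frames L"
  then obtain V e where e: "c = (V, e)" "(V, e)\<in>frames L" by (cases c) auto
  have "smooth_fun_on (base L) (V Int pts (base L)) (%x. coord (e x) 0)"
   by (rule sfun_cong[OF lbD(2)[OF L] _ sfun_const[of _ _ 0]])
    (use lbD(5,8)[OF L e(2)] opn_pts[OF lbD(2)[OF L]] in auto)
  thus "case c of (V, e) => smooth_fun_on (base L) (V Int pts (base L)) (%x. coord (e x) 0)" by (simp add: e)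
 qed
 thus ?thesis by (simp add: sections_def zero_off_def)
qed

lemma secs_sum: "(!!i. i\<in>I ==> s i\<in>sections L) ==> (%x. \<Sum>i\<in>I. s i x)\<in>sections L"
 by (induction I rule: infinite_finite_induct) (auto intro: secs_add secs_zero)

lemma secs_extend:
 assumes W: "openin (mtop (base L)) W" "x\<in>W" "smooth_section_on L W t"
 shows "EX s:sections L. \<exists>W'. openin (mtop (base L)) W' & x\<in>W' & W' \<subseteq> W & (ALL y:W'. s y = t y)"
proof -
 note A = lbD(2)[OF L]
 obtain ka W' Z where ka: "ka\<in>Cinf (base L)" "openin (mtop (base L)) W'" "x\<in>W'" "W' \<subseteq> W" "!!y. y\<in>W' ==> ka y = 1"
  "openin (mtop (base L)) Z" "W Un Z = pts (base L)" "!!y. y\<in>Z ==> ka y = 0" using manifold_bump[OF lbD(1)[OF L] W(1,2)] by metis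
 define s where "s = (%y. if y\<in>W then ka y *\<^sub>R t y else 0)"
 have "smooth_section_on L (pts (base L)) s"
 proof (rule ssec_local[OF L opn_pts[OF A]])
  fix y assume y: "y\<in>pts (base L)"
  have "smooth_section_on L W s" by (rule ssec_cong[OF ssec_scale[OF L W(1) _ W(3)]])
    (use sfun_subset[OF CinfD(1)[OF ka(1)]] opn_subset_pts[OF A W(1)] in \<open>auto simp: s_def\<close>)
  moreover have "smooth_section_on L Z s" by (rule ssec_cong[OF ssec_subset[OF sectionsD(1)[OF secs_zero]]])
    (use ka(7,8) in \<open>auto simp: s_def\<close>)
  ultimately show "\<exists>T. openin (mtop (base L)) T & y\<in>T & smooth_section_on L T s" using y ka(6,7) W(1) by blast
 qed
 moreover have "zero_off (pts (base L)) s" using opn_subset_pts[OF A W(1)] by (auto simp: zero_off_def s_def)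
 ultimately have "s\<in>sections L" by (simp add: sections_def)
 thus ?thesis using ka by (intro bexI[of _ s] exI[of _ W']) (auto simp: s_def)
qed

end

section \<open>Derivations and tangent vectors at a point\<close>

lemma linear_functD:
 assumes "linear_funct A T"
 shows "f\<in>A ==> g\<in>A ==> T (%y. f y + g y) = T f + T g" "f\<in>A ==> T (%y. c *\<^sub>R f y) = c *\<^sub>R T f"
 using assms by (auto simp: linear_funct_def)

lemma section_derivationsD:
 assumes "a\<in>section_derivations F G V x"
 shows "s \<notin> G ==> a s = 0" "s\<in>G ==> a s\<in>V" "linear_funct G a"
  "EX de:point_derivations F x. ALL f:F. ALL s:G. a (%y. f y *\<^sub>R s y) = f x *\<^sub>R a s + de f *\<^sub>R s x"
 using assms by (auto simp: section_derivations_def zero_off_def)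

lemma DerD:
 assumes "a\<in>Der L x"
 shows "s \<notin> sections L ==> a s = 0" "s\<in>sections L ==> a s\<in>fibre L x"
  "s\<in>sections L ==> t\<in>sections L ==> a (%y. s y + t y) = a s + a t"
  "s\<in>sections L ==> a (%y. c *\<^sub>R s y) = c *\<^sub>R a s" using section_derivationsD[OF assms[unfolded Der_def]] linear_functD by blast+

lemma Der_symbol:
 assumes "a\<in>Der L x"
 obtains de where "de\<in>tangent (base L) x"
  "ALL f:Cinf (base L). ALL s:sections L. a (%y. f y *\<^sub>R s y) = f x *\<^sub>R a s + de f *\<^sub>R s x"
 using section_derivationsD(4)[OF assms[unfolded Der_def]] unfolding tangent_def by blast

lemma Der_diff:
 assumes "line_bundle L" "a\<in>Der L x" "s\<in>sections L" "t\<in>sections L"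
 shows "a (%y. s y - t y) = a s - a t" using DerD(3)[OF assms(2,3), of "%y. (-1) *\<^sub>R t y"] DerD(4)[OF assms(2,4), of "-1"]
  secs_minus[OF assms(1,4)] by simp

lemma Der_minus: "a\<in>Der L x ==> s\<in>sections L ==> a (%y. - s y) = - a s" using DerD(4)[of a L x s "-1"] by simp

lemma Der_zero: "line_bundle L ==> a\<in>Der L x ==> a (%y. 0) = 0" using DerD(4)[of a L x "%y. 0" 0] secs_zero[of L] by simp

lemma Der_sum:
 assumes L: "line_bundle L" and a: "a\<in>Der L x" and s: "!!i. i\<in>I ==> s i\<in>sections L"
 shows "a (%y. \<Sum>i\<in>I. s i y) = (\<Sum>i\<in>I. a (s i))" using s by (induction I rule: infinite_finite_induct)
  (auto simp: Der_zero[OF L a] DerD(3)[OF a] secs_sum[OF L])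

lemma tangentD:
 assumes "de\<in>tangent M x"
 shows "f \<notin> Cinf M ==> de f = 0"
  "f\<in>Cinf M ==> g\<in>Cinf M ==> de (%y. f y + g y) = de f + de g"
  "f\<in>Cinf M ==> de (%y. c * f y) = c * de f"
  "f\<in>Cinf M ==> g\<in>Cinf M ==> de (%y. f y * g y) = f x * de g + de f * g x"
 using assms by (auto simp: tangent_def point_derivations_def zero_off_def linear_funct_def)

text \<open>The difference times a bump function is 0. The Leibniz rule evaluates this product at
  \<open>x\<close>, where the bump is 1 and the difference vanishes.\<close>

lemma Der_local:
 assumes L: "line_bundle L" and a: "a\<in>Der L x"
  and s: "s\<in>sections L" "t\<in>sections L" and W: "openin (mtop (base L)) W" "x\<in>W" "!!y. y\<in>W ==> s y = t y"
 shows "a s = a t"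
proof -
 obtain de where de: "ALL f:Cinf (base L). ALL s:sections L. a (%y. f y *\<^sub>R s y) = f x *\<^sub>R a s + de f *\<^sub>R s x"
  using Der_symbol[OF a] by blast
 obtain ka W' Z where ka: "ka\<in>Cinf (base L)" "openin (mtop (base L)) W'" "x\<in>W'" "W' \<subseteq> W" "!!y. y\<in>W' ==> ka y = 1"
  "openin (mtop (base L)) Z" "W Un Z = pts (base L)" "!!y. y\<in>Z ==> ka y = 0" using manifold_bump[OF lbD(1)[OF L] W(1,2)] by metis
 have "ka y *\<^sub>R (s y - t y) = 0" for y
 proof -
  consider "y\<in>W" | "y\<in>Z" | "y \<notin> pts (base L)" using ka(7) by blast
  thus ?thesis using ka(8) W(3) sectionsD(3)[OF s(1)] sectionsD(3)[OF s(2)] by cases simp_all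
 qed
 hence "(%y. ka y *\<^sub>R (s y - t y)) = (%y. 0)" by (rule ext)
 hence "0 = ka x *\<^sub>R a (%y. s y - t y) + de ka *\<^sub>R (s x - t x)"
  using de[rule_format, OF ka(1) secs_diff[OF L s]] Der_zero[OF L a] by simp
 thus ?thesis using ka(3,5) W(2,3) Der_diff[OF L a s] by simp
qed

lemma tangent_local:
 assumes M: "smooth_manifold M" and d: "de\<in>tangent M x"
  and f: "f\<in>Cinf M" "g\<in>Cinf M" and W: "openin (mtop M) W" "x\<in>W" "!!y. y\<in>W ==> f y = g y"
 shows "de f = de g"
proof -
 have A: "atlas M" using M mfd_atlas by blast
 obtain ka W' Z where ka: "ka\<in>Cinf M" "openin (mtop M) W'" "x\<in>W'" "W' \<subseteq> W" "!!y. y\<in>W' ==> ka y = 1"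
  "openin (mtop M) Z" "W Un Z = pts M" "!!y. y\<in>Z ==> ka y = 0" using manifold_bump[OF M W(1,2)] by metis
 have "ka y * f y = ka y * g y" for y
 proof -
  consider "y\<in>W" | "y\<in>Z" | "y \<notin> pts M" using ka(7) by blast
  thus ?thesis using ka(8) W(3) CinfD(2)[OF f(1)] CinfD(2)[OF f(2)] by cases simp_all
 qed
 hence "(%y. ka y * f y) = (%y. ka y * g y)" by (rule ext)
 hence "de (%y. ka y * f y) = de (%y. ka y * g y)" by simp
 thus ?thesis using tangentD(4)[OF d ka(1)] f ka(3,5) W(2,3) by simp
qed

lemma tangent_const:
 assumes M: "atlas M" and d: "de\<in>tangent M x" and x: "x\<in>pts M"
 shows "de (restrict0 (pts M) (%y. c)) = 0"
proof -
 let ?o = "%c. restrict0 (pts M) (%y. c::real)"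
 have "(%y. ?o 1 y * ?o 1 y) = ?o 1" by (auto simp: restrict0_def)
 hence "de (?o 1) = 0" using tangentD(4)[OF d Cinf_one[OF M, of 1] Cinf_one[OF M, of 1]] x by (simp add: restrict0_def)
 moreover have "?o c = (%y. c * ?o 1 y)" by (auto simp: restrict0_def)
 ultimately show ?thesis using tangentD(3)[OF d Cinf_one[OF M, of 1], of c] by simp
qed

lemma Cinf_sum: "atlas M ==> (!!i. i\<in>I ==> f i\<in>Cinf M) ==> (%x. \<Sum>i\<in>I. f i x)\<in>Cinf M"
proof (induction I rule: infinite_finite_induct)
 case empty
 show ?case using Cinf_one[OF empty(1), of 0] by (simp add: restrict0_def)
next
 case (infinite I)
 show ?case using Cinf_one[OF infinite(2), of 0] infinite(1) by (simp add: restrict0_def)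
qed (auto intro: Cinf_add)

lemma tangent_sum:
 assumes M: "atlas M" and d: "de\<in>tangent M x" and f: "!!i. i\<in>I ==> f i\<in>Cinf M"
 shows "de (%y. \<Sum>i\<in>I. f i y) = (\<Sum>i\<in>I. de (f i))"
proof -
 have z: "de (%y. 0) = 0" using tangentD(3)[OF d Cinf_one[OF M, of 1], of 0] by simp
 show ?thesis using f by (induction I rule: infinite_finite_induct)
  (auto simp: z tangentD(2)[OF d] Cinf_sum[OF M])
qed

section \<open>Trivialised line bundles\<close>

text \<open>Chart and frame may have different domains; local work takes place on the intersection
  \<open>dm\<close>. In it \<open>rep\<close> is the coordinate expression of a section and
  \<open>pt\<close> inverts the chart.\<close>

locale triv =
 fixes L :: "('m, 'e::findim, 'l::real_vector) line_bundle" and U ph V e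
 assumes L: "line_bundle L" and ch: "(U, ph)\<in>charts (base L)" and fr: "(V, e)\<in>frames L"
begin

definition dm :: "'m set" where "dm = U Int V"
definition img :: "'e set" where "img = ph ` (U Int V)"
definition pt :: "'e => 'm" where "pt = inv_into U ph"
definition rep :: "('m => 'l) => 'e => real" where "rep s = (%y. coord (e (pt y)) (s (pt y)))"

lemmas A = lbD(2)[OF L] and M = lbD(1)[OF L]
 and sc = atlas_ch[OF lbD(2)[OF L] ch]
 and cd = chartD[OF atlas_ch[OF lbD(2)[OF L] ch]]

lemma open_img: "open img" unfolding img_def by (rule chart_image[OF A ch lbD(5)[OF L fr]])

lemma opn_dm: "openin (mtop (base L)) dm" unfolding dm_def by (intro openin_Int chart_dom[OF A sc] lbD(5)[OF L fr])

lemma dm_pts: "x\<in>dm ==> x\<in>pts (base L)" using cd(1) by (auto simp: dm_def)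
lemma pt_phi[simp]: "x\<in>dm ==> pt (ph x) = x" using cd(2) by (simp add: dm_def pt_def)
lemma phi_img: "x\<in>dm ==> ph x\<in>img" by (simp add: img_def dm_def)
lemma pt_dm: "y\<in>img ==> pt y\<in>dm" using cd(2) by (auto simp: dm_def pt_def img_def)
lemma phi_pt[simp]: "y\<in>img ==> ph (pt y) = y" using cd(2) by (auto simp: pt_def img_def)
lemma e_nz: "x\<in>dm ==> e x ~= 0" using lbD(8)[OF L fr] by (simp add: dm_def)
lemma e_fib: "x\<in>dm ==> e x\<in>fibre L x" using lbD(7)[OF L fr] by (simp add: dm_def)

lemma fibre_scale: "x\<in>dm ==> c *\<^sub>R e x\<in>fibre L x" using subspace_scale[OF lbD(3)[OF L dm_pts] e_fib] by blast

lemma fibre_coord: "x\<in>dm ==> v\<in>fibre L x ==> coord (e x) v *\<^sub>R e x = v" using frame_coord[OF L fr, of x v] by (simp add: dm_def)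

lemma open_preimage: "open S ==> openin (mtop (base L)) (dm Int ph -` S)"
 using openin_Int[OF opn_dm chart_openin[OF A sc]] by (simp add: dm_def Int_assoc Int_left_commute Int_left_absorb)

lemma open_image: "openin (mtop (base L)) T ==> open (ph ` (dm Int T))"
 using chart_image[OF A ch openin_Int[OF lbD(5)[OF L fr]]] by (simp add: dm_def Int_assoc)

lemma rep_phi: "x\<in>dm ==> rep s (ph x) = coord (e x) (s x)" by (simp add: rep_def)

lemma rep_at: "x\<in>dm ==> s x\<in>fibre L x ==> rep s (ph x) *\<^sub>R e x = s x" by (simp add: rep_phi fibre_coord)

lemma rep_section: "x\<in>dm ==> s\<in>sections L ==> rep s (ph x) *\<^sub>R e x = s x" by (rule rep_at) (auto intro: sectionsD(2) dm_pts)

lemma fun_smooth: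
 assumes "smooth_fun_on (base L) T f"
 shows "smooth_on (ph ` (dm Int T)) (%y. f (pt y))"
 using smooth_subset[OF smooth_fun_onD[OF assms ch], of "ph ` (dm Int T)"] by (auto simp: dm_def pt_def)

lemma Cinf_smooth: "f\<in>Cinf (base L) ==> smooth_on img (%y. f (pt y))"
 using fun_smooth[OF CinfD(1), of f] cd(1) by (simp add: img_def dm_def Int_absorb2 inf.coboundedI1)

lemma fun_smoothI:
 assumes "openin (mtop (base L)) T" "T \<subseteq> dm" "open S" "smooth_on S h" "!!x. x\<in>T ==> ph x\<in>S & f x = h (ph x)"
 shows "smooth_fun_on (base L) T f" by (rule sfun_chart[OF A sc assms(1) _ assms(3,4,5)]) (use assms(2) in \<open>auto simp: dm_def\<close>)

lemma rep_smooth_on: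
 assumes "smooth_section_on L T s" "openin (mtop (base L)) T"
 shows "smooth_on (ph ` (dm Int T)) (rep s)"
proof -
 have "smooth_fun_on (base L) (V Int T) (%x. coord (e x) (s x))" using assms fr ssec_iff[OF L assms(2)] by blast
 from fun_smooth[OF this] show ?thesis by (simp add: rep_def dm_def Int_assoc Int_left_absorb)
qed

lemma rep_smooth: "s\<in>sections L ==> smooth_on img (rep s)" using rep_smooth_on[OF sectionsD(1) opn_pts[OF A], of s] cd(1)
 by (simp add: img_def dm_def Int_absorb2 inf.coboundedI1)

lemma rep_diff: "s\<in>sections L ==> x\<in>dm ==> rep s differentiable (at (ph x))" by (rule smooth_diffble[OF rep_smooth phi_img])

lemma Cinf_diff: "f\<in>Cinf (base L) ==> x\<in>dm ==> (%y. f (pt y)) differentiable (at (ph x))"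
 by (rule smooth_diffble[OF Cinf_smooth phi_img])

lemma section_smoothI:
 assumes "openin (mtop (base L)) T" "T \<subseteq> dm" "open S" "smooth_on S h" "!!x. x\<in>T ==> ph x\<in>S & s x = h (ph x) *\<^sub>R e x"
 shows "smooth_section_on L T s" by (rule ssec_frame[OF L fr assms(1) _ fun_smoothI[OF assms(1-4), of "%x. h (ph x)"]])
  (use assms in \<open>auto simp: dm_def\<close>)

text \<open>Derivations act on global sections only, so coordinate functions have to be realised
  globally. A cut-off does this at the price of agreement only near the point.\<close>

lemma rep_extend:
 assumes "open S" "smooth_on S h" "x\<in>dm" "ph x\<in>S"
 shows "EX s:sections L. \<exists>S'. open S' & ph x\<in>S' & S' \<subseteq> S Int img & (ALL y:S'. rep s y = h y)"
proof -
 let ?T = "dm Int ph -` S"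
 have "smooth_section_on L ?T (%z. h (ph z) *\<^sub>R e z)" by (rule section_smoothI[OF open_preimage[OF assms(1)] _ assms(1,2)]) auto
 then obtain s W where s: "s\<in>sections L" "openin (mtop (base L)) W" "x\<in>W" "W \<subseteq> ?T"
  "!!y. y\<in>W ==> s y = h (ph y) *\<^sub>R e y"
  using secs_extend[OF L open_preimage[OF assms(1)], of x "%z. h (ph z) *\<^sub>R e z"] assms(3,4) by auto
 have "rep s y = h y" if "y\<in>ph ` (dm Int W)" for y using that s(4,5) by (auto simp: rep_phi e_nz)
 thus ?thesis using s open_image[OF s(2)] assms(3) by (intro bexI[of _ s] exI[of _ "ph ` (dm Int W)"]) (auto simp: phi_img)
qed

lemma Cinf_extend_chart:
 assumes "open S" "smooth_on S h" "x\<in>dm" "ph x\<in>S"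
 shows "EX f:Cinf (base L). \<exists>S'. open S' & ph x\<in>S' & S' \<subseteq> S Int img & (ALL y:S'. f (pt y) = h y)"
proof -
 let ?T = "dm Int ph -` S"
 have "smooth_fun_on (base L) ?T (%z. h (ph z))" by (rule fun_smoothI[OF open_preimage[OF assms(1)] _ assms(1,2)]) auto
 then obtain f W where s: "f\<in>Cinf (base L)" "openin (mtop (base L)) W" "x\<in>W" "W \<subseteq> ?T"
  "!!y. y\<in>W ==> f y = h (ph y)" using Cinf_extend[OF M open_preimage[OF assms(1)], of x "%z. h (ph z)"] assms(3,4) by auto
 have "f (pt y) = h y" if "y\<in>ph ` (dm Int W)" for y using that s(4,5) by auto
 thus ?thesis using s open_image[OF s(2)] assms(3) by (intro bexI[of _ f] exI[of _ "ph ` (dm Int W)"]) (auto simp: phi_img)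
qed

abbreviation jr :: "('m => 'l) => 'm => 'e \<times> real" where "jr s x \<equiv> jet1 (rep s) (ph x)"

text \<open>Affine functions already have all possible 1-jets.\<close>

lemma jr_obtain:
 assumes "x\<in>dm" obtains s where "s\<in>sections L" "jr s x = j"
proof -
 let ?h = "%y. fst j\<bullet>y + (snd j - fst j\<bullet>ph x)"
 have "smooth_on img ?h" by (intro smooth_intros open_img)
 from rep_extend[OF open_img this assms phi_img[OF assms]]
 obtain s S where s: "s\<in>sections L" "open S" "ph x\<in>S" "!!y. y\<in>S ==> rep s y = ?h y" by blast
 have "jr s x = jet1 ?h (ph x)" by (rule jet1_cong[OF s(2,3,4)])
 thus thesis using s(1) that by (simp add: jet1_affine)
qed

lemma rep_add: "s\<in>sections L ==> r\<in>sections L ==> y\<in>img ==> rep (%x. s x + r x) y = rep s y + rep r y"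
 using fibre_coord[OF pt_dm sectionsD(2)[OF _ dm_pts[OF pt_dm]], of y s]
  fibre_coord[OF pt_dm sectionsD(2)[OF _ dm_pts[OF pt_dm]], of y r] e_nz[OF pt_dm] by (metis (no_types, lifting) coord_scale rep_def scaleR_add_left)

lemma rep_mult:
 assumes "s\<in>sections L" "y\<in>img"
 shows "rep (%x. f x *\<^sub>R s x) y = f (pt y) * rep s y"
proof -
 have "f (pt y) *\<^sub>R s (pt y) = (f (pt y) * rep s y) *\<^sub>R e (pt y)"
  using rep_section[OF pt_dm[OF assms(2)] assms(1)] assms(2) by (metis phi_pt scaleR_scaleR)
 thus ?thesis using e_nz[OF pt_dm[OF assms(2)]] by (simp add: rep_def)
qed

lemma jr_add: "s\<in>sections L ==> r\<in>sections L ==> x\<in>dm ==> jr (%x. s x + r x) x = jr s x + jr r x"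
proof -
 assume s: "s\<in>sections L" "r\<in>sections L" and x: "x\<in>dm"
 have "jr (%x. s x + r x) x = jet1 (%y. rep s y + rep r y) (ph x)" by (rule jet1_cong[OF open_img phi_img[OF x]]) (simp add: rep_add s)
 thus ?thesis by (simp add: jet1_add rep_diff s x)
qed

lemma jr_mult: "f\<in>Cinf (base L) ==> s\<in>sections L ==> x\<in>dm ==>
  jr (%x. f x *\<^sub>R s x) x = f x *\<^sub>R jr s x + (rep s (ph x) *\<^sub>R grad (%y. f (pt y)) (ph x), 0)"
proof -
 assume s: "f\<in>Cinf (base L)" "s\<in>sections L" and x: "x\<in>dm"
 have "jr (%x. f x *\<^sub>R s x) x = jet1 (%y. f (pt y) * rep s y) (ph x)" by (rule jet1_cong[OF open_img phi_img[OF x]]) (simp add: rep_mult s)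
 thus ?thesis using jet1_mult[OF Cinf_diff[OF s(1) x] rep_diff[OF s(2) x]] x by simp
qed

lemma jr_scale: "s\<in>sections L ==> x\<in>dm ==> jr (%x. c *\<^sub>R s x) x = c *\<^sub>R jr s x"
proof -
 assume s: "s\<in>sections L" and x: "x\<in>dm"
 have "jr (%x. c *\<^sub>R s x) x = jet1 (%y. c * rep s y) (ph x)" by (rule jet1_cong[OF open_img phi_img[OF x]]) (simp add: rep_mult s)
 thus ?thesis by (simp add: jet1_scale rep_diff s x)
qed

text \<open>The pair \<open>w = (v, c)\<close> stands for the derivative in direction
  \<open>v\<close> plus \<open>c\<close> times the identity. All derivations at a point turn out to
  have this form, so they are coordinatised by the same space as the 1-jets.\<close>

definition der :: "'e \<times> real => 'm => ('m => 'l) => 'l" where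
 "der w x = restrict0 (sections L) (%s. (w\<bullet>jr s x) *\<^sub>R e x)"

definition tan :: "'e => 'm => ('m => real) => real" where
 "tan v x = restrict0 (Cinf (base L)) (%f. v\<bullet>grad (%y. f (pt y)) (ph x))"

lemma der_sec: "s\<in>sections L ==> der w x s = (w\<bullet>jr s x) *\<^sub>R e x" by (simp add: der_def restrict0_def)

lemma der_inj: "x\<in>dm ==> der w x = der w' x ==> w = w'"
proof -
 assume x: "x\<in>dm" and eq: "der w x = der w' x"
 have *: "w\<bullet>j = w'\<bullet>j" for j
 proof -
  obtain s where "s\<in>sections L" "jr s x = j" using jr_obtain[OF x] .
  thus ?thesis using fun_cong[OF eq, of s] e_nz[OF x] by (simp add: der_sec)
 qed
 show ?thesis by (rule onb_eqI) (rule *)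
qed

lemma tan_tangent: "x\<in>dm ==> tan v x\<in>tangent (base L) x"
proof -
 assume x: "x\<in>dm"
 have 1: "grad (%y. f (pt y) + g (pt y)) (ph x) = grad (%y. f (pt y)) (ph x) + grad (%y. g (pt y)) (ph x)"
  if "f\<in>Cinf (base L)" "g\<in>Cinf (base L)" for f g
  using arg_cong[OF jet1_add[OF Cinf_diff[OF that(1) x] Cinf_diff[OF that(2) x]], of fst] by simp
 have 2: "grad (%y. f (pt y) * g (pt y)) (ph x) = f x *\<^sub>R grad (%y. g (pt y)) (ph x) + g x *\<^sub>R grad (%y. f (pt y)) (ph x)"
  if "f\<in>Cinf (base L)" "g\<in>Cinf (base L)" for f g
  using arg_cong[OF jet1_mult[OF Cinf_diff[OF that(1) x] Cinf_diff[OF that(2) x]], of fst] x by simp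
 have 3: "grad (%y. c * f (pt y)) (ph x) = c *\<^sub>R grad (%y. f (pt y)) (ph x)" if "f\<in>Cinf (base L)" for f c
  using arg_cong[OF jet1_scale[OF Cinf_diff[OF that x]], of fst] by simp
 show ?thesis unfolding tangent_def point_derivations_def linear_funct_def tan_def using Cinf_add[OF A] Cinf_mult[OF A] Cinf_scale[OF A]
  by (auto simp: zero_off_def restrict0_def 1 2 3 inner_add_right algebra_simps)
qed

lemma der_Der: assumes x: "x\<in>dm" shows "der w x\<in>Der L x"
proof -
 have "der w x (%y. f y *\<^sub>R s y) = f x *\<^sub>R der w x s + tan (fst w) x f *\<^sub>R s x"
  if "f\<in>Cinf (base L)" "s\<in>sections L" for f s
 proof -
  have "w\<bullet>jr (%y. f y *\<^sub>R s y) x = f x * (w\<bullet>jr s x) + tan (fst w) x f * rep s (ph x)"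
   using that by (simp add: jr_mult x inner_prod_def tan_def restrict0_def algebra_simps)
  thus ?thesis using secs_mult[OF L that] that rep_section[OF x that(2)] by (simp add: der_sec scaleR_add_left flip: scaleR_scaleR)
 qed
 moreover have "linear_funct (sections L) (der w x)" unfolding linear_funct_def
  by (auto simp: der_sec secs_add[OF L] secs_scale[OF L] jr_add[OF _ _ x] jr_scale[OF _ x]
   inner_add_right scaleR_add_left)
 ultimately show ?thesis unfolding Der_def section_derivations_def using tan_tangent[OF x, of "fst w"] fibre_scale[OF x]
  by (auto simp: zero_off_def der_def restrict0_def tangent_def)
qed

text \<open>By Hadamard's lemma, tangent vectors are determined by their values on the coordinate functions.\<close>

lemma tangent_tan:
 assumes x: "x\<in>dm" and d: "de\<in>tangent (base L) x"
 shows "\<exists>v. ALL f:Cinf (base L). de f = v\<bullet>grad (%y. f (pt y)) (ph x)"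
proof -
 obtain r where r: "r > 0" "ball (ph x) r \<subseteq> img" using openE[OF open_img phi_img[OF x]] .
 have xb: "ph x\<in>ball (ph x) r" using r(1) by simp
 have "smooth_on img (%y. (y - ph x)\<bullet>b)" for b by (intro smooth_on_inner smooth_diff smooth_ident smooth_const open_img)
 from Cinf_extend_chart[OF open_img this x phi_img[OF x]]
 have "EX X:Cinf (base L). \<exists>S. open S & ph x\<in>S & S \<subseteq> img & (ALL y:S. X (pt y) = (y - ph x)\<bullet>b)" for b
  by (simp only: Int_absorb)
 then obtain X SX where X: "!!b. X b\<in>Cinf (base L)" "!!b. open (SX b)" "!!b. ph x\<in>SX b"
  "!!b. SX b \<subseteq> img" "!!b y. y\<in>SX b ==> X b (pt y) = (y - ph x)\<bullet>b" by metis
 have Xx: "X b x = 0" for b using X(5)[OF X(3), of b] x by simp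
 define v where "v = (\<Sum>b\<in>onb. de (X b) *\<^sub>R b)"
 have "de f = v\<bullet>grad (%y. f (pt y)) (ph x)" if f: "f\<in>Cinf (base L)" for f
 proof -
  let ?f = "%y. f (pt y)"
  have "smooth_on (ball (ph x) r) ?f" using smooth_subset[OF Cinf_smooth[OF f] r(2)] .
  from hadamard[OF this r(1)] obtain g where g0: "ALL b:onb. smooth_on (ball (ph x) r) (g b) \<and>
   g b (ph x) = grad ?f (ph x)\<bullet>b \<and>
   (ALL y:ball (ph x) r. ?f y = ?f (ph x) + (\<Sum>b\<in>onb. ((y - ph x)\<bullet>b) * g b y))" by (elim exE) (rule that)
  note g = g0[rule_format, THEN conjunct1] g0[rule_format, THEN conjunct2, THEN conjunct1]
   g0[rule_format, THEN conjunct2, THEN conjunct2, rule_format]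
  \<comment> \<open>The expansion in \<open>g0\<close> stands under a quantifier over
    \<open>onb\<close> and says nothing in dimension 0, where instead there is only one
    point.\<close>
  have g3: "?f y = ?f (ph x) + (\<Sum>b\<in>onb. ((y - ph x)\<bullet>b) * g b y)" if "y\<in>ball (ph x) r" for y
  proof (cases "onb = ({}::'e set)")
   case True
   hence "y = ph x" by - (rule onb_eqI, auto)
   thus ?thesis by simp
  next
   case False
   then obtain b0 :: 'e where "b0\<in>onb" by blast
   from g(3)[OF this that] show ?thesis .
  qed
  have "EX G:Cinf (base L). \<exists>S. open S & ph x\<in>S & S \<subseteq> img & (ALL y:S. G (pt y) = g b y)" if "b\<in>onb" for b
   using Cinf_extend_chart[OF open_ball g(1)[OF that] x xb] by blast
  then obtain G SG where G: "!!b. b\<in>onb ==> G b\<in>Cinf (base L)" "!!b. b\<in>onb ==> open (SG b)"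
   "!!b. b\<in>onb ==> ph x\<in>SG b" "!!b y. b\<in>onb ==> y\<in>SG b ==> G b (pt y) = g b y" by metis
  \<comment> \<open>A global version of Hadamard's expansion, equal to \<open>f\<close> near
    \<open>x\<close>. The constant is annihilated by \<open>de\<close>, and in the products only the
    term with \<open>de (X b)\<close> survives since \<open>X b\<close> vanishes at
    \<open>x\<close>.\<close>
  define f' where "f' = (%z. restrict0 (pts (base L)) (%z. f x) z + (\<Sum>b\<in>onb. X b z * G b z))"
  have XG: "(%z. X b z * G b z)\<in>Cinf (base L)" if "b\<in>onb" for b using Cinf_mult[OF A X(1) G(1)[OF that]] .
  have f': "f'\<in>Cinf (base L)" unfolding f'_def by (intro Cinf_add Cinf_sum A XG Cinf_one)
  define S where "S = ball (ph x) r Int (\<Inter>b\<in>onb. SX b Int SG b)"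
  have S: "open S" "ph x\<in>S" unfolding S_def using X(2,3) G(2,3) xb onb(1) by (auto intro!: open_Int open_INT)
  have "de f = de f'"
  proof (rule tangent_local[OF M d f f' open_preimage[OF S(1)]])
   show "x\<in>dm Int ph -` S" using x S(2) by simp
   fix z assume z: "z\<in>dm Int ph -` S"
   hence "ph z\<in>ball (ph x) r" "!!b. b\<in>onb ==> ph z\<in>SX b" "!!b. b\<in>onb ==> ph z\<in>SG b" by (auto simp: S_def)
   thus "f z = f' z" using g3[of "ph z"] z x X(5)[of "ph z"] G(4)[of _ "ph z"] dm_pts[of z] by (simp add: f'_def restrict0_def)
  qed
  also have "\<dots> = (\<Sum>b\<in>onb. de (%z. X b z * G b z))" unfolding f'_def
   by (simp add: tangentD(2)[OF d Cinf_one[OF A] Cinf_sum[OF A XG]] tangent_const[OF A d dm_pts[OF x]]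
    tangent_sum[OF A d XG])
  also have "\<dots> = (\<Sum>b\<in>onb. de (X b) * (grad ?f (ph x)\<bullet>b))"
  proof (rule sum.cong[OF refl])
   fix b :: 'e assume b: "b\<in>onb"
   have "G b x = grad ?f (ph x)\<bullet>b" using G(4)[OF b G(3)[OF b]] g(2)[OF b] x by simp
   thus "de (%z. X b z * G b z) = de (X b) * (grad ?f (ph x)\<bullet>b)" using tangentD(4)[OF d X(1) G(1)[OF b], of b] by (simp add: Xx)
  qed
  also have "\<dots> = v\<bullet>grad ?f (ph x)" by (simp add: v_def inner_sum_left inner_commute)
  finally show ?thesis .
 qed
 thus ?thesis by blast
qed

lemma tangent_eq: "x\<in>dm ==> de\<in>tangent (base L) x ==> \<exists>v. de = tan v x"
 using tangent_tan[of x de] tangentD(1)[of de] by (fastforce simp: tan_def restrict0_def)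

text \<open>Near \<open>x\<close> every section is a function times a local unit section
  \<open>t\<close>. Locality and the Leibniz rule then leave only the symbol, known from
  \<open>tangent_tan\<close>, and the value \<open>a t\<close>.\<close>

lemma Der_der:
 assumes x: "x\<in>dm" and a: "a\<in>Der L x" shows "\<exists>w. a = der w x"
proof -
 obtain de where d: "de\<in>tangent (base L) x"
  and de: "ALL f:Cinf (base L). ALL s:sections L. a (%y. f y *\<^sub>R s y) = f x *\<^sub>R a s + de f *\<^sub>R s x" using Der_symbol[OF a] by blast
 obtain v where v: "!!f. f\<in>Cinf (base L) ==> de f = v\<bullet>grad (%y. f (pt y)) (ph x)" using tangent_tan[OF x d] by blast
 from rep_extend[OF open_img smooth_const x phi_img[OF x], of 1]
 obtain t St where t: "t\<in>sections L" "open St" "ph x\<in>St" "St \<subseteq> img" "!!y. y\<in>St ==> rep t y = 1" by blast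
 have tx: "t x = e x" using rep_section[OF x t(1)] t(3,5) by simp
 define w where "w = (v, coord (e x) (a t))"
 have "a s = der w x s" for s
 proof (cases "s\<in>sections L")
  case False thus ?thesis using DerD(1)[OF a] by (simp add: der_def restrict0_def)
 next
  case s: True
  from Cinf_extend_chart[OF open_img rep_smooth[OF s] x phi_img[OF x]]
  obtain f Sf where f: "f\<in>Cinf (base L)" "open Sf" "ph x\<in>Sf" "!!y. y\<in>Sf ==> f (pt y) = rep s y" by blast
  have gr: "grad (%y. f (pt y)) (ph x) = grad (rep s) (ph x)" by (rule grad_cong[OF f(2,3,4)])
  have "a s = a (%y. f y *\<^sub>R t y)"
  proof (rule Der_local[OF L a s secs_mult[OF L f(1) t(1)] open_preimage[OF open_Int[OF t(2) f(2)]]])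
   show "x\<in>dm Int ph -` (St Int Sf)" using x t(3) f(3) by simp
   fix z assume z: "z\<in>dm Int ph -` (St Int Sf)"
   hence "t z = e z" "f z = rep s (ph z)" using rep_section[OF _ t(1), of z] t(5)[of "ph z"] f(4)[of "ph z"] by auto
   thus "s z = f z *\<^sub>R t z" using rep_section[OF _ s, of z] z by simp
  qed
  also have "\<dots> = f x *\<^sub>R a t + de f *\<^sub>R e x" using de[rule_format, OF f(1) t(1)] tx by simp
  also have "\<dots> = (rep s (ph x) * coord (e x) (a t) + v\<bullet>grad (rep s) (ph x)) *\<^sub>R e x"
   using f(4)[OF f(3)] x v[OF f(1)] gr fibre_coord[OF x DerD(2)[OF a t(1)]] by (metis (no_types, lifting) pt_phi scaleR_add_left scaleR_scaleR)
  also have "\<dots> = der w x s" using s by (simp add: der_sec w_def inner_prod_def mult.commute add.commute)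
  finally show ?thesis .
 qed
 thus ?thesis by blast
qed

lemma der_jr: "x\<in>dm ==> a\<in>Der L x ==> s\<in>sections L ==> r\<in>sections L ==> jr s x = jr r x ==> a s = a r"
 using Der_der[of x a] by (auto simp: der_sec)

lemma der_add: "der (w + w') x s = der w x s + der w' x s" by (simp add: der_def restrict0_def inner_add_left scaleR_add_left)

lemma der_scale: "der (c *\<^sub>R w) x s = c *\<^sub>R der w x s" by (simp add: der_def restrict0_def)

lemma jet_eq_iff:
 assumes x: "x\<in>dm" and s: "s\<in>sections L" "r\<in>sections L"
 shows "jet L s x = jet L r x \<longleftrightarrow> jr s x = jr r x"
proof
 assume eq: "jet L s x = jet L r x"
 have *: "w\<bullet>jr s x = w\<bullet>jr r x" for w
  using fun_cong[OF eq, of "der w x"] der_Der[OF x, of w] e_nz[OF x] s by (simp add: jet_def restrict0_def der_sec)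
 show "jr s x = jr r x" by (rule onb_eqI) (subst (1 2) inner_commute, rule *)
next
 assume "jr s x = jr r x"
 thus "jet L s x = jet L r x" using der_jr[OF x _ s] by (auto simp: jet_def restrict0_def)
qed

text \<open>A linear form on derivations is linear in their coordinates \<open>w\<close>, hence an
  inner product with some vector, and every vector is the 1-jet of a section.\<close>

lemma Jet_obtain:
 assumes x: "x\<in>dm" and al: "al\<in>Jet L x"
 shows "EX s:sections L. al = jet L s x"
proof -
 have lin: "linear_funct (Der L x) al" and fib: "!!a. a\<in>Der L x ==> al a\<in>fibre L x"
  and off: "!!a. a \<notin> Der L x ==> al a = 0" using al by (auto simp: Jet_def zero_off_def)
 define f where "f w = coord (e x) (al (der w x))" for w
 have f: "al (der w x) = f w *\<^sub>R e x" for w using fibre_coord[OF x fib[OF der_Der[OF x]]] by (simp add: f_def)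
 have "f (w + w') = f w + f w'" for w w'
 proof -
  have "der (w + w') x = (%s. der w x s + der w' x s)" by (simp add: der_add fun_eq_iff)
  hence "f (w + w') *\<^sub>R e x = (f w + f w') *\<^sub>R e x"
   using linear_functD(1)[OF lin der_Der[OF x] der_Der[OF x], of w w'] by (simp add: f[symmetric] scaleR_add_left)
  thus ?thesis using e_nz[OF x] by simp
 qed
 moreover have "f (c *\<^sub>R w) = c *\<^sub>R f w" for c w
 proof -
  have "der (c *\<^sub>R w) x = (%s. c *\<^sub>R der w x s)" by (simp add: der_scale fun_eq_iff)
  hence "f (c *\<^sub>R w) *\<^sub>R e x = (c * f w) *\<^sub>R e x"
   using linear_functD(2)[OF lin der_Der[OF x], of c w] by (simp add: f[symmetric] flip: scaleR_scaleR)
  thus ?thesis using e_nz[OF x] by simp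
 qed
 ultimately have "linear f" by (rule linearI)
 hence "f w = w\<bullet>(\<Sum>b\<in>onb. f b *\<^sub>R b)" for w using linear_onb[of f w] by (simp add: inner_sum_right mult.commute)
 then obtain j where j: "!!w. f w = w\<bullet>j" by blast
 obtain s where s: "s\<in>sections L" "jr s x = j" using jr_obtain[OF x] .
 have "al a = jet L s x a" for a using off[of a] Der_der[OF x, of a] s j by (cases "a\<in>Der L x") (auto simp: jet_def restrict0_def f der_sec)
 thus ?thesis using s(1) by blast
qed

end

lemma triv_obtain:
 assumes "line_bundle L" "x\<in>pts (base L)"
 obtains U ph V e where "triv L U ph V e" "x\<in>U Int V"
proof -
 obtain U ph where "(U, ph)\<in>charts (base L)" "x\<in>U" using atlas_obtain[OF lbD(2)[OF assms(1)] assms(2)] .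
 moreover obtain V e where "(V, e)\<in>frames L" "x\<in>V" using frame_obtain[OF assms] .
 ultimately show thesis using that[of U ph V e] assms(1) by (auto simp: triv_def)
qed

text \<open>\<open>jet\<close> is cut off to 0 outside \<open>Der L x\<close>, so its linearity uses
  that sums and multiples of derivations are derivations; this is visible in coordinates.\<close>

lemma jet_Jet:
 assumes "line_bundle L" "x\<in>pts (base L)" "s\<in>sections L" shows "jet L s x\<in>Jet L x"
proof -
 have add: "(%s. a s + b s)\<in>Der L x" and scale: "(%s. c *\<^sub>R a s)\<in>Der L x" if ab: "a\<in>Der L x" "b\<in>Der L x" for a b c
 proof -
  obtain U ph V e where t: "triv L U ph V e" "x\<in>U Int V" using triv_obtain[OF assms(1,2)] .
  interpret triv L U ph V e by fact
  have x: "x\<in>dm" using t(2) by (simp add: dm_def)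
  obtain w w' where w: "a = der w x" "b = der w' x" using Der_der[OF x] ab by blast
  have "(%s. a s + b s) = der (w + w') x" "(%s. c *\<^sub>R a s) = der (c *\<^sub>R w) x" by (auto simp: w der_add der_scale)
  thus "(%s. a s + b s)\<in>Der L x" "(%s. c *\<^sub>R a s)\<in>Der L x" using der_Der[OF x] by auto
 qed
 thus ?thesis using DerD(2)[OF _ assms(3)] by (auto simp: Jet_def jet_def zero_off_def restrict0_def linear_funct_def)
qed

lemma Jet_eq:
 assumes "line_bundle L" "x\<in>pts (base L)" shows "Jet L x = (%s. jet L s x) ` sections L"
proof -
 obtain U ph V e where t: "triv L U ph V e" "x\<in>U Int V" using triv_obtain[OF assms] .
 interpret triv L U ph V e by fact
 show ?thesis using Jet_obtain[of x] jet_Jet[OF assms] t(2) by (auto simp: dm_def)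
qed

section \<open>Biderivations and Jacobi brackets\<close>

lemma (in triv) der_zero: "der 0 x = (%s. 0)" by (auto simp: der_def restrict0_def)

lemma (in triv) der_diff: "der (w - w') x s = der w x s - der w' x s" by (simp add: der_def restrict0_def inner_diff_left scaleR_diff_left)

lemma Der_closed:
 assumes "line_bundle L" "x\<in>pts (base L)" "a\<in>Der L x" "b\<in>Der L x"
 shows "(%s. a s + b s)\<in>Der L x" "(%s. c *\<^sub>R a s)\<in>Der L x" "(%s. a s - b s)\<in>Der L x" "(%s. 0)\<in>Der L x"
proof -
 obtain U ph V e where t: "triv L U ph V e" "x\<in>U Int V" using triv_obtain[OF assms(1,2)] .
 interpret triv L U ph V e by fact
 have x: "x\<in>dm" using t(2) by (simp add: dm_def)
 obtain w w' where w: "a = der w x" "b = der w' x" using Der_der[OF x] assms by blast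
 have "(%s. a s + b s) = der (w + w') x" "(%s. c *\<^sub>R a s) = der (c *\<^sub>R w) x"
  "(%s. a s - b s) = der (w - w') x" by (auto simp: w der_add der_scale der_diff)
 thus "(%s. a s + b s)\<in>Der L x" "(%s. c *\<^sub>R a s)\<in>Der L x" "(%s. a s - b s)\<in>Der L x" "(%s. 0)\<in>Der L x"
  using der_Der[OF x] der_Der[OF x, of 0] by (auto simp: der_zero)
qed

text \<open>\<open>symbol\<close> is a definite description. Uniqueness comes from a section that
  does not vanish at \<open>x\<close>, on which the Leibniz rule isolates the symbol.\<close>

lemma symbol_Der:
 assumes "line_bundle L" "x\<in>pts (base L)" "a\<in>Der L x"
 shows "symbol L x a\<in>tangent (base L) x"
  "f\<in>Cinf (base L) ==> s\<in>sections L ==> a (%y. f y *\<^sub>R s y) = f x *\<^sub>R a s + symbol L x a f *\<^sub>R s x"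
  "de\<in>tangent (base L) x ==> (ALL f:Cinf (base L). ALL s:sections L. a (%y. f y *\<^sub>R s y) = f x *\<^sub>R a s + de f *\<^sub>R s x) ==>
   symbol L x a = de"
proof -
 obtain U ph V e where t: "triv L U ph V e" "x\<in>U Int V" using triv_obtain[OF assms(1,2)] .
 interpret triv L U ph V e by fact
 have x: "x\<in>dm" using t(2) by (simp add: dm_def)
 obtain w where w: "a = der w x" using Der_der[OF x assms(3)] by blast
 obtain s where s: "s\<in>sections L" "jr s x = (0, 1)" using jr_obtain[OF x] .
 have sx: "s x ~= 0" using rep_section[OF x s(1)] s(2) e_nz[OF x] by (metis scaleR_one snd_conv snd_jet1)
 have uniq: "de = de'" if "de\<in>tangent (base L) x" "de'\<in>tangent (base L) x"
  "ALL f:Cinf (base L). ALL s:sections L. a (%y. f y *\<^sub>R s y) = f x *\<^sub>R a s + de f *\<^sub>R s x"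
  "ALL f:Cinf (base L). ALL s:sections L. a (%y. f y *\<^sub>R s y) = f x *\<^sub>R a s + de' f *\<^sub>R s x" for de de'
 proof
  fix f
  show "de f = de' f"
  proof (cases "f\<in>Cinf (base L)")
   case True
   hence "de f *\<^sub>R s x = de' f *\<^sub>R s x" using that(3)[rule_format, OF True s(1)] that(4)[rule_format, OF True s(1)] by auto
   thus ?thesis using sx by simp
  next
   case False
   thus ?thesis using tangentD(1)[OF that(1)] tangentD(1)[OF that(2)] by simp
  qed
 qed
 obtain de' where d': "de'\<in>tangent (base L) x" "ALL f:Cinf (base L). ALL s:sections L. a (%y. f y *\<^sub>R s y) = f x *\<^sub>R a s + de' f *\<^sub>R s x"
  using Der_symbol[OF assms(3)] by blast
 have sym: "symbol L x a = de'" unfolding symbol_def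
 proof (rule the_equality)
  fix de
  assume d: "de\<in>tangent (base L) x & (ALL f:Cinf (base L). ALL s:sections L. a (%y. f y *\<^sub>R s y) = f x *\<^sub>R a s + de f *\<^sub>R s x)"
  show "de = de'" by (rule uniq[OF d[THEN conjunct1] d'(1) d[THEN conjunct2] d'(2)])
 qed (intro conjI d')
 show "symbol L x a\<in>tangent (base L) x" unfolding sym by (rule d'(1))
 show "f\<in>Cinf (base L) ==> s\<in>sections L ==> a (%y. f y *\<^sub>R s y) = f x *\<^sub>R a s + symbol L x a f *\<^sub>R s x" for f s
  unfolding sym by (rule d'(2)[rule_format])
 show "symbol L x a = de" if "de\<in>tangent (base L) x"
  "ALL f:Cinf (base L). ALL s:sections L. a (%y. f y *\<^sub>R s y) = f x *\<^sub>R a s + de f *\<^sub>R s x"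
  unfolding sym by (rule uniq[OF d'(1) that(1) d'(2) that(2)])
qed

lemma (in triv) symbol_der:
 assumes x: "x\<in>dm" shows "symbol L x (der w x) = tan (fst w) x"
proof (rule symbol_Der(3)[OF L dm_pts[OF x] der_Der[OF x] tan_tangent[OF x]], intro ballI)
 fix f s assume f: "f\<in>Cinf (base L)" and s: "s\<in>sections L"
 hence "w\<bullet>jr (%y. f y *\<^sub>R s y) x = f x * (w\<bullet>jr s x) + tan (fst w) x f * rep s (ph x)"
  by (simp add: jr_mult x inner_prod_def tan_def restrict0_def algebra_simps)
 thus "der w x (%y. f y *\<^sub>R s y) = f x *\<^sub>R der w x s + tan (fst w) x f *\<^sub>R s x" using secs_mult[OF L f s] s rep_section[OF x s]
  by (simp add: der_sec scaleR_add_left flip: scaleR_scaleR)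
qed

lemma dersD:
 assumes "a\<in>derivations L"
 shows "s\<in>sections L ==> a s\<in>sections L" "s \<notin> sections L ==> a s = (%x. 0)"
  "x\<in>pts (base L) ==> (%s. a s x)\<in>Der L x" using assms by (auto simp: derivations_def)

lemma derivations_off: "a\<in>derivations L ==> x \<notin> pts (base L) ==> a s x = 0" using dersD(1,2) sectionsD(3) by metis

text \<open>The pointwise coefficients depend smoothly on the point because they can be recovered
  from finitely many smooth sections: the images of a unit section and of the coordinate
  functions.\<close>

lemma (in triv) ders_field:
 assumes a: "a\<in>derivations L"
 shows "\<exists>w. smooth_on img w & (ALL x:dm. (%s. a s x) = der (w (ph x)) x)"
proof -
 have "\<exists>w. (%s. a s x) = der w x" if "x\<in>dm" for x using Der_der[OF that dersD(3)[OF a dm_pts[OF that]]] .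
 then obtain w' where w': "!!x. x\<in>dm ==> (%s. a s x) = der (w' x) x" by metis
 define w where "w y = w' (pt y)" for y
 have w: "(%s. a s x) = der (w (ph x)) x" if "x\<in>dm" for x using w'[OF that] that by (simp add: w_def)
 have rep_w: "rep (a s) y = w y\<bullet>jet1 (rep s) y" if "s\<in>sections L" "y\<in>img" for s y
  using fun_cong[OF w[OF pt_dm[OF that(2)]], of s] that e_nz[OF pt_dm[OF that(2)]] by (simp add: rep_def der_sec)
 have "smooth_on img w"
 proof (rule smooth_local)
  fix y assume y: "y\<in>img"
  let ?x = "pt y"
  have x: "?x\<in>dm" using pt_dm[OF y] .
  have ext: "EX s:sections L. \<exists>S. open S & y\<in>S & S \<subseteq> img & (ALL y:S. rep s y = h y)" if "smooth_on img h" for h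
   using rep_extend[OF open_img that x phi_img[OF x]] y by simp
  have "smooth_on img (%y. b\<bullet>y + 0)" for b by (intro smooth_intros open_img)
  from ext[OF this] obtain t St where t: "!!b. t b\<in>sections L" "!!b. open (St b)" "!!b. y\<in>St b"
   "!!b. St b \<subseteq> img" "!!b z. z\<in>St b ==> rep (t b) z = b\<bullet>z + 0" by metis
  obtain t0 S0 where t0: "t0\<in>sections L" "open S0" "y\<in>S0" "S0 \<subseteq> img" "!!z. z\<in>S0 ==> rep t0 z = 1"
   using ext[OF smooth_const[of _ 1]] by blast
  define S where "S = S0 Int (\<Inter>b\<in>onb. St b)"
  have S: "open S" "y\<in>S" "S \<subseteq> img" unfolding S_def using t t0 onb(1) by (auto intro!: open_Int open_INT)
  \<comment> \<open>The image of the unit section is the zeroth-order coefficient; subtracting its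
    contribution from the images of the linear coordinates leaves the vector part.\<close>
  define F where "F z = ((\<Sum>b\<in>onb. (rep (a (t b)) z - (b\<bullet>z) * rep (a t0) z) *\<^sub>R b), rep (a t0) z)" for z
  have as: "smooth_on S (rep (a s))" if "s\<in>sections L" for s using smooth_subset[OF rep_smooth[OF dersD(1)[OF a that]] S(3)] .
  have "smooth_on S F" unfolding F_def by (intro smooth_intros S(1) as[OF t(1)] as[OF t0(1)])
  moreover have "F z = w z" if z: "z\<in>S" for z
  proof -
   have zi: "z\<in>img" using z S(3) by blast
   have "jet1 (rep t0) z = jet1 (%z. 1) z" using t0(2,5) z by (intro jet1_cong[of S0]) (auto simp: S_def)
   hence 0: "rep (a t0) z = snd (w z)" using rep_w[OF t0(1) zi] by (simp add: jet1_const inner_prod_def)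
   have "rep (a (t b)) z = fst (w z)\<bullet>b + snd (w z) * (b\<bullet>z)" if b: "b\<in>onb" for b
   proof -
    have "jet1 (rep (t b)) z = jet1 (%z. b\<bullet>z + 0) z" using t(2,5) z b by (intro jet1_cong[of "St b"]) (auto simp: S_def)
    also have "\<dots> = (b, b\<bullet>z)" using jet1_affine[of b 0 z] by (simp only: add_0_right)
    finally have "rep (a (t b)) z = w z\<bullet>(b, b\<bullet>z)" using rep_w[OF t(1)[of b] zi] by (simp only:)
    thus ?thesis by (simp add: inner_prod_def)
   qed
   hence "(\<Sum>b\<in>onb. (rep (a (t b)) z - (b\<bullet>z) * rep (a t0) z) *\<^sub>R b) = (\<Sum>b\<in>onb. (fst (w z)\<bullet>b) *\<^sub>R b)"
    by (intro sum.cong) (auto simp: 0 mult.commute)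
   thus ?thesis by (simp add: F_def 0 onb_expand)
  qed
  ultimately have "smooth_on S w" using smooth_cong S(1) by blast
  thus "\<exists>T. open T & y\<in>T & smooth_on T w" using S by blast
 qed
 thus ?thesis using w by blast
qed

lemma (in triv) rep_der:
 "(%s. a s x) = der w x ==> x\<in>dm ==> s\<in>sections L ==> rep (a s) (ph x) = w\<bullet>jr s x"
 using e_nz[of x] fun_cong[of "%s. a s x" "der w x" s] by (simp add: rep_phi der_sec)

text \<open>\<open>S\<close> may cut out less than the whole chart: for a factor, coefficients make
  sense only over the part that the base map sends into a given trivialisation.\<close>

lemma (in triv) cutoff_derivation:
 assumes S: "open S" "smooth_on (S Int img) w" and ka: "ka\<in>Cinf (base L)"
  and Z: "openin (mtop (base L)) Z" "(dm Int ph -` S) Un Z = pts (base L)" "!!z. z\<in>Z ==> ka z = 0"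
 shows "(%s z. if z\<in>dm Int ph -` S then ka z *\<^sub>R der (w (ph z)) z s else 0)\<in>derivations L" (is "?a\<in>_")
proof -
 let ?W = "dm Int ph -` S"
 have W: "openin (mtop (base L)) ?W" by (rule open_preimage[OF S(1)])
 have o: "open (S Int img)" using S(1) open_img by blast
 have off: "?a s = (%x. 0)" if "s \<notin> sections L" for s using that by (auto simp: der_def restrict0_def)
 have D: "(%s. ?a s x)\<in>Der L x" if x: "x\<in>pts (base L)" for x
 proof (cases "x\<in>?W")
  case True
  thus ?thesis using der_Der[of x "ka x *\<^sub>R w (ph x)"] by (simp add: der_scale[abs_def])
 next
  case False
  obtain U' ph' V' e' where t: "triv L U' ph' V' e'" "x\<in>U' Int V'" using triv_obtain[OF L x] .
  hence "(%s. 0)\<in>Der L x" using triv.der_Der[OF t(1), of x 0] triv.der_zero[OF t(1)] by (simp add: triv.dm_def[OF t(1)])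
  moreover have "(%s. ?a s x) = (%s. 0)" using False by auto
  ultimately show ?thesis by (simp only:)
 qed
 have "?a s\<in>sections L" if s: "s\<in>sections L" for s
 proof -
  have k: "smooth_on (S Int img) (%y. ka (pt y) * (w y\<bullet>jet1 (rep s) y))"
   using smooth_subset[OF Cinf_smooth[OF ka]] smooth_subset[OF smooth_jet1[OF open_img rep_smooth[OF s]]]
   by (intro smooth_on_mult smooth_on_inner o S(2)) auto
  have 1: "smooth_section_on L ?W (?a s)" by (rule section_smoothI[OF W _ o k]) (auto simp: phi_img der_sec[OF s])
  have 2: "smooth_section_on L Z (?a s)" by (rule ssec_cong[OF ssec_subset[OF sectionsD(1)[OF secs_zero[OF L]]]])
    (use Z in auto)
  have "smooth_section_on L (pts (base L)) (?a s)" by (rule ssec_local[OF L opn_pts[OF A]]) (use 1 2 W Z(1,2) in blast)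
  thus ?thesis using dm_pts by (auto simp: sections_def zero_off_def)
 qed
 thus ?thesis using off D by (simp add: derivations_def)
qed

lemma (in triv) ders_obtain:
 assumes x: "x\<in>dm" and w: "smooth_on img w"
 shows "EX a:derivations L. \<exists>W. openin (mtop (base L)) W & x\<in>W & W \<subseteq> dm & (ALL z:W. (%s. a s z) = der (w (ph z)) z)"
proof -
 obtain ka W Z where ka: "ka\<in>Cinf (base L)" "openin (mtop (base L)) W" "x\<in>W" "W \<subseteq> dm" "!!y. y\<in>W ==> ka y = 1"
  "openin (mtop (base L)) Z" "dm Un Z = pts (base L)" "!!y. y\<in>Z ==> ka y = 0" using manifold_bump[OF M opn_dm x] by metis
 have "(%s z. if z\<in>dm Int ph -` UNIV then ka z *\<^sub>R der (w (ph z)) z s else 0)\<in>derivations L"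
  by (rule cutoff_derivation[OF open_UNIV _ ka(1,6) _ ka(8)]) (use w ka(7) in auto)
 thus ?thesis using ka(2-5) by (intro bexI[rotated]) (auto intro!: exI[of _ W])
qed

lemma ders_symbol:
 assumes L: "line_bundle L" and a: "a\<in>derivations L" and f: "f\<in>Cinf (base L)"
 shows "restrict0 (pts (base L)) (%x. symbol L x (%s. a s x) f)\<in>Cinf (base L)"
proof -
 let ?X = "restrict0 (pts (base L)) (%x. symbol L x (%s. a s x) f)"
 have "smooth_fun_on (base L) (pts (base L)) ?X"
 proof (rule sfun_local[OF lbD(2)[OF L]])
  fix x assume x: "x\<in>pts (base L)"
  obtain U ph V e where t: "triv L U ph V e" "x\<in>U Int V" using triv_obtain[OF L x] .
  interpret triv L U ph V e by fact
  obtain w where w: "smooth_on img w" "!!x. x\<in>dm ==> (%s. a s x) = der (w (ph x)) x" using ders_field[OF a] by blast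
  have s: "smooth_on img (%y. fst (w y)\<bullet>grad (%y. f (pt y)) y)"
   by (intro smooth_on_inner smooth_on_fst smooth_grad open_img w(1) Cinf_smooth f)
  have "smooth_fun_on (base L) dm ?X" by (rule fun_smoothI[OF opn_dm _ open_img s])
    (auto simp: phi_img restrict0_def dm_pts w(2) symbol_der tan_def f)
  thus "\<exists>T. openin (mtop (base L)) T & x\<in>T & smooth_fun_on (base L) T ?X" using opn_dm t(2) by (auto simp: dm_def)
 qed
 thus ?thesis by (auto simp: Cinf_def zero_off_def restrict0_def)
qed

lemma ders_mult:
 assumes "line_bundle L" "a\<in>derivations L" "f\<in>Cinf (base L)" "s\<in>sections L"
 shows "a (%y. f y *\<^sub>R s y) = (%x. f x *\<^sub>R a s x + restrict0 (pts (base L)) (%x. symbol L x (%s. a s x) f) x *\<^sub>R s x)"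
proof
 fix x
 show "a (%y. f y *\<^sub>R s y) x = f x *\<^sub>R a s x + restrict0 (pts (base L)) (%x. symbol L x (%s. a s x) f) x *\<^sub>R s x"
  using symbol_Der(2)[OF assms(1) _ dersD(3)[OF assms(2)] assms(3,4), of x] derivations_off[OF assms(2), of x]
  by (cases "x\<in>pts (base L)") (auto simp: restrict0_def)
qed

lemma ders_linear:
 assumes "line_bundle L" "a\<in>derivations L" "s\<in>sections L" "r\<in>sections L"
 shows "a (%y. s y + r y) = (%x. a s x + a r x)" "a (%y. c *\<^sub>R s y) = (%x. c *\<^sub>R a s x)"
  "a (%y. s y - r y) = (%x. a s x - a r x)" "a (%y. - s y) = (%x. - a s x)" "a (%y. 0) = (%x. 0)"
proof -
 have "a (%y. s y + r y) x = a s x + a r x & a (%y. c *\<^sub>R s y) x = c *\<^sub>R a s x \<and>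
  a (%y. s y - r y) x = a s x - a r x & a (%y. - s y) x = - a s x & a (%y. 0) x = 0" for x
 proof (cases "x\<in>pts (base L)")
  case True
  note D = dersD(3)[OF assms(2) True]
  show ?thesis using DerD(3,4)[OF D] Der_diff[OF assms(1) D] Der_minus[OF D] Der_zero[OF assms(1) D] assms(3,4) by auto
 qed (simp add: derivations_off[OF assms(2)])
 thus "a (%y. s y + r y) = (%x. a s x + a r x)" "a (%y. c *\<^sub>R s y) = (%x. c *\<^sub>R a s x)"
  "a (%y. s y - r y) = (%x. a s x - a r x)" "a (%y. - s y) = (%x. - a s x)" "a (%y. 0) = (%x. 0)" by auto
qed

text \<open>The mixed first-order terms of the two iterated products cancel, and the symbol of the
  commutator is the Lie bracket of the symbols, here
  \<open>X a (X b f) - X b (X a f)\<close>.\<close>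

lemma comm_ders:
 assumes L: "line_bundle L" and a: "a\<in>derivations L" and b: "b\<in>derivations L"
 shows "commutator a b\<in>derivations L"
proof -
 define X where "X = (%a f. restrict0 (pts (base L)) (%x. symbol L x (%s. a s x) f))"
 have XC: "X a f\<in>Cinf (base L)" if "a\<in>derivations L" "f\<in>Cinf (base L)" for a f unfolding X_def by (rule ders_symbol[OF L that])
 have Xm: "a (%y. f y *\<^sub>R s y) = (%x. f x *\<^sub>R a s x + X a f x *\<^sub>R s x)"
  if "a\<in>derivations L" "f\<in>Cinf (base L)" "s\<in>sections L" for a f s unfolding X_def by (rule ders_mult[OF L that])
 have Xt: "X a (%y. f y + g y) x = X a f x + X a g x" "X a (%y. c * f y) x = c * X a f x"
  "X a (%y. f y * g y) x = f x * X a g x + X a f x * g x"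
  if "a\<in>derivations L" "f\<in>Cinf (base L)" "g\<in>Cinf (base L)" for a f g c x
  using tangentD[OF symbol_Der(1)[OF L _ dersD(3)[OF that(1)]]] that(2,3) by (auto simp: X_def restrict0_def)
 note A = lbD(2)[OF L]
 have mult: "a (b (%y. f y *\<^sub>R s y)) = (%x. f x *\<^sub>R a (b s) x + X a f x *\<^sub>R b s x + X b f x *\<^sub>R a s x + X a (X b f) x *\<^sub>R s x)"
  if a: "a\<in>derivations L" and b: "b\<in>derivations L" and f: "f\<in>Cinf (base L)" and s: "s\<in>sections L" for a b f s
  using ders_linear(1)[OF L a secs_mult[OF L f dersD(1)[OF b s]] secs_mult[OF L XC[OF b f] s]]
  by (simp add: Xm[OF b f s] Xm[OF a f dersD(1)[OF b s]] Xm[OF a XC[OF b f] s] add.assoc)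
 have C: "(%s. commutator a b s x)\<in>Der L x" if x: "x\<in>pts (base L)" for x
 proof -
  let ?d = "restrict0 (Cinf (base L)) (%f. X a (X b f) x - X b (X a f) x)"
  have X1: "X c (X d (%y. f y + g y)) x = X c (X d f) x + X c (X d g) x"
   "X c (X d (%y. k * f y)) x = k * X c (X d f) x"
   "X c (X d (%y. f y * g y)) x = f x * X c (X d g) x + X c f x * X d g x + X d f x * X c g x + X c (X d f) x * g x"
   if c: "c\<in>derivations L" and d: "d\<in>derivations L" and f: "f\<in>Cinf (base L)" "g\<in>Cinf (base L)" for c d f g k
  proof -
   note Xf = XC[OF d f(1)] and Xg = XC[OF d f(2)]
   have "X d (%y. f y + g y) = (%x. X d f x + X d g x)" "X d (%y. k * f y) = (%x. k * X d f x)"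
    "X d (%y. f y * g y) = (%x. f x * X d g x + X d f x * g x)" by (auto simp: Xt[OF d f])
   thus "X c (X d (%y. f y + g y)) x = X c (X d f) x + X c (X d g) x"
    "X c (X d (%y. k * f y)) x = k * X c (X d f) x"
    "X c (X d (%y. f y * g y)) x = f x * X c (X d g) x + X c f x * X d g x + X d f x * X c g x + X c (X d f) x * g x"
    using Xt[OF c Xf Xg] Xt(1)[OF c Cinf_mult[OF A f(1) Xg] Cinf_mult[OF A Xf f(2)]]
     Xt(3)[OF c f(1) Xg] Xt(3)[OF c Xf f(2)] by simp_all
  qed
  have t: "?d\<in>tangent (base L) x" unfolding tangent_def point_derivations_def linear_funct_def
   using Cinf_add[OF A] Cinf_mult[OF A] Cinf_scale[OF A] by (auto simp: zero_off_def restrict0_def X1[OF a b] X1[OF b a] algebra_simps)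
  have l: "commutator a b (%y. f y *\<^sub>R s y) x = f x *\<^sub>R commutator a b s x + ?d f *\<^sub>R s x"
   if "f\<in>Cinf (base L)" "s\<in>sections L" for f s using that by (simp add: commutator_def mult[OF a b] mult[OF b a] restrict0_def algebra_simps)
  have lin: "linear_funct (sections L) (%s. commutator a b s x)" unfolding linear_funct_def commutator_def
   by (auto simp: ders_linear(1)[OF L a] ders_linear(1)[OF L b] ders_linear(2)[OF L a]
    ders_linear(2)[OF L b] dersD(1)[OF a] dersD(1)[OF b] algebra_simps)
  have off: "commutator a b s x = 0" if "s \<notin> sections L" for s using that ders_linear(5)[OF L a secs_zero[OF L] secs_zero[OF L]]
    ders_linear(5)[OF L b secs_zero[OF L] secs_zero[OF L]] by (simp add: commutator_def dersD(2)[OF a] dersD(2)[OF b])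
  have fib: "commutator a b s x\<in>fibre L x" if "s\<in>sections L" for s unfolding commutator_def using that x
   by (intro subspace_diff lbD(3)[OF L] sectionsD(2) dersD(1)[OF a] dersD(1)[OF b])
  show ?thesis unfolding Der_def section_derivations_def using t l lin off fib by (auto simp: zero_off_def tangent_def)
 qed
 show ?thesis unfolding derivations_def
 proof (intro CollectI conjI ballI allI impI C)
  fix s assume s: "s\<in>sections L"
  show "commutator a b s\<in>sections L" unfolding commutator_def by (intro secs_diff[OF L] dersD(1)[OF a] dersD(1)[OF b] s)
 next
  fix s assume "s \<notin> sections L"
  thus "commutator a b s = (%x. 0)" using ders_linear(5)[OF L a secs_zero[OF L] secs_zero[OF L]]
    ders_linear(5)[OF L b secs_zero[OF L] secs_zero[OF L]] by (simp add: commutator_def dersD(2)[OF a] dersD(2)[OF b])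
 qed
qed

lemma ders_diff_op:
 assumes L: "line_bundle L" and a: "a\<in>derivations L"
 shows "diff_op 1 L a"
proof -
 have lin: "linear_funct (sections L) (%s. a s x)" for x
  unfolding linear_funct_def by (auto simp: ders_linear(1)[OF L a] ders_linear(2)[OF L a])
 have "diff_op 0 L (%s x. a (%y. f y *\<^sub>R s y) x - f x *\<^sub>R a s x)" if f: "f\<in>Cinf (base L)" for f
 proof -
  let ?X = "restrict0 (pts (base L)) (%x. symbol L x (%s. a s x) f)"
  have *: "a (%y. f y *\<^sub>R s y) x - f x *\<^sub>R a s x = ?X x *\<^sub>R s x" if "s\<in>sections L" for s x
   by (simp add: ders_mult[OF L a f that])
  have "(%x. a (%y. f y *\<^sub>R s y) x - f x *\<^sub>R a s x)\<in>sections L" if "s\<in>sections L" for s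
   using secs_mult[OF L ders_symbol[OF L a f] that] by (simp add: *[OF that])
  moreover have "linear_funct (sections L) (%s. a (%y. f y *\<^sub>R s y) x - f x *\<^sub>R a s x)" for x unfolding linear_funct_def
  proof (intro conjI ballI allI)
   fix s r c assume s: "s\<in>sections L" "r\<in>sections L"
   show "a (%y. f y *\<^sub>R (s y + r y)) x - f x *\<^sub>R a (%y. s y + r y) x =
     a (%y. f y *\<^sub>R s y) x - f x *\<^sub>R a s x + (a (%y. f y *\<^sub>R r y) x - f x *\<^sub>R a r x)"
    unfolding *[OF secs_add[OF L s]] *[OF s(1)] *[OF s(2)] by (simp add: scaleR_add_right)
  next
   fix s c assume s: "s\<in>sections L"
   show "a (%y. f y *\<^sub>R (c *\<^sub>R s y)) x - f x *\<^sub>R a (%y. c *\<^sub>R s y) x = c *\<^sub>R (a (%y. f y *\<^sub>R s y) x - f x *\<^sub>R a s x)"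
    unfolding *[OF secs_scale[OF L s]] *[OF s] by simp
  qed
  moreover have "a (%y. f y *\<^sub>R (g y *\<^sub>R s y)) x - f x *\<^sub>R a (%y. g y *\<^sub>R s y) x
    = g x *\<^sub>R (a (%y. f y *\<^sub>R s y) x - f x *\<^sub>R a s x)" if "g\<in>Cinf (base L)" "s\<in>sections L" for g s x
   unfolding *[OF secs_mult[OF L that]] *[OF that(2)] by simp
  ultimately show ?thesis by (simp only: diff_op.simps) blast
 qed
 thus ?thesis using lin dersD(1)[OF a] by (simp del: diff_op.simps(1))
qed

text \<open>Special to rank 1: the commutator with multiplication by \<open>f\<close> is linear over
  functions, hence acts at \<open>x\<close> as multiplication by a number \<open>de f\<close>, and
  this number is the symbol.\<close>

lemma diff_op_derivation:
 assumes L: "line_bundle L" and a: "diff_op 1 L a" and off: "!!s. s \<notin> sections L ==> a s = (%x. 0)"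
 shows "a\<in>derivations L"
proof -
 define D where "D f s x = a (%y. f y *\<^sub>R s y) x - f x *\<^sub>R a s x" for f s x
 have a1: "!!s. s\<in>sections L ==> a s\<in>sections L" "!!x. linear_funct (sections L) (%s. a s x)"
  and D: "!!f. f\<in>Cinf (base L) ==> diff_op 0 L (D f)" using a by (simp_all add: D_def[abs_def] del: diff_op.simps(1))
 have D1: "!!f s. f\<in>Cinf (base L) ==> s\<in>sections L ==> D f s\<in>sections L"
  "!!f x. f\<in>Cinf (base L) ==> linear_funct (sections L) (%s. D f s x)"
  "!!f g s x. f\<in>Cinf (base L) ==> g\<in>Cinf (base L) ==> s\<in>sections L ==> D f (%y. g y *\<^sub>R s y) x = g x *\<^sub>R D f s x"
  using D by auto
 note lin = linear_functD[OF a1(2)] and A = lbD(2)[OF L]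
 have "(%s. a s x)\<in>Der L x" if x: "x\<in>pts (base L)" for x
 proof -
  obtain U ph V e where t: "triv L U ph V e" "x\<in>U Int V" using triv_obtain[OF L x] .
  interpret triv L U ph V e by fact
  have xd: "x\<in>dm" using t(2) by (simp add: dm_def)
  from rep_extend[OF open_img smooth_const xd phi_img[OF xd], of 1]
  obtain t St where t: "t\<in>sections L" "open St" "ph x\<in>St" "St \<subseteq> img" "!!y. y\<in>St ==> rep t y = 1" by blast
  have tx: "t x = e x" using rep_section[OF xd t(1)] t(3,5) by simp
  define de where "de = restrict0 (Cinf (base L)) (%f. coord (e x) (D f t x))"
  have Dt: "D f t x = de f *\<^sub>R e x" if "f\<in>Cinf (base L)" for f
   using fibre_coord[OF xd sectionsD(2)[OF D1(1)[OF that t(1)] x]] that by (simp add: de_def restrict0_def)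
  have Ds: "D f s x = de f *\<^sub>R s x" if f: "f\<in>Cinf (base L)" and s: "s\<in>sections L" for f s
  proof -
   from Cinf_extend_chart[OF open_img rep_smooth[OF s] xd phi_img[OF xd]]
   obtain h Sh where h: "h\<in>Cinf (base L)" "open Sh" "ph x\<in>Sh" "!!y. y\<in>Sh ==> h (pt y) = rep s y" by blast
   let ?W = "dm Int ph -` (St Int Sh)"
   have W: "openin (mtop (base L)) ?W" "x\<in>?W" using open_preimage[OF open_Int[OF t(2) h(2)]] t(3) h(3) xd by blast+
   obtain ka W' Z where ka: "ka\<in>Cinf (base L)" "openin (mtop (base L)) W'" "x\<in>W'" "W' \<subseteq> ?W" "!!y. y\<in>W' ==> ka y = 1"
    "openin (mtop (base L)) Z" "?W Un Z = pts (base L)" "!!y. y\<in>Z ==> ka y = 0" using manifold_bump[OF M W] by metis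
   \<comment> \<open>Linearity over functions does not include locality. After the cut-off,
     \<open>s\<close> is globally a function times the unit section \<open>t\<close>, and the
     comparison becomes algebraic.\<close>
   have "ka z *\<^sub>R s z = (ka z * h z) *\<^sub>R t z" for z
   proof -
    consider "z\<in>?W" | "z\<in>Z" | "z \<notin> pts (base L)" using ka(7) by blast
    thus ?thesis
    proof cases
     case 1
     hence "t z = e z" "h z = rep s (ph z)" using rep_section[OF _ t(1), of z] t(5)[of "ph z"] h(4)[of "ph z"] by auto
     thus ?thesis using rep_section[OF _ s, of z] 1 by (simp flip: scaleR_scaleR)
    qed (use ka(8) sectionsD(3)[OF s] sectionsD(3)[OF t(1)] in auto)
   qed
   hence "D f (%y. ka y *\<^sub>R s y) x = D f (%y. (ka y * h y) *\<^sub>R t y) x" by simp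
   hence "D f s x = h x *\<^sub>R D f t x" using D1(3)[OF f ka(1) s, of x] D1(3)[OF f Cinf_mult[OF A ka(1) h(1)] t(1), of x] ka(3,5) by simp
   moreover have "h x = rep s (ph x)" using h(4)[OF h(3)] xd by simp
   ultimately show ?thesis using Dt[OF f] rep_section[OF xd s] by (metis scaleR_left_commute)
  qed
  have mult: "a (%y. f y *\<^sub>R s y) x = f x *\<^sub>R a s x + de f *\<^sub>R s x" if "f\<in>Cinf (base L)" "s\<in>sections L" for f s
   using Ds[OF that] by (simp add: D_def algebra_simps)
  have "de (%y. f y + g y) *\<^sub>R e x = (de f + de g) *\<^sub>R e x" if fg: "f\<in>Cinf (base L)" "g\<in>Cinf (base L)" for f g
   using mult[OF Cinf_add[OF A fg] t(1)] mult[OF fg(1) t(1)] mult[OF fg(2) t(1)]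
    lin(1)[OF secs_mult[OF L fg(1) t(1)] secs_mult[OF L fg(2) t(1)], of x] by (simp add: scaleR_add_left tx)
  moreover have "de (%y. c * f y) *\<^sub>R e x = (c * de f) *\<^sub>R e x" if f: "f\<in>Cinf (base L)" for f c
   using mult[OF Cinf_scale[OF A f] t(1), of c] mult[OF f t(1)] lin(2)[OF secs_mult[OF L f t(1)], of c x] by (simp add: scaleR_add_right tx)
  moreover have "de (%y. f y * g y) *\<^sub>R e x = (f x * de g + de f * g x) *\<^sub>R e x" if fg: "f\<in>Cinf (base L)" "g\<in>Cinf (base L)" for f g
   using mult[OF Cinf_mult[OF A fg] t(1)] mult[OF fg(1) secs_mult[OF L fg(2) t(1)]] mult[OF fg(2) t(1)]
   by (simp add: scaleR_add_left tx algebra_simps)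
  ultimately have "de\<in>point_derivations (Cinf (base L)) x"
   using e_nz[OF xd] by (auto simp: point_derivations_def linear_funct_def zero_off_def de_def restrict0_def)
  thus ?thesis unfolding Der_def section_derivations_def using mult off a1 sectionsD(2)[OF a1(1) x] by (auto simp: zero_off_def)
 qed
 thus ?thesis using a1(1) off by (simp add: derivations_def)
qed

section \<open>Biderivations and their determination by generators\<close>

text \<open>What is left of a Jacobi structure without skew symmetry and Jacobi identity. These
  brackets can be given by local formulas and glued; the two identities are checked afterwards on
  generators.\<close>

definition biders :: "('m, 'e::findim, 'l::real_vector) line_bundle => ('m, 'l) bracket => bool" where
 "biders L br \<longleftrightarrow> (\<forall>s r. s \<notin> sections L | r \<notin> sections L --> br s r = (%x. 0)) \<and>
  (ALL s:sections L. br s\<in>derivations L & (%r. br r s)\<in>derivations L)"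

lemma jacobi_iff:
 assumes L: "line_bundle L"
 shows "jacobi L br \<longleftrightarrow> biders L br & (ALL s:sections L. br s s = (%x. 0)) \<and>
  (ALL s:sections L. ALL r:sections L. ALL t:sections L. \<forall>x.
    br s (br r t) x + br r (br t s) x + br t (br s r) x = 0)"
proof -
 have "(br s\<in>derivations L \<longleftrightarrow> diff_op 1 L (br s)) & ((%r. br r s)\<in>derivations L \<longleftrightarrow> diff_op 1 L (%r. br r s))"
  if "\<forall>s r. s \<notin> sections L | r \<notin> sections L --> br s r = (%x. 0)" for s
  using ders_diff_op[OF L] diff_op_derivation[OF L, of "br s"] diff_op_derivation[OF L, of "%r. br r s"] that by blast
 thus ?thesis unfolding jacobi_def biders_def by blast
qed

text \<open>Dual formulation of the condition that the 1-jets of \<open>G\<close> span all jets; it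
  is the form in which equality of derivations is deduced.\<close>

definition jet_spanning :: "('m, 'e::findim, 'l::real_vector) line_bundle => ('m => 'l) set => bool" where
 "jet_spanning L G \<longleftrightarrow> G \<subseteq> sections L \<and>
  (ALL x:pts (base L). ALL a:Der L x. (ALL g:G. a g = 0) --> a = (%s. 0))"

lemma jet_spanning_eq:
 assumes L: "line_bundle L" and G: "jet_spanning L G" and x: "x\<in>pts (base L)"
  and a: "a\<in>Der L x" "b\<in>Der L x" and eq: "!!g. g\<in>G ==> a g = b g"
 shows "a = b"
proof -
 have "(%s. a s - b s) = (%s. 0)" using G Der_closed(3)[OF L x a] x eq unfolding jet_spanning_def by auto
 thus ?thesis by (metis (no_types) eq_iff_diff_eq_0 ext)
qed

text \<open>One argument is freed at a time. The lemma speaks about a single point and uses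
  \<open>restrict0\<close>, so that it also compares brackets that exist only locally.\<close>

lemma biders_point_eq:
 assumes L: "line_bundle L" and G: "jet_spanning L G" and x: "x\<in>pts (base L)"
  and F: "!!s. s\<in>sections L ==> restrict0 (sections L) (F s)\<in>Der L x"
   "!!s. s\<in>sections L ==> restrict0 (sections L) (%r. F r s)\<in>Der L x"
  and F': "!!s. s\<in>sections L ==> restrict0 (sections L) (F' s)\<in>Der L x"
   "!!s. s\<in>sections L ==> restrict0 (sections L) (%r. F' r s)\<in>Der L x"
  and eq: "!!g h. g\<in>G ==> h\<in>G ==> F g h = F' g h"
  and s: "s\<in>sections L" "r\<in>sections L"
 shows "F s r = F' s r"
proof -
 have GS: "!!g. g\<in>G ==> g\<in>sections L" using G by (auto simp: jet_spanning_def)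
 have 1: "F g r = F' g r" if "g\<in>G" "r\<in>sections L" for g r
 proof -
  have "restrict0 (sections L) (F g) = restrict0 (sections L) (F' g)"
   by (rule jet_spanning_eq[OF L G x F(1)[OF GS[OF that(1)]] F'(1)[OF GS[OF that(1)]]])
    (use eq that GS in \<open>auto simp: restrict0_def\<close>)
  from fun_cong[OF this, of r] that show ?thesis by (simp add: restrict0_def)
 qed
 have "restrict0 (sections L) (%s. F s r) = restrict0 (sections L) (%s. F' s r)" by (rule jet_spanning_eq[OF L G x F(2)[OF s(2)] F'(2)[OF s(2)]])
   (use 1 s GS in \<open>auto simp: restrict0_def\<close>)
 from fun_cong[OF this, of s] s show ?thesis by (simp add: restrict0_def)
qed

lemma bidersD:
 assumes "biders L br"
 shows "s \<notin> sections L | r \<notin> sections L ==> br s r = (%x. 0)"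
  "s\<in>sections L ==> br s\<in>derivations L" "s\<in>sections L ==> (%r. br r s)\<in>derivations L"
  "s\<in>sections L ==> x\<in>pts (base L) ==> (%r. br s r x)\<in>Der L x"
  "s\<in>sections L ==> x\<in>pts (base L) ==> (%r. br r s x)\<in>Der L x"
  "s\<in>sections L ==> r\<in>sections L ==> br s r\<in>sections L"
  "x \<notin> pts (base L) ==> br s r x = 0"
proof -
 show 1: "s \<notin> sections L | r \<notin> sections L ==> br s r = (%x. 0)"
  and 2: "s\<in>sections L ==> br s\<in>derivations L" and 3: "s\<in>sections L ==> (%r. br r s)\<in>derivations L" for s r
  using assms by (auto simp: biders_def)
 show "s\<in>sections L ==> x\<in>pts (base L) ==> (%r. br s r x)\<in>Der L x" using dersD(3)[OF 2] .
 show "s\<in>sections L ==> x\<in>pts (base L) ==> (%r. br r s x)\<in>Der L x" using dersD(3)[OF 3] .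
 show 6: "s\<in>sections L ==> r\<in>sections L ==> br s r\<in>sections L" using dersD(1)[OF 2] .
 show "x \<notin> pts (base L) ==> br s r x = 0" using 1[of s r] 2[of s] derivations_off[of "br s" L x r] by (cases "s\<in>sections L") auto
qed

lemma biders_eq:
 assumes L: "line_bundle L" and G: "jet_spanning L G" and br: "biders L br" "biders L br'"
  and eq: "!!g h. g\<in>G ==> h\<in>G ==> br g h = br' g h"
 shows "br = br'"
proof (intro ext)
 fix s r x
 have restr: "restrict0 (sections L) (%r. b s r x) = (%r. b s r x)" "restrict0 (sections L) (%r. b r s x) = (%r. b r s x)"
  if "biders L b" for b s using bidersD(1)[OF that] by (auto simp: restrict0_def fun_eq_iff)
 show "br s r x = br' s r x"
 proof (cases "s\<in>sections L & r\<in>sections L & x\<in>pts (base L)")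
  case True
  thus ?thesis using biders_point_eq[OF L G, of x "%s r. br s r x" "%s r. br' s r x" s r]
    bidersD(4,5)[OF br(1)] bidersD(4,5)[OF br(2)] eq by (simp add: restr br)
 next
  case False
  thus ?thesis using bidersD(1,7)[OF br(1)] bidersD(1,7)[OF br(2)] by metis
 qed
qed

text \<open>For a skew-symmetric biderivation, the Jacobiator is a derivation in each argument.\<close>

lemma jacobiI:
 assumes L: "line_bundle L" and G: "jet_spanning L G" and br: "biders L br"
  and skew: "!!g h. g\<in>G ==> h\<in>G ==> br g h = (%x. - br h g x)"
  and jac: "!!g h k x. g\<in>G ==> h\<in>G ==> k\<in>G ==> br g (br h k) x + br h (br k g) x + br k (br g h) x = 0"
 shows "jacobi L br"
proof -
 note bd = bidersD[OF br]
 have GS: "!!g. g\<in>G ==> g\<in>sections L" using G by (auto simp: jet_spanning_def)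
 let ?op = "%s r x. - br r s x"
 have neg: "(%s x. - a s x)\<in>derivations L" if a: "a\<in>derivations L" for a
 proof -
  have "(%s. (-1) *\<^sub>R a s x)\<in>Der L x" if "x\<in>pts (base L)" for x
   using Der_closed(2)[OF L that dersD(3)[OF a that] dersD(3)[OF a that]] .
  thus ?thesis using dersD(1,2)[OF a] secs_minus[OF L] by (simp add: derivations_def)
 qed
 \<comment> \<open>The opposite bracket is again a biderivation, so uniqueness extends skew symmetry
   from \<open>G\<close> to all sections.\<close>
 have "biders L ?op" unfolding biders_def using bd(1) neg[OF bd(2)] neg[OF bd(3)] by auto
 hence op: "br = ?op" by (rule biders_eq[OF L G br]) (rule skew)
 have sk: "br s r = (%x. - br r s x)" for s r using fun_cong[OF fun_cong[OF op, of s], of r] .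
 have "br s s x = 0" for s x
 proof -
  have "br s s x = - br s s x" using fun_cong[OF sk[of s s], of x] .
  hence "2 *\<^sub>R br s s x = 0" by (metis add.right_inverse scaleR_2)
  thus ?thesis by simp
 qed
 hence alt: "br s s = (%x. 0)" for s by blast
 define J where "J s r t x = br s (br r t) x + br r (br t s) x + br t (br s r) x" for s r t x
 have cyc: "J s r t = J r t s" for s r t by (auto simp: J_def)
 \<comment> \<open>By skew symmetry the Jacobiator is the commutator of two derivations minus a
   third derivation, applied to the last argument.\<close>
 have JD: "restrict0 (sections L) (%t. J s r t x)\<in>Der L x"
  if s: "s\<in>sections L" and r: "r\<in>sections L" and x: "x\<in>pts (base L)" for s r x
 proof -
  have "restrict0 (sections L) (%t. J s r t x) = (%t. commutator (br s) (br r) t x - br (br s r) t x)"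
  proof
   fix t
   show "restrict0 (sections L) (%t. J s r t x) t = commutator (br s) (br r) t x - br (br s r) t x"
   proof (cases "t\<in>sections L")
    case True
    have "br r (br t s) x = - br r (br s t) x" using fun_cong[OF ders_linear(4)[OF L bd(2)[OF r] bd(6)[OF s True] bd(6)[OF s True]], of x]
     by (simp only: sk[of t s])
    moreover have "br t (br s r) x = - br (br s r) t x" using fun_cong[OF sk[of t "br s r"], of x] .
    ultimately show ?thesis using True by (simp add: restrict0_def J_def commutator_def)
   next
    case False
    thus ?thesis using dersD(2)[OF comm_ders[OF L bd(2)[OF s] bd(2)[OF r]]] bd(1) by (simp add: restrict0_def)
   qed
  qed
  thus ?thesis using Der_closed(3)[OF L x dersD(3)[OF comm_ders[OF L bd(2)[OF s] bd(2)[OF r]] x] bd(4)[OF bd(6)[OF s r] x]]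
   by (simp only:)
 qed
 have step: "J s r t x = 0" if s: "s\<in>sections L" "r\<in>sections L" "t\<in>sections L" and x: "x\<in>pts (base L)"
  and z: "!!g. g\<in>G ==> J s r g x = 0" for s r t x
 proof -
  have "ALL g:G. restrict0 (sections L) (%t. J s r t x) g = 0" using z GS by (simp add: restrict0_def)
  hence "restrict0 (sections L) (%t. J s r t x) = (%t. 0)" using G JD[OF s(1,2) x] x unfolding jet_spanning_def by blast
  from fun_cong[OF this, of t] s(3) show ?thesis by (simp add: restrict0_def)
 qed
 have "J s r t x = 0" if s: "s\<in>sections L" "r\<in>sections L" "t\<in>sections L" for s r t x
 proof (cases "x\<in>pts (base L)")
  case x: True
  \<comment> \<open>Cyclic invariance moves each argument in turn into the last slot, where it can
    be freed from \<open>G\<close>.\<close>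
  have 0: "J g h k x = 0" if "g\<in>G" "h\<in>G" "k\<in>G" for g h k using jac[OF that] by (simp add: J_def)
  have 1: "J g h t x = 0" if "g\<in>G" "h\<in>G" "t\<in>sections L" for g h t by (rule step[OF GS GS that(3) x]) (use 0 that in auto)
  have 2: "J g r t x = 0" if "g\<in>G" "r\<in>sections L" "t\<in>sections L" for g r t
  proof -
   have "J t g r x = 0" by (rule step[OF that(3) GS[OF that(1)] that(2) x]) (use 1[OF that(1)] that cyc in metis)
   thus ?thesis using cyc by metis
  qed
  show ?thesis
  proof (rule step[OF s x])
   fix g assume "g\<in>G"
   thus "J s r g x = 0" using 2[of g s r] s cyc[of g s r] by metis
  qed
 next
  case False thus ?thesis using bd(7) by (simp add: J_def)
 qed
 thus ?thesis unfolding jacobi_iff[OF L] using br alt by (simp add: J_def)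
qed

section \<open>Local brackets and gluing\<close>

text \<open>Only the values are local; the arguments stay global sections. This avoids a calculus of
  sections over open sets.\<close>

definition local_biders ::
 "('m, 'e::findim, 'l::real_vector) line_bundle => 'm set => ('m, 'l) bracket => bool" where
 "local_biders L W be \<longleftrightarrow> openin (mtop (base L)) W \<and>
  (ALL s:sections L. ALL r:sections L. smooth_section_on L W (be s r)) \<and>
  (ALL z:W. ALL s:sections L. restrict0 (sections L) (%r. be s r z)\<in>Der L z \<and>
    restrict0 (sections L) (%r. be r s z)\<in>Der L z)"

text \<open>All local brackets take the values \<open>K\<close> on generators, so they agree on
  overlaps and the choice of \<open>W x\<close> is immaterial. The last conjunct makes each of them
  a formula for the glued bracket.\<close>

lemma biders_glue:
 assumes L: "line_bundle L" and G: "jet_spanning L G"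
  and loc: "!!x. x\<in>pts (base L) ==> \<exists>W be. x\<in>W & local_biders L W be & (ALL g:G. ALL h:G. ALL z:W. be g h z = K g h z)"
 shows "\<exists>br. biders L br & (ALL g:G. ALL h:G. ALL x:pts (base L). br g h x = K g h x) \<and>
  (\<forall>W be. local_biders L W be --> (ALL g:G. ALL h:G. ALL z:W. be g h z = K g h z) -->
   (ALL s:sections L. ALL r:sections L. ALL z:W. br s r z = be s r z))"
proof -
 let ?P = "%W be. local_biders L W be & (ALL g:G. ALL h:G. ALL z:W. be g h z = K g h z)"
 note A = lbD(2)[OF L]
 have GS: "!!g. g\<in>G ==> g\<in>sections L" using G by (auto simp: jet_spanning_def)
 have agree: "be s r z = be' s r z"
  if P: "?P W be" "?P W' be'" and z: "z\<in>W" "z\<in>W'" and s: "s\<in>sections L" "r\<in>sections L" for W W' be be' z s r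
 proof -
  have "z\<in>pts (base L)" using P z opn_subset_pts[OF A] by (auto simp: local_biders_def)
  from biders_point_eq[OF L G this, of "%s r. be s r z" "%s r. be' s r z" s r]
  show ?thesis using P z s by (auto simp: local_biders_def)
 qed
 from loc have "ALL x:pts (base L). \<exists>W be. x\<in>W & ?P W be" by blast
 then obtain W be where W: "!!x. x\<in>pts (base L) ==> x\<in>W x & ?P (W x) (be x)" by metis
 define br where "br s r x = (if s\<in>sections L & r\<in>sections L & x\<in>pts (base L) then be x s r x else 0)" for s r x
 have br: "br s r z = be' s r z" if "?P W' be'" "s\<in>sections L" "r\<in>sections L" "z\<in>W'" for s r z W' be'
 proof -
  have z: "z\<in>pts (base L)" using that opn_subset_pts[OF A] by (auto simp: local_biders_def)
  show ?thesis using agree[OF _ that(1) _ that(4,2,3), of "W z" "be z"] W[OF z] that z by (simp add: br_def)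
 qed
 have sec: "br s r\<in>sections L" if s: "s\<in>sections L" "r\<in>sections L" for s r
 proof -
  have "smooth_section_on L (pts (base L)) (br s r)"
  proof (rule ssec_local[OF L opn_pts[OF A]])
   fix x assume x: "x\<in>pts (base L)"
   note Wx = W[OF x]
   have o: "openin (mtop (base L)) (W x)" and sm: "smooth_section_on L (W x) (be x s r)" using Wx s by (auto simp: local_biders_def)
   have "smooth_section_on L (W x) (br s r)" by (rule ssec_cong[OF sm]) (use br[of "W x" "be x"] Wx s in simp)
   thus "\<exists>T. openin (mtop (base L)) T & x\<in>T & smooth_section_on L T (br s r)" using o Wx by blast
  qed
  thus ?thesis by (simp add: sections_def zero_off_def br_def)
 qed
 have D: "(%r. br s r x)\<in>Der L x" "(%r. br r s x)\<in>Der L x" if "s\<in>sections L" "x\<in>pts (base L)" for s x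
 proof -
  have "(%r. br s r x) = restrict0 (sections L) (%r. be x s r x)" "(%r. br r s x) = restrict0 (sections L) (%r. be x r s x)"
   using that by (auto simp: br_def restrict0_def)
  thus "(%r. br s r x)\<in>Der L x" "(%r. br r s x)\<in>Der L x" using W[OF that(2)] that(1) by (auto simp: local_biders_def)
 qed
 have "biders L br" unfolding biders_def derivations_def using sec D by (auto simp: br_def)
 moreover have "br g h x = K g h x" if "g\<in>G" "h\<in>G" "x\<in>pts (base L)" for g h x using W[OF that(3)] that GS by (auto simp: br_def)
 ultimately show ?thesis using br by blast
qed

text \<open>With one jet fixed, a bilinear form is a linear functional of the other jet, that is an
  inner product with a vector, and this is a derivation \<open>der\<close>.\<close>

lemma (in triv) bilinear_form_biderivation:
 assumes bl: "!!y. bilinear (La y)" and sm: "!!u v. smooth_on img (%y. La y u v)"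
 shows "local_biders L dm (%s r z. La (ph z) (jr s z) (jr r z) *\<^sub>R e z)" unfolding local_biders_def
proof (intro conjI ballI opn_dm)
 fix s r assume s: "s\<in>sections L" "r\<in>sections L"
 have "La y u v = (\<Sum>b\<in>onb. \<Sum>c\<in>onb. (u\<bullet>b) * (v\<bullet>c) * La y b c)" for y u v
 proof -
  have l: "linear (%u. La y u v)" "linear (La y u)" for u v using bl[of y] unfolding bilinear_def by blast+
  show ?thesis by (subst linear_onb[OF l(1)], subst linear_onb[OF l(2)])
    (simp add: sum_distrib_left mult.assoc)
 qed
 hence e: "(%y. La y (jet1 (rep s) y) (jet1 (rep r) y)) =
  (%y. \<Sum>b\<in>onb. \<Sum>c\<in>onb. (jet1 (rep s) y\<bullet>b) * (jet1 (rep r) y\<bullet>c) * La y b c)" by (intro ext)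
 have "smooth_on img (%y. La y (jet1 (rep s) y) (jet1 (rep r) y))" unfolding e
  by (intro smooth_sum smooth_on_mult smooth_on_inner smooth_const smooth_jet1 open_img rep_smooth s sm)
 thus "smooth_section_on L dm (%z. La (ph z) (jr s z) (jr r z) *\<^sub>R e z)"
  by (rule section_smoothI[OF opn_dm subset_refl open_img]) (simp add: phi_img)
next
 fix z s assume z: "z\<in>dm" and s: "s\<in>sections L"
 have l: "linear (%u. La (ph z) u v)" "linear (La (ph z) u)" for u v using bl[of "ph z"] unfolding bilinear_def by blast+
 have "\<exists>w. \<forall>v. f v = w\<bullet>v" if f: "linear f" for f :: "'e \<times> real => real"
 proof (intro exI allI)
  fix v
  have "f v = (\<Sum>b\<in>onb. (v\<bullet>b) *\<^sub>R f b)" by (rule linear_onb[OF f])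
  also have "\<dots> = (\<Sum>b\<in>onb. f b *\<^sub>R b)\<bullet>v" by (simp add: inner_sum_left inner_commute[of v] mult.commute)
  finally show "f v = (\<Sum>b\<in>onb. f b *\<^sub>R b)\<bullet>v" .
 qed
 from this[OF l(1), of "jr s z"] this[OF l(2), of "jr s z"] obtain w w'
  where w: "!!v. La (ph z) v (jr s z) = w\<bullet>v" "!!v. La (ph z) (jr s z) v = w'\<bullet>v" by blast
 show "restrict0 (sections L) (%r. La (ph z) (jr s z) (jr r z) *\<^sub>R e z)\<in>Der L z" using der_Der[OF z, of w'] by (simp add: w der_def)
 show "restrict0 (sections L) (%r. La (ph z) (jr r z) (jr s z) *\<^sub>R e z)\<in>Der L z" using der_Der[OF z, of w] by (simp add: w der_def)
qed

section \<open>Factors and pull-backs\<close>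

lemma lin_isoD:
 assumes C: "linear_iso_on V W C"
 shows "v\<in>V ==> C v\<in>W" "v\<in>V ==> inv_into V C (C v) = v"
  "w\<in>W ==> inv_into V C w\<in>V" "w\<in>W ==> C (inv_into V C w) = w"
  "u\<in>V ==> v\<in>V ==> C (u + v) = C u + C v" "v\<in>V ==> C (c *\<^sub>R v) = c *\<^sub>R C v" using C unfolding linear_iso_on_def bij_betw_def
 by (auto simp: inv_into_f_f inv_into_into f_inv_into_f)

lemma linear_iso_on_inv:
 assumes C: "linear_iso_on V W C" and V: "subspace V"
 shows "w\<in>W ==> w'\<in>W ==> inv_into V C (w + w') = inv_into V C w + inv_into V C w'"
  "w\<in>W ==> inv_into V C (c *\<^sub>R w) = c *\<^sub>R inv_into V C w"
proof -
 note D = lin_isoD[OF C]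
 show "inv_into V C (w + w') = inv_into V C w + inv_into V C w'" if "w\<in>W" "w'\<in>W"
  using D(2)[OF subspace_add[OF V D(3)[OF that(1)] D(3)[OF that(2)]]] D(5)[OF D(3)[OF that(1)] D(3)[OF that(2)]]
   D(4)[OF that(1)] D(4)[OF that(2)] by simp
 show "inv_into V C (c *\<^sub>R w) = c *\<^sub>R inv_into V C w" if "w\<in>W"
  using D(2)[OF subspace_scale[OF V D(3)[OF that]]] D(6)[OF D(3)[OF that]] D(4)[OF that] by simp
qed

lemma linear_iso_on_inv_zero: "linear_iso_on V W C ==> subspace V ==> inv_into V C 0 = 0"
 using lin_isoD(2)[of V W C 0] lin_isoD(6)[of V W C 0 0] subspace_0[of V] by simp

lemma factorD:
 assumes "factor L1 L2 B"
 shows "smooth_map (base L1) (base L2) (fst B)"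
  "x\<in>pts (base L1) ==> linear_iso_on (fibre L1 x) (fibre L2 (fst B x)) (snd B x)"
  "(U, e)\<in>frames L1 ==> (V, e')\<in>frames L2 ==>
    \<exists>g. smooth_fun_on (base L1) (U Int fst B -` V) g & (ALL x:U Int fst B -` V. snd B x (e x) = g x *\<^sub>R e' (fst B x))"
 using assms by (auto simp: factor_def split: prod.splits)

lemma pull_section_at:
 "x\<in>pts (base L1) ==> pull_section L1 B s x = inv_into (fibre L1 x) (snd B x) (s (fst B x))" by (simp add: pull_section_def restrict0_def)

section \<open>Factors in trivialisations\<close>

locale factor_triv =
 t1: triv L1 U1 ph1 V1 e1 + t2: triv L2 U2 ph2 V2 e2
 for L1 :: "('m, 'e::findim, 'l::real_vector) line_bundle" and U1 ph1 V1 e1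
  and L2 :: "('n, 'f::findim, 'k::real_vector) line_bundle" and U2 ph2 V2 e2 +
 fixes B :: "('m, 'l, 'n, 'k) bundle_map"
 assumes F: "factor L1 L2 B"
begin

definition fdom :: "'m set" where "fdom = t1.dm Int fst B -` t2.dm"
definition ftau :: "'e => 'f" where "ftau y = ph2 (fst B (t1.pt y))"
text \<open>The inverse of the matrix entry of \<open>B\<close> in the two frames: sections are
  pulled back with the inverses of the fibre maps, so in coordinates pull-back is \<open>f\<close>
  to \<open>fH\<close> times \<open>f\<close> after \<open>ftau\<close>.\<close>

definition fH :: "'e => real" where
 "fH y = coord (e1 (t1.pt y)) (inv_into (fibre L1 (t1.pt y)) (snd B (t1.pt y)) (e2 (fst B (t1.pt y))))"

lemma fdomD: "x\<in>fdom ==> x\<in>t1.dm" "x\<in>fdom ==> fst B x\<in>t2.dm" by (auto simp: fdom_def)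

lemma opn_fdom: "openin (mtop (base L1)) fdom"
proof -
 have "openin (mtop (base L1)) (t1.dm Int (pts (base L1) Int fst B -` t2.dm))"
  by (intro openin_Int t1.opn_dm smap_openin[OF t1.A t2.A factorD(1)[OF F] t2.opn_dm])
 moreover have "t1.dm Int (pts (base L1) Int fst B -` t2.dm) = fdom" using t1.dm_pts by (auto simp: fdom_def)
 ultimately show ?thesis by simp
qed

lemma open_fimg: "open (ph1 ` fdom)"
 using t1.open_image[OF opn_fdom] fdomD(1) by (metis (no_types, lifting) Int_absorb2 fdom_def inf.absorb_iff2 inf_left_idem)

lemma ftau_smooth: "smooth_on (ph1 ` fdom) ftau"
proof -
 have "smooth_on (ph1 ` (U1 Int fst B -` U2)) ftau" using smooth_mapD(3)[OF factorD(1)[OF F] t1.ch t2.ch] by (simp add: ftau_def[abs_def] t1.pt_def)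
 thus ?thesis by (rule smooth_subset) (auto simp: fdom_def t1.dm_def t2.dm_def)
qed

lemma iso: "x\<in>fdom ==> linear_iso_on (fibre L1 x) (fibre L2 (fst B x)) (snd B x)" using factorD(2)[OF F t1.dm_pts[OF fdomD(1)]] .

lemma fH_at:
 assumes x: "x\<in>fdom"
 shows "fH (ph1 x) *\<^sub>R e1 x = inv_into (fibre L1 x) (snd B x) (e2 (fst B x))"
 using t1.fibre_coord[OF fdomD(1)[OF x] lin_isoD(3)[OF iso[OF x] t2.e_fib[OF fdomD(2)[OF x]]]]
  fdomD(1)[OF x] by (simp add: fH_def)

lemma B_fH: "x\<in>fdom ==> fH (ph1 x) *\<^sub>R snd B x (e1 x) = e2 (fst B x)"
 using lin_isoD(4)[OF iso t2.e_fib[OF fdomD(2)], of x] lin_isoD(6)[OF iso t1.e_fib[OF fdomD(1)], of x "fH (ph1 x)"]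
 by (simp add: fH_at[symmetric])

lemma fH_nz: "x\<in>fdom ==> fH (ph1 x) ~= 0" using B_fH[of x] t2.e_nz[OF fdomD(2)] by auto

lemma B_e: "x\<in>fdom ==> snd B x (e1 x) = inverse (fH (ph1 x)) *\<^sub>R e2 (fst B x)"
 using B_fH[of x] fH_nz[of x] by (metis left_inverse scaleR_one scaleR_scaleR)

lemma fH_smooth: "smooth_on (ph1 ` fdom) fH"
proof -
 obtain g where g: "smooth_fun_on (base L1) (V1 Int fst B -` V2) g"
  "!!x. x\<in>V1 Int fst B -` V2 ==> snd B x (e1 x) = g x *\<^sub>R e2 (fst B x)" using factorD(3)[OF F t1.fr t2.fr] by blast
 have s: "smooth_fun_on (base L1) fdom g" by (rule sfun_subset[OF g(1)]) (auto simp: fdom_def t1.dm_def t2.dm_def)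
 have gi: "inverse (g x) = fH (ph1 x)" if "x\<in>fdom" for x
 proof -
  have "snd B x (e1 x) = g x *\<^sub>R e2 (fst B x)" using g(2) that by (auto simp: fdom_def t1.dm_def t2.dm_def)
  hence "inverse (fH (ph1 x)) = g x" using B_e[OF that] t2.e_nz[OF fdomD(2)[OF that]] by simp
  thus ?thesis by (metis inverse_inverse_eq)
 qed
 have "smooth_on (ph1 ` fdom) (%y. g (t1.pt y))" using t1.fun_smooth[OF s] fdomD(1) by (simp add: Int_absorb1 subset_iff)
 hence "smooth_on (ph1 ` fdom) (%y. inverse (g (t1.pt y)))" by (rule smooth_inverse[OF open_fimg]) (use gi fH_nz fdomD in force)
 thus ?thesis by (rule smooth_cong[OF _ open_fimg]) (use gi fdomD in auto)
qed

lemma rep_pull: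
 assumes s: "s\<in>sections L2" and x: "x\<in>fdom"
 shows "t1.rep (pull_section L1 B s) (ph1 x) = fH (ph1 x) * t2.rep s (ftau (ph1 x))"
proof -
 note D = fdomD[OF x]
 have "pull_section L1 B s x = inv_into (fibre L1 x) (snd B x) (t2.rep s (ph2 (fst B x)) *\<^sub>R e2 (fst B x))"
  by (simp add: pull_section_at[OF t1.dm_pts[OF D(1)]] t2.rep_section[OF D(2) s])
 also have "\<dots> = t2.rep s (ph2 (fst B x)) *\<^sub>R fH (ph1 x) *\<^sub>R e1 x"
  by (simp only: linear_iso_on_inv(2)[OF iso[OF x] lbD(3)[OF t1.L t1.dm_pts[OF D(1)]] t2.e_fib[OF D(2)]] fH_at[OF x])
 finally show ?thesis using D t1.e_nz[OF D(1)] by (simp add: t1.rep_phi ftau_def mult.commute)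
qed

lemma ftau_phi: "x\<in>fdom ==> ftau (ph1 x) = ph2 (fst B x)" using fdomD by (simp add: ftau_def)

lemma jr_pull:
 assumes s: "s\<in>sections L2" and x: "x\<in>fdom"
 shows "t1.jr (pull_section L1 B s) x = jet_pull fH ftau (ph1 x) (t2.jr s (fst B x))"
proof -
 have "t1.jr (pull_section L1 B s) x = jet1 (%y. fH y * t2.rep s (ftau y)) (ph1 x)" by (rule jet1_cong[OF open_fimg]) (use rep_pull[OF s] x in auto)
 also have "\<dots> = jet_pull fH ftau (ph1 x) (jet1 (t2.rep s) (ftau (ph1 x)))" using x t2.rep_diff[OF s fdomD(2)[OF x]]
  by (intro jet1_pull smooth_diffble[OF fH_smooth] smooth_diffble[OF ftau_smooth])
   (auto simp: ftau_phi)
 finally show ?thesis by (simp add: ftau_phi[OF x])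
qed

lemma pull_smooth:
 assumes s: "s\<in>sections L2" shows "smooth_section_on L1 fdom (pull_section L1 B s)"
proof (rule t1.section_smoothI[OF opn_fdom _ open_fimg])
 show "fdom \<subseteq> t1.dm" using fdomD by blast
 show "smooth_on (ph1 ` fdom) (%y. fH y * t2.rep s (ftau y))"
  by (intro smooth_on_mult open_fimg fH_smooth smooth_comp[OF open_fimg t2.open_img ftau_smooth _ t2.rep_smooth[OF s]])
   (auto simp: ftau_phi t2.phi_img fdomD)
 show "ph1 x\<in>ph1 ` fdom & pull_section L1 B s x = (fH (ph1 x) * t2.rep s (ftau (ph1 x))) *\<^sub>R e1 x" if x: "x\<in>fdom" for x
 proof -
  have "pull_section L1 B s x\<in>fibre L1 x" unfolding pull_section_at[OF t1.dm_pts[OF fdomD(1)[OF x]]]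
   by (intro lin_isoD(3)[OF iso[OF x]] sectionsD(2)[OF s] t2.dm_pts fdomD(2) x)
  from t1.rep_at[where s="pull_section L1 B s", OF fdomD(1)[OF x] this] show ?thesis using x by (simp add: rep_pull[OF s x])
 qed
qed

end

lemma factor_triv_obtain:
 fixes L1 :: "('m, 'e::findim, 'l::real_vector) line_bundle" and L2 :: "('n, 'f::findim, 'k::real_vector) line_bundle"
 assumes "line_bundle L1" "line_bundle L2" "factor L1 L2 B" "x\<in>pts (base L1)"
 obtains U1 ph1 V1 e1 U2 ph2 V2 e2 where "factor_triv L1 U1 ph1 V1 e1 L2 U2 ph2 V2 e2 B"
  "x\<in>U1 Int V1" "fst B x\<in>U2 Int V2"
proof -
 obtain U1 ph1 V1 e1 where 1: "triv L1 U1 ph1 V1 e1" "x\<in>U1 Int V1" using triv_obtain[OF assms(1,4)] .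
 obtain U2 ph2 V2 e2 where 2: "triv L2 U2 ph2 V2 e2" "fst B x\<in>U2 Int V2"
  using triv_obtain[OF assms(2) smooth_mapD(1)[OF factorD(1)[OF assms(3)] assms(4)]] .
 show thesis by (rule that[OF _ 1(2) 2(2)]) (use 1 2 assms(3) in \<open>simp add: factor_triv_def factor_triv_axioms_def\<close>)
qed

section \<open>Pull-back of sections, functions and derivations\<close>

context
 fixes L1 :: "('m, 'e::findim, 'l::real_vector) line_bundle" and L2 :: "('n, 'f::findim, 'k::real_vector) line_bundle"
  and B :: "('m, 'l, 'n, 'k) bundle_map"
 assumes L1: "line_bundle L1" and L2: "line_bundle L2" and F: "factor L1 L2 B"
begin

lemma pull_in:
 assumes s: "s\<in>sections L2" shows "pull_section L1 B s\<in>sections L1"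
proof -
 have "smooth_section_on L1 (pts (base L1)) (pull_section L1 B s)"
 proof (rule ssec_local[OF L1 opn_pts[OF lbD(2)[OF L1]]])
  fix x assume x: "x\<in>pts (base L1)"
  obtain U1 ph1 V1 e1 U2 ph2 V2 e2 where *: "factor_triv L1 U1 ph1 V1 e1 L2 U2 ph2 V2 e2 B"
   "x\<in>U1 Int V1" "fst B x\<in>U2 Int V2" using factor_triv_obtain[OF L1 L2 F x] .
  interpret factor_triv L1 U1 ph1 V1 e1 L2 U2 ph2 V2 e2 B by fact
  show "\<exists>T. openin (mtop (base L1)) T & x\<in>T & smooth_section_on L1 T (pull_section L1 B s)"
   using opn_fdom pull_smooth[OF s] *(2,3) by (intro exI[of _ fdom]) (simp add: fdom_def t1.dm_def t2.dm_def)
 qed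
 thus ?thesis by (simp add: sections_def zero_off_def pull_section_def restrict0_def)
qed

lemma Cinf_pull:
 assumes "f\<in>Cinf (base L2)" shows "restrict0 (pts (base L1)) (%x. f (fst B x))\<in>Cinf (base L1)"
proof -
 note b = factorD(1)[OF F] and A1 = lbD(2)[OF L1] and A2 = lbD(2)[OF L2]
 have "pts (base L1) Int fst B -` pts (base L2) = pts (base L1)" using smooth_mapD(1)[OF b] by auto
 hence "smooth_fun_on (base L1) (pts (base L1)) (%x. f (fst B x))" using sfun_comp[OF A1 A2 b opn_pts[OF A2] CinfD(1)[OF assms]] by simp
 hence "smooth_fun_on (base L1) (pts (base L1)) (restrict0 (pts (base L1)) (%x. f (fst B x)))"
  by (rule sfun_cong[OF A1 opn_pts[OF A1]]) (simp add: restrict0_def)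
 thus ?thesis by (simp add: Cinf_def zero_off_def restrict0_def)
qed

lemma pull_linear:
 assumes s: "s\<in>sections L2" "r\<in>sections L2"
 shows "pull_section L1 B (%x. s x + r x) = (%x. pull_section L1 B s x + pull_section L1 B r x)"
  "pull_section L1 B (%x. c *\<^sub>R s x) = (%x. c *\<^sub>R pull_section L1 B s x)"
  "pull_section L1 B (%x. s x - r x) = (%x. pull_section L1 B s x - pull_section L1 B r x)"
  "pull_section L1 B (%x. - s x) = (%x. - pull_section L1 B s x)"
  "pull_section L1 B (%x. f x *\<^sub>R s x) = (%x. restrict0 (pts (base L1)) (%x. f (fst B x)) x *\<^sub>R pull_section L1 B s x)"
  "pull_section L1 B (%x. 0) = (%x. 0)"
proof -
 have i: "linear_iso_on (fibre L1 x) (fibre L2 (fst B x)) (snd B x)" "subspace (fibre L1 x)"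
  "s (fst B x)\<in>fibre L2 (fst B x)" "r (fst B x)\<in>fibre L2 (fst B x)" "subspace (fibre L2 (fst B x))"
  if "x\<in>pts (base L1)" for x using factorD(2)[OF F that] lbD(3)[OF L1 that] smooth_mapD(1)[OF factorD(1)[OF F] that]
   sectionsD(2)[OF s(1)] sectionsD(2)[OF s(2)] lbD(3)[OF L2] by auto
 show add: "pull_section L1 B (%x. s x + r x) = (%x. pull_section L1 B s x + pull_section L1 B r x)"
  and sc: "pull_section L1 B (%x. c *\<^sub>R s x) = (%x. c *\<^sub>R pull_section L1 B s x)"
  and "pull_section L1 B (%x. f x *\<^sub>R s x) = (%x. restrict0 (pts (base L1)) (%x. f (fst B x)) x *\<^sub>R pull_section L1 B s x)"
  by (auto simp: pull_section_def restrict0_def fun_eq_iff linear_iso_on_inv[OF i(1,2)] i(3,4))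
 have m: "inv_into (fibre L1 x) (snd B x) (- v) = - inv_into (fibre L1 x) (snd B x) v"
  if "x\<in>pts (base L1)" "v\<in>fibre L2 (fst B x)" for x v using linear_iso_on_inv(2)[OF i(1,2)[OF that(1)] that(2), of "-1"] by simp
 show "pull_section L1 B (%x. - s x) = (%x. - pull_section L1 B s x)" by (auto simp: pull_section_def restrict0_def fun_eq_iff m i(3))
 show "pull_section L1 B (%x. s x - r x) = (%x. pull_section L1 B s x - pull_section L1 B r x)"
 proof
  fix x
  show "pull_section L1 B (%x. s x - r x) x = pull_section L1 B s x - pull_section L1 B r x"
  proof (cases "x\<in>pts (base L1)")
   case True
   thus ?thesis using linear_iso_on_inv(1)[OF i(1,2)[OF True] i(3)[OF True] subspace_neg[OF i(5)[OF True] i(4)[OF True]]]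
     m[OF True i(4)[OF True]] by (simp add: pull_section_at)
  qed (simp add: pull_section_def restrict0_def)
 qed
 show "pull_section L1 B (%x. 0) = (%x. 0)" using linear_iso_on_inv_zero[OF i(1,2)] by (auto simp: pull_section_def restrict0_def fun_eq_iff)
qed

lemma Der_map_sec: "s\<in>sections L2 ==> Der_map L1 L2 B x a s = snd B x (a (pull_section L1 B s))" by (simp add: Der_map_def restrict0_def)

text \<open>Pull-back of sections turns multiplication by a function into multiplication by the
  pulled-back function. The image therefore satisfies the Leibniz rule, with the push-forward of the
  symbol.\<close>

lemma Der_map_Der:
 assumes x: "x\<in>pts (base L1)" and a: "a\<in>Der L1 x"
 shows "Der_map L1 L2 B x a\<in>Der L2 (fst B x)"
proof -
 let ?a = "Der_map L1 L2 B x a"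
 note i = factorD(2)[OF F x] and b = smooth_mapD(1)[OF factorD(1)[OF F] x]
 note A1 = lbD(2)[OF L1]
 obtain de where d: "de\<in>tangent (base L1) x"
  and de: "ALL f:Cinf (base L1). ALL s:sections L1. a (%y. f y *\<^sub>R s y) = f x *\<^sub>R a s + de f *\<^sub>R s x"
  using Der_symbol[OF a] by blast
 let ?p = "%f. restrict0 (pts (base L1)) (%x. f (fst B x))"
 let ?d = "restrict0 (Cinf (base L2)) (%f. de (?p f))"
 note A2 = lbD(2)[OF L2]
 have p: "?p (%y. f y + g y) = (%y. ?p f y + ?p g y)" "?p (%y. f y * g y) = (%y. ?p f y * ?p g y)"
  "?p (%y. c * f y) = (%y. c * ?p f y)" "?p f x = f (fst B x)" for f g :: "'n => real" and c using x by (auto simp: restrict0_def)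
 have t: "?d\<in>tangent (base L2) (fst B x)" unfolding tangent_def point_derivations_def linear_funct_def
  using Cinf_add[OF A2] Cinf_mult[OF A2] Cinf_scale[OF A2] tangentD[OF d] Cinf_pull
  by (auto simp: zero_off_def restrict0_def[of "Cinf _"] p(1-3)) (simp_all add: p(4))
 have fib: "?a s\<in>fibre L2 (fst B x)" if "s\<in>sections L2" for s
  using lin_isoD(1)[OF i DerD(2)[OF a pull_in[OF that]]] by (simp add: Der_map_sec that)
 have aS: "a (pull_section L1 B s)\<in>fibre L1 x" if "s\<in>sections L2" for s using DerD(2)[OF a pull_in[OF that]] .
 have lin: "linear_funct (sections L2) ?a" unfolding linear_funct_def
  by (auto simp: Der_map_sec secs_add[OF L2] secs_scale[OF L2] pull_linear DerD(3,4)[OF a] pull_in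
   lin_isoD(5,6)[OF i] aS)
 have leib: "?a (%y. f y *\<^sub>R s y) = f (fst B x) *\<^sub>R ?a s + ?d f *\<^sub>R s (fst B x)"
  if f: "f\<in>Cinf (base L2)" and s: "s\<in>sections L2" for f s
 proof -
  have "a (pull_section L1 B (%y. f y *\<^sub>R s y)) =
    f (fst B x) *\<^sub>R a (pull_section L1 B s) + de (?p f) *\<^sub>R pull_section L1 B s x"
   using de[rule_format, OF Cinf_pull[OF f] pull_in[OF s]] by (simp add: pull_linear(5)[OF s s] p(4))
  moreover have "snd B x (pull_section L1 B s x) = s (fst B x)"
   using lin_isoD(4)[OF i sectionsD(2)[OF s b]] by (simp add: pull_section_at[OF x])
  moreover have "pull_section L1 B s x\<in>fibre L1 x" using sectionsD(2)[OF pull_in[OF s] x] .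
  ultimately show ?thesis using aS[OF s] f secs_mult[OF L2 f s] lbD(3)[OF L1 x]
   by (simp add: Der_map_sec s lin_isoD(5,6)[OF i] subspace_scale restrict0_def)
 qed
 show ?thesis unfolding Der_def section_derivations_def using t fib lin leib
  by (auto simp: zero_off_def Der_map_def restrict0_def[of "sections _"] tangent_def)
qed

lemma jet_pi_Der_map:
 assumes x: "x\<in>pts (base L1)" and a: "a\<in>Der L1 x" and r: "r\<in>sections L2"
 shows "inv_into (fibre L1 x) (snd B x) (jet L2 r (fst B x) (Der_map L1 L2 B x a)) = jet L1 (pull_section L1 B r) x a"
 using Der_map_Der[OF x a] a lin_isoD(2)[OF factorD(2)[OF F x] DerD(2)[OF a pull_in[OF r]]]
 by (simp add: jet_def restrict0_def Der_map_sec r)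

text \<open>Every jet over the target comes from a section \<open>r\<close>, and then the condition
  on the jet over the source says that it is the jet of the pull-back of \<open>r\<close>. This
  parametrisation replaces the relation between linear forms in all later arguments.\<close>

lemma jet_lift_eq:
 "jet_lift L1 L2 B = {((q, jet L1 (pull_section L1 B r) q), (fst B q, jet L2 r (fst B q)), restrict0 (fibre L1 q) (snd B q)) | q r.
  q\<in>pts (base L1) & r\<in>sections L2}" (is "_ = ?R")
proof (intro equalityI subsetI)
 fix z assume "z\<in>jet_lift L1 L2 B"
 then obtain q al be where z: "z = ((q, al), (fst B q, be), restrict0 (fibre L1 q) (snd B q))"
  "q\<in>pts (base L1)" "al\<in>Jet L1 q" "be\<in>Jet L2 (fst B q)"
  "!!a. a\<in>Der L1 q ==> al a = inv_into (fibre L1 q) (snd B q) (be (Der_map L1 L2 B q a))" by (auto simp: jet_lift_def jet_manifold_def)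
 obtain r where r: "r\<in>sections L2" "be = jet L2 r (fst B q)" using Jet_eq[OF L2 smooth_mapD(1)[OF factorD(1)[OF F] z(2)]] z(4) by blast
 have "al a = jet L1 (pull_section L1 B r) q a" for a
 proof (cases "a\<in>Der L1 q")
  case True thus ?thesis using z(5)[OF True] jet_pi_Der_map[OF z(2) True r(1)] r(2) by simp
 next
  case False thus ?thesis using z(3) by (auto simp: Jet_def zero_off_def jet_def restrict0_def)
 qed
 thus "z\<in>?R" using z(1,2) r by blast
next
 fix z assume "z\<in>?R"
 then obtain q r where z: "z = ((q, jet L1 (pull_section L1 B r) q), (fst B q, jet L2 r (fst B q)), restrict0 (fibre L1 q) (snd B q))"
  "q\<in>pts (base L1)" "r\<in>sections L2" by blast
 note b = smooth_mapD(1)[OF factorD(1)[OF F] z(2)]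
 show "z\<in>jet_lift L1 L2 B" using z jet_Jet[OF L1 z(2) pull_in[OF z(3)]] jet_Jet[OF L2 b z(3)] b jet_pi_Der_map[OF z(2) _ z(3)]
  by (simp add: jet_lift_def jet_manifold_def)
qed

end

section \<open>Pull-back bundles\<close>

lemma pull_bundle_simps[simp]: "base (pull_bundle N b L) = N" "fibre (pull_bundle N b L) x = fibre L (b x)"
 "frames (pull_bundle N b L) = {(pts N Int b -` U, e \<circ> b) | U e. (U, e)\<in>frames L}" by (simp_all add: pull_bundle_def)

lemma pull_bundle_line_bundle:
 assumes N: "smooth_manifold N" and L: "line_bundle L" and b: "smooth_map N (base L) b"
 shows "line_bundle (pull_bundle N b L)"
proof -
 note A = mfd_atlas[OF N] and D = lbD[OF L] and B = smooth_mapD(1)[OF b]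
 have "pts N = (\<Union>(U, e)\<in>frames (pull_bundle N b L). U)"
 proof (intro equalityI subsetI)
  fix x assume x: "x\<in>pts N"
  obtain V e where "(V, e)\<in>frames L" "b x\<in>V" using frame_obtain[OF L B[OF x]] .
  thus "x\<in>(\<Union>(U, e)\<in>frames (pull_bundle N b L). U)" using x by (auto intro!: bexI[of _ "(pts N Int b -` V, e \<circ> b)"])
 qed auto
 moreover have "\<exists>g. smooth_fun_on N (pts N Int b -` U Int (pts N Int b -` V)) g \<and>
   (ALL x:pts N Int b -` U Int (pts N Int b -` V). e' (b x) = g x *\<^sub>R e (b x))"
  if e: "(U, e)\<in>frames L" "(V, e')\<in>frames L" for U e V e'
 proof -
  obtain g where g: "smooth_fun_on (base L) (U Int V) g" "ALL x:U Int V. e' x = g x *\<^sub>R e x" using D(9)[OF e] by blast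
  have "smooth_fun_on N (pts N Int b -` (U Int V)) (%x. g (b x))"
   by (rule sfun_comp[OF A D(2) b _ g(1)]) (intro openin_Int D(5)[OF e(1)] D(5)[OF e(2)])
  hence "smooth_fun_on N (pts N Int b -` U Int (pts N Int b -` V)) (%x. g (b x))" by (rule sfun_subset) auto
  thus ?thesis using g(2) by (intro exI[of _ "%x. g (b x)"]) auto
 qed
 ultimately show ?thesis unfolding line_bundle_def using N D(3,4)[OF B] D(7,8) smap_openin[OF A D(2) b D(5)] by (auto simp: o_def)
qed

lemma pull_bundle_factor:
 assumes N: "smooth_manifold N" and L: "line_bundle L" and b: "smooth_map N (base L) b"
 shows "factor (pull_bundle N b L) L (b, %x l. l)"
proof -
 note A = mfd_atlas[OF N] and D = lbD[OF L] and B = smooth_mapD(1)[OF b]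
 have "\<exists>g. smooth_fun_on N (pts N Int b -` U Int b -` V) g \<and>
   (ALL x:pts N Int b -` U Int b -` V. e' (b x) = g x *\<^sub>R e (b x))"
  if e: "(U, e')\<in>frames L" "(V, e)\<in>frames L" for U e V e'
 proof -
  obtain g where g: "smooth_fun_on (base L) (V Int U) g" "ALL x:V Int U. e' x = g x *\<^sub>R e x" using D(9)[OF e(2,1)] by blast
  have "smooth_fun_on N (pts N Int b -` (V Int U)) (%x. g (b x))"
   by (rule sfun_comp[OF A D(2) b _ g(1)]) (intro openin_Int D(5)[OF e(1)] D(5)[OF e(2)])
  hence "smooth_fun_on N (pts N Int b -` U Int b -` V) (%x. g (b x))" by (rule sfun_subset) auto
  thus ?thesis using g(2) by (intro exI[of _ "%x. g (b x)"]) auto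
 qed
 thus ?thesis using b by (auto simp: factor_def linear_iso_on_def bij_betw_def)
qed

lemma id_factor_factor: "line_bundle L ==> factor L L id_factor"
proof -
 assume L: "line_bundle L"
 have "\<exists>g. smooth_fun_on (base L) (U Int V) g & (ALL x:U Int V. e x = g x *\<^sub>R e' x)"
  if "(U, e)\<in>frames L" "(V, e')\<in>frames L" for U e V e' using lbD(9)[OF L that(2,1)] by (simp add: Int_commute)
 thus ?thesis using smap_id[OF lbD(2)[OF L]] by (auto simp: factor_def id_factor_def linear_iso_on_def bij_betw_def vimage_def)
qed

lemma pull_section_id: "s\<in>sections L ==> pull_section L id_factor s = s" using sectionsD(2,3)[of s L] inv_into_f_f[of "%l. l"]
 by (fastforce simp: pull_section_def restrict0_def id_factor_def inj_on_def)

section \<open>The jet bundle\<close>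

context triv
begin

lemma partial_der_der: "q\<in>dm ==> partial_der L (U, ph) e q v = der (v, 0) q" unfolding partial_der_def der_def restrict0_def
proof (intro ext)
 fix s assume q: "q\<in>dm"
 have "(%y. coord (e y) (s y)) \<circ> inv_into (fst (U, ph)) (snd (U, ph)) = rep s" by (simp add: rep_def pt_def o_def)
 thus "(if s\<in>sections L then frechet_derivative ((%y. coord (e y) (s y)) \<circ> inv_into (fst (U, ph)) (snd (U, ph)))
   (at (snd (U, ph) q)) v *\<^sub>R e q else 0) = (if s\<in>sections L then ((v, 0)\<bullet>jr s q) *\<^sub>R e q else 0)"
  using frechet_grad[OF rep_diff[OF _ q], of s v] by (simp add: inner_prod_def inner_commute)
qed

lemma id_der_der: "q\<in>dm ==> id_der L q = der (0, 1) q" using rep_section[of q] by (auto simp: id_der_def der_def restrict0_def inner_prod_def)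

lemma jet_der: "q\<in>dm ==> s\<in>sections L ==> jet L s q (der w q) = (w\<bullet>jr s q) *\<^sub>R e q"
 by (simp add: jet_def restrict0_def der_Der der_sec)

text \<open>The frame in the definition of \<open>jet_chart\<close> consists of the derivations
  \<open>der (v, 0)\<close> and \<open>der (0, 1)\<close>, so the coordinates of the jet of a
  section are those of its coordinate 1-jet.\<close>

lemma jet_chart_jet:
 assumes q: "q\<in>dm" and s: "s\<in>sections L"
 shows "jet_chart L (U, ph) e (q, jet L s q) = (ph q, jr s q)"
proof -
 have "(THE p. \<forall>v. p\<bullet>v = coord (e q) (jet L s q (partial_der L (U, ph) e q v))) = fst (jr s q)"
 proof (rule the_equality)
  show *: "\<forall>v. fst (jr s q)\<bullet>v = coord (e q) (jet L s q (partial_der L (U, ph) e q v))"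
   using e_nz[OF q] by (simp add: partial_der_der[OF q] jet_der[OF q s] inner_prod_def inner_commute)
  fix p assume p: "\<forall>v. p\<bullet>v = coord (e q) (jet L s q (partial_der L (U, ph) e q v))"
  show "p = fst (jr s q)" by (rule onb_eqI) (simp only: p[rule_format] *[rule_format])
 qed
 thus ?thesis using e_nz[OF q] by (simp add: jet_chart_def id_der_der[OF q] jet_der[OF q s] inner_prod_def jet1_def)
qed

definition jU :: "('m, 'l) jet_pt set" where "jU = {(q, al). q\<in>U Int V & al\<in>Jet L q}"
definition jph :: "('m, 'l) jet_pt => 'e \<times> 'e \<times> real" where "jph = jet_chart L (U, ph) e"

lemma jU_obtain:
 assumes "z\<in>jU" obtains q s where "q\<in>dm" "s\<in>sections L" "z = (q, jet L s q)" "jph z = (ph q, jr s q)"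
proof -
 obtain q al where z: "z = (q, al)" "q\<in>dm" "al\<in>Jet L q" using assms by (auto simp: jU_def dm_def)
 obtain s where "s\<in>sections L" "al = jet L s q" using Jet_obtain[OF z(2,3)] by blast
 thus thesis using z that[of q s] by (simp add: jph_def jet_chart_jet)
qed

lemma jU_I: "q\<in>dm ==> s\<in>sections L ==> (q, jet L s q)\<in>jU" using jet_Jet[OF L dm_pts] by (auto simp: jU_def dm_def)

lemma jph_jet: "q\<in>dm ==> s\<in>sections L ==> jph (q, jet L s q) = (ph q, jr s q)" by (simp add: jph_def jet_chart_jet)

lemma jU_fst: "z\<in>jU ==> fst z\<in>dm" "z\<in>jU ==> fst (jph z) = ph (fst z)" by (auto elim!: jU_obtain)

lemma jph_inj: "inj_on jph jU"
proof (rule inj_onI)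
 fix z z' assume z: "z\<in>jU" "z'\<in>jU" and eq: "jph z = jph z'"
 obtain q s where q: "q\<in>dm" "s\<in>sections L" "z = (q, jet L s q)" "jph z = (ph q, jr s q)" using jU_obtain[OF z(1)] .
 obtain q' s' where q': "q'\<in>dm" "s'\<in>sections L" "z' = (q', jet L s' q')" "jph z' = (ph q', jr s' q')" using jU_obtain[OF z(2)] .
 have "(ph q, jr s q) = (ph q', jr s' q')" using eq unfolding q(4) q'(4) .
 hence "ph q = ph q'" "jr s q = jr s' q'" by (blast dest: prod.inject[THEN iffD1])+
 hence "q = q'" using pt_phi[OF q(1)] pt_phi[OF q'(1)] by metis
 thus "z = z'" using \<open>jr s q = jr s' q'\<close> q q' jet_eq_iff[OF q(1) q(2) q'(2)] by simp
qed

lemma jph_img: "W \<subseteq> dm ==> jph ` (jU Int fst -` W) = ph ` W \<times> UNIV"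
proof (intro equalityI subsetI)
 fix y assume "W \<subseteq> dm" "y\<in>jph ` (jU Int fst -` W)"
 thus "y\<in>ph ` W \<times> UNIV" by (auto elim!: jU_obtain)
next
 fix y :: "'e \<times> 'e \<times> real"
 assume W: "W \<subseteq> dm" and y: "y\<in>ph ` W \<times> UNIV"
 obtain q j where q: "y = (ph q, j)" "q\<in>W" using y by (cases y) auto
 hence qd: "q\<in>dm" using W by blast
 obtain s where s: "s\<in>sections L" "jr s q = j" using jr_obtain[OF qd] .
 hence "jph (q, jet L s q) = y" using q qd by (simp add: jph_jet)
 thus "y\<in>jph ` (jU Int fst -` W)" using jU_I[OF qd s(1)] q(2) by (intro image_eqI[of _ _ "(q, jet L s q)"]) auto
qed

end

text \<open>Two trivialisations of one bundle form a trivialised identity factor. Its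
  \<open>ftau\<close> is the change of base coordinates, and \<open>jet_pull\<close> for the factor
  in the opposite direction transports the jets.\<close>

lemma jet_trans_smooth:
 assumes t1: "triv L U1 ph1 V1 e1" and t2: "triv L U2 ph2 V2 e2"
 shows "open (triv.jph L U1 ph1 e1 ` (triv.jU L U1 V1 Int triv.jU L U2 V2))"
  "smooth_on (triv.jph L U1 ph1 e1 ` (triv.jU L U1 V1 Int triv.jU L U2 V2))
   (%y. triv.jph L U2 ph2 e2 (inv_into (triv.jU L U1 V1) (triv.jph L U1 ph1 e1) y))"
proof -
 interpret t1: triv L U1 ph1 V1 e1 by fact
 interpret t2: triv L U2 ph2 V2 e2 by fact
 interpret f12: factor_triv L U1 ph1 V1 e1 L U2 ph2 V2 e2 id_factor by unfold_locales (rule id_factor_factor[OF t1.L])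
 interpret f21: factor_triv L U2 ph2 V2 e2 L U1 ph1 V1 e1 id_factor by unfold_locales (rule id_factor_factor[OF t1.L])
 let ?W = "t1.dm Int t2.dm"
 have fd: "f12.fdom = ?W" "f21.fdom = ?W" by (simp_all only: f12.fdom_def f21.fdom_def) (auto simp: id_factor_def)
 have int: "t1.jU Int t2.jU = t1.jU Int fst -` ?W" by (auto simp: t1.jU_def t2.jU_def t1.dm_def t2.dm_def)
 have img: "t1.jph ` (t1.jU Int t2.jU) = ph1 ` ?W \<times> UNIV" unfolding int by (rule t1.jph_img) auto
 have o1: "open (ph1 ` ?W)" using f12.open_fimg by (simp add: fd)
 have o2: "open (ph2 ` ?W)" using f21.open_fimg by (simp add: fd)
 show o: "open (t1.jph ` (t1.jU Int t2.jU))" unfolding img using o1 by (simp add: open_Times)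
 have o': "open (ph1 ` ?W \<times> (UNIV::('b \<times> real) set))" using o1 by (simp add: open_Times)
 have tau: "smooth_on (ph1 ` ?W \<times> (UNIV::('b \<times> real) set)) (%y. f12.ftau (fst y))"
  by (rule smooth_comp[OF o' o1 _ _ f12.ftau_smooth[unfolded fd]])
   (auto intro!: smooth_on_fst[OF o' smooth_ident])
 have tau': "f12.ftau y\<in>ph2 ` ?W" if y: "y\<in>ph1 ` ?W" for y
 proof -
  obtain q where q: "y = ph1 q" "q\<in>?W" using y by blast
  have "f12.ftau (ph1 q) = ph2 q" using f12.ftau_phi[unfolded fd, of q] q(2) by (simp add: id_factor_def)
  thus ?thesis using q by auto
 qed
 have "smooth_on (ph1 ` ?W \<times> (UNIV::('b \<times> real) set)) (%y. jet_pull f21.fH f21.ftau (fst (f12.ftau (fst y), snd y)) (snd (f12.ftau (fst y), snd y)))"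
  by (rule smooth_comp[OF o' _ _ _ smooth_jet_pull[OF o2 f21.fH_smooth[unfolded fd] f21.ftau_smooth[unfolded fd]], of "%y. (f12.ftau (fst y), snd y)"])
   (use o2 tau' in \<open>auto intro!: open_Times smooth_Pair[OF o' tau] smooth_on_snd[OF o' smooth_ident]\<close>)
 hence s: "smooth_on (ph1 ` ?W \<times> (UNIV::('b \<times> real) set)) (%y. (f12.ftau (fst y), jet_pull f21.fH f21.ftau (f12.ftau (fst y)) (snd y)))"
  using smooth_Pair[OF o' tau] by simp
 show "smooth_on (t1.jph ` (t1.jU Int t2.jU)) (%y. t2.jph (inv_into t1.jU t1.jph y))" unfolding img
 proof (rule smooth_cong[OF s o'])
  fix y :: "'b \<times> 'b \<times> real" assume y: "y\<in>ph1 ` ?W \<times> UNIV"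
  hence "y\<in>t1.jph ` (t1.jU Int t2.jU)" unfolding img .
  then obtain z where z: "z\<in>t1.jU" "z\<in>t2.jU" "y = t1.jph z" by blast
  obtain q r where q: "q\<in>t1.dm" "r\<in>sections L" "z = (q, jet L r q)" "t1.jph z = (ph1 q, t1.jr r q)" using t1.jU_obtain[OF z(1)] .
  have q2: "q\<in>t2.dm" using z(2) q(3) by (simp add: t2.jU_def t2.dm_def)
  have "f12.ftau (ph1 q) = ph2 q" using f12.ftau_phi[unfolded fd, of q] q(1) q2 by (simp add: id_factor_def)
  moreover have "t2.jr r q = jet_pull f21.fH f21.ftau (ph2 q) (t1.jr r q)"
   using f21.jr_pull[unfolded fd, OF q(2), of q] q(1) q2 unfolding pull_section_id[OF q(2)] by (simp add: id_factor_def)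
  ultimately show "(f12.ftau (fst y), jet_pull f21.fH f21.ftau (f12.ftau (fst y)) (snd y)) = t2.jph (inv_into t1.jU t1.jph y)"
   using inv_into_f_f[OF t1.jph_inj z(1)] z(3) q t2.jph_jet[OF q2 q(2)] by simp
 qed
qed

section \<open>The jet bundle as a manifold with a line bundle\<close>

lemma jet_mf_simps: "pts (JM L) = {(q, al). q\<in>pts (base L) & al\<in>Jet L q}"
 "charts (JM L) = {({(q, al). q\<in>U Int V & al\<in>Jet L q}, jet_chart L (U, ph) e) | U ph V e.
   (U, ph)\<in>charts (base L) & (V, e)\<in>frames L}" by (simp_all add: jet_manifold_def)

lemma jet_chart_obtain:
 assumes "line_bundle L" "(W, ps)\<in>charts (JM L)"
 obtains U ph V e where "triv L U ph V e" "W = triv.jU L U V" "ps = triv.jph L U ph e"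
proof -
 obtain U ph V e where *: "W = {(q, al). q\<in>U Int V & al\<in>Jet L q}" "ps = jet_chart L (U, ph) e"
  "(U, ph)\<in>charts (base L)" "(V, e)\<in>frames L" using assms(2) by (auto simp: jet_mf_simps)
 have t: "triv L U ph V e" using * assms(1) by (simp add: triv_def)
 show thesis by (rule that[OF t]) (simp_all only: triv.jU_def[OF t] triv.jph_def[OF t] *(1,2))
qed

lemma (in triv) jet_chart_in: "(jU, jph)\<in>charts (JM L)" unfolding jet_mf_simps jU_def jph_def using ch fr by blast

lemma (in triv) jU_pts: "jU \<subseteq> pts (JM L)" using dm_pts by (auto simp: jU_def jet_mf_simps dm_def)

lemma jet_atlas:
 assumes L: "line_bundle L" shows "atlas (JM L)" unfolding atlas_def
proof (intro conjI ballI)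
 fix c assume "c\<in>charts (JM L)"
 then obtain W ps where c: "c = (W, ps)" "(W, ps)\<in>charts (JM L)" by (cases c) auto
 obtain U ph V e where t: "triv L U ph V e" "W = triv.jU L U V" "ps = triv.jph L U ph e" using jet_chart_obtain[OF L c(2)] .
 interpret t: triv L U ph V e by fact
 have "open (t.jph ` t.jU)"
  using t.jph_img[of t.dm] t.jU_fst(1) t.open_img by (simp add: Int_absorb2 subset_iff open_Times t.img_def[folded t.dm_def])
 moreover have "compatible c d" if d: "d\<in>charts (JM L)" for d
 proof -
  obtain W' ps' where d: "d = (W', ps')" "(W', ps')\<in>charts (JM L)" using d by (cases d) auto
  obtain U' ph' V' e' where t': "triv L U' ph' V' e'" "W' = triv.jU L U' V'" "ps' = triv.jph L U' ph' e'" using jet_chart_obtain[OF L d(2)] .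
  show ?thesis unfolding c d t(2,3) t'(2,3) compatible_def o_def
   using jet_trans_smooth[OF t(1) t'(1)] jet_trans_smooth[OF t'(1) t(1)] by (simp add: Int_commute)
 qed
 ultimately show "smooth_chart (JM L) c" unfolding c t(2,3) smooth_chart_def using t.jU_pts t.jph_inj by simp
next
 show "pts (JM L) = (\<Union>(U, ph)\<in>charts (JM L). U)"
 proof (intro equalityI subsetI)
  fix z assume z: "z\<in>pts (JM L)"
  hence "fst z\<in>pts (base L)" by (auto simp: jet_mf_simps)
  then obtain U ph V e where t: "triv L U ph V e" "fst z\<in>U Int V" by (rule triv_obtain[OF L])
  have "z\<in>triv.jU L U V" using t z by (auto simp: triv.jU_def[OF t(1)] jet_mf_simps)
  thus "z\<in>(\<Union>(U, ph)\<in>charts (JM L). U)" using triv.jet_chart_in[OF t(1)] by blast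
 next
  fix z assume "z\<in>(\<Union>(U, ph)\<in>charts (JM L). U)"
  then obtain W ps where z: "z\<in>W" "(W, ps)\<in>charts (JM L)" by blast
  obtain U ph V e where t: "triv L U ph V e" "W = triv.jU L U V" using jet_chart_obtain[OF L z(2)] .
  thus "z\<in>pts (JM L)" using triv.jU_pts[OF t(1)] z(1) by blast
 qed
qed

lemma jet_proj_smooth:
 assumes L: "line_bundle L" shows "smooth_map (JM L) (base L) fst"
proof (rule smooth_mapI[OF jet_atlas[OF L] lbD(2)[OF L]])
 show "fst z\<in>pts (base L)" if "z\<in>pts (JM L)" for z using that by (auto simp: jet_mf_simps)
 fix z assume z: "z\<in>pts (JM L)"
 hence "fst z\<in>pts (base L)" by (auto simp: jet_mf_simps)
 then obtain U ph V e where t: "triv L U ph V e" "fst z\<in>U Int V" by (rule triv_obtain[OF L])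
 interpret t: triv L U ph V e by fact
 have zU: "z\<in>t.jU" using t z by (auto simp: t.jU_def jet_mf_simps)
 have 1: "openin (mtop (JM L)) t.jU" by (rule chart_dom[OF jet_atlas[OF L] atlas_ch[OF jet_atlas[OF L] t.jet_chart_in]])
 have 2: "fst ` t.jU \<subseteq> U" using t.jU_fst(1) by (auto simp: t.dm_def)
 have 3: "smooth_on UNIV (fst :: 'b \<times> 'b \<times> real => 'b)" by (rule smooth_linear[OF bounded_linear_fst])
 have 4: "ALL z:t.jU. t.jph z\<in>UNIV & ph (fst z) = fst (t.jph z)" using t.jU_fst(2) by simp
 show "\<exists>U ph V ps T S h. (U, ph)\<in>charts (JM L) & (V, ps)\<in>charts (base L) & openin (mtop (JM L)) T \<and>
   z\<in>T & T \<subseteq> U & fst ` T \<subseteq> V & open S & smooth_on S h & (ALL z:T. ph z\<in>S & ps (fst z) = h (ph z))"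
  by (intro exI conjI) (fact t.jet_chart_in t.ch 1 zU subset_refl 2 open_UNIV 3 4)+
qed

lemma smooth_map_separates:
 assumes A: "atlas P" and N: "atlas N" "Hausdorff_space (mtop N)" and p: "smooth_map P N p" and z: "z\<in>pts P" "z'\<in>pts P" "p z ~= p z'"
 shows "\<exists>V W. openin (mtop P) V & openin (mtop P) W & z\<in>V & z'\<in>W & V Int W = {}"
proof -
 have q: "p z\<in>pts N" "p z'\<in>pts N" using smooth_mapD(1)[OF p] z by auto
 then obtain V W where VW: "openin (mtop N) V" "openin (mtop N) W" "p z\<in>V" "p z'\<in>W" "disjnt V W"
  using N(2) z(3) unfolding Hausdorff_space_def topspace_mtop[OF N(1)] by metis
 let ?p = "%V. pts P Int p -` V"
 have "openin (mtop P) (?p V)" "openin (mtop P) (?p W)" using smap_openin[OF A N(1) p] VW(1,2) by blast+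
 moreover have "z\<in>?p V" "z'\<in>?p W" "?p V Int ?p W = {}" using VW(3-5) z by (auto simp: disjnt_def)
 ultimately show ?thesis by blast
qed

lemma countable_trivializations:
 assumes L: "line_bundle L"
 shows "\<exists>J\<subseteq>charts (base L) \<times> frames L. countable J & pts (base L) \<subseteq> (\<Union>i\<in>J. (%(c, f). fst c Int fst f) i)"
proof -
 let ?f = "%(c, f). fst c Int fst f"
 note AM = lbD(2)[OF L]
 have "second_countable (mtop (base L))" using lbD(1)[OF L] by (simp add: smooth_manifold_def)
 moreover have "EX i:charts (base L) \<times> frames L. x\<in>?f i" if x: "x\<in>pts (base L)" for x
 proof -
  obtain U ph where "(U, ph)\<in>charts (base L)" "x\<in>U" using atlas_obtain[OF AM x] .
  moreover obtain V e where "(V, e)\<in>frames L" "x\<in>V" using frame_obtain[OF L x] .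
  ultimately show ?thesis by (intro bexI[of _ "((U, ph), (V, e))"]) auto
 qed
 moreover have "openin (mtop (base L)) (?f i)" if "i\<in>charts (base L) \<times> frames L" for i
  using that chart_dom[OF AM atlas_ch[OF AM]] lbD(5)[OF L] by auto
 ultimately show ?thesis by (rule cble_subcover[OF AM])
qed

lemma jet_mfd:
 assumes L: "line_bundle L" shows "smooth_manifold (JM L)" unfolding smooth_manifold_def
proof (intro conjI)
 note A = jet_atlas[OF L] and AM = lbD(2)[OF L]
 show "ALL c:charts (JM L). smooth_chart (JM L) c"
  "pts (JM L) = (\<Union>(U, ph)\<in>charts (JM L). U)" using A by (auto simp: atlas_def)
 show "Hausdorff_space (mtop (JM L))"
 proof (rule Hausdorff_mtopI[OF A])
  fix z z' assume z: "z\<in>pts (JM L)" "z'\<in>pts (JM L)" "z ~= z'"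
  have p: "fst z\<in>pts (base L)" "fst z'\<in>pts (base L)" using z by (auto simp: jet_mf_simps)
  show "(EX (U, ph):charts (JM L). z\<in>U & z'\<in>U) \<or>
   (\<exists>V W. openin (mtop (JM L)) V & openin (mtop (JM L)) W & z\<in>V & z'\<in>W & V Int W = {})"
  proof (cases "fst z = fst z'")
   case True
   obtain U ph V e where t: "triv L U ph V e" "fst z\<in>U Int V" using triv_obtain[OF L p(1)] .
   have "z\<in>triv.jU L U V" "z'\<in>triv.jU L U V" using t z True by (auto simp: triv.jU_def[OF t(1)] jet_mf_simps)
   thus ?thesis using triv.jet_chart_in[OF t(1)] by blast
  next
   case False
   have "Hausdorff_space (mtop (base L))" using lbD(1)[OF L] by (simp add: smooth_manifold_def)
   thus ?thesis using smooth_map_separates[OF A AM _ jet_proj_smooth[OF L] z(1,2) False] by blast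
  qed
 qed
 show "second_countable (mtop (JM L))"
 proof -
  obtain J where J: "J \<subseteq> charts (base L) \<times> frames L" "countable J" "pts (base L) \<subseteq> (\<Union>i\<in>J. (%(c, f). fst c Int fst f) i)"
   using countable_trivializations[OF L] by blast
  let ?C = "(%(c, f). ({(q, al). q\<in>fst c Int fst f & al\<in>Jet L q}, jet_chart L c (snd f))) ` J"
  show ?thesis
  proof (rule cble_mtopI[OF A])
   show "countable ?C" using J(2) by simp
   show "?C \<subseteq> charts (JM L)"
   proof
    fix x assume "x\<in>?C"
    then obtain c f where cf: "(c, f)\<in>J" "x = ({(q, al). q\<in>fst c Int fst f & al\<in>Jet L q}, jet_chart L c (snd f))" by auto
    obtain U ph V e where e: "c = (U, ph)" "f = (V, e)" by (cases c, cases f)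
    have "(U, ph)\<in>charts (base L)" "(V, e)\<in>frames L" using cf(1) J(1) e by auto
    thus "x\<in>charts (JM L)" unfolding jet_mf_simps cf(2) e
     by (intro CollectI exI[of _ U] exI[of _ ph] exI[of _ V] exI[of _ e]) simp
   qed
   show "pts (JM L) \<subseteq> (\<Union>(U, ph)\<in>?C. U)"
   proof
    fix z assume "z\<in>pts (JM L)"
    then obtain q al where z: "z = (q, al)" "q\<in>pts (base L)" "al\<in>Jet L q" by (auto simp: jet_mf_simps)
    then obtain c f where "(c, f)\<in>J" "q\<in>fst c Int fst f" using J(3) by fastforce
    thus "z\<in>(\<Union>(U, ph)\<in>?C. U)" using z by (auto intro!: bexI[of _ "(c, f)"])
   qed
  qed
 qed
qed

lemma jet_line_bundle:
 assumes L: "line_bundle L" shows "line_bundle (JL L)" unfolding jet_line_bundle_def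
 by (rule pull_bundle_line_bundle[OF jet_mfd[OF L] L jet_proj_smooth[OF L]])

lemma jet_lb_simps[simp]: "base (JL L) = JM L" "fibre (JL L) z = fibre L (fst z)"
 by (simp_all add: jet_line_bundle_def)

lemma jet_factor: "line_bundle L ==> factor (JL L) L (fst, %x l. l)"
 unfolding jet_line_bundle_def by (rule pull_bundle_factor[OF jet_mfd _ jet_proj_smooth])

section \<open>The canonical bracket on the jet bundle\<close>

text \<open>The derivative of each coefficient along the vector part of the other, as for vector
  fields. Testing on sections with affine representative suffices, since their jets \<open>j\<close>
  are arbitrary.\<close>

lemma (in triv) commutator_field:
 assumes a: "a\<in>derivations L" and b: "b\<in>derivations L" and x: "x\<in>dm"
  and wa: "smooth_on img wa" "ALL x:dm. (%s. a s x) = der (wa (ph x)) x"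
  and wb: "smooth_on img wb" "ALL x:dm. (%s. b s x) = der (wb (ph x)) x"
  and wc: "(%s. commutator a b s x) = der wc x"
 shows "wc = frechet_derivative wb (at (ph x)) (fst (wa (ph x))) - frechet_derivative wa (at (ph x)) (fst (wb (ph x)))"
proof -
 let ?y = "ph x"
 have y: "?y\<in>img" using phi_img[OF x] .
 have main: "wc\<bullet>j = (frechet_derivative wb (at ?y) (fst (wa ?y)) - frechet_derivative wa (at ?y) (fst (wb ?y)))\<bullet>j"
  for j :: "'e \<times> real"
 proof -
  define c d where "c = fst j" and "d = snd j - c\<bullet>?y"
  let ?h = "%y. c\<bullet>y + d"
  have "smooth_on img ?h" by (intro smooth_intros open_img)
  from rep_extend[OF open_img this x y] obtain s S where s: "s\<in>sections L" "open S" "?y\<in>S" "S \<subseteq> img"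
   "!!y. y\<in>S ==> rep s y = ?h y" by blast
  have js: "jet1 (rep s) z = (c, ?h z)" if "z\<in>S" for z using jet1_cong[OF s(2) that s(5)] by (simp add: jet1_affine)
  have jx: "jr s x = j" using js[OF s(3)] by (simp add: c_def d_def prod_eq_iff)
  \<comment> \<open>For an affine representative the gradient is constant, so the derivative of
    \<open>rep (b' s)\<close> comes only from the coefficient \<open>w'\<close> and from the value
    component of the jet.\<close>
  have two: "rep (a' (b' s)) ?y = frechet_derivative w' (at ?y) (fst (w ?y))\<bullet>j + snd (w' ?y) * (c\<bullet>fst (w ?y)) + snd (w ?y) * (w' ?y\<bullet>j)"
   if a': "a'\<in>derivations L" and b': "b'\<in>derivations L"
    and w: "ALL x:dm. (%s. a' s x) = der (w (ph x)) x"
    and w': "smooth_on img w'" "ALL x:dm. (%s. b' s x) = der (w' (ph x)) x" for a' b' w w'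
  proof -
   have r: "rep (b' s) z = w' z\<bullet>(c, ?h z)" if "z\<in>S" for z
   proof -
    have z: "pt z\<in>dm" "ph (pt z) = z" using that s(4) pt_dm by auto
    show ?thesis using rep_der[of b' "pt z" "w' z", OF _ z(1) s(1)] w'(2)[rule_format, OF z(1)] js[OF that] by (simp only: z(2))
   qed
   let ?D = "frechet_derivative w' (at ?y)"
   have D: "(w' has_derivative ?D) (at ?y)" by (rule smooth_has_der[OF w'(1) y])
   have hd: "((%z. (c, ?h z)) has_derivative (%v. (0, c\<bullet>v))) (at ?y)" by (auto intro!: derivative_eq_intros)
   have "((%z. w' z\<bullet>(c, ?h z)) has_derivative (%v. w' ?y\<bullet>(0, c\<bullet>v) + ?D v\<bullet>(c, ?h ?y))) (at ?y)"
    by (rule has_derivative_inner[OF D hd])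
   hence "(rep (b' s) has_derivative (%v. w' ?y\<bullet>(0, c\<bullet>v) + ?D v\<bullet>(c, ?h ?y))) (at ?y)"
    by (rule has_derivative_transform_within_open[OF _ s(2,3)]) (simp add: r)
   moreover have "(rep (b' s) has_derivative (%v. grad (rep (b' s)) ?y\<bullet>v)) (at ?y)"
    by (rule has_grad[OF rep_diff[OF dersD(1)[OF b' s(1)] x]])
   ultimately have eq: "(%v. w' ?y\<bullet>(0, c\<bullet>v) + ?D v\<bullet>(c, ?h ?y)) = (%v. grad (rep (b' s)) ?y\<bullet>v)"
    by (rule has_derivative_unique)
   have "grad (rep (b' s)) ?y\<bullet>v = w' ?y\<bullet>(0, c\<bullet>v) + ?D v\<bullet>(c, ?h ?y)" for v using fun_cong[OF eq, of v] by (rule sym)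
   hence g: "grad (rep (b' s)) ?y\<bullet>v = snd (w' ?y) * (c\<bullet>v) + ?D v\<bullet>j" for v by (simp add: inner_prod_def c_def d_def)
   have "rep (a' (b' s)) ?y = w ?y\<bullet>jr (b' s) x"
    by (rule rep_der[of a' x "w ?y" "b' s", OF w[rule_format, OF x] x dersD(1)[OF b' s(1)]])
   also have "\<dots> = grad (rep (b' s)) ?y\<bullet>fst (w ?y) + snd (w ?y) * rep (b' s) ?y" by (simp add: inner_prod_def inner_commute)
   also have "rep (b' s) ?y = w' ?y\<bullet>j" using rep_der[of b' x "w' ?y" s, OF w'(2)[rule_format, OF x] x s(1)] by (simp only: jx)
   finally show ?thesis by (simp add: g)
  qed
  have "wc\<bullet>j = rep (commutator a b s) ?y" using rep_der[of "commutator a b" x wc s, OF wc x s(1)] by (simp only: jx)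
  also have "\<dots> = rep (a (b s)) ?y - rep (b (a s)) ?y"
  proof -
   have ab: "a (b s)\<in>sections L" "b (a s)\<in>sections L"
    using dersD(1)[OF a dersD(1)[OF b s(1)]] dersD(1)[OF b dersD(1)[OF a s(1)]] by auto
   have "commutator a b s x = (rep (a (b s)) ?y - rep (b (a s)) ?y) *\<^sub>R e x"
    by (simp only: commutator_def scaleR_diff_left rep_section[OF x ab(1)] rep_section[OF x ab(2)])
   thus ?thesis using e_nz[OF x] by (simp add: rep_phi[OF x, of "commutator a b s"])
  qed
  also have "\<dots> = (frechet_derivative wb (at ?y) (fst (wa ?y)) - frechet_derivative wa (at ?y) (fst (wb ?y)))\<bullet>j"
   unfolding two[OF a b wa(2) wb] two[OF b a wb(2) wa] by (simp add: inner_diff_left inner_prod_def c_def inner_commute algebra_simps)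
  finally show ?thesis .
 qed
 show ?thesis by (rule onb_eqI) (rule main)
qed

lemma (in triv) jet_triv:
 "triv (JL L) jU jph (pts (JM L) Int fst -` V) (e \<circ> fst)"
 unfolding triv_def using jet_line_bundle[OF L] jet_chart_in fr by (auto simp: jet_line_bundle_def)

locale jtriv = triv L U ph V e +
 J: triv "JL L" "triv.jU L U V" "triv.jph L U ph e" "pts (JM L) Int fst -` V" "e \<circ> fst"
 for L :: "('m, 'e::findim, 'l::real_vector) line_bundle" and U ph V e

lemma triv_jtriv: "triv L U ph V e ==> jtriv L U ph V e" using triv.jet_triv by (simp add: jtriv_def)

text \<open>In jet coordinates \<open>(x, p, u)\<close> a 1-jet is \<open>((f\<^sub>x, f\<^sub>p, f\<^sub>u), f)\<close>, and \<open>f - (p, u) \<bullet> (f\<^sub>p, f\<^sub>u)\<close> is its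
  component that vanishes on linear sections.\<close>

definition canon_form :: "'e::findim \<times> 'e \<times> real => ('e \<times> 'e \<times> real) \<times> real => ('e \<times> 'e \<times> real) \<times> real => real" where
 "canon_form y f g = fst (snd (fst f))\<bullet>fst (fst g) - fst (fst f)\<bullet>fst (snd (fst g)) +
  snd (snd (fst f)) * (snd g - snd y\<bullet>snd (fst g)) - (snd f - snd y\<bullet>snd (fst f)) * snd (snd (fst g))"

lemma canon_form_bilinear: "bilinear (canon_form y)" unfolding bilinear_def
 by (auto intro!: linearI simp: canon_form_def inner_prod_def inner_add_left inner_add_right algebra_simps)

lemma canon_form_smooth: "open S ==> smooth_on S (%y. canon_form y f g)" unfolding canon_form_def by (intro smooth_intros)

lemma jet_pi_eq:
 "line_bundle L ==> s\<in>sections L ==> jet_pull_section L s = pull_section (JL L) (fst, %x l. l) s"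
 by (rule ext) (auto simp: jet_pull_section_def pull_section_def restrict0_def jet_mf_simps sectionsD(2)
  intro!: inv_into_f_f[symmetric, of "%l. l"])

lemma jet_pull_in:
 "line_bundle L ==> s\<in>sections L ==> jet_pull_section L s\<in>sections (JL L)"
 using pull_in[OF jet_line_bundle _ jet_factor] jet_pi_eq by metis

lemma jet_pi_at: "z\<in>pts (JM L) ==> jet_pull_section L s z = s (fst z)"
 by (cases z) (simp add: jet_pull_section_def restrict0_def)

lemma jet_linear_at:
 assumes "line_bundle L" "a\<in>derivations L" "q\<in>pts (base L)" "r\<in>sections L"
 shows "jet_linear_section L a (q, jet L r q) = a r q" using assms dersD(3)[OF assms(2,3)] jet_Jet[OF assms(1,3,4)]
 by (simp add: jet_linear_section_def restrict0_def jet_mf_simps jet_def)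

lemma jet_pt_obtain:
 assumes "line_bundle L" "z\<in>pts (JM L)"
 obtains q r where "z = (q, jet L r q)" "q\<in>pts (base L)" "r\<in>sections L"
proof -
 obtain q al where z: "z = (q, al)" "q\<in>pts (base L)" "al\<in>Jet L q" using assms(2) by (auto simp: jet_mf_simps)
 then obtain r where "r\<in>sections L" "al = jet L r q" using Jet_eq[OF assms(1) z(2)] by blast
 thus thesis using z that by blast
qed

context jtriv
begin

lemma J_dm: "J.dm = jU" using jU_pts jU_fst(1) by (auto simp: J.dm_def dm_def)

lemma J_img: "J.img = img \<times> UNIV"
 using jph_img[of dm] jU_fst(1) by (simp add: J.img_def[folded J.dm_def] J_dm img_def[folded dm_def] Int_absorb2 subset_iff)

lemma J_pt_fst: "y\<in>img ==> fst (J.pt (y, j)) = pt y"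
 using J.pt_dm[of "(y, j)"] J.phi_pt[of "(y, j)"] jU_fst[of "J.pt (y, j)"] pt_phi[of "fst (J.pt (y, j))"] by (simp add: J_img J_dm)

lemma J_rep_pi: "w\<in>J.img ==> J.rep (jet_pull_section L s) w = rep s (fst w)"
 using J.pt_dm[of w] J_pt_fst[of "fst w" "snd w"] J.dm_pts[of "J.pt w"] by (auto simp: J.rep_def rep_def jet_pi_at J_img)

lemma J_jr_pi:
 assumes s: "s\<in>sections L" and z: "z\<in>jU"
 shows "J.jr (jet_pull_section L s) z = ((grad (rep s) (ph (fst z)), 0), rep s (ph (fst z)))"
proof -
 have zi: "jph z\<in>J.img" using J.phi_img z J_dm by simp
 have f: "fst (jph z) = ph (fst z)" using jU_fst(2)[OF z] .
 have "jet1 (J.rep (jet_pull_section L s)) (jph z) = jet1 (%w. rep s (fst w)) (jph z)" by (rule jet1_cong[OF J.open_img zi J_rep_pi])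
 also have "\<dots> = ((grad (rep s) (ph (fst z)), 0), rep s (ph (fst z)))"
 proof (rule jet1_eqI)
  have "((%w. fst w) has_derivative fst) (at (jph z))" by (rule has_derivative_fst[OF has_derivative_ident])
  from has_derivative_compose[OF this has_grad]
  have "((%w. rep s (fst w)) has_derivative (%v. grad (rep s) (fst (jph z))\<bullet>fst v)) (at (jph z))"
   using rep_diff[OF s jU_fst(1)[OF z]] by (simp add: f)
  thus "((%w. rep s (fst w)) has_derivative (\<bullet>) (grad (rep s) (ph (fst z)), 0)) (at (jph z))" by (simp add: f inner_prod_def[abs_def])
 qed (simp add: f)
 finally show ?thesis .
qed

lemma J_rep_lin:
 assumes a: "a\<in>derivations L" and w: "ALL x:dm. (%s. a s x) = der (w (ph x)) x" and y: "y\<in>J.img"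
 shows "J.rep (jet_linear_section L a) y = w (fst y)\<bullet>snd y"
proof -
 have "J.pt y\<in>jU" using J.pt_dm[OF y] by (simp add: J_dm)
 then obtain q s where q: "q\<in>dm" "s\<in>sections L" "J.pt y = (q, jet L s q)" "jph (J.pt y) = (ph q, jr s q)" by (rule jU_obtain)
 have yq: "y = (ph q, jr s q)" using J.phi_pt[OF y] q(4) by simp
 have "jet_linear_section L a (J.pt y) = a s q" unfolding q(3) by (rule jet_linear_at[OF L a dm_pts[OF q(1)] q(2)])
 also have "\<dots> = (w (ph q)\<bullet>jr s q) *\<^sub>R e q" using fun_cong[OF w[rule_format, OF q(1)], of s] q(2) by (simp add: der_sec)
 finally have "J.rep (jet_linear_section L a) y = w (ph q)\<bullet>jr s q" using e_nz[OF q(1)] by (simp add: J.rep_def q(3))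
 moreover have "w (fst y)\<bullet>snd y = w (ph q)\<bullet>jr s q" by (simp only: yq fst_conv snd_conv)
 ultimately show ?thesis by simp
qed

text \<open>In coordinates a linear section is the pairing of \<open>w\<close>, a function of the
  base point, with the fibre coordinates. Its fibre derivative is \<open>w\<close> itself, so its
  value is determined by its fibre derivative.\<close>

lemma J_jr_lin:
 assumes a: "a\<in>derivations L" and sm: "smooth_on img w" and w: "ALL x:dm. (%s. a s x) = der (w (ph x)) x" and z: "z\<in>jU"
 shows "snd (fst (J.jr (jet_linear_section L a) z)) = w (ph (fst z))"
  "snd (J.jr (jet_linear_section L a) z) = w (ph (fst z))\<bullet>snd (jph z)"
  "fst (fst (J.jr (jet_linear_section L a) z))\<bullet>v = frechet_derivative w (at (ph (fst z))) v\<bullet>snd (jph z)"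
proof -
 have zi: "jph z\<in>J.img" using J.phi_img z J_dm by simp
 have f: "fst (jph z) = ph (fst z)" using jU_fst(2)[OF z] .
 let ?D = "frechet_derivative w (at (ph (fst z)))"
 have j: "J.jr (jet_linear_section L a) z = jet1 (%y. w (fst y)\<bullet>snd y) (jph z)" by (rule jet1_cong[OF J.open_img zi J_rep_lin[OF a w]])
 have D: "(w has_derivative ?D) (at (fst (jph z)))" using smooth_has_der[OF sm phi_img[OF jU_fst(1)[OF z]]] by (simp add: f)
 have "((%y. w (fst y)\<bullet>snd y) has_derivative (%v. w (fst (jph z))\<bullet>snd v + ?D (fst v)\<bullet>snd (jph z))) (at (jph z))"
  by (intro has_derivative_inner has_derivative_compose[OF has_derivative_fst[OF has_derivative_ident] D]
   has_derivative_snd has_derivative_ident)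
 moreover have "(%y. w (fst y)\<bullet>snd y) differentiable (at (jph z))" using calculation by (auto simp: differentiable_def)
 from has_grad[OF this] have "((%y. w (fst y)\<bullet>snd y) has_derivative (%v. grad (%y. w (fst y)\<bullet>snd y) (jph z)\<bullet>v)) (at (jph z))" .
 ultimately have "(%v. grad (%y. w (fst y)\<bullet>snd y) (jph z)\<bullet>v) = (%v. w (fst (jph z))\<bullet>snd v + ?D (fst v)\<bullet>snd (jph z))"
  by (intro has_derivative_unique)
 hence g: "grad (%y. w (fst y)\<bullet>snd y) (jph z)\<bullet>v = w (ph (fst z))\<bullet>snd v + ?D (fst v)\<bullet>snd (jph z)" for v by (metis f)
 have z0: "?D 0 = 0" using linear_0[OF has_derivative_linear[OF D]] .
 show "snd (fst (J.jr (jet_linear_section L a) z)) = w (ph (fst z))"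
 proof (rule onb_eqI)
  fix b :: "'e \<times> real"
  show "snd (fst (J.jr (jet_linear_section L a) z))\<bullet>b = w (ph (fst z))\<bullet>b"
   using g[of "(0, b)"] z0 unfolding j by (simp add: inner_prod_def[of "grad _ _"])
 qed
 show "snd (J.jr (jet_linear_section L a) z) = w (ph (fst z))\<bullet>snd (jph z)" unfolding j by (simp add: f)
 show "fst (fst (J.jr (jet_linear_section L a) z))\<bullet>v = ?D v\<bullet>snd (jph z)"
  using g[of "(v, 0)"] unfolding j by (simp add: inner_prod_def[of "grad _ _"])
qed

end

lemma jet_linear_in:
 assumes L: "line_bundle L" and a: "a\<in>derivations L"
 shows "jet_linear_section L a\<in>sections (JL L)"
proof -
 have "smooth_section_on (JL L) (pts (JM L)) (jet_linear_section L a)"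
 proof (rule ssec_local[OF jet_line_bundle[OF L]])
  show "openin (mtop (base (JL L))) (pts (JM L))" using opn_pts[OF jet_atlas[OF L]] by simp
  fix z assume z: "z\<in>pts (JM L)"
  hence "fst z\<in>pts (base L)" by (auto simp: jet_mf_simps)
  then obtain U ph V e where t: "triv L U ph V e" "fst z\<in>U Int V" by (rule triv_obtain[OF L])
  interpret jtriv L U ph V e by (rule triv_jtriv[OF t(1)])
  obtain w where w: "smooth_on img w" "ALL x:dm. (%s. a s x) = der (w (ph x)) x" using ders_field[OF a] by blast
  have zU: "z\<in>jU" using t z by (auto simp: jU_def jet_mf_simps)
  have s1: "smooth_on J.img (%y. w (fst y))"
   by (rule smooth_comp[OF J.open_img open_img smooth_linear[OF bounded_linear_fst] _ w(1)]) (auto simp: J_img)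
  have s: "smooth_on J.img (%y. w (fst y)\<bullet>snd y)" by (intro smooth_on_inner J.open_img s1 smooth_linear[OF bounded_linear_snd])
  have "smooth_section_on (JL L) J.dm (jet_linear_section L a)"
  proof (rule J.section_smoothI[OF J.opn_dm subset_refl J.open_img s], intro conjI)
   fix x assume x: "x\<in>J.dm"
   show "jph x\<in>J.img" using J.phi_img[OF x] .
   obtain q r where q: "q\<in>dm" "r\<in>sections L" "x = (q, jet L r q)" "jph x = (ph q, jr r q)" using jU_obtain x[unfolded J_dm] by blast
   have "jet_linear_section L a x = a r q" unfolding q(3) by (rule jet_linear_at[OF L a dm_pts[OF q(1)] q(2)])
   thus "jet_linear_section L a x = (w (fst (jph x))\<bullet>snd (jph x)) *\<^sub>R (e \<circ> fst) x"
    using fun_cong[OF w(2)[rule_format, OF q(1)], of r] q(2) unfolding q(4) by (simp add: der_sec q(3))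
  qed
  thus "\<exists>T. openin (mtop (base (JL L))) T & z\<in>T & smooth_section_on (JL L) T (jet_linear_section L a)"
   using J.opn_dm zU J_dm by auto
 qed
 thus ?thesis by (simp add: sections_def zero_off_def jet_linear_section_def restrict0_def)
qed

section \<open>Generators and the canonical bracket\<close>

definition jet_gens where
 "jet_gens L = jet_linear_section L ` derivations L Un jet_pull_section L ` sections L"

text \<open>Basic sections detect the base directions and the value component; linear sections with
  arbitrary coefficient \<open>j\<close> then detect the fibre directions.\<close>

lemma jet_spanning_gens:
 assumes L: "line_bundle L" shows "jet_spanning (JL L) (jet_gens L)" unfolding jet_spanning_def
proof (intro conjI ballI impI)
 show "jet_gens L \<subseteq> sections (JL L)"
  using jet_linear_in[OF L] jet_pull_in[OF L] by (auto simp: jet_gens_def)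
 fix z a assume z: "z\<in>pts (base (JL L))" and a: "a\<in>Der (JL L) z"
  and k: "ALL g:jet_gens L. a g = 0"
 have zp: "z\<in>pts (JM L)" using z by simp
 hence "fst z\<in>pts (base L)" by (auto simp: jet_mf_simps)
 then obtain U ph V e where t: "triv L U ph V e" "fst z\<in>U Int V" by (rule triv_obtain[OF L])
 interpret jtriv L U ph V e by (rule triv_jtriv[OF t(1)])
 have zU: "z\<in>jU" using t zp by (auto simp: jU_def jet_mf_simps)
 have q: "fst z\<in>dm" using jU_fst(1)[OF zU] .
 obtain W where W: "a = J.der W z" using J.Der_der[OF _ a] zU J_dm by auto
 have z0: "W\<bullet>J.jr g z = 0" if "g\<in>jet_gens L" for g
 proof -
  have "g\<in>sections (JL L)"
   using that jet_linear_in[OF L] jet_pull_in[OF L] by (auto simp: jet_gens_def)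
  thus ?thesis using k that e_nz[OF q] by (auto simp: W J.der_sec)
 qed
 have 1: "(fst (fst W), snd W)\<bullet>jr s (fst z) = 0" if "s\<in>sections L" for s using z0[of "jet_pull_section L s"] that J_jr_pi[OF that zU]
  by (simp add: jet_gens_def inner_prod_def)
 have "(fst (fst W), snd W)\<bullet>j = 0" for j
 proof -
  obtain s where "s\<in>sections L" "jr s (fst z) = j" using jr_obtain[OF q] .
  thus ?thesis using 1 by blast
 qed
 from this[of "(fst (fst W), snd W)"] have "(fst (fst W), snd W) = 0" by (simp only: inner_eq_zero_iff)
 hence W1: "fst (fst W) = 0" "snd W = 0" by (simp_all add: zero_prod_def)
 have "snd (fst W)\<bullet>j = 0" for j
 proof -
  obtain b T where b: "b\<in>derivations L" "fst z\<in>T" "T \<subseteq> dm" "!!z. z\<in>T ==> (%s. b s z) = der j z"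
   using ders_obtain[OF q smooth_const[of _ j]] by blast
  obtain w where w: "smooth_on img w" "ALL x:dm. (%s. b s x) = der (w (ph x)) x" using ders_field[OF b(1)] by blast
  have "w (ph (fst z)) = j" using w(2)[rule_format, OF q] b(4)[OF b(2)] der_inj[OF q] by metis
  thus ?thesis using z0[of "jet_linear_section L b"] b(1) J_jr_lin(1)[OF b(1) w zU] W1
   by (simp add: jet_gens_def inner_prod_def[of W] inner_prod_def[of "fst W"])
 qed
 from this[of "snd (fst W)"] have "W = 0" using W1 by (simp add: prod_eq_iff)
 thus "a = (%s. 0)" by (simp add: W J.der_zero)
qed

text \<open>The multiplication table of the generators. It is a relation because a section may be a
  generator in several ways, the zero section being both linear and basic; consistency is only seen
  from the local formula. The third rule is the skew counterpart of the second.\<close>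

inductive jet_gb for L where
 "a\<in>derivations L ==> b\<in>derivations L ==>
  jet_gb L (jet_linear_section L a) (jet_linear_section L b) (jet_linear_section L (commutator a b))"
| "a\<in>derivations L ==> s\<in>sections L ==>
  jet_gb L (jet_linear_section L a) (jet_pull_section L s) (jet_pull_section L (a s))"
| "a\<in>derivations L ==> s\<in>sections L ==>
  jet_gb L (jet_pull_section L s) (jet_linear_section L a) (jet_pull_section L (%x. - a s x))"
| "s\<in>sections L ==> r\<in>sections L ==>
  jet_gb L (jet_pull_section L s) (jet_pull_section L r) (%x. 0)"

context jtriv
begin

abbreviation canon_local where
 "canon_local s r z \<equiv> canon_form (jph z) (J.jr s z) (J.jr r z) *\<^sub>R (e \<circ> fst) z"

text \<open>Confronts the coordinate formula with the table. For two linear sections the correction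
  terms vanish by \<open>J_jr_lin\<close>, and what remains is the coordinate formula of
  \<open>commutator_field\<close>.\<close>

lemma canon_local_gen:
 assumes "jet_gb L g h k" and z: "z\<in>J.dm"
 shows "canon_local g h z = k z" using assms(1)
proof cases
 case (1 a b)
 have zU: "z\<in>jU" using z J_dm by simp
 have q: "fst z\<in>dm" using jU_fst(1)[OF zU] .
 note c = comm_ders[OF L 1(4,5)]
 obtain wa where wa: "smooth_on img wa" "ALL x:dm. (%s. a s x) = der (wa (ph x)) x" using ders_field[OF 1(4)] by blast
 obtain wb where wb: "smooth_on img wb" "ALL x:dm. (%s. b s x) = der (wb (ph x)) x" using ders_field[OF 1(5)] by blast
 obtain wc where wc: "smooth_on img wc" "ALL x:dm. (%s. commutator a b s x) = der (wc (ph x)) x" using ders_field[OF c] by blast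
 have ksec: "J.rep k (jph z) *\<^sub>R (e \<circ> fst) z = k z" using J.rep_section[OF z jet_linear_in[OF L c]] 1(3) by simp
 have "J.rep k (jph z) = wc (ph (fst z))\<bullet>snd (jph z)" using J_jr_lin(2)[OF c wc zU] 1(3) by simp
 also have "\<dots> = (frechet_derivative wb (at (ph (fst z))) (fst (wa (ph (fst z)))) -
   frechet_derivative wa (at (ph (fst z))) (fst (wb (ph (fst z)))))\<bullet>snd (jph z)"
  by (simp only: commutator_field[OF 1(4,5) q wa wb wc(2)[rule_format, OF q]])
 also have "\<dots> = canon_form (jph z) (J.jr g z) (J.jr h z)"
 proof -
  note ja = J_jr_lin[OF 1(4) wa(1) wa(2) zU] and jb = J_jr_lin[OF 1(5) wb(1) wb(2) zU]
  have "canon_form (jph z) (J.jr g z) (J.jr h z) =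
    fst (fst (J.jr h z))\<bullet>fst (wa (ph (fst z))) - fst (fst (J.jr g z))\<bullet>fst (wb (ph (fst z)))"
   unfolding canon_form_def 1(1,2) ja(1,2) jb(1,2)
   by (simp only: inner_commute[of "snd (jph z)"] inner_commute[of "fst (wa _)"] diff_self mult_zero_left mult_zero_right diff_zero add_0_right)
  thus ?thesis by (simp only: 1(1,2) ja(3) jb(3) inner_diff_left)
 qed
 finally show ?thesis using ksec by simp
next
 case (2 a s)
 have zU: "z\<in>jU" using z J_dm by simp
 have q: "fst z\<in>dm" using jU_fst(1)[OF zU] .
 obtain w where w: "smooth_on img w" "ALL x:dm. (%s. a s x) = der (w (ph x)) x" using ders_field[OF 2(4)] by blast
 have "k z = a s (fst z)" using 2(3) zU jU_pts by (auto simp: jet_pi_at)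
 also have "\<dots> = (w (ph (fst z))\<bullet>jr s (fst z)) *\<^sub>R e (fst z)" using fun_cong[OF w(2)[rule_format, OF q], of s] 2(5) by (simp add: der_sec)
 also have "w (ph (fst z))\<bullet>jr s (fst z) = canon_form (jph z) (J.jr g z) (J.jr h z)"
  unfolding 2(1,2) canon_form_def J_jr_lin(1,2)[OF 2(4) w zU] J_jr_pi[OF 2(5) zU] by (simp add: inner_prod_def jet1_def)
 finally show ?thesis by simp
next
 case (3 a s)
 have zU: "z\<in>jU" using z J_dm by simp
 have q: "fst z\<in>dm" using jU_fst(1)[OF zU] .
 obtain w where w: "smooth_on img w" "ALL x:dm. (%s. a s x) = der (w (ph x)) x" using ders_field[OF 3(4)] by blast
 have "k z = - a s (fst z)" using 3(3) zU jU_pts by (auto simp: jet_pi_at)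
 also have "\<dots> = (- (w (ph (fst z))\<bullet>jr s (fst z))) *\<^sub>R e (fst z)" using fun_cong[OF w(2)[rule_format, OF q], of s] 3(5) by (simp add: der_sec)
 also have "- (w (ph (fst z))\<bullet>jr s (fst z)) = canon_form (jph z) (J.jr g z) (J.jr h z)"
  unfolding 3(1,2) canon_form_def J_jr_lin(1,2)[OF 3(4) w zU] J_jr_pi[OF 3(5) zU] by (simp add: inner_prod_def jet1_def inner_commute)
 finally show ?thesis by simp
next
 case (4 s r)
 have zU: "z\<in>jU" using z J_dm by simp
 show ?thesis unfolding 4(1-3) canon_form_def J_jr_pi[OF 4(4) zU] J_jr_pi[OF 4(5) zU] by simp
qed

lemma canon_local_biderivation: "local_biders (JL L) J.dm canon_local"
 by (rule J.bilinear_form_biderivation[OF canon_form_bilinear canon_form_smooth[OF J.open_img]])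

end

lemma jacobiD:
 assumes "line_bundle L" "jacobi L br"
 shows "biders L br" "br s r = (%x. - br r s x)"
proof -
 show bd: "biders L br" using assms jacobi_iff by blast
 show "br s r = (%x. - br r s x)"
 proof (cases "s\<in>sections L & r\<in>sections L")
  case True
  have alt: "br t t x = 0" if "t\<in>sections L" for t x using assms(2) that by (simp add: jacobi_iff[OF assms(1)])
  note D = bidersD(2,3)[OF bd]
  have s: "s\<in>sections L" "r\<in>sections L" and sr: "(%y. s y + r y)\<in>sections L" using True secs_add[OF assms(1)] by auto
  have "br s r x + br r s x = 0" for x using alt[OF sr, of x] alt[OF s(1), of x] alt[OF s(2), of x]
    fun_cong[OF ders_linear(1)[OF assms(1) D(1)[OF sr] s], of x]
    fun_cong[OF ders_linear(1)[OF assms(1) D(2)[OF s(1)] s], of x]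
    fun_cong[OF ders_linear(1)[OF assms(1) D(2)[OF s(2)] s], of x] by (simp add: add.commute)
  thus ?thesis by (simp add: fun_eq_iff eq_neg_iff_add_eq_0)
 next
  case False
  thus ?thesis using bidersD(1)[OF bd] by (metis neg_0_equal_iff_equal)
 qed
qed

lemma jet_gen_bracket_ex:
 assumes "g\<in>jet_gens L" "h\<in>jet_gens L" shows "\<exists>k. jet_gb L g h k"
 using assms unfolding jet_gens_def by (auto intro: jet_gb.intros)

lemma jet_pt_jtriv:
 assumes L: "line_bundle L" and z: "z\<in>pts (JM L)"
 obtains U ph V e where "jtriv L U ph V e" "z\<in>triv.jU L U V"
proof -
 have "fst z\<in>pts (base L)" using z by (auto simp: jet_mf_simps)
 then obtain U ph V e where t: "triv L U ph V e" "fst z\<in>U Int V" by (rule triv_obtain[OF L])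
 have "z\<in>triv.jU L U V" using t z by (auto simp: triv.jU_def[OF t(1)] jet_mf_simps)
 thus thesis using that triv_jtriv[OF t(1)] by blast
qed

lemma canonical_bracket_ex:
 assumes L: "line_bundle L"
 shows "\<exists>br. biders (JL L) br & (\<forall>g h k. jet_gb L g h k --> br g h = k) \<and>
  (\<forall>U ph V e. jtriv L U ph V e --> (ALL s:sections (JL L). ALL r:sections (JL L).
   ALL z:triv.jU L U V. br s r z = jtriv.canon_local L U ph V e s r z))"
proof -
 let ?J = "JL L" and ?G = "jet_gens L"
 note G = jet_spanning_gens[OF L]
 \<comment> \<open>Any entry of the table will do: the local formula realises all entries, so the
   choice leaves no trace.\<close>
 define K where "K g h = (SOME k. jet_gb L g h k)" for g h
 have K: "jet_gb L g h (K g h)" if "g\<in>?G" "h\<in>?G" for g h unfolding K_def using jet_gen_bracket_ex[OF that] by (rule someI_ex)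
 have loc: "\<exists>W be. z\<in>W & local_biders ?J W be & (ALL g:?G. ALL h:?G. ALL x:W. be g h x = K g h x)"
  if z: "z\<in>pts (base ?J)" for z
 proof -
  have "z\<in>pts (JM L)" using z by simp
  then obtain U ph V e where t: "jtriv L U ph V e" "z\<in>triv.jU L U V" by (rule jet_pt_jtriv[OF L])
  interpret jtriv L U ph V e by fact
  show ?thesis using canon_local_biderivation canon_local_gen[OF K] t(2) J_dm by blast
 qed
 from biders_glue[OF jet_line_bundle[OF L] G loc] obtain br where br: "biders ?J br"
  "\<forall>W be. local_biders ?J W be --> (ALL g:?G. ALL h:?G. ALL z:W. be g h z = K g h z) -->
   (ALL s:sections ?J. ALL r:sections ?J. ALL z:W. br s r z = be s r z)" by blast
 have form: "br s r z = jtriv.canon_local L U ph V e s r z"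
  if t: "jtriv L U ph V e" and s: "s\<in>sections ?J" "r\<in>sections ?J" and z: "z\<in>triv.jU L U V" for U ph V e s r z
 proof -
  interpret jtriv L U ph V e by fact
  show ?thesis using br(2)[rule_format, OF canon_local_biderivation _ s] canon_local_gen[OF K] z J_dm by blast
 qed
 have "br g h = k" if R: "jet_gb L g h k" for g h k
 proof
  fix z
  have gh: "g\<in>sections ?J" "h\<in>sections ?J" and k: "k\<in>sections ?J" using R
   by (cases; simp add: jet_linear_in[OF L] jet_pull_in[OF L] dersD(1)[of _ L] secs_minus[OF L]
    comm_ders[OF L] secs_zero[OF jet_line_bundle[OF L]])+
  show "br g h z = k z"
  proof (cases "z\<in>pts (JM L)")
   case True
   obtain U ph V e where t: "jtriv L U ph V e" "z\<in>triv.jU L U V" using jet_pt_jtriv[OF L True] .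
   interpret jtriv L U ph V e by fact
   show ?thesis using form[OF t(1) gh t(2)] canon_local_gen[OF R] t(2) J_dm by simp
  next
   case False
   thus ?thesis using bidersD(7)[OF br(1)] sectionsD(3)[OF k] by simp
  qed
 qed
 thus ?thesis using br(1) form by blast
qed

definition canon_spec where
 "canon_spec L br \<longleftrightarrow> (ALL a:derivations L. ALL b:derivations L.
    br (jet_linear_section L a) (jet_linear_section L b) = jet_linear_section L (commutator a b)) \<and>
  (ALL a:derivations L. ALL s:sections L.
    br (jet_linear_section L a) (jet_pull_section L s) = jet_pull_section L (a s)) \<and>
  (ALL s:sections L. ALL r:sections L.
    br (jet_pull_section L s) (jet_pull_section L r) = (%x. 0))"

lemma jet_pi_minus: "jet_pull_section L (%x. - s x) = (%z. - jet_pull_section L s z)" by (auto simp: jet_pull_section_def restrict0_def)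

lemma canon_spec_gen:
 assumes L: "line_bundle L" and br: "jacobi (JL L) br" "canon_spec L br" and R: "jet_gb L g h k"
 shows "br g h = k" using R
proof cases
 case (3 a s)
 have "br g h = (%x. - br h g x)" by (rule jacobiD(2)[OF jet_line_bundle[OF L] br(1)])
 thus ?thesis using 3 br(2) by (simp add: canon_spec_def jet_pi_minus)
qed (use br(2) in \<open>simp_all add: canon_spec_def\<close>)

text \<open>The identity splits by the number of linear arguments. Three give the Jacobi identity
  for commutators, two the definition of the commutator, and with at most one every term
  vanishes.\<close>

lemma jacobi_jet_bracket:
 assumes L: "line_bundle L" and br: "biders (JL L) br"
  and K: "!!g h k. jet_gb L g h k ==> br g h = k"
 shows "jacobi (JL L) br"
proof (rule jacobiI[OF jet_line_bundle[OF L] jet_spanning_gens[OF L] br])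
 let ?J = "JL L" and ?l = "jet_linear_section L" and ?p = "jet_pull_section L"
 note c = comm_ders[OF L] and D = dersD(1) and mi = secs_minus[OF L]
 have ll: "br (?l a) (?l b) = ?l (commutator a b)" if "a\<in>derivations L" "b\<in>derivations L" for a b
  by (rule K[OF jet_gb.intros(1)[OF that]])
 have lp: "br (?l a) (?p s) = ?p (a s)" if "a\<in>derivations L" "s\<in>sections L" for a s by (rule K[OF jet_gb.intros(2)[OF that]])
 have pl: "br (?p s) (?l a) = ?p (%x. - a s x)" if "a\<in>derivations L" "s\<in>sections L" for a s by (rule K[OF jet_gb.intros(3)[OF that]])
 have pp: "br (?p s) (?p r) = (%x. 0)" if "s\<in>sections L" "r\<in>sections L" for s r by (rule K[OF jet_gb.intros(4)[OF that]])
 have gs: "?l a\<in>sections ?J" "?p s\<in>sections ?J" if "a\<in>derivations L" "s\<in>sections L" for a s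
  using jet_linear_in[OF L that(1)] jet_pull_in[OF L that(2)] by auto
 have z0: "br g (%x. 0) = (%x. 0)" if "g\<in>sections ?J" for g
  using ders_linear(5)[OF jet_line_bundle[OF L] bidersD(2)[OF br that] that that] .
 have lat: "?l a (q, jet L r q) = a r q" if "a\<in>derivations L" "q\<in>pts (base L)" "r\<in>sections L" for a q r
  by (rule jet_linear_at[OF L that])
 have off: "?l a z = 0" "?p s z = 0" if "z \<notin> pts (JM L)" for a s z
  using that by (auto simp: jet_linear_section_def jet_pull_section_def restrict0_def)
 show "br g h = (%x. - br h g x)" if g: "g\<in>jet_gens L" and h: "h\<in>jet_gens L" for g h
 proof -
  consider a b where "a\<in>derivations L" "b\<in>derivations L" "g = ?l a" "h = ?l b"
   | a s where "a\<in>derivations L" "s\<in>sections L" "g = ?l a" "h = ?p s"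
   | a s where "a\<in>derivations L" "s\<in>sections L" "g = ?p s" "h = ?l a"
   | s r where "s\<in>sections L" "r\<in>sections L" "g = ?p s" "h = ?p r" using g h by (auto simp: jet_gens_def)
  thus ?thesis
  proof cases
   case 1
   have "?l (commutator a b) z = - ?l (commutator b a) z" for z
   proof (cases "z\<in>pts (JM L)")
    case True
    obtain q r where q: "z = (q, jet L r q)" "q\<in>pts (base L)" "r\<in>sections L" using jet_pt_obtain[OF L True] .
    show ?thesis by (simp add: q(1) lat[OF c q(2,3)] 1) (simp add: commutator_def)
   qed (simp add: off)
   thus ?thesis unfolding 1(3,4) ll[OF 1(1,2)] ll[OF 1(2,1)] by (rule ext)
  qed (simp_all add: lp pl pp jet_pi_minus)
 qed
 have lll: "br (?l a) (br (?l b) (?l d)) x + br (?l b) (br (?l d) (?l a)) x + br (?l d) (br (?l a) (?l b)) x = 0"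
  if a: "a\<in>derivations L" and b: "b\<in>derivations L" and d: "d\<in>derivations L" for a b d x
 proof (cases "x\<in>pts (JM L)")
  case True
  obtain q r where q: "x = (q, jet L r q)" "q\<in>pts (base L)" "r\<in>sections L" using jet_pt_obtain[OF L True] .
  have e: "?l (commutator a' (commutator b' d')) x = a' (b' (d' r)) q - a' (d' (b' r)) q - (b' (d' (a' r)) q - d' (b' (a' r)) q)"
   if a': "a'\<in>derivations L" and b': "b'\<in>derivations L" and d': "d'\<in>derivations L" for a' b' d'
  proof -
   have "?l (commutator a' (commutator b' d')) x = commutator a' (commutator b' d') r q" unfolding q(1) by (rule lat[OF c[OF a' c[OF b' d']] q(2,3)])
   also have "\<dots> = a' (%x. b' (d' r) x - d' (b' r) x) q - (b' (d' (a' r)) q - d' (b' (a' r)) q)" by (simp add: commutator_def)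
   finally show ?thesis by (simp add: ders_linear(3)[OF L a' D[OF b' D[OF d' q(3)]] D[OF d' D[OF b' q(3)]]])
  qed
  show ?thesis by (simp add: ll a b d c e)
 qed (simp add: ll a b d c off)
 have llp: "br (?l a) (br (?l b) (?p s)) x + br (?l b) (br (?p s) (?l a)) x + br (?p s) (br (?l a) (?l b)) x = 0"
  if a: "a\<in>derivations L" and b: "b\<in>derivations L" and s: "s\<in>sections L" for a b s x
  using ders_linear(4)[OF L b D[OF a s] D[OF a s]]
  by (simp add: lp pl ll a b s c D[OF a s] D[OF b s] mi) (simp add: jet_pull_section_def restrict0_def commutator_def split: prod.splits)
 have lpp: "br (?l a) (br (?p s) (?p r)) x + br (?p s) (br (?p r) (?l a)) x + br (?p r) (br (?l a) (?p s)) x = 0"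
  if a: "a\<in>derivations L" and s: "s\<in>sections L" "r\<in>sections L" for a s r x by (simp add: pp pl lp a s z0 gs[OF a s(1)] D[OF a] mi)
 have ppp: "br (?p s) (br (?p r) (?p t)) x = 0" if "s\<in>sections L" "r\<in>sections L" "t\<in>sections L" for s r t x
  using z0[OF jet_pull_in[OF L that(1)]] by (simp add: pp that)
 show "br g (br h k) x + br h (br k g) x + br k (br g h) x = 0"
  if "g\<in>jet_gens L" "h\<in>jet_gens L" "k\<in>jet_gens L" for g h k x
 proof -
  let ?A = "?l ` derivations L" and ?B = "?p ` sections L"
  define T where "T g h k = br g (br h k) x + br h (br k g) x + br k (br g h) x" for g h k
  \<comment> \<open>Rotation reduces the eight distributions of linear and basic arguments to
    four.\<close>
  have cyc: "T g h k = T h k g" for g h k by (simp add: T_def add.commute add.left_commute)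
  have AAA: "T g h k = 0" if "g\<in>?A" "h\<in>?A" "k\<in>?A" for g h k using that unfolding T_def by (elim imageE) (simp only: lll)
  have AAB: "T g h k = 0" if "g\<in>?A" "h\<in>?A" "k\<in>?B" for g h k using that unfolding T_def by (elim imageE) (simp only: llp)
  have ABB: "T g h k = 0" if "g\<in>?A" "h\<in>?B" "k\<in>?B" for g h k using that unfolding T_def by (elim imageE) (simp only: lpp)
  have BBB: "T g h k = 0" if "g\<in>?B" "h\<in>?B" "k\<in>?B" for g h k using that unfolding T_def by (elim imageE) (simp add: ppp)
  have "g\<in>?A | g\<in>?B" "h\<in>?A | h\<in>?B" "k\<in>?A | k\<in>?B" using that by (auto simp: jet_gens_def)
  hence "T g h k = 0" using AAA[of g h k] BBB[of g h k] AAB[of g h k] AAB[of h k g] AAB[of k g h] ABB[of g h k] ABB[of h k g] ABB[of k g h]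
    cyc[of g h k] cyc[of h k g] by argo
  thus ?thesis by (simp add: T_def)
 qed
qed

text \<open>Resolves the definite description: the glued bracket meets the specification, and a
  second candidate agrees with it on generators. The coordinate formula is kept because
  non-degeneracy and the product bracket are computed with it.\<close>

lemma canonical_bracket:
 assumes L: "line_bundle L"
 shows "jacobi (JL L) (canonical_bracket L)"
  "!!g h k. jet_gb L g h k ==> canonical_bracket L g h = k"
  "!!U ph V e s r z. jtriv L U ph V e ==> s\<in>sections (JL L) ==> r\<in>sections (JL L) ==>
   z\<in>triv.jU L U V ==> canonical_bracket L s r z = jtriv.canon_local L U ph V e s r z"
proof -
 obtain br where br: "biders (JL L) br" "\<forall>g h k. jet_gb L g h k --> br g h = k"
  "\<forall>U ph V e. jtriv L U ph V e --> (ALL s:sections (JL L). ALL r:sections (JL L).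
   ALL z:triv.jU L U V. br s r z = jtriv.canon_local L U ph V e s r z)" using canonical_bracket_ex[OF L] by blast
 have j: "jacobi (JL L) br" by (rule jacobi_jet_bracket[OF L br(1)]) (use br(2) in blast)
 have sp: "canon_spec L br" unfolding canon_spec_def by (intro conjI ballI br(2)[rule_format] jet_gb.intros)
 have "canonical_bracket L = br" unfolding canonical_bracket_def
 proof (rule the_equality, goal_cases)
  case 1 show ?case by (rule conjI[OF j sp[unfolded canon_spec_def]])
 next
  case (2 br')
  hence b': "jacobi (JL L) br'" "canon_spec L br'" unfolding canon_spec_def by (rule conjunct1, rule conjunct2)
  show ?case
  proof (rule biders_eq[OF jet_line_bundle[OF L] jet_spanning_gens[OF L] jacobiD(1)[OF jet_line_bundle[OF L] b'(1)] br(1)])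
   fix g h assume "g\<in>jet_gens L" "h\<in>jet_gens L"
   then obtain k where k: "jet_gb L g h k" using jet_gen_bracket_ex by blast
   show "br' g h = br g h" using canon_spec_gen[OF L b' k] br(2) k by simp
  qed
 qed
 note cb = this
 show "jacobi (JL L) (canonical_bracket L)" unfolding cb by (rule j)
 show "!!g h k. jet_gb L g h k ==> canonical_bracket L g h = k" unfolding cb by (rule br(2)[rule_format])
 show
  "!!U ph V e s r z. jtriv L U ph V e ==> s\<in>sections (JL L) ==> r\<in>sections (JL L) ==>
   z\<in>triv.jU L U V ==> canonical_bracket L s r z = jtriv.canon_local L U ph V e s r z" unfolding cb by (rule br(3)[rule_format])
qed

section \<open>Non-degeneracy\<close>

text \<open>The bracket at \<open>x\<close> is a derivation in its first argument too, so it depends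
  on \<open>s\<close> only through the jet; hence the definite description is well defined.\<close>

lemma Pi_sharp_jet:
 assumes L: "line_bundle L" and br: "biders L br" and x: "x\<in>pts (base L)" and s: "s\<in>sections L"
 shows "Pi_sharp L br x (jet L s x) = (%r. br s r x)" unfolding Pi_sharp_def
proof (rule the_equality)
 show "EX s':sections L. jet L s' x = jet L s x & (%r. br s r x) = (%r. br s' r x)" using s by blast
 fix a assume "EX s':sections L. jet L s' x = jet L s x & a = (%r. br s' r x)"
 then obtain t where t: "t\<in>sections L" "jet L t x = jet L s x" "a = (%r. br t r x)" by blast
 have "br t r x = br s r x" for r
 proof (cases "r\<in>sections L")
  case True
  note D = bidersD(5)[OF br True x]
  have "jet L t x (%s. br s r x) = jet L s x (%s. br s r x)" by (simp only: t(2))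
  thus ?thesis using D by (simp add: jet_def restrict0_def)
 qed (use bidersD(1)[OF br] in simp)
 thus "a = (%r. br s r x)" using t(3) by simp
qed

lemma nondegenerateI:
 assumes L: "line_bundle L" and br: "biders L br"
  and inj: "!!x s t. x\<in>pts (base L) ==> s\<in>sections L ==> t\<in>sections L ==> ALL r:sections L. br s r x = br t r x ==> jet L s x = jet L t x"
  and surj: "!!x a. x\<in>pts (base L) ==> a\<in>Der L x ==> EX s:sections L. a = (%r. br s r x)"
 shows "nondegenerate L br" unfolding nondegenerate_def bij_betw_def
proof (intro ballI conjI)
 fix x assume x: "x\<in>pts (base L)"
 note J = Jet_eq[OF L x] and P = Pi_sharp_jet[OF L br x]
 show "inj_on (Pi_sharp L br x) (Jet L x)" unfolding J
 proof (intro inj_onI, elim imageE, goal_cases)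
  case (1 al be s t)
  have "(%r. br s r x) = (%r. br t r x)" using 1(1) unfolding 1(2,4) P[OF 1(3)] P[OF 1(5)] .
  hence "jet L s x = jet L t x" using inj[OF x 1(3,5)] by meson
  thus ?case using 1(2,4) by (simp only:)
 qed
 show "Pi_sharp L br x ` Jet L x = Der L x" unfolding J
 proof (intro equalityI subsetI, goal_cases)
  case (1 a)
  then obtain s where s: "s\<in>sections L" "a = Pi_sharp L br x (jet L s x)" by blast
  thus ?case unfolding s(2) P[OF s(1)] by (intro bidersD(4)[OF br s(1) x])
 next
  case (2 a)
  then obtain s where s: "s\<in>sections L" "a = (%r. br s r x)" using surj[OF x 2] by blast
  show ?case unfolding s(2) P[OF s(1), symmetric] using s(1) by (intro imageI)
 qed
qed

lemma canonical_Der: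
 assumes L: "line_bundle L" and z: "z\<in>pts (JM L)" and a: "a\<in>Der (JL L) z"
 shows "EX s:sections (JL L). a = (%r. canonical_bracket L s r z)"
proof -
 let ?J = "JL L"
 obtain U ph V e where t: "jtriv L U ph V e" "z\<in>triv.jU L U V" using jet_pt_jtriv[OF L z] .
 interpret jtriv L U ph V e by fact
 have zd: "z\<in>J.dm" using t(2) J_dm by simp
 obtain W where W: "a = J.der W z" using J.Der_der[OF zd a] by blast
 define F where "F = (fst (fst W), snd W)"
 \<comment> \<open>The solution of \<open>canon_form (jph z) f g = W \<bullet> g\<close> for all
   \<open>g\<close>, found by comparing the coefficients of the components of
   \<open>g\<close>.\<close>
 define f where "f = ((- fst (snd (fst W)) - snd W *\<^sub>R fst (snd (jph z)), F),
  snd (jph z)\<bullet>F - snd W * snd (snd (jph z)) - snd (snd (fst W)))"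
 obtain s where s: "s\<in>sections ?J" "J.jr s z = f" using J.jr_obtain[OF zd] .
 have form: "canon_form (jph z) f g = W\<bullet>g" for g
  by (simp add: canon_form_def f_def F_def inner_prod_def inner_diff_left inner_add_left inner_commute algebra_simps)
 note bd = jacobiD(1)[OF jet_line_bundle[OF L] canonical_bracket(1)[OF L]]
 have "a r = canonical_bracket L s r z" for r
 proof (cases "r\<in>sections ?J")
  case True
  thus ?thesis using canonical_bracket(3)[OF L t(1) s(1) True t(2)] by (simp add: s(2) form W J.der_sec)
 next
  case False
  thus ?thesis using DerD(1)[OF a] bidersD(1)[OF bd] by simp
 qed
 thus ?thesis using s(1) by blast
qed

lemma canonical_contact:
 assumes L: "line_bundle L" shows "contact_object (JL L) (canonical_bracket L)" unfolding contact_object_def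
proof (intro conjI jet_line_bundle[OF L] canonical_bracket(1)[OF L])
 let ?J = "JL L"
 note bd = jacobiD(1)[OF jet_line_bundle[OF L] canonical_bracket(1)[OF L]]
 show "nondegenerate ?J (canonical_bracket L)"
 proof (rule nondegenerateI[OF jet_line_bundle[OF L] bd])
  fix z s t assume z: "z\<in>pts (base ?J)" and s: "s\<in>sections ?J" "t\<in>sections ?J"
   and eq: "ALL r:sections ?J. canonical_bracket L s r z = canonical_bracket L t r z"
  have "z\<in>pts (JM L)" using z by simp
  then obtain U ph V e where tr: "jtriv L U ph V e" "z\<in>triv.jU L U V" by (rule jet_pt_jtriv[OF L])
  interpret jtriv L U ph V e by fact
  have zd: "z\<in>J.dm" using tr(2) J_dm by simp
  have c: "canon_form (jph z) (J.jr s z) g = canon_form (jph z) (J.jr t z) g" for g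
  proof -
   obtain r where r: "r\<in>sections ?J" "J.jr r z = g" using J.jr_obtain[OF zd] .
   show ?thesis using eq r(1) canonical_bracket(3)[OF L tr(1) s(1) r(1) tr(2)] canonical_bracket(3)[OF L tr(1) s(2) r(1) tr(2)] J.e_nz[OF zd]
    by (simp add: r(2))
  qed
  let ?f = "J.jr s z" and ?g = "J.jr t z"
  \<comment> \<open>Test jets with a single nonzero component isolate the components of
    \<open>?f\<close> one after the other, each step using those already known.\<close>
  have 1: "fst (snd (fst ?f)) = fst (snd (fst ?g))"
  proof (rule onb_eqI)
   fix b
   show "fst (snd (fst ?f))\<bullet>b = fst (snd (fst ?g))\<bullet>b" using c[of "((b, 0), 0)"] by (simp add: canon_form_def)
  qed
  have 2: "snd (snd (fst ?f)) = snd (snd (fst ?g))" using c[of "(0, 1)"] by (simp add: canon_form_def)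
  have 3: "fst (fst ?f) = fst (fst ?g)"
  proof (rule onb_eqI)
   fix b
   show "fst (fst ?f)\<bullet>b = fst (fst ?g)\<bullet>b" using c[of "((0, (b, 0)), 0)"] 2 by (simp add: canon_form_def inner_prod_def)
  qed
  have 4: "snd ?f = snd ?g" using c[of "((0, (0, 1)), 0)"] 1 2 by (simp add: canon_form_def inner_prod_def)
  have "?f = ?g" using 1 2 3 4 by (simp only: prod_eq_iff)
  thus "jet ?J s z = jet ?J t z" using J.jet_eq_iff[OF zd s] by simp
 next
  fix z a assume "z\<in>pts (base ?J)" "a\<in>Der ?J z"
  thus "EX s:sections ?J. a = (%r. canonical_bracket L s r z)" using canonical_Der[OF L] by simp
 qed
qed

lemma (in triv) coord_linear:
 assumes "x\<in>dm" "u\<in>fibre L x" "v\<in>fibre L x"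
 shows "coord (e x) (u + v) = coord (e x) u + coord (e x) v" "coord (e x) (c *\<^sub>R u) = c * coord (e x) u"
proof -
 have "u + v = (coord (e x) u + coord (e x) v) *\<^sub>R e x" "c *\<^sub>R u = (c * coord (e x) u) *\<^sub>R e x"
  using fibre_coord[OF assms(1,2)] fibre_coord[OF assms(1,3)] by (simp_all add: scaleR_add_left flip: scaleR_scaleR)
 thus "coord (e x) (u + v) = coord (e x) u + coord (e x) v" "coord (e x) (c *\<^sub>R u) = c * coord (e x) u"
  using coord_scale[OF e_nz[OF assms(1)]] by simp_all
qed

section \<open>The line product and its bracket\<close>

locale prod_triv =
 t1: triv L1 U1 ph1 V1 e1 + t2: triv L2 U2 ph2 V2 e2
 for L1 :: "('m, 'e::findim, 'l::real_vector) line_bundle" and U1 ph1 V1 e1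
  and L2 :: "('n, 'f::findim, 'k::real_vector) line_bundle" and U2 ph2 V2 e2
begin

definition pU :: "('m \<times> 'n \<times> ('l => 'k)) set" where
 "pU = {(x, y, C). x\<in>t1.dm & y\<in>t2.dm & zero_off (fibre L1 x) C & linear_iso_on (fibre L1 x) (fibre L2 y) C}"

definition pph :: "'m \<times> 'n \<times> ('l => 'k) => 'e \<times> 'f \<times> real" where
 "pph = (%(x, y, C). (ph1 x, ph2 y, coord (e2 y) (C (e1 x))))"

text \<open>Inverse of the chart: the isomorphism with matrix entry \<open>c\<close>. It is cut off
  to 0 outside the fibre, as the encoding of points of the base product demands.\<close>

definition pmk :: "'m => 'n => real => 'm \<times> 'n \<times> ('l => 'k)" where
 "pmk x y c = (x, y, restrict0 (fibre L1 x) (%l. (coord (e1 x) l * c) *\<^sub>R e2 y))"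

lemma pmk_pU:
 assumes x: "x\<in>t1.dm" and y: "y\<in>t2.dm" and c: "c ~= 0"
 shows "pmk x y c\<in>pU" "pph (pmk x y c) = (ph1 x, ph2 y, c)"
proof -
 let ?C = "restrict0 (fibre L1 x) (%l. (coord (e1 x) l * c) *\<^sub>R e2 y)"
 note F = lbD(3)[OF t1.L t1.dm_pts[OF x]]
 have b: "bij_betw ?C (fibre L1 x) (fibre L2 y)"
 proof (rule bij_betw_byWitness[where f' = "%l. (coord (e2 y) l / c) *\<^sub>R e1 x"])
  show "ALL a:fibre L1 x. (coord (e2 y) (?C a) / c) *\<^sub>R e1 x = a"
   using c t1.fibre_coord[OF x] by (simp add: restrict0_def coord_scale[OF t2.e_nz[OF y]])
  show "ALL a:fibre L2 y. ?C ((coord (e2 y) a / c) *\<^sub>R e1 x) = a"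
   using c t2.fibre_coord[OF y] t1.fibre_scale[OF x] by (simp add: restrict0_def coord_scale[OF t1.e_nz[OF x]])
  show "?C ` fibre L1 x \<subseteq> fibre L2 y" using t2.fibre_scale[OF y] by (auto simp: restrict0_def)
  show "(%l. (coord (e2 y) l / c) *\<^sub>R e1 x) ` fibre L2 y \<subseteq> fibre L1 x" using t1.fibre_scale[OF x] by auto
 qed
 have "linear_iso_on (fibre L1 x) (fibre L2 y) ?C" unfolding linear_iso_on_def
 proof (intro conjI ballI allI b)
  fix u v assume uv: "u\<in>fibre L1 x" "v\<in>fibre L1 x"
  show "?C (u + v) = ?C u + ?C v" using uv subspace_add[OF F uv] by (simp add: restrict0_def t1.coord_linear[OF x uv] algebra_simps)
 next
  fix k u assume u: "u\<in>fibre L1 x"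
  show "?C (k *\<^sub>R u) = k *\<^sub>R ?C u" using u subspace_scale[OF F u] by (simp add: restrict0_def t1.coord_linear(2)[OF x u u])
 qed
 thus "pmk x y c\<in>pU" using x y by (simp add: pU_def pmk_def zero_off_def restrict0_def)
 show "pph (pmk x y c) = (ph1 x, ph2 y, c)" using t1.e_fib[OF x] by (simp add: pph_def pmk_def restrict0_def t1.e_nz[OF x] t2.e_nz[OF y])
qed

lemma pU_pmk:
 assumes z: "(x, y, C)\<in>pU"
 shows "C (e1 x) = coord (e2 y) (C (e1 x)) *\<^sub>R e2 y" "coord (e2 y) (C (e1 x)) ~= 0"
  "(x, y, C) = pmk x y (coord (e2 y) (C (e1 x)))"
proof -
 have D: "x\<in>t1.dm" "y\<in>t2.dm" "zero_off (fibre L1 x) C" "linear_iso_on (fibre L1 x) (fibre L2 y) C" using z by (auto simp: pU_def)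
 note C = lin_isoD[OF D(4)]
 show e: "C (e1 x) = coord (e2 y) (C (e1 x)) *\<^sub>R e2 y" by (rule t2.fibre_coord[OF D(2) C(1)[OF t1.e_fib[OF D(1)]], symmetric])
 have e0: "C 0 = 0" using C(6)[OF t1.e_fib[OF D(1)], of 0] by simp
 show "coord (e2 y) (C (e1 x)) ~= 0"
 proof
  assume "coord (e2 y) (C (e1 x)) = 0"
  hence "C (e1 x) = 0" using e by simp
  hence "e1 x = 0" using C(2)[OF t1.e_fib[OF D(1)]] C(2)[OF subspace_0[OF lbD(3)[OF t1.L t1.dm_pts[OF D(1)]]]] e0 by simp
  thus False using t1.e_nz[OF D(1)] by simp
 qed
 have "C l = restrict0 (fibre L1 x) (%l. (coord (e1 x) l * coord (e2 y) (C (e1 x))) *\<^sub>R e2 y) l" for l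
 proof (cases "l\<in>fibre L1 x")
  case True
  have "C l = coord (e1 x) l *\<^sub>R C (e1 x)" using C(6)[OF t1.e_fib[OF D(1)], of "coord (e1 x) l"] t1.fibre_coord[OF D(1) True] by simp
  also have "\<dots> = coord (e1 x) l *\<^sub>R coord (e2 y) (C (e1 x)) *\<^sub>R e2 y" using e by (rule arg_cong)
  finally show ?thesis using True by (simp add: restrict0_def)
 qed (use D(3) in \<open>simp add: zero_off_def restrict0_def\<close>)
 hence "C = restrict0 (fibre L1 x) (%l. (coord (e1 x) l * coord (e2 y) (C (e1 x))) *\<^sub>R e2 y)" by (rule ext)
 thus "(x, y, C) = pmk x y (coord (e2 y) (C (e1 x)))" unfolding pmk_def by (rule arg_cong[of _ _ "%C'. (x, y, C')"])
qed

lemma pU_obtain: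
 assumes "z\<in>pU"
 obtains x y c where "x\<in>t1.dm" "y\<in>t2.dm" "c ~= 0" "z = pmk x y c" "pph z = (ph1 x, ph2 y, c)"
proof -
 obtain x y C where z: "z = (x, y, C)" by (cases z)
 note P = pU_pmk[OF assms[unfolded z]]
 have d: "x\<in>t1.dm" "y\<in>t2.dm" using assms z by (auto simp: pU_def)
 have "pph z = (ph1 x, ph2 y, coord (e2 y) (C (e1 x)))" by (simp add: z pph_def)
 thus thesis by (rule that[OF d P(2) P(3)[folded z]])
qed

lemma pmk_fst[simp]: "fst (pmk x y c) = x" "fst (snd (pmk x y c)) = y" by (simp_all add: pmk_def)

lemma pph_inj: "inj_on pph pU"
proof (rule inj_onI)
 fix z w assume z: "z\<in>pU" and w: "w\<in>pU" and eq: "pph z = pph w"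
 obtain x y c where 1: "x\<in>t1.dm" "y\<in>t2.dm" "z = pmk x y c" "c ~= 0" "pph z = (ph1 x, ph2 y, c)" by (rule pU_obtain[OF z])
 obtain x' y' c' where 2: "x'\<in>t1.dm" "y'\<in>t2.dm" "w = pmk x' y' c'" "c' ~= 0" "pph w = (ph1 x', ph2 y', c')" by (rule pU_obtain[OF w])
 have *: "ph1 x = ph1 x'" "ph2 y = ph2 y'" "c = c'" using eq unfolding 1(5) 2(5) by simp_all
 have "x = x'" using t1.pt_phi[OF 1(1)] unfolding *(1) t1.pt_phi[OF 2(1)] by (rule sym)
 moreover have "y = y'" using t2.pt_phi[OF 1(2)] unfolding *(2) t2.pt_phi[OF 2(2)] by (rule sym)
 ultimately show "z = w" using 1(3) 2(3) *(3) by simp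
qed

lemma pph_img:
 assumes "W1 \<subseteq> t1.dm" "W2 \<subseteq> t2.dm"
 shows "pph ` (pU Int {z. fst z\<in>W1 & fst (snd z)\<in>W2}) = ph1 ` W1 \<times> ph2 ` W2 \<times> - {0}"
proof (intro equalityI subsetI)
 fix w assume "w\<in>pph ` (pU Int {z. fst z\<in>W1 & fst (snd z)\<in>W2})"
 then obtain z where z: "z\<in>pU" "fst z\<in>W1" "fst (snd z)\<in>W2" "w = pph z" by blast
 obtain x y c where 1: "x\<in>t1.dm" "y\<in>t2.dm" "z = pmk x y c" "c ~= 0" "pph z = (ph1 x, ph2 y, c)" by (rule pU_obtain[OF z(1)])
 show "w\<in>ph1 ` W1 \<times> ph2 ` W2 \<times> - {0}" using z(2,3) 1(4) unfolding z(4) 1(5) unfolding 1(3) by simp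
next
 fix w assume "w\<in>ph1 ` W1 \<times> ph2 ` W2 \<times> - {0::real}"
 then obtain x y c where *: "w = (ph1 x, ph2 y, c)" "x\<in>W1" "y\<in>W2" "c ~= 0" by auto
 note P = pmk_pU[OF subsetD[OF assms(1) *(2)] subsetD[OF assms(2) *(3)] *(4)]
 show "w\<in>pph ` (pU Int {z. fst z\<in>W1 & fst (snd z)\<in>W2})" by (rule image_eqI[of _ _ "pmk x y c"]) (use P * in simp_all)
qed

lemma pU_fst: "z\<in>pU ==> fst z\<in>t1.dm" "z\<in>pU ==> fst (snd z)\<in>t2.dm" by (auto simp: pU_def)

end

text \<open>The base coordinates change by \<open>ftau\<close> of the two identity factors; the
  matrix entry is multiplied by \<open>fH\<close> on the source side and divided by
  \<open>fH\<close> on the target side.\<close>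

lemma prod_trans_smooth:
 fixes L1 :: "('m, 'e::findim, 'l::real_vector) line_bundle" and L2 :: "('n, 'f::findim, 'k::real_vector) line_bundle"
 assumes 1: "prod_triv L1 U1 ph1 V1 e1 L2 U2 ph2 V2 e2" and 2: "prod_triv L1 U1' ph1' V1' e1' L2 U2' ph2' V2' e2'"
 defines "W \<equiv> prod_triv.pU L1 U1 V1 L2 U2 V2" and "W' \<equiv> prod_triv.pU L1 U1' V1' L2 U2' V2'"
  and "ps \<equiv> prod_triv.pph ph1 e1 ph2 e2" and "ps' \<equiv> prod_triv.pph ph1' e1' ph2' e2'"
 shows "open (ps ` (W Int W'))" "smooth_on (ps ` (W Int W')) (%y. ps' (inv_into W ps y))"
proof -
 interpret p: prod_triv L1 U1 ph1 V1 e1 L2 U2 ph2 V2 e2 by fact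
 interpret p': prod_triv L1 U1' ph1' V1' e1' L2 U2' ph2' V2' e2' by fact
 interpret f1: factor_triv L1 U1 ph1 V1 e1 L1 U1' ph1' V1' e1' id_factor by unfold_locales (rule id_factor_factor[OF p.t1.L])
 interpret f2: factor_triv L2 U2 ph2 V2 e2 L2 U2' ph2' V2' e2' id_factor by unfold_locales (rule id_factor_factor[OF p.t2.L])
 have eqs: "W = p.pU" "W' = p'.pU" "ps = p.pph" "ps' = p'.pph" by (simp_all add: assms)
 have fd: "f1.fdom = p.t1.dm Int p'.t1.dm" "f2.fdom = p.t2.dm Int p'.t2.dm" by (simp_all only: f1.fdom_def f2.fdom_def) (auto simp: id_factor_def)
 let ?O = "ph1 ` f1.fdom \<times> ph2 ` f2.fdom \<times> - {0::real}"
 have int: "W Int W' = p.pU Int {z. fst z\<in>f1.fdom & fst (snd z)\<in>f2.fdom}" unfolding eqs fd by (auto simp: p.pU_def p'.pU_def)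
 have img: "ps ` (W Int W') = ?O" unfolding int eqs(3) by (rule p.pph_img) (use fd in auto)
 have o1: "open (ph1 ` f1.fdom)" and o2: "open (ph2 ` f2.fdom)" by (rule f1.open_fimg, rule f2.open_fimg)
 have o: "open ?O" using o1 o2 by (intro open_Times) auto
 show "open (ps ` (W Int W'))" unfolding img by (rule o)
 note id = smooth_ident[of ?O]
 have s1: "smooth_on ?O (%y. f1.ftau (fst y))" "smooth_on ?O (%y. f1.fH (fst y))"
  by (rule smooth_comp[OF o o1 smooth_on_fst[OF o id] _ f1.ftau_smooth] smooth_comp[OF o o1 smooth_on_fst[OF o id] _ f1.fH_smooth]; auto)+
 have s2: "smooth_on ?O (%y. f2.ftau (fst (snd y)))" "smooth_on ?O (%y. f2.fH (fst (snd y)))"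
  by (rule smooth_comp[OF o o2 smooth_on_fst[OF o smooth_on_snd[OF o id]] _ f2.ftau_smooth] smooth_comp[OF o o2 smooth_on_fst[OF o smooth_on_snd[OF o id]] _ f2.fH_smooth]; auto)+
 have nz: "f2.fH (fst (snd y)) ~= 0" if "y\<in>?O" for y using that f2.fH_nz by auto
 have "smooth_on ?O (%y. (f1.ftau (fst y), f2.ftau (fst (snd y)), f1.fH (fst y) * snd (snd y) / f2.fH (fst (snd y))))"
  by (intro smooth_Pair[OF o] s1(1) s2(1) smooth_divide[OF o] smooth_on_mult[OF o] s1(2) s2(2) smooth_on_snd[OF o] id nz)
 thus "smooth_on (ps ` (W Int W')) (%y. ps' (inv_into W ps y))" unfolding img
 proof (rule smooth_cong[OF _ o])
  fix w assume "w\<in>?O"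
  hence "w\<in>ps ` (W Int W')" using img by simp
  then obtain z where z: "z\<in>p.pU" "z\<in>p'.pU" "w = p.pph z" unfolding eqs by blast
  obtain x y C where zz: "z = (x, y, C)" by (cases z)
  have d: "x\<in>f1.fdom" "y\<in>f2.fdom" "x\<in>p.t1.dm" "linear_iso_on (fibre L1 x) (fibre L2 y) C" "y\<in>p'.t2.dm"
   using z(1,2) zz by (auto simp: p.pU_def p'.pU_def fd)
  let ?c = "coord (e2 y) (C (e1 x))"
  have w: "w = (ph1 x, ph2 y, ?c)" using z(3) zz by (simp add: p.pph_def)
  have e1: "e1' x = f1.fH (ph1 x) *\<^sub>R e1 x" using f1.B_fH[OF d(1)] by (simp add: id_factor_def)
  have e2: "e2' y = f2.fH (ph2 y) *\<^sub>R e2 y" using f2.B_fH[OF d(2)] by (simp add: id_factor_def)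
  have "C (e1' x) = f1.fH (ph1 x) *\<^sub>R C (e1 x)" unfolding e1 by (rule lin_isoD(6)[OF d(4) p.t1.e_fib[OF d(3)]])
  also have "\<dots> = f1.fH (ph1 x) *\<^sub>R ?c *\<^sub>R e2 y" using p.pU_pmk(1)[OF z(1)[unfolded zz]] by (rule arg_cong)
  also have "\<dots> = (f1.fH (ph1 x) * ?c / f2.fH (ph2 y)) *\<^sub>R e2' y" unfolding e2 using f2.fH_nz[OF d(2)] by simp
  finally have "coord (e2' y) (C (e1' x)) = f1.fH (ph1 x) * ?c / f2.fH (ph2 y)" using coord_scale[OF p'.t2.e_nz[OF d(5)]] by simp
  hence "p'.pph z = (f1.ftau (fst w), f2.ftau (fst (snd w)), f1.fH (fst w) * snd (snd w) / f2.fH (fst (snd w)))"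
   using f1.ftau_phi[OF d(1)] f2.ftau_phi[OF d(2)] by (simp add: zz p'.pph_def w id_factor_def)
  moreover have "inv_into W ps w = z" unfolding eqs z(3) by (rule inv_into_f_f[OF p.pph_inj z(1)])
  ultimately show "(f1.ftau (fst w), f2.ftau (fst (snd w)), f1.fH (fst w) * snd (snd w) / f2.fH (fst (snd w))) = ps' (inv_into W ps w)"
   unfolding eqs(4) by simp
 qed
qed

section \<open>The base product as a manifold with a line bundle\<close>

lemma bp_simps:
 "pts (base_product L1 L2) = {(x, y, C). x\<in>pts (base L1) & y\<in>pts (base L2) \<and>
  zero_off (fibre L1 x) C & linear_iso_on (fibre L1 x) (fibre L2 y) C}"
 "charts (base_product L1 L2) = {(pts (base_product L1 L2) Int {(x1, x2, C). x1\<in>U1 Int V1 & x2\<in>U2 Int V2},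
   %(x1, x2, C). (ph1 x1, ph2 x2, coord (e2 x2) (C (e1 x1)))) | U1 ph1 V1 e1 U2 ph2 V2 e2.
  (U1, ph1)\<in>charts (base L1) & (V1, e1)\<in>frames L1 & (U2, ph2)\<in>charts (base L2) & (V2, e2)\<in>frames L2}"
 by (simp_all add: base_product_def Let_def)

lemma (in prod_triv) pU_eq: "pU = pts (base_product L1 L2) Int {(x1, x2, C). x1\<in>U1 Int V1 & x2\<in>U2 Int V2}"
 using t1.dm_pts t2.dm_pts by (auto simp: pU_def bp_simps(1) t1.dm_def t2.dm_def)

lemma (in prod_triv) prod_chart_in: "(pU, pph)\<in>charts (base_product L1 L2)"
 unfolding bp_simps(2) pU_eq pph_def using t1.ch t1.fr t2.ch t2.fr by blast

lemma (in prod_triv) pU_pts: "pU \<subseteq> pts (base_product L1 L2)" unfolding pU_eq by blast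

lemma prod_chart_obtain:
 assumes "line_bundle L1" "line_bundle L2" "(W, ps)\<in>charts (base_product L1 L2)"
 obtains U1 ph1 V1 e1 U2 ph2 V2 e2 where "prod_triv L1 U1 ph1 V1 e1 L2 U2 ph2 V2 e2"
  "W = prod_triv.pU L1 U1 V1 L2 U2 V2" "ps = prod_triv.pph ph1 e1 ph2 e2"
proof -
 obtain U1 ph1 V1 e1 U2 ph2 V2 e2 where *:
  "W = pts (base_product L1 L2) Int {(x1, x2, C). x1\<in>U1 Int V1 & x2\<in>U2 Int V2}"
  "ps = (%(x1, x2, C). (ph1 x1, ph2 x2, coord (e2 x2) (C (e1 x1))))"
  "(U1, ph1)\<in>charts (base L1)" "(V1, e1)\<in>frames L1" "(U2, ph2)\<in>charts (base L2)" "(V2, e2)\<in>frames L2"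
  using assms(3) unfolding bp_simps(2) by blast
 have t: "prod_triv L1 U1 ph1 V1 e1 L2 U2 ph2 V2 e2" using * assms(1,2) by (simp add: prod_triv_def triv_def)
 show thesis by (rule that[OF t]) (simp_all only: prod_triv.pU_eq[OF t] prod_triv.pph_def[OF t] *(1,2))
qed

lemma bp_pt:
 assumes "line_bundle L1" "line_bundle L2" "z\<in>pts (base_product L1 L2)"
 obtains U1 ph1 V1 e1 U2 ph2 V2 e2 where "prod_triv L1 U1 ph1 V1 e1 L2 U2 ph2 V2 e2"
  "z\<in>prod_triv.pU L1 U1 V1 L2 U2 V2"
proof -
 have p: "fst z\<in>pts (base L1)" "fst (snd z)\<in>pts (base L2)" using assms(3) by (auto simp: bp_simps)
 obtain U1 ph1 V1 e1 where 1: "triv L1 U1 ph1 V1 e1" "fst z\<in>U1 Int V1" using triv_obtain[OF assms(1) p(1)] .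
 obtain U2 ph2 V2 e2 where 2: "triv L2 U2 ph2 V2 e2" "fst (snd z)\<in>U2 Int V2" using triv_obtain[OF assms(2) p(2)] .
 have t: "prod_triv L1 U1 ph1 V1 e1 L2 U2 ph2 V2 e2" using 1 2 by (simp add: prod_triv_def)
 show thesis by (rule that[OF t]) (use 1 2 assms(3) in \<open>auto simp: prod_triv.pU_eq[OF t]\<close>)
qed

context
 fixes L1 :: "('m, 'e::findim, 'l::real_vector) line_bundle" and L2 :: "('n, 'f::findim, 'k::real_vector) line_bundle"
 assumes L1: "line_bundle L1" and L2: "line_bundle L2"
begin

lemma bp_atlas: "atlas (base_product L1 L2)" unfolding atlas_def
proof (intro conjI ballI)
 fix c assume "c\<in>charts (base_product L1 L2)"
 then obtain W ps where c: "c = (W, ps)" "(W, ps)\<in>charts (base_product L1 L2)" by (cases c) auto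
 obtain U1 ph1 V1 e1 U2 ph2 V2 e2 where t: "prod_triv L1 U1 ph1 V1 e1 L2 U2 ph2 V2 e2"
  "W = prod_triv.pU L1 U1 V1 L2 U2 V2" "ps = prod_triv.pph ph1 e1 ph2 e2" using prod_chart_obtain[OF L1 L2 c(2)] .
 interpret t: prod_triv L1 U1 ph1 V1 e1 L2 U2 ph2 V2 e2 by fact
 have "open (t.pph ` t.pU)" using prod_trans_smooth(1)[OF t(1) t(1)] by simp
 moreover have "compatible c d" if d: "d\<in>charts (base_product L1 L2)" for d
 proof -
  obtain W' ps' where d: "d = (W', ps')" "(W', ps')\<in>charts (base_product L1 L2)" using d by (cases d) auto
  obtain U1' ph1' V1' e1' U2' ph2' V2' e2' where t': "prod_triv L1 U1' ph1' V1' e1' L2 U2' ph2' V2' e2'"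
   "W' = prod_triv.pU L1 U1' V1' L2 U2' V2'" "ps' = prod_triv.pph ph1' e1' ph2' e2'" using prod_chart_obtain[OF L1 L2 d(2)] .
  show ?thesis unfolding c d t(2,3) t'(2,3) compatible_def o_def
   using prod_trans_smooth[OF t(1) t'(1)] prod_trans_smooth[OF t'(1) t(1)] by (simp add: Int_commute)
 qed
 ultimately show "smooth_chart (base_product L1 L2) c" unfolding c t(2,3) smooth_chart_def using t.pU_pts t.pph_inj by simp
next
 show "pts (base_product L1 L2) = (\<Union>(U, ph)\<in>charts (base_product L1 L2). U)"
 proof (intro equalityI subsetI)
  fix z assume z: "z\<in>pts (base_product L1 L2)"
  obtain U1 ph1 V1 e1 U2 ph2 V2 e2 where t: "prod_triv L1 U1 ph1 V1 e1 L2 U2 ph2 V2 e2"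
   "z\<in>prod_triv.pU L1 U1 V1 L2 U2 V2" using bp_pt[OF L1 L2 z] .
  thus "z\<in>(\<Union>(U, ph)\<in>charts (base_product L1 L2). U)" using prod_triv.prod_chart_in[OF t(1)] by blast
 next
  fix z assume "z\<in>(\<Union>(U, ph)\<in>charts (base_product L1 L2). U)"
  thus "z\<in>pts (base_product L1 L2)" unfolding bp_simps(2) by auto
 qed
qed

lemma bp_proj1: "smooth_map (base_product L1 L2) (base L1) fst"
proof (rule smooth_mapI[OF bp_atlas lbD(2)[OF L1]])
 show "fst z\<in>pts (base L1)" if "z\<in>pts (base_product L1 L2)" for z using that by (auto simp: bp_simps)
 fix z assume z: "z\<in>pts (base_product L1 L2)"
 obtain U1 ph1 V1 e1 U2 ph2 V2 e2 where t: "prod_triv L1 U1 ph1 V1 e1 L2 U2 ph2 V2 e2"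
  "z\<in>prod_triv.pU L1 U1 V1 L2 U2 V2" using bp_pt[OF L1 L2 z] .
 interpret t: prod_triv L1 U1 ph1 V1 e1 L2 U2 ph2 V2 e2 by fact
 have 1: "openin (mtop (base_product L1 L2)) t.pU"
  by (rule chart_dom[OF bp_atlas atlas_ch[OF bp_atlas t.prod_chart_in]])
 have 2: "fst ` t.pU \<subseteq> U1" using t.pU_fst by (auto simp: t.t1.dm_def)
 have 3: "smooth_on UNIV (fst :: 'e \<times> 'f \<times> real => 'e)" by (rule smooth_linear[OF bounded_linear_fst])
 have 4: "ALL z:t.pU. t.pph z\<in>UNIV & ph1 (fst z) = fst (t.pph z)" by (auto simp: t.pph_def)
 show "\<exists>U ph V ps T S h. (U, ph)\<in>charts (base_product L1 L2) & (V, ps)\<in>charts (base L1) & openin (mtop (base_product L1 L2)) T \<and>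
   z\<in>T & T \<subseteq> U & fst ` T \<subseteq> V & open S & smooth_on S h & (ALL z:T. ph z\<in>S & ps (fst z) = h (ph z))"
  by (intro exI conjI) (fact t.prod_chart_in t.t1.ch 1 t(2) subset_refl 2 open_UNIV 3 4)+
qed

lemma bp_proj2: "smooth_map (base_product L1 L2) (base L2) (%z. fst (snd z))"
proof (rule smooth_mapI[OF bp_atlas lbD(2)[OF L2]])
 show "fst (snd z)\<in>pts (base L2)" if "z\<in>pts (base_product L1 L2)" for z using that by (auto simp: bp_simps)
 fix z assume z: "z\<in>pts (base_product L1 L2)"
 obtain U1 ph1 V1 e1 U2 ph2 V2 e2 where t: "prod_triv L1 U1 ph1 V1 e1 L2 U2 ph2 V2 e2"
  "z\<in>prod_triv.pU L1 U1 V1 L2 U2 V2" using bp_pt[OF L1 L2 z] .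
 interpret t: prod_triv L1 U1 ph1 V1 e1 L2 U2 ph2 V2 e2 by fact
 have 1: "openin (mtop (base_product L1 L2)) t.pU"
  by (rule chart_dom[OF bp_atlas atlas_ch[OF bp_atlas t.prod_chart_in]])
 have 2: "(%z. fst (snd z)) ` t.pU \<subseteq> U2" using t.pU_fst by (auto simp: t.t2.dm_def)
 have 3: "smooth_on UNIV (%y :: 'e \<times> 'f \<times> real. fst (snd y))" by (intro smooth_intros open_UNIV)
 have 4: "ALL z:t.pU. t.pph z\<in>UNIV & ph2 (fst (snd z)) = fst (snd (t.pph z))" by (auto simp: t.pph_def)
 show "\<exists>U ph V ps T S h. (U, ph)\<in>charts (base_product L1 L2) & (V, ps)\<in>charts (base L2) & openin (mtop (base_product L1 L2)) T \<and>
   z\<in>T & T \<subseteq> U & (%z. fst (snd z)) ` T \<subseteq> V & open S & smooth_on S h & (ALL z:T. ph z\<in>S & ps (fst (snd z)) = h (ph z))"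
  by (intro exI conjI) (fact t.prod_chart_in t.t2.ch 1 t(2) subset_refl 2 open_UNIV 3 4)+
qed

lemma bp_mfd: "smooth_manifold (base_product L1 L2)" unfolding smooth_manifold_def
proof (intro conjI)
 let ?P = "base_product L1 L2"
 note A = bp_atlas and A1 = lbD(2)[OF L1] and A2 = lbD(2)[OF L2]
 show "ALL c:charts ?P. smooth_chart ?P c" "pts ?P = (\<Union>(U, ph)\<in>charts ?P. U)" using A by (auto simp: atlas_def)
 show "Hausdorff_space (mtop ?P)"
 proof (rule Hausdorff_mtopI[OF A])
  fix z z' assume z: "z\<in>pts ?P" "z'\<in>pts ?P" "z ~= z'"
  have H: "Hausdorff_space (mtop (base L1))" "Hausdorff_space (mtop (base L2))"
   using lbD(1)[OF L1] lbD(1)[OF L2] by (simp_all add: smooth_manifold_def)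
  show "(EX (U, ph):charts ?P. z\<in>U & z'\<in>U) \<or>
   (\<exists>V W. openin (mtop ?P) V & openin (mtop ?P) W & z\<in>V & z'\<in>W & V Int W = {})"
  proof (cases "fst z = fst z' & fst (snd z) = fst (snd z')")
   case True
   obtain U1 ph1 V1 e1 U2 ph2 V2 e2 where t: "prod_triv L1 U1 ph1 V1 e1 L2 U2 ph2 V2 e2"
    "z\<in>prod_triv.pU L1 U1 V1 L2 U2 V2" using bp_pt[OF L1 L2 z(1)] .
   have "z'\<in>prod_triv.pU L1 U1 V1 L2 U2 V2" using t(2) z(2) True by (auto simp: prod_triv.pU_eq[OF t(1)])
   thus ?thesis using prod_triv.prod_chart_in[OF t(1)] t(2) by blast
  next
   case False
   then consider "fst z ~= fst z'" | "fst (snd z) ~= fst (snd z')" by blast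
   thus ?thesis by cases (rule disjI2, rule smooth_map_separates[OF A A1 H(1) bp_proj1 z(1,2)], assumption,
     rule disjI2, rule smooth_map_separates[OF A A2 H(2) bp_proj2 z(1,2)], assumption)
  qed
 qed
 show "second_countable (mtop ?P)"
 proof -
  let ?f = "%(c, f). fst c Int fst f"
  obtain J1 where J1: "J1 \<subseteq> charts (base L1) \<times> frames L1" "countable J1" "pts (base L1) \<subseteq> (\<Union>i\<in>J1. ?f i)"
   using countable_trivializations[OF L1] by blast
  obtain J2 where J2: "J2 \<subseteq> charts (base L2) \<times> frames L2" "countable J2" "pts (base L2) \<subseteq> (\<Union>i\<in>J2. ?f i)"
   using countable_trivializations[OF L2] by blast
  define F where "F = (%((c1, f1), (c2, f2)). (pts ?P Int {(x::'m, y::'n, C::'l => 'k). x\<in>fst c1 Int fst f1 & y\<in>fst c2 Int fst f2},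
   %(x::'m, y::'n, C::'l => 'k). (snd c1 x :: 'e, snd c2 y :: 'f, coord (snd f2 y) (C (snd f1 x)))))"
  show ?thesis
  proof (rule cble_mtopI[OF A])
   show "countable (F ` (J1 \<times> J2))" using J1(2) J2(2) by simp
   show "F ` (J1 \<times> J2) \<subseteq> charts ?P"
   proof
    fix x assume "x\<in>F ` (J1 \<times> J2)"
    then obtain c1 f1 c2 f2 where *: "(c1, f1)\<in>J1" "(c2, f2)\<in>J2" "x = F ((c1, f1), (c2, f2))" by auto
    obtain U ph V e U' ph' V' e' where e: "c1 = (U, ph)" "f1 = (V, e)" "c2 = (U', ph')" "f2 = (V', e')" by (cases c1, cases f1, cases c2, cases f2)
    have "(U, ph)\<in>charts (base L1)" "(V, e)\<in>frames L1" "(U', ph')\<in>charts (base L2)" "(V', e')\<in>frames L2"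
     using *(1,2) J1(1) J2(1) e by auto
    thus "x\<in>charts ?P" unfolding *(3) e F_def bp_simps(2) prod.case fst_conv snd_conv by blast
   qed
   show "pts ?P \<subseteq> (\<Union>(U, ph)\<in>F ` (J1 \<times> J2). U)"
   proof
    fix z assume z: "z\<in>pts ?P"
    have p: "fst z\<in>pts (base L1)" "fst (snd z)\<in>pts (base L2)" using z by (auto simp: bp_simps)
    obtain c1 f1 where 1: "(c1, f1)\<in>J1" "fst z\<in>fst c1 Int fst f1" using p(1) J1(3) by fastforce
    obtain c2 f2 where 2: "(c2, f2)\<in>J2" "fst (snd z)\<in>fst c2 Int fst f2" using p(2) J2(3) by fastforce
    have "z\<in>fst (F ((c1, f1), (c2, f2)))" using z 1 2 by (auto simp: F_def)
    thus "z\<in>(\<Union>(U, ph)\<in>F ` (J1 \<times> J2). U)" using 1(1) 2(1) by (auto simp: case_prod_beta)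
   qed
  qed
 qed
qed

lemma lp_lb: "line_bundle (line_product L1 L2)" unfolding line_product_def
 by (rule pull_bundle_line_bundle[OF bp_mfd L1 bp_proj1])

lemma lp_simps[simp]: "base (line_product L1 L2) = base_product L1 L2" "fibre (line_product L1 L2) z = fibre L1 (fst z)"
 by (simp_all add: line_product_def)

end

section \<open>Brackets as bilinear forms on 1-jets\<close>

lemma smooth_bilinear_family:
 fixes La :: "'a::findim => 'b::findim => 'c::findim => real"
 assumes S: "open S" and bl: "!!y. bilinear (La y)" and sm: "!!u v. smooth_on S (%y. La y u v)"
  and u: "smooth_on S u" and v: "smooth_on S v"
 shows "smooth_on S (%y. La y (u y) (v y))"
proof -
 have "La y (u y) (v y) = (\<Sum>b\<in>onb. \<Sum>c\<in>onb. (u y\<bullet>b) * (v y\<bullet>c) * La y b c)" for y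
 proof -
  have "La y (u y) (v y) = (\<Sum>b\<in>onb. (u y\<bullet>b) *\<^sub>R La y b (v y))" using bl[of y] by (intro linear_onb) (simp add: bilinear_def)
  also have "\<dots> = (\<Sum>b\<in>onb. (u y\<bullet>b) *\<^sub>R (\<Sum>c\<in>onb. (v y\<bullet>c) *\<^sub>R La y b c))"
   using bl[of y] by (intro sum.cong refl arg_cong[of _ _ "%t. _ *\<^sub>R t"] linear_onb) (simp add: bilinear_def)
  finally show ?thesis by (simp add: sum_distrib_left mult.assoc)
 qed
 moreover have "smooth_on S (%y. \<Sum>b\<in>onb. \<Sum>c\<in>onb. (u y\<bullet>b) * (v y\<bullet>c) * La y b c)"
  by (intro smooth_sum[OF S] smooth_on_mult[OF S] smooth_on_inner[OF S] u v sm smooth_const)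
 ultimately show ?thesis by simp
qed

text \<open>Coordinate formula of a bracket by a smooth family of bilinear forms on 1-jets. The form
  of a product bracket is assembled from those of its factors.\<close>

definition local_form where
 "local_form L br U ph V e La \<longleftrightarrow> triv L U ph V e & (\<forall>y. bilinear (La y)) \<and>
  (\<forall>u v. smooth_on (triv.img U ph V) (%y. La y u v)) \<and>
  (ALL s:sections L. ALL r:sections L. ALL x:U Int V. br s r x = La (ph x) (triv.jr U ph e s x) (triv.jr U ph e r x) *\<^sub>R e x)"

lemma proj1_eq: "proj1 = (fst, %z l. l)" by (auto simp: proj1_def fun_eq_iff)

lemma proj2_eq: "fst proj2 = (%z. fst (snd z))" "snd proj2 z = snd (snd z)" by (auto simp: proj2_def fun_eq_iff split: prod.splits)

text \<open>In product coordinates \<open>(x, y, c)\<close> the sections \<open>P\<^sub>1\<^sup>*s\<close> and \<open>P\<^sub>2\<^sup>*r\<close> are represented by \<open>s(x)\<close> and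
  \<open>r(y) / c\<close>; \<open>pj1\<close> and \<open>pj2\<close> recover the jets of \<open>s\<close> and \<open>r\<close> and kill those of the other kind.\<close>

definition pj1 :: "real => ('x::findim \<times> 'y::findim \<times> real) \<times> real => 'x \<times> real" where
 "pj1 c f = (fst (fst f), snd f + c * snd (snd (fst f)))"

definition pj2 :: "real => ('x::findim \<times> 'y::findim \<times> real) \<times> real => 'y \<times> real" where
 "pj2 c f = (c *\<^sub>R fst (snd (fst f)), - (c^2) * snd (snd (fst f)))"

text \<open>The second summand is divided by \<open>c\<close> because its value is a vector of the
  second fibre that is carried back to the first one.\<close>

definition prod_form where
 "prod_form La1 La2 y f g = La1 (fst y) (pj1 (snd (snd y)) f) (pj1 (snd (snd y)) g) +
  La2 (fst (snd y)) (pj2 (snd (snd y)) f) (pj2 (snd (snd y)) g) * inverse (snd (snd y))"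

locale ptriv = prod_triv L1 U1 ph1 V1 e1 L2 U2 ph2 V2 e2 +
 Z: triv "line_product L1 L2" "prod_triv.pU L1 U1 V1 L2 U2 V2" "prod_triv.pph ph1 e1 ph2 e2"
  "pts (base_product L1 L2) Int fst -` V1" "e1 \<circ> fst"
 for L1 :: "('m, 'e::findim, 'l::real_vector) line_bundle" and U1 ph1 V1 e1
  and L2 :: "('n, 'f::findim, 'k::real_vector) line_bundle" and U2 ph2 V2 e2

lemma prod_triv_ptriv: "prod_triv L1 U1 ph1 V1 e1 L2 U2 ph2 V2 e2 ==> ptriv L1 U1 ph1 V1 e1 L2 U2 ph2 V2 e2"
proof -
 assume p: "prod_triv L1 U1 ph1 V1 e1 L2 U2 ph2 V2 e2"
 interpret prod_triv L1 U1 ph1 V1 e1 L2 U2 ph2 V2 e2 by fact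
 have "(pts (base_product L1 L2) Int fst -` V1, e1 \<circ> fst)\<in>frames (line_product L1 L2)" using t1.fr by (auto simp: line_product_def)
 hence "triv (line_product L1 L2) pU pph (pts (base_product L1 L2) Int fst -` V1) (e1 \<circ> fst)"
  unfolding triv_def using lp_lb[OF t1.L t2.L] prod_chart_in by (simp add: lp_simps[OF t1.L t2.L])
 thus ?thesis using p by (simp add: ptriv_def)
qed

lemma lp_pt:
 assumes "line_bundle L1" "line_bundle L2" "z\<in>pts (base_product L1 L2)"
 obtains U1 ph1 V1 e1 U2 ph2 V2 e2 where "ptriv L1 U1 ph1 V1 e1 L2 U2 ph2 V2 e2"
  "z\<in>prod_triv.pU L1 U1 V1 L2 U2 V2" by (rule bp_pt[OF assms]) (blast intro: prod_triv_ptriv that)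

context
 fixes L1 :: "('m, 'e::findim, 'l::real_vector) line_bundle" and L2 :: "('n, 'f::findim, 'k::real_vector) line_bundle"
 assumes L1: "line_bundle L1" and L2: "line_bundle L2"
begin

lemma proj1_factor: "factor (line_product L1 L2) L1 proj1" unfolding proj1_eq line_product_def
 by (rule pull_bundle_factor[OF bp_mfd[OF L1 L2] L1 bp_proj1[OF L1 L2]])

text \<open>In contrast to the first projection, the fibre map over \<open>(x, y, C)\<close> is
  \<open>C\<close>. Its matrix entry in the frames is one of the chart coordinates and therefore
  smooth.\<close>

lemma proj2_factor: "factor (line_product L1 L2) L2 proj2"
proof -
 let ?P = "base_product L1 L2"
 note A = bp_atlas[OF L1 L2] and A1 = lbD(2)[OF L1] and A2 = lbD(2)[OF L2]
 have g: "\<exists>g. smooth_fun_on ?P (pts ?P Int fst -` V1 Int (%z. fst (snd z)) -` V2) g \<and>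
   (ALL z:pts ?P Int fst -` V1 Int (%z. fst (snd z)) -` V2. snd (snd z) (e1 (fst z)) = g z *\<^sub>R e2 (fst (snd z)))"
  if e: "(V1, e1)\<in>frames L1" "(V2, e2)\<in>frames L2" for V1 e1 V2 e2
 proof -
  let ?W = "pts ?P Int fst -` V1 Int (%z. fst (snd z)) -` V2"
  let ?g = "%z. coord (e2 (fst (snd z))) (snd (snd z) (e1 (fst z)))"
  have loc: "\<exists>T. openin (mtop ?P) T & z\<in>T & smooth_fun_on ?P T ?g & snd (snd z) (e1 (fst z)) = ?g z *\<^sub>R e2 (fst (snd z))"
   if z: "z\<in>?W" for z
  proof -
   have p: "fst z\<in>pts (base L1)" "fst (snd z)\<in>pts (base L2)" using z by (auto simp: bp_simps)
   obtain U1 ph1 where 1: "(U1, ph1)\<in>charts (base L1)" "fst z\<in>U1" using atlas_obtain[OF A1 p(1)] .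
   obtain U2 ph2 where 2: "(U2, ph2)\<in>charts (base L2)" "fst (snd z)\<in>U2" using atlas_obtain[OF A2 p(2)] .
   interpret prod_triv L1 U1 ph1 V1 e1 L2 U2 ph2 V2 e2 using 1 2 e L1 L2 by (simp add: prod_triv_def triv_def)
   note sc = atlas_ch[OF A prod_chart_in]
   have zU: "z\<in>pU" using z 1 2 by (auto simp: pU_eq)
   have "smooth_on UNIV (%y :: 'e \<times> 'f \<times> real. snd (snd y))" by (intro smooth_intros open_UNIV)
   hence "smooth_fun_on ?P pU ?g" by (rule sfun_chart[OF A sc chart_dom[OF A sc] subset_refl open_UNIV]) (auto simp: pph_def)
   moreover have "snd (snd z) (e1 (fst z)) = ?g z *\<^sub>R e2 (fst (snd z))" using pU_pmk(1)[of "fst z" "fst (snd z)" "snd (snd z)"] zU by simp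
   ultimately show ?thesis using zU chart_dom[OF A sc] by blast
  qed
  have "smooth_fun_on ?P ?W ?g" by (rule sfun_local[OF A]) (use loc in blast)
  thus ?thesis using loc by blast
 qed
 have "ALL x:pts ?P. linear_iso_on (fibre L1 (fst x)) (fibre L2 (fst (snd x))) (snd (snd x))" by (auto simp: bp_simps)
 thus ?thesis unfolding factor_def case_prod_beta proj2_eq lp_simps[OF L1 L2]
  using bp_proj2[OF L1 L2] g by (auto simp: line_product_def)
qed

abbreviation pl1 where "pl1 \<equiv> pull_section (line_product L1 L2) proj1"
abbreviation pl2 where "pl2 \<equiv> pull_section (line_product L1 L2) proj2"

lemma pl1_sections: "s\<in>sections L1 ==> pl1 s\<in>sections (line_product L1 L2)"
 by (rule pull_in[OF lp_lb[OF L1 L2] L1 proj1_factor])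

lemma pl2_sections: "s\<in>sections L2 ==> pl2 s\<in>sections (line_product L1 L2)"
 by (rule pull_in[OF lp_lb[OF L1 L2] L2 proj2_factor])

lemma pl1_at: "s\<in>sections L1 ==> z\<in>pts (base_product L1 L2) ==> pl1 s z = s (fst z)"
 by (auto simp: pull_section_def restrict0_def lp_simps[OF L1 L2] proj1_eq bp_simps sectionsD(2)
  intro!: inv_into_f_f[of "%l. l"])

lemma pl2_at: "z\<in>pts (base_product L1 L2) ==> pl2 s z = inv_into (fibre L1 (fst z)) (snd (snd z)) (s (fst (snd z)))"
 by (simp add: pull_section_def restrict0_def lp_simps[OF L1 L2] proj2_eq)

lemma pl_off: "z \<notin> pts (base_product L1 L2) ==> pl1 s z = 0" "z \<notin> pts (base_product L1 L2) ==> pl2 r z = 0"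
 by (simp_all add: pull_section_def restrict0_def lp_simps[OF L1 L2])

end

context ptriv
begin

lemma Z_dm: "Z.dm = pU" using pU_pts pU_fst(1) by (auto simp: Z.dm_def t1.dm_def)

lemma Z_img: "Z.img = t1.img \<times> t2.img \<times> - {0}"
proof -
 have "Z.img = pph ` Z.dm" by (simp add: Z.img_def Z.dm_def)
 also have "\<dots> = pph ` (pU Int {z. fst z\<in>t1.dm & fst (snd z)\<in>t2.dm})"
  unfolding Z_dm using pU_fst by (intro arg_cong[of _ _ "%S. pph ` S"]) auto
 also have "\<dots> = t1.img \<times> t2.img \<times> - {0}" by (subst pph_img) (auto simp: t1.img_def t2.img_def t1.dm_def t2.dm_def)
 finally show ?thesis .
qed

lemma Z_img_obtain:
 assumes "w\<in>Z.img"
 obtains x y c where "x\<in>t1.dm" "y\<in>t2.dm" "c ~= 0" "w = (ph1 x, ph2 y, c)" "Z.pt w = pmk x y c"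
proof -
 obtain x y c where *: "x\<in>t1.dm" "y\<in>t2.dm" "c ~= 0" "w = (ph1 x, ph2 y, c)"
  using assms unfolding Z_img by (auto simp: t1.img_def t2.img_def t1.dm_def t2.dm_def)
 note P = pmk_pU[OF *(1-3)]
 have "Z.pt w = pmk x y c" using Z.pt_phi[of "pmk x y c"] P by (simp add: Z_dm *(4))
 thus thesis by (rule that[OF *])
qed

lemma Z_rep_pl1:
 assumes s: "s\<in>sections L1" and w: "w\<in>Z.img"
 shows "Z.rep (pl1 L1 L2 s) w = t1.rep s (fst w)"
proof -
 obtain x y c where *: "x\<in>t1.dm" "y\<in>t2.dm" "c ~= 0" "w = (ph1 x, ph2 y, c)" "Z.pt w = pmk x y c" using Z_img_obtain[OF w] .
 have "pmk x y c\<in>pts (base_product L1 L2)" using pmk_pU(1)[OF *(1-3)] pU_pts by blast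
 thus ?thesis using pl1_at[OF t1.L t2.L s, of "pmk x y c"] unfolding Z.rep_def *(5) by (simp add: *(4) t1.rep_phi[OF *(1)])
qed

lemma Z_rep_pl2:
 assumes s: "s\<in>sections L2" and w: "w\<in>Z.img"
 shows "Z.rep (pl2 L1 L2 s) w = t2.rep s (fst (snd w)) / snd (snd w)"
proof -
 obtain x y c where *: "x\<in>t1.dm" "y\<in>t2.dm" "c ~= 0" "w = (ph1 x, ph2 y, c)" "Z.pt w = pmk x y c" using Z_img_obtain[OF w] .
 have U: "pmk x y c\<in>pU" by (rule pmk_pU(1)[OF *(1-3)])
 hence P: "pmk x y c\<in>pts (base_product L1 L2)" using pU_pts by blast
 let ?C = "snd (snd (pmk x y c))"
 have i: "linear_iso_on (fibre L1 x) (fibre L2 y) ?C" using P by (auto simp: bp_simps pmk_def)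
 have "s y = ?C ((t2.rep s (ph2 y) / c) *\<^sub>R e1 x)"
  using t2.rep_section[OF *(2) s] t1.fibre_scale[OF *(1)] *(3) by (simp add: pmk_def restrict0_def coord_scale[OF t1.e_nz[OF *(1)]])
 hence "inv_into (fibre L1 x) ?C (s y) = (t2.rep s (ph2 y) / c) *\<^sub>R e1 x" using lin_isoD(2)[OF i t1.fibre_scale[OF *(1)]] by simp
 hence "pl2 L1 L2 s (pmk x y c) = (t2.rep s (ph2 y) / c) *\<^sub>R e1 x" using pl2_at[OF t1.L t2.L P] by simp
 thus ?thesis unfolding Z.rep_def *(5) by (simp add: *(4) coord_scale[OF t1.e_nz[OF *(1)]])
qed

lemma pph_simps: "z\<in>pU ==> fst (pph z) = ph1 (fst z)" "z\<in>pU ==> fst (snd (pph z)) = ph2 (fst (snd z))"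
  "z\<in>pU ==> snd (snd (pph z)) ~= 0" by (auto elim!: pU_obtain)

lemma Z_jr_pl1:
 assumes s: "s\<in>sections L1" and z: "z\<in>pU"
 shows "Z.jr (pl1 L1 L2 s) z = ((grad (t1.rep s) (ph1 (fst z)), 0, 0), t1.rep s (ph1 (fst z)))"
proof -
 have zi: "pph z\<in>Z.img" using z Z_dm Z.phi_img by simp
 have "Z.jr (pl1 L1 L2 s) z = jet1 (%w. t1.rep s (fst w)) (pph z)" by (rule jet1_cong[OF Z.open_img zi Z_rep_pl1[OF s]])
 also have "\<dots> = ((grad (t1.rep s) (ph1 (fst z)), 0, 0), t1.rep s (ph1 (fst z)))"
 proof (rule jet1_eqI)
  have d: "(t1.rep s has_derivative (%v. grad (t1.rep s) (ph1 (fst z))\<bullet>v)) (at (fst (pph z)))"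
   using has_grad[OF t1.rep_diff[OF s pU_fst(1)[OF z]]] pph_simps(1)[OF z] by simp
  show "((%w. t1.rep s (fst w)) has_derivative (%v. (grad (t1.rep s) (ph1 (fst z)), 0, 0)\<bullet>v)) (at (pph z))"
   using has_derivative_compose[OF has_derivative_fst[OF has_derivative_ident] d] by (simp add: inner_prod_def)
 qed (simp add: pph_simps[OF z])
 finally show ?thesis .
qed

lemma Z_jr_pl2:
 assumes s: "s\<in>sections L2" and z: "z\<in>pU" and c: "c = snd (snd (pph z))"
 shows "Z.jr (pl2 L1 L2 s) z = ((0, inverse c *\<^sub>R grad (t2.rep s) (ph2 (fst (snd z))), - t2.rep s (ph2 (fst (snd z))) / c^2),
  t2.rep s (ph2 (fst (snd z))) / c)"
proof -
 have zi: "pph z\<in>Z.img" using z Z_dm Z.phi_img by simp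
 have c0: "snd (snd (pph z)) ~= 0" by (rule pph_simps(3)[OF z])
 have "Z.jr (pl2 L1 L2 s) z = jet1 (%w. t2.rep s (fst (snd w)) / snd (snd w)) (pph z)" by (rule jet1_cong[OF Z.open_img zi Z_rep_pl2[OF s]])
 also have "\<dots> = ((0, inverse c *\<^sub>R grad (t2.rep s) (ph2 (fst (snd z))), - t2.rep s (ph2 (fst (snd z))) / c^2),
  t2.rep s (ph2 (fst (snd z))) / c)"
 proof (rule jet1_eqI)
  have d: "(t2.rep s has_derivative (%v. grad (t2.rep s) (ph2 (fst (snd z)))\<bullet>v)) (at (fst (snd (pph z))))"
   using has_grad[OF t2.rep_diff[OF s pU_fst(2)[OF z]]] pph_simps(2)[OF z] by simp
  have d1: "((%w. t2.rep s (fst (snd w))) has_derivative (%v. grad (t2.rep s) (ph2 (fst (snd z)))\<bullet>fst (snd v))) (at (pph z))"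
   by (rule has_derivative_compose[OF has_derivative_fst[OF has_derivative_snd[OF has_derivative_ident]] d])
  have d2: "((%w. snd (snd w)) has_derivative (%v. snd (snd v))) (at (pph z))"
   by (rule has_derivative_snd[OF has_derivative_snd[OF has_derivative_ident]])
  show "((%w. t2.rep s (fst (snd w)) / snd (snd w)) has_derivative
   (%v. (0, inverse c *\<^sub>R grad (t2.rep s) (ph2 (fst (snd z))), - t2.rep s (ph2 (fst (snd z))) / c^2)\<bullet>v)) (at (pph z))"
   by (rule has_derivative_eq_rhs[OF has_derivative_divide[OF d1 d2 c0]])
    (use c0 in \<open>simp add: c inner_prod_def fun_eq_iff power2_eq_square field_simps pph_simps[OF z]\<close>)
 qed (simp add: pph_simps[OF z] c)
 finally show ?thesis .
qed

lemma pj_pl1: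
 assumes s: "s\<in>sections L1" and z: "z\<in>pU"
 shows "pj1 c (Z.jr (pl1 L1 L2 s) z) = t1.jr s (fst z)" "pj2 c (Z.jr (pl1 L1 L2 s) z) = 0"
 unfolding Z_jr_pl1[OF s z] by (simp_all add: pj1_def pj2_def jet1_def zero_prod_def)

lemma pj_pl2:
 assumes s: "s\<in>sections L2" and z: "z\<in>pU"
 shows "pj1 (snd (snd (pph z))) (Z.jr (pl2 L1 L2 s) z) = 0"
  "pj2 (snd (snd (pph z))) (Z.jr (pl2 L1 L2 s) z) = t2.jr s (fst (snd z))" unfolding Z_jr_pl2[OF s z refl] using pph_simps(3)[OF z]
 by (simp_all add: pj1_def pj2_def jet1_def zero_prod_def power2_eq_square)

text \<open>Pull-backs along the first projection detect the directions of \<open>x\<close> and the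
  value component. Those along the second then detect the directions of \<open>y\<close>, and that
  of \<open>c\<close> once the value component is known to vanish.\<close>

lemma gens_separate:
 assumes z: "z\<in>pU" and a: "a\<in>Der (line_product L1 L2) z"
  and k1: "!!s. s\<in>sections L1 ==> a (pl1 L1 L2 s) = 0" and k2: "!!s. s\<in>sections L2 ==> a (pl2 L1 L2 s) = 0"
 shows "a = (%s. 0)"
proof -
 have zd: "z\<in>Z.dm" using z Z_dm by simp
 obtain w where w: "a = Z.der w z" using Z.Der_der[OF zd a] by blast
 let ?c = "snd (snd (pph z))"
 note c = pph_simps(3)[OF z]
 have e: "(e1 \<circ> fst) z ~= 0" using Z.e_nz[OF zd] .
 have w1: "w\<bullet>((g, 0, 0), t) = 0" for g t
 proof -
  obtain s where s: "s\<in>sections L1" "t1.jr s (fst z) = (g, t)" using t1.jr_obtain[OF pU_fst(1)[OF z]] .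
  show ?thesis using k1[OF s(1)] e s(2) unfolding w Z.der_sec[OF pl1_sections[OF t1.L t2.L s(1)]] Z_jr_pl1[OF s(1) z] by (simp add: jet1_def)
 qed
 have w2: "w\<bullet>((0, inverse ?c *\<^sub>R g, - t / ?c^2), t / ?c) = 0" for g t
 proof -
  obtain s where s: "s\<in>sections L2" "t2.jr s (fst (snd z)) = (g, t)" using t2.jr_obtain[OF pU_fst(2)[OF z]] .
  show ?thesis using k2[OF s(1)] e s(2) unfolding w Z.der_sec[OF pl2_sections[OF t1.L t2.L s(1)]] Z_jr_pl2[OF s(1) z refl] by (simp add: jet1_def)
 qed
 have a0: "snd w = 0" using w1[of 0 1] by (simp add: inner_prod_def)
 have a1: "fst (fst w) = 0" by (rule onb_eqI) (use w1[of _ 0] in \<open>simp add: inner_prod_def\<close>)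
 have a2: "fst (snd (fst w)) = 0" by (rule onb_eqI) (use w2[of "?c *\<^sub>R _" 0] c in \<open>simp add: inner_prod_def\<close>)
 have a3: "snd (snd (fst w)) = 0" using w2[of 0 1] c a0 by (simp add: inner_prod_def)
 have "w = 0" using a0 a1 a2 a3 by (simp add: prod_eq_iff)
 thus ?thesis unfolding w by (simp only: Z.der_zero)
qed

lemma prod_form_biderivation:
 assumes 1: "local_form L1 br1 U1 ph1 V1 e1 La1" and 2: "local_form L2 br2 U2 ph2 V2 e2 La2"
 shows "local_biders (line_product L1 L2) Z.dm (%s r z. prod_form La1 La2 (pph z) (Z.jr s z) (Z.jr r z) *\<^sub>R (e1 \<circ> fst) z)"
proof (rule Z.bilinear_form_biderivation)
 have b: "bilinear (La1 y)" "bilinear (La2 y')" for y y' using 1 2 by (simp_all add: local_form_def)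
 have l1: "linear (pj1 c)" for c by (rule linearI) (simp_all add: pj1_def algebra_simps)
 have l2: "linear (pj2 c)" for c by (rule linearI) (simp_all add: pj2_def algebra_simps)
 note L = linear_add[OF l1] linear_add[OF l2] linear_scale[OF l1] linear_scale[OF l2]
 show "bilinear (prod_form La1 La2 y)" for y unfolding bilinear_def by (intro conjI allI linearI)
   (simp_all add: prod_form_def L bilinear_ladd[OF b(1)] bilinear_ladd[OF b(2)] bilinear_radd[OF b(1)] bilinear_radd[OF b(2)]
    bilinear_lmul[OF b(1)] bilinear_lmul[OF b(2)] bilinear_rmul[OF b(1)] bilinear_rmul[OF b(2)] algebra_simps)
 fix u v
 note o = Z.open_img and id = smooth_ident[of Z.img]
 have y1: "smooth_on Z.img (%y. fst y)" and y2: "smooth_on Z.img (%y. fst (snd y))" and y3: "smooth_on Z.img (%y. snd (snd y))"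
  by (intro smooth_on_fst[OF o] smooth_on_snd[OF o] id)+
 have sm: "smooth_on t1.img (%y. La1 y u v)" "smooth_on t2.img (%y. La2 y u' v')" for u v u' v' using 1 2 unfolding local_form_def by blast+
 have s1: "smooth_on Z.img (%y. La1 (fst y) u v)" for u v by (rule smooth_comp[OF o t1.open_img y1 _ sm(1)]) (auto simp: Z_img)
 have s2: "smooth_on Z.img (%y. La2 (fst (snd y)) u v)" for u v by (rule smooth_comp[OF o t2.open_img y2 _ sm(2)]) (auto simp: Z_img)
 have j1: "smooth_on Z.img (%y. pj1 (snd (snd y)) u)" for u
  unfolding pj1_def by (intro smooth_Pair[OF o] smooth_add[OF o] smooth_on_mult[OF o] smooth_const y3)
 have j2: "smooth_on Z.img (%y. pj2 (snd (snd y)) u)" for u unfolding pj2_def power2_eq_square minus_mult_left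
  by (intro smooth_Pair[OF o] smooth_on_scaleR[OF o] smooth_on_mult[OF o] smooth_on_minus[OF o] smooth_const y3)
 show "smooth_on Z.img (%y. prod_form La1 La2 y u v)" unfolding prod_form_def
  by (intro smooth_add[OF o] smooth_on_mult[OF o] smooth_inverse[OF o] y3
   smooth_bilinear_family[OF o b(1) s1 j1 j1] smooth_bilinear_family[OF o b(2) s2 j2 j2]) (auto simp: Z_img)
qed

end

section \<open>The product bracket\<close>

text \<open>A relation for the same reason as \<open>jet_gb\<close>; the fourth rule is the skew
  counterpart of the third.\<close>

inductive prod_gb for L1 br1 L2 br2 where
 "s\<in>sections L1 ==> s'\<in>sections L1 ==> prod_gb L1 br1 L2 br2 (pl1 L1 L2 s) (pl1 L1 L2 s') (pl1 L1 L2 (br1 s s'))"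
| "r\<in>sections L2 ==> r'\<in>sections L2 ==> prod_gb L1 br1 L2 br2 (pl2 L1 L2 r) (pl2 L1 L2 r') (pl2 L1 L2 (br2 r r'))"
| "s\<in>sections L1 ==> r\<in>sections L2 ==> prod_gb L1 br1 L2 br2 (pl1 L1 L2 s) (pl2 L1 L2 r) (%z. 0)"
| "s\<in>sections L1 ==> r\<in>sections L2 ==> prod_gb L1 br1 L2 br2 (pl2 L1 L2 r) (pl1 L1 L2 s) (%z. 0)"

lemma (in ptriv) prod_form_gen:
 assumes 1: "local_form L1 br1 U1 ph1 V1 e1 La1" and 2: "local_form L2 br2 U2 ph2 V2 e2 La2"
  and br: "biders L1 br1" "biders L2 br2"
  and R: "prod_gb L1 br1 L2 br2 g h k" and z: "z\<in>pU"
 shows "prod_form La1 La2 (pph z) (Z.jr g z) (Z.jr h z) *\<^sub>R (e1 \<circ> fst) z = k z"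
proof -
 have b: "bilinear (La1 y)" "bilinear (La2 y')" for y y' using 1 2 by (simp_all add: local_form_def)
 note zero = bilinear_lzero[OF b(1)] bilinear_rzero[OF b(1)] bilinear_lzero[OF b(2)] bilinear_rzero[OF b(2)]
 have zd: "z\<in>Z.dm" using z Z_dm by simp
 have zP: "z\<in>pts (base_product L1 L2)" using z pU_pts by blast
 have d: "fst z\<in>U1 Int V1" "fst (snd z)\<in>U2 Int V2" using pU_fst[OF z] by (simp_all add: t1.dm_def t2.dm_def)
 show ?thesis using R
 proof cases
  case (1 s s')
  have "br1 s s' (fst z) = La1 (ph1 (fst z)) (t1.jr s (fst z)) (t1.jr s' (fst z)) *\<^sub>R e1 (fst z)"
   using assms(1) 1 d(1) by (simp add: local_form_def)
  thus ?thesis using pl1_at[OF t1.L t2.L bidersD(6)[OF br(1) 1(4,5)] zP] 1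
   by (simp add: prod_form_def pj_pl1[OF _ z] zero pph_simps[OF z] del: fst_jet1 snd_jet1)
 next
  case (2 r r')
  let ?c = "snd (snd (pph z))"
  have "br2 r r' (fst (snd z)) = La2 (ph2 (fst (snd z))) (t2.jr r (fst (snd z))) (t2.jr r' (fst (snd z))) *\<^sub>R e2 (fst (snd z))"
   using assms(2) 2 d(2) by (simp add: local_form_def)
  hence rep: "t2.rep (br2 r r') (ph2 (fst (snd z))) = La2 (ph2 (fst (snd z))) (t2.jr r (fst (snd z))) (t2.jr r' (fst (snd z)))"
   by (simp add: t2.rep_phi[OF pU_fst(2)[OF z]] coord_scale[OF t2.e_nz[OF pU_fst(2)[OF z]]])
  have b2: "br2 r r'\<in>sections L2" by (rule bidersD(6)[OF br(2) 2(4,5)])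
  have "k z = (t2.rep (br2 r r') (ph2 (fst (snd z))) / ?c) *\<^sub>R (e1 \<circ> fst) z"
   using Z.rep_section[OF zd pl2_sections[OF t1.L t2.L b2]] Z_rep_pl2[OF b2 Z.phi_img[OF zd]] 2(3) by (simp add: pph_simps[OF z])
  thus ?thesis unfolding 2(1,2) prod_form_def pj_pl2[OF 2(4) z] pj_pl2[OF 2(5) z] zero rep pph_simps(1,2)[OF z] by (simp add: divide_inverse)
 next
  case (3 s r)
  show ?thesis unfolding 3(1,2,3) prod_form_def pj_pl1[OF 3(4) z] pj_pl2[OF 3(5) z] zero by simp
 next
  case (4 s r)
  show ?thesis unfolding 4(1,2,3) prod_form_def pj_pl1[OF 4(4) z] pj_pl2[OF 4(5) z] zero by simp
 qed
qed

text \<open>Brackets of pull-backs are pull-backs of brackets, so both identities are images under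
  the linear map \<open>l\<close> of the identities of \<open>b\<close>.\<close>

lemma pull_jacobi:
 assumes LP: "line_bundle P" and L: "line_bundle L" and F: "factor P L p" and j: "jacobi L b"
  and K: "!!s s'. s\<in>sections L ==> s'\<in>sections L ==> br (pull_section P p s) (pull_section P p s') = pull_section P p (b s s')"
  and s: "s\<in>sections L" "r\<in>sections L" "t\<in>sections L"
 defines "l == pull_section P p"
 shows "br (l s) (l r) = (%x. - br (l r) (l s) x)"
  "br (l s) (br (l r) (l t)) x + br (l r) (br (l t) (l s)) x + br (l t) (br (l s) (l r)) x = 0"
proof -
 note lin = pull_linear[OF LP L F, folded l_def] and K = K[folded l_def]
 have b: "b s s'\<in>sections L" if "s\<in>sections L" "s'\<in>sections L" for s s' by (rule bidersD(6)[OF jacobiD(1)[OF L j] that])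
 show "br (l s) (l r) = (%x. - br (l r) (l s) x)"
  unfolding K[OF s(1,2)] K[OF s(2,1)] using lin(4)[OF b[OF s(2,1)] b[OF s(2,1)]] jacobiD(2)[OF L j, of s r] by simp
 note bb = b[OF s(2,3)] b[OF s(3,1)] b[OF s(1,2)]
 note bbb = b[OF s(1) bb(1)] b[OF s(2) bb(2)] b[OF s(3) bb(3)]
 have ba: "(%x. b s (b r t) x + b r (b t s) x)\<in>sections L" by (rule secs_add[OF L bbb(1,2)])
 have jac: "(%x. b s (b r t) x + b r (b t s) x + b t (b s r) x) = (%x. 0)" using j s by (simp add: jacobi_def)
 have "br (l s) (br (l r) (l t)) x + br (l r) (br (l t) (l s)) x + br (l t) (br (l s) (l r)) x =
   l (%x. b s (b r t) x + b r (b t s) x + b t (b s r) x) x"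
  unfolding K[OF s(2,3)] K[OF s(3,1)] K[OF s(1,2)] K[OF s(1) bb(1)] K[OF s(2) bb(2)] K[OF s(3) bb(3)]
   lin(1)[OF ba bbb(3)] lin(1)[OF bbb(1,2)] by (rule refl)
 thus "br (l s) (br (l r) (l t)) x + br (l r) (br (l t) (l s)) x + br (l t) (br (l s) (l r)) x = 0" unfolding jac lin(6)[OF s(1) s(1)] .
qed

text \<open>Jacobi structures with a coordinate formula around each point. Existence of the product
  bracket rests on this form; it holds for the canonical bracket and passes to the opposite
  one.\<close>

definition loc_formed where
 "loc_formed L br \<longleftrightarrow> jacobi L br & (ALL x:pts (base L). \<exists>U ph V e La. x\<in>U Int V & local_form L br U ph V e La)"

context
 fixes L1 :: "('m, 'e::findim, 'l::real_vector) line_bundle" and L2 :: "('n, 'f::findim, 'k::real_vector) line_bundle"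
  and br1 br2
 assumes L1: "line_bundle L1" and L2: "line_bundle L2" and br1: "loc_formed L1 br1" and br2: "loc_formed L2 br2"
begin

definition prod_gens where
 "prod_gens = pl1 L1 L2 ` sections L1 Un pl2 L1 L2 ` sections L2"

lemma prod_spanning: "jet_spanning (line_product L1 L2) prod_gens" unfolding jet_spanning_def
proof (intro conjI ballI impI)
 show "prod_gens \<subseteq> sections (line_product L1 L2)"
  using pl1_sections[OF L1 L2] pl2_sections[OF L1 L2] by (auto simp: prod_gens_def)
 fix z a assume z: "z\<in>pts (base (line_product L1 L2))" and a: "a\<in>Der (line_product L1 L2) z" "ALL g:prod_gens. a g = 0"
 have "z\<in>pts (base_product L1 L2)" using z by (simp add: lp_simps[OF L1 L2])
 then obtain U1 ph1 V1 e1 U2 ph2 V2 e2 where t: "ptriv L1 U1 ph1 V1 e1 L2 U2 ph2 V2 e2"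
  "z\<in>prod_triv.pU L1 U1 V1 L2 U2 V2" by (rule lp_pt[OF L1 L2])
 show "a = (%s. 0)" by (rule ptriv.gens_separate[OF t(1,2) a(1)]) (use a(2) in \<open>auto simp: prod_gens_def\<close>)
qed

lemma pl_secs_gen:
 "s\<in>sections L1 ==> pl1 L1 L2 s\<in>prod_gens" "r\<in>sections L2 ==> pl2 L1 L2 r\<in>prod_gens" by (auto simp: prod_gens_def)

lemma bd1: "biders L1 br1" and bd2: "biders L2 br2"
 using jacobiD(1)[OF L1] jacobiD(1)[OF L2] br1 br2 by (simp_all add: loc_formed_def)

lemma prod_gen_bracket_ex:
 assumes "g\<in>prod_gens" "h\<in>prod_gens" shows "\<exists>k. prod_gb L1 br1 L2 br2 g h k"
 using assms unfolding prod_gens_def by (elim UnE imageE) (auto intro: prod_gb.intros)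

lemma product_bracket_ex:
 "\<exists>br. biders (line_product L1 L2) br & (\<forall>g h k. prod_gb L1 br1 L2 br2 g h k --> br g h = k)"
proof -
 let ?J = "line_product L1 L2" and ?R = "prod_gb L1 br1 L2 br2"
 note LP = lp_lb[OF L1 L2] and simps = lp_simps[OF L1 L2]
 define K where "K g h = (SOME k. ?R g h k)" for g h
 have K: "?R g h (K g h)" if "g\<in>prod_gens" "h\<in>prod_gens" for g h
  unfolding K_def using prod_gen_bracket_ex[OF that] by (rule someI_ex)
 have loc: "\<exists>W be. z\<in>W & local_biders ?J W be & (\<forall>g h k x. ?R g h k --> x\<in>W --> be g h x = k x)"
  if z: "z\<in>pts (base_product L1 L2)" for z
 proof -
  have p: "fst z\<in>pts (base L1)" "fst (snd z)\<in>pts (base L2)" using z by (auto simp: bp_simps)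
  obtain U1 ph1 V1 e1 La1 where 1: "fst z\<in>U1 Int V1" "local_form L1 br1 U1 ph1 V1 e1 La1" using br1 p(1) unfolding loc_formed_def by metis
  obtain U2 ph2 V2 e2 La2 where 2: "fst (snd z)\<in>U2 Int V2" "local_form L2 br2 U2 ph2 V2 e2 La2"
   using br2 p(2) unfolding loc_formed_def by metis
  interpret ptriv L1 U1 ph1 V1 e1 L2 U2 ph2 V2 e2 by (rule prod_triv_ptriv) (use 1 2 in \<open>simp add: prod_triv_def local_form_def\<close>)
  have zU: "z\<in>pU" using z 1(1) 2(1) by (auto simp: pU_eq)
  show ?thesis using prod_form_biderivation[OF 1(2) 2(2)] prod_form_gen[OF 1(2) 2(2) bd1 bd2] zU unfolding Z_dm by blast
 qed
 have loc': "\<exists>W be. z\<in>W & local_biders ?J W be & (ALL g:prod_gens. ALL h:prod_gens. ALL x:W. be g h x = K g h x)"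
  if "z\<in>pts (base ?J)" for z
 proof -
  have "z\<in>pts (base_product L1 L2)" using that by (simp add: simps)
  from loc[OF this] obtain W be where *: "z\<in>W" "local_biders ?J W be" "\<forall>g h k x. ?R g h k --> x\<in>W --> be g h x = k x"
   by (elim exE conjE)
  show ?thesis by (intro exI[of _ W] exI[of _ be] conjI *(1,2) ballI *(3)[rule_format] K)
 qed
 from biders_glue[OF LP prod_spanning loc'] obtain br where br: "biders ?J br"
  "ALL g:prod_gens. ALL h:prod_gens. ALL x:pts (base ?J). br g h x = K g h x" by blast
 have "br g h = k" if R: "?R g h k" for g h k
 proof
  fix z
  have gh: "g\<in>prod_gens" "h\<in>prod_gens" and k: "!!z. z \<notin> pts (base_product L1 L2) ==> k z = 0"
   using R by (cases; simp add: pl_secs_gen pl_off[OF L1 L2])+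
  have gs: "g\<in>sections ?J" "h\<in>sections ?J" using gh prod_spanning by (auto simp: jet_spanning_def)
  show "br g h z = k z"
  proof (cases "z\<in>pts (base_product L1 L2)")
   case True
   obtain W be where *: "z\<in>W" "\<forall>g h k x. ?R g h k --> x\<in>W --> be g h x = k x" using loc[OF True] by (elim exE conjE)
   have "br g h z = K g h z" using br(2) gh True by (simp add: simps)
   also have "\<dots> = be g h z" by (rule *(2)[rule_format, OF K[OF gh] *(1), symmetric])
   also have "\<dots> = k z" by (rule *(2)[rule_format, OF R *(1)])
   finally show ?thesis .
  next
   case False
   thus ?thesis using bidersD(7)[OF br(1)] k by (simp add: simps)
  qed
 qed
 thus ?thesis using br(1) by (intro exI[of _ br] conjI allI impI)
qed

lemma jacobi_prod_bracket:
 assumes br: "biders (line_product L1 L2) br" and K: "!!g h k. prod_gb L1 br1 L2 br2 g h k ==> br g h = k"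
 shows "jacobi (line_product L1 L2) br"
proof (rule jacobiI[OF lp_lb[OF L1 L2] prod_spanning br])
 let ?J = "line_product L1 L2" and ?l = "pl1 L1 L2" and ?p = "pl2 L1 L2"
 let ?A = "?l ` sections L1" and ?B = "?p ` sections L2"
 note LP = lp_lb[OF L1 L2]
 have j: "jacobi L1 br1" "jacobi L2 br2" using br1 br2 by (simp_all add: loc_formed_def)
 have b1: "br1 s s'\<in>sections L1" if "s\<in>sections L1" "s'\<in>sections L1" for s s' by (rule bidersD(6)[OF bd1 that])
 have b2: "br2 s s'\<in>sections L2" if "s\<in>sections L2" "s'\<in>sections L2" for s s' by (rule bidersD(6)[OF bd2 that])
 have ll: "br (?l s) (?l s') = ?l (br1 s s')" if "s\<in>sections L1" "s'\<in>sections L1" for s s' by (rule K[OF prod_gb.intros(1)[OF that]])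
 have pp: "br (?p s) (?p s') = ?p (br2 s s')" if "s\<in>sections L2" "s'\<in>sections L2" for s s' by (rule K[OF prod_gb.intros(2)[OF that]])
 have lp: "br (?l s) (?p r) = (%z. 0)" if "s\<in>sections L1" "r\<in>sections L2" for s r by (rule K[OF prod_gb.intros(3)[OF that]])
 have pl: "br (?p r) (?l s) = (%z. 0)" if "s\<in>sections L1" "r\<in>sections L2" for s r by (rule K[OF prod_gb.intros(4)[OF that]])
 have z0: "br g (%x. 0) = (%x. 0)" if "g\<in>sections ?J" for g by (rule ders_linear(5)[OF LP bidersD(2)[OF br that] that that])
 note lz = z0[OF pl1_sections[OF L1 L2]] and pz = z0[OF pl2_sections[OF L1 L2]]
 note J1 = pull_jacobi[OF LP L1 proj1_factor[OF L1 L2] j(1) ll] and J2 = pull_jacobi[OF LP L2 proj2_factor[OF L1 L2] j(2) pp]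
 show "br g h = (%x. - br h g x)" if g: "g\<in>prod_gens" and h: "h\<in>prod_gens" for g h
 proof -
  have "g\<in>?A | g\<in>?B" "h\<in>?A | h\<in>?B" using g h by (auto simp: prod_gens_def)
  moreover have ?thesis if "g\<in>?A" "h\<in>?A" using that J1(1) by blast
  moreover have ?thesis if "g\<in>?B" "h\<in>?B" using that J2(1) by blast
  moreover have ?thesis if "g\<in>?A" "h\<in>?B" using that by (elim imageE) (simp only: lp pl minus_zero)
  moreover have ?thesis if "g\<in>?B" "h\<in>?A" using that by (elim imageE) (simp only: lp pl minus_zero)
  ultimately show ?thesis by argo
 qed
 define T where "T g h k x = br g (br h k) x + br h (br k g) x + br k (br g h) x" for g h k x
 have cyc: "T g h k x = T h k g x" for g h k x by (simp add: T_def add.commute add.left_commute)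
 have AAA: "T g h k x = 0" if "g\<in>?A" "h\<in>?A" "k\<in>?A" for g h k x using that J1(2) unfolding T_def by blast
 have BBB: "T g h k x = 0" if "g\<in>?B" "h\<in>?B" "k\<in>?B" for g h k x using that J2(2) unfolding T_def by blast
 have AAB: "T g h k x = 0" if "g\<in>?A" "h\<in>?A" "k\<in>?B" for g h k x using that unfolding T_def by (elim imageE) (simp add: lp pl ll lz pz b1)
 have ABB: "T g h k x = 0" if "g\<in>?A" "h\<in>?B" "k\<in>?B" for g h k x using that unfolding T_def by (elim imageE) (simp add: lp pl pp lz pz b2)
 show "br g (br h k) x + br h (br k g) x + br k (br g h) x = 0"
  if "g\<in>prod_gens" "h\<in>prod_gens" "k\<in>prod_gens" for g h k x
 proof -
  have "g\<in>?A | g\<in>?B" "h\<in>?A | h\<in>?B" "k\<in>?A | k\<in>?B" using that by (auto simp: prod_gens_def)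
  hence "T g h k x = 0"
   using AAA[of g h k x] BBB[of g h k x] AAB[of g h k x] AAB[of h k g x] AAB[of k g h x] ABB[of g h k x] ABB[of h k g x] ABB[of k g h x]
    cyc[of g h k x] cyc[of h k g x] by argo
  thus ?thesis by (simp add: T_def)
 qed
qed

lemma product_bracket:
 shows "jacobi (line_product L1 L2) (product_bracket L1 br1 L2 br2)"
  "!!g h k. prod_gb L1 br1 L2 br2 g h k ==> product_bracket L1 br1 L2 br2 g h = k"
proof -
 let ?J = "line_product L1 L2" and ?R = "prod_gb L1 br1 L2 br2"
 note LP = lp_lb[OF L1 L2]
 obtain br where br: "biders ?J br" "\<forall>g h k. ?R g h k --> br g h = k" using product_bracket_ex by (elim exE conjE)
 have j: "jacobi ?J br" by (rule jacobi_prod_bracket[OF br(1) br(2)[rule_format]])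
 have cb: "product_bracket L1 br1 L2 br2 = br" unfolding product_bracket_def Let_def
 proof (rule the_equality, goal_cases)
  case 1 show ?case by (intro conjI ballI j br(2)[rule_format] prod_gb.intros)
 next
  case (2 br')
  note b' = 2[THEN conjunct1] and s1 = 2[THEN conjunct2, THEN conjunct1, rule_format]
   and s2 = 2[THEN conjunct2, THEN conjunct2, THEN conjunct1, rule_format]
   and s3 = 2[THEN conjunct2, THEN conjunct2, THEN conjunct2, rule_format]
  have gen: "br' g h = k" if "?R g h k" for g h k using that
  proof cases
   case (1 s s') thus ?thesis using s1 by simp
  next
   case (2 s s') thus ?thesis using s2 by simp
  next
   case (3 s s') thus ?thesis using s3 by simp
  next
   case (4 s r)
   have "br' g h = (%x. - br' h g x)" by (rule jacobiD(2)[OF LP b'])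
   also have "br' h g = (%x. 0)" unfolding 4(1,2) by (rule s3[OF 4(4,5)])
   finally show ?thesis using 4(3) by simp
  qed
  show ?case
  proof (rule biders_eq[OF LP prod_spanning jacobiD(1)[OF LP b'] br(1)])
   fix g h assume "g\<in>prod_gens" "h\<in>prod_gens"
   then obtain k where k: "?R g h k" using prod_gen_bracket_ex by blast
   show "br' g h = br g h" using gen[OF k] br(2) k by simp
  qed
 qed
 show "jacobi ?J (product_bracket L1 br1 L2 br2)" unfolding cb by (rule j)
 show "!!g h k. ?R g h k ==> product_bracket L1 br1 L2 br2 g h = k" unfolding cb by (rule br(2)[rule_format])
qed

text \<open>Push \<open>a\<close> forward along both projections, represent each image by a bracket
  with \<open>s1\<close> or \<open>s2\<close>, and add the pull-backs of these sections. As mixed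
  brackets vanish, the sum represents \<open>a\<close> on all generators.\<close>

lemma product_Der:
 assumes surj1: "ALL x:pts (base L1). ALL a:Der L1 x. EX s:sections L1. a = (%r. br1 s r x)"
  and surj2: "ALL x:pts (base L2). ALL a:Der L2 x. EX s:sections L2. a = (%r. br2 s r x)"
  and z: "z\<in>pts (base_product L1 L2)" and a: "a\<in>Der (line_product L1 L2) z"
 shows "EX s:sections (line_product L1 L2). a = (%r. product_bracket L1 br1 L2 br2 s r z)"
proof -
 let ?J = "line_product L1 L2" and ?br = "product_bracket L1 br1 L2 br2"
 note LP = lp_lb[OF L1 L2] and simps = lp_simps[OF L1 L2]
 note F1 = proj1_factor[OF L1 L2] and F2 = proj2_factor[OF L1 L2]
 have zb: "z\<in>pts (base ?J)" using z by (simp add: simps)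
 have p: "fst z\<in>pts (base L1)" "fst (snd z)\<in>pts (base L2)" and i: "linear_iso_on (fibre L1 (fst z)) (fibre L2 (fst (snd z))) (snd (snd z))"
  using z by (auto simp: bp_simps)
 have "Der_map ?J L1 proj1 z a\<in>Der L1 (fst z)" using Der_map_Der[OF LP L1 F1 zb a] by (simp add: proj1_eq)
 then obtain s1 where s1: "s1\<in>sections L1" "Der_map ?J L1 proj1 z a = (%r. br1 s1 r (fst z))" using surj1 p(1) by blast
 have "Der_map ?J L2 proj2 z a\<in>Der L2 (fst (snd z))" using Der_map_Der[OF LP L2 F2 zb a] by (simp add: proj2_eq)
 then obtain s2 where s2: "s2\<in>sections L2" "Der_map ?J L2 proj2 z a = (%r. br2 s2 r (fst (snd z)))" using surj2 p(2) by blast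
 let ?s = "%x. pl1 L1 L2 s1 x + pl2 L1 L2 s2 x"
 note P1 = pl1_sections[OF L1 L2] and P2 = pl2_sections[OF L1 L2]
 have s: "?s\<in>sections ?J" by (rule secs_add[OF LP P1[OF s1(1)] P2[OF s2(1)]])
 note bd = jacobiD(1)[OF LP product_bracket(1)]
 have add: "?br ?s r z = ?br (pl1 L1 L2 s1) r z + ?br (pl2 L1 L2 s2) r z" if "r\<in>sections ?J" for r
  by (rule DerD(3)[OF bidersD(5)[OF bd that zb] P1[OF s1(1)] P2[OF s2(1)]])
 have "a = (%r. ?br ?s r z)"
 proof (rule jet_spanning_eq[OF LP prod_spanning zb a bidersD(4)[OF bd s zb]])
  fix g assume "g\<in>prod_gens"
  then consider t where "t\<in>sections L1" "g = pl1 L1 L2 t" | t where "t\<in>sections L2" "g = pl2 L1 L2 t" by (auto simp: prod_gens_def)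
  thus "a g = ?br ?s g z"
  proof cases
   case (1 t)
   have "?br ?s g z = pl1 L1 L2 (br1 s1 t) z" unfolding 1(2) add[OF P1[OF 1(1)]] product_bracket(2)[OF prod_gb.intros(1)[OF s1(1) 1(1)]]
     product_bracket(2)[OF prod_gb.intros(4)[OF 1(1) s2(1)]] by simp
   also have "\<dots> = br1 s1 t (fst z)" by (rule pl1_at[OF L1 L2 bidersD(6)[OF bd1 s1(1) 1(1)] z])
   also have "\<dots> = Der_map ?J L1 proj1 z a t" by (simp only: s1(2))
   also have "\<dots> = a g" using Der_map_sec[OF LP L1 F1 1(1)] by (simp add: 1(2) proj1_eq)
   finally show ?thesis by simp
  next
   case (2 t)
   have "?br ?s g z = pl2 L1 L2 (br2 s2 t) z" unfolding 2(2) add[OF P2[OF 2(1)]] product_bracket(2)[OF prod_gb.intros(2)[OF s2(1) 2(1)]]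
     product_bracket(2)[OF prod_gb.intros(3)[OF s1(1) 2(1)]] by simp
   also have "\<dots> = inv_into (fibre L1 (fst z)) (snd (snd z)) (br2 s2 t (fst (snd z)))" by (rule pl2_at[OF L1 L2 z])
   also have "br2 s2 t (fst (snd z)) = Der_map ?J L2 proj2 z a t" by (simp only: s2(2))
   also have "\<dots> = snd (snd z) (a g)" using Der_map_sec[OF LP L2 F2 2(1)] by (simp add: 2(2) proj2_eq)
   also have "inv_into (fibre L1 (fst z)) (snd (snd z)) \<dots> = a g"
    using lin_isoD(2)[OF i] DerD(2)[OF a P2[OF 2(1)]] by (simp add: 2(2) simps)
   finally show ?thesis by simp
  qed
 qed
 thus ?thesis using s by blast
qed

end

section \<open>Functoriality\<close>

lemma derivations_minus: "line_bundle L ==> a\<in>derivations L ==> (%s x. - a s x)\<in>derivations L"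
 using Der_closed(2)[of L _ _ _ "-1"] secs_minus[of L] by (auto simp: derivations_def)

lemma jacobi_op_bracket:
 assumes L: "line_bundle L" and j: "jacobi L br" shows "jacobi L (op_bracket br)"
proof -
 note bd = jacobiD(1)[OF L j] and i = jacobi_iff[OF L]
 have s: "br s r\<in>sections L" if "s\<in>sections L" "r\<in>sections L" for s r by (rule bidersD(6)[OF bd that])
 have "biders L (op_bracket br)" using bidersD(1-3)[OF bd] derivations_minus[OF L] by (simp add: biders_def op_bracket_def)
 \<comment> \<open>An iterated opposite bracket carries two signs, which cancel.\<close>
 moreover have "op_bracket br s (op_bracket br r t) = br s (br r t)" if "s\<in>sections L" "r\<in>sections L" "t\<in>sections L" for s r t
  using ders_linear(4)[OF L bidersD(2)[OF bd that(1)] s[OF that(2,3)] s[OF that(2,3)]] by (simp add: op_bracket_def)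
 ultimately show ?thesis using j by (simp add: i) (simp add: op_bracket_def)
qed

lemma loc_formed_op:
 assumes L: "line_bundle L" and br: "loc_formed L br" shows "loc_formed L (op_bracket br)" unfolding loc_formed_def
proof (intro conjI ballI)
 show "jacobi L (op_bracket br)" using jacobi_op_bracket[OF L] br by (simp add: loc_formed_def)
 fix x assume "x\<in>pts (base L)"
 then obtain U ph V e La where *: "x\<in>U Int V" "local_form L br U ph V e La" using br unfolding loc_formed_def by metis
 have "local_form L (op_bracket br) U ph V e (%y u v. - La y u v)" unfolding local_form_def
 proof (intro conjI allI ballI)
  have t: "triv L U ph V e" and b: "bilinear (La y)" and f: "smooth_on (triv.img U ph V) (%y. La y u v)"
   "s\<in>sections L ==> r\<in>sections L ==> x\<in>U Int V ==> br s r x = La (ph x) (triv.jr U ph e s x) (triv.jr U ph e r x) *\<^sub>R e x"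
   for y u v s r x using *(2) unfolding local_form_def by blast+
  show "triv L U ph V e" by (rule t)
  show "bilinear (%u v. - La y u v)" for y using b[of y] unfolding bilinear_def by (auto intro: linear_compose_neg)
  show "smooth_on (triv.img U ph V) (%y. - La y u v)" for u v by (rule smooth_on_minus[OF triv.open_img[OF t] f(1)])
  fix s r x assume "s\<in>sections L" "r\<in>sections L" "x\<in>U Int V"
  from f(2)[OF this] show "op_bracket br s r x = - La (ph x) (triv.jr U ph e s x) (triv.jr U ph e r x) *\<^sub>R e x"
   by (simp only: op_bracket_def scaleR_minus_left)
 qed
 thus "\<exists>U ph V e La. x\<in>U Int V & local_form L (op_bracket br) U ph V e La" using *(1) by blast
qed

lemma canonical_loc_formed:
 assumes L: "line_bundle L" shows "loc_formed (JL L) (canonical_bracket L)" unfolding loc_formed_def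
proof (intro conjI ballI canonical_bracket(1)[OF L])
 fix z assume "z\<in>pts (base (JL L))"
 hence z: "z\<in>pts (JM L)" by simp
 obtain U ph V e where t: "jtriv L U ph V e" "z\<in>triv.jU L U V" using jet_pt_jtriv[OF L z] .
 interpret jtriv L U ph V e by fact
 have "local_form (JL L) (canonical_bracket L) jU jph (pts (JM L) Int fst -` V) (e \<circ> fst) canon_form"
  unfolding local_form_def
 proof (intro conjI allI ballI canon_form_bilinear canon_form_smooth J.open_img)
  show "triv (JL L) jU jph (pts (JM L) Int fst -` V) (e \<circ> fst)" by unfold_locales
  fix s r z assume "s\<in>sections (JL L)" "r\<in>sections (JL L)" "z\<in>jU Int (pts (JM L) Int fst -` V)"
  thus "canonical_bracket L s r z = canon_form (jph z) (J.jr s z) (J.jr r z) *\<^sub>R (e \<circ> fst) z"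
   using canonical_bracket(3)[OF L t(1)] by blast
 qed
 moreover have "z\<in>jU Int (pts (JM L) Int fst -` V)" using t(2) J_dm by (auto simp: J.dm_def)
 ultimately show "\<exists>U ph V e La. z\<in>U Int V & local_form (JL L) (canonical_bracket L) U ph V e La" by (intro exI conjI)
qed

section \<open>Identities and composition\<close>

lemma jet_lift_id:
 fixes L :: "('m, 'e::findim, 'l::real_vector) line_bundle"
 assumes L: "line_bundle L" shows "jet_lift L L id_factor = diagonal_relation (JL L)"
proof (intro equalityI subsetI)
 let ?i = "id_factor :: ('m, 'l, 'm, 'l) bundle_map"
 note eq = jet_lift_eq[OF L L id_factor_factor[OF L]]
 fix z assume "z\<in>jet_lift L L ?i"
 then obtain q r where z: "z = ((q, jet L (pull_section L ?i r) q), (fst ?i q, jet L r (fst ?i q)), restrict0 (fibre L q) (snd ?i q))"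
  "q\<in>pts (base L)" "r\<in>sections L" unfolding eq by (elim CollectE exE conjE) (rule that)
 have "z = ((q, jet L r q), (q, jet L r q), restrict0 (fibre L q) (%l. l))" unfolding z(1) pull_section_id[OF z(3)] by (simp add: id_factor_def)
 thus "z\<in>diagonal_relation (JL L)" using jet_Jet[OF L z(2,3)] z(2) by (auto simp: diagonal_relation_def jet_mf_simps)
next
 let ?i = "id_factor :: ('m, 'l, 'm, 'l) bundle_map"
 note eq = jet_lift_eq[OF L L id_factor_factor[OF L]]
 fix z assume "z\<in>diagonal_relation (JL L)"
 then obtain x where x: "z = (x, x, restrict0 (fibre L (fst x)) (%l. l))" "x\<in>pts (JM L)" by (auto simp: diagonal_relation_def)
 obtain q r where q: "x = (q, jet L r q)" "q\<in>pts (base L)" "r\<in>sections L" using jet_pt_obtain[OF L x(2)] .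
 have "z = ((q, jet L (pull_section L ?i r) q), (fst ?i q, jet L r (fst ?i q)), restrict0 (fibre L q) (snd ?i q))"
  unfolding pull_section_id[OF q(3)] x(1) q(1) by (simp add: id_factor_def)
 thus "z\<in>jet_lift L L ?i" unfolding eq using q(2,3) by blast
qed

lemma pull_section_comp:
 assumes L: "line_bundle L1" "line_bundle L2" "line_bundle L3" and F: "factor L1 L2 B" "factor L2 L3 B'" and r: "r\<in>sections L3"
 shows "pull_section L1 (comp_factor B' B) r = pull_section L1 B (pull_section L2 B' r)"
proof
 fix x
 show "pull_section L1 (comp_factor B' B) r x = pull_section L1 B (pull_section L2 B' r) x"
 proof (cases "x\<in>pts (base L1)")
  case True
  note y = smooth_mapD(1)[OF factorD(1)[OF F(1)] True]
  note w = smooth_mapD(1)[OF factorD(1)[OF F(2)] y]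
  note i = factorD(2)[OF F(1) True] and i' = factorD(2)[OF F(2) y]
  define v where "v = inv_into (fibre L1 x) (snd B x) (inv_into (fibre L2 (fst B x)) (snd B' (fst B x)) (r (fst B' (fst B x))))"
  note rw = sectionsD(2)[OF r w] and r2 = lin_isoD(3)[OF i' sectionsD(2)[OF r w]]
  have v: "v\<in>fibre L1 x" unfolding v_def by (rule lin_isoD(3)[OF i r2])
  have vv: "snd B' (fst B x) (snd B x v) = r (fst B' (fst B x))" unfolding v_def lin_isoD(4)[OF i r2] by (rule lin_isoD(4)[OF i' rw])
  have inj: "inj_on (snd (comp_factor B' B) x) (fibre L1 x)"
   using i i' unfolding linear_iso_on_def bij_betw_def comp_factor_def by (auto intro: comp_inj_on)
  have "inv_into (fibre L1 x) (snd (comp_factor B' B) x) (r (fst B' (fst B x))) = v" using inv_into_f_f[OF inj v] vv by (simp add: comp_factor_def)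
  thus ?thesis using True y by (simp add: pull_section_at v_def comp_factor_def)
 qed (simp add: pull_section_def restrict0_def)
qed

text \<open>Smoothness of the coefficient passes through a frame of the middle bundle that depends
  on the point. As the coefficient is named by \<open>coord\<close>, the local choices of frame need
  not match.\<close>

lemma comp_factor_factor:
 assumes L: "line_bundle L1" "line_bundle L2" "line_bundle L3" and F: "factor L1 L2 B" "factor L2 L3 B'"
 shows "factor L1 L3 (comp_factor B' B)"
proof -
 note A = lbD(2)[OF L(1)] lbD(2)[OF L(2)] lbD(2)[OF L(3)]
 note b = factorD(1)[OF F(1)] and b' = factorD(1)[OF F(2)]
 let ?b = "%x. fst B' (fst B x)"
 have sm: "smooth_map (base L1) (base L3) ?b" by (rule smap_comp[OF A b b'])
 have iso: "linear_iso_on (fibre L1 x) (fibre L3 (?b x)) (%l. snd B' (fst B x) (snd B x l))" if x: "x\<in>pts (base L1)" for x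
 proof -
  note i = factorD(2)[OF F(1) x] and i' = factorD(2)[OF F(2) smooth_mapD(1)[OF b x]]
  have "bij_betw (snd B' (fst B x) \<circ> snd B x) (fibre L1 x) (fibre L3 (?b x))"
   using i i' unfolding linear_iso_on_def by (blast intro: bij_betw_trans)
  thus ?thesis using lin_isoD(1,5,6)[OF i] lin_isoD(5,6)[OF i'] unfolding linear_iso_on_def by (simp add: o_def)
 qed
 have g: "\<exists>g. smooth_fun_on (base L1) (U Int ?b -` V) g & (ALL x:U Int ?b -` V. snd B' (fst B x) (snd B x (e x)) = g x *\<^sub>R e' (?b x))"
  if e: "(U, e)\<in>frames L1" "(V, e')\<in>frames L3" for U e V e'
 proof -
  let ?g = "%x. coord (e' (?b x)) (snd B' (fst B x) (snd B x (e x)))"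
  have loc: "\<exists>T. openin (mtop (base L1)) T & x\<in>T & smooth_fun_on (base L1) T ?g & snd B' (fst B x) (snd B x (e x)) = ?g x *\<^sub>R e' (?b x)"
   if x: "x\<in>U Int ?b -` V" for x
  proof -
   have xp: "x\<in>pts (base L1)" using x lbD(6)[OF L(1) e(1)] by blast
   obtain W f where f: "(W, f)\<in>frames L2" "fst B x\<in>W" using frame_obtain[OF L(2) smooth_mapD(1)[OF b xp]] .
   obtain g where g: "smooth_fun_on (base L1) (U Int fst B -` W) g" "ALL x:U Int fst B -` W. snd B x (e x) = g x *\<^sub>R f (fst B x)"
    using factorD(3)[OF F(1) e(1) f(1)] by blast
   obtain h where h: "smooth_fun_on (base L2) (W Int fst B' -` V) h" "ALL y:W Int fst B' -` V. snd B' y (f y) = h y *\<^sub>R e' (fst B' y)"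
    using factorD(3)[OF F(2) f(1) e(2)] by blast
   have oW: "openin (mtop (base L2)) (W Int fst B' -` V)"
   proof -
    have "openin (mtop (base L2)) (W Int (pts (base L2) Int fst B' -` V))"
     by (intro openin_Int smap_openin[OF A(2,3) b'] lbD(5)[OF L(2) f(1)] lbD(5)[OF L(3) e(2)])
    moreover have "W Int (pts (base L2) Int fst B' -` V) = W Int fst B' -` V" using lbD(6)[OF L(2) f(1)] by blast
    ultimately show ?thesis by simp
   qed
   let ?T = "U Int (pts (base L1) Int fst B -` (W Int fst B' -` V))"
   have oT: "openin (mtop (base L1)) ?T" by (intro openin_Int smap_openin[OF A(1,2) b oW] lbD(5)[OF L(1) e(1)])
   have eq: "snd B' (fst B y) (snd B y (e y)) = (g y * h (fst B y)) *\<^sub>R e' (?b y)" if y: "y\<in>?T" for y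
   proof -
    have "snd B' (fst B y) (g y *\<^sub>R f (fst B y)) = g y *\<^sub>R snd B' (fst B y) (f (fst B y))"
     by (rule lin_isoD(6)[OF factorD(2)[OF F(2)] lbD(7)[OF L(2) f(1)]])
      (use y smooth_mapD(1)[OF b] in auto)
    thus ?thesis using g(2) h(2) y by simp
   qed
   have nz: "e' (?b y) ~= 0" if "y\<in>?T" for y using that lbD(8)[OF L(3) e(2)] by blast
   have "smooth_fun_on (base L1) ?T (%x. g x * h (fst B x))" using sfun_comp[OF A(1,2) b oW h(1)]
    by (intro sfun_mult[OF A(1) oT] sfun_subset[OF g(1)] sfun_subset[OF sfun_comp[OF A(1,2) b oW h(1)]]) auto
   hence "smooth_fun_on (base L1) ?T ?g" by (rule sfun_cong[OF A(1) oT]) (simp only: eq coord_scale[OF nz])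
   moreover have "x\<in>?T" using x f(2) xp by blast
   moreover from this have "snd B' (fst B x) (snd B x (e x)) = ?g x *\<^sub>R e' (?b x)" by (simp only: eq coord_scale[OF nz])
   ultimately show ?thesis using oT by blast
  qed
  have "smooth_fun_on (base L1) (U Int ?b -` V) ?g" by (rule sfun_local[OF A(1)]) (use loc in blast)
  thus ?thesis using loc by blast
 qed
 show ?thesis unfolding factor_def comp_factor_def using sm iso g by (auto simp: o_def)
qed

text \<open>Composable elements share a jet over \<open>L2\<close>, represented once by a section
  \<open>r\<close> and once by the pull-back of a section \<open>r'\<close>. Only the jets of these
  sections agree, but the jet of a pull-back depends only on the jet.\<close>

lemma jet_lift_comp:
 assumes L: "line_bundle L1" "line_bundle L2" "line_bundle L3" and F: "factor L1 L2 B" "factor L2 L3 B'"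
 shows "jet_lift L1 L3 (comp_factor B' B) = relation_comp (jet_lift L1 L2 B) (jet_lift L2 L3 B')"
proof -
 note e13 = jet_lift_eq[OF L(1,3) comp_factor_factor[OF L F]] and e12 = jet_lift_eq[OF L(1,2) F(1)] and e23 = jet_lift_eq[OF L(2,3) F(2)]
 \<comment> \<open>Outside the fibre the inner map gives 0, and the outer map sends 0 to 0, so the
   composition is again cut off in the right way.\<close>
 have C: "restrict0 (fibre L2 (fst B q)) (snd B' (fst B q)) \<circ> restrict0 (fibre L1 q) (snd B q) =
   restrict0 (fibre L1 q) (snd (comp_factor B' B) q)" if q: "q\<in>pts (base L1)" for q
 proof -
  note i = factorD(2)[OF F(1) q] and y = smooth_mapD(1)[OF factorD(1)[OF F(1)] q]
  note i' = factorD(2)[OF F(2) y] and s = lbD(3)[OF L(2) y]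
  have "snd B' (fst B q) 0 = 0" using lin_isoD(6)[OF i' subspace_0[OF s], of 0] by simp
  thus ?thesis using lin_isoD(1)[OF i] by (auto simp: restrict0_def comp_factor_def fun_eq_iff)
 qed
 show ?thesis
 proof (intro equalityI subsetI)
  fix z assume "z\<in>jet_lift L1 L3 (comp_factor B' B)"
  then obtain q r where z: "z = ((q, jet L1 (pull_section L1 (comp_factor B' B) r) q), (fst (comp_factor B' B) q, jet L3 r (fst (comp_factor B' B) q)),
    restrict0 (fibre L1 q) (snd (comp_factor B' B) q))" and q: "q\<in>pts (base L1)" and r: "r\<in>sections L3" unfolding e13 by blast
  let ?r = "pull_section L2 B' r"
  have r2: "?r\<in>sections L2" by (rule pull_in[OF L(2,3) F(2) r])
  have "((q, jet L1 (pull_section L1 B ?r) q), (fst B q, jet L2 ?r (fst B q)), restrict0 (fibre L1 q) (snd B q))\<in>jet_lift L1 L2 B"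
   unfolding e12 using q r2 by blast
  moreover have "((fst B q, jet L2 ?r (fst B q)), (fst B' (fst B q), jet L3 r (fst B' (fst B q))), restrict0 (fibre L2 (fst B q)) (snd B' (fst B q)))\<in>jet_lift L2 L3 B'"
   unfolding e23 using smooth_mapD(1)[OF factorD(1)[OF F(1)] q] r by blast
  moreover have "z = ((q, jet L1 (pull_section L1 B ?r) q), (fst B' (fst B q), jet L3 r (fst B' (fst B q))),
    restrict0 (fibre L2 (fst B q)) (snd B' (fst B q)) \<circ> restrict0 (fibre L1 q) (snd B q))"
   unfolding z C[OF q] pull_section_comp[OF L F r] by (simp add: comp_factor_def)
  ultimately show "z\<in>relation_comp (jet_lift L1 L2 B) (jet_lift L2 L3 B')" unfolding relation_comp_def by blast
 next
  fix z assume "z\<in>relation_comp (jet_lift L1 L2 B) (jet_lift L2 L3 B')"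
  then obtain x y w C D where z: "z = (x, w, D \<circ> C)" "(x, y, C)\<in>jet_lift L1 L2 B" "(y, w, D)\<in>jet_lift L2 L3 B'"
   unfolding relation_comp_def by blast
  obtain q r where 1: "x = (q, jet L1 (pull_section L1 B r) q)" "y = (fst B q, jet L2 r (fst B q))" "C = restrict0 (fibre L1 q) (snd B q)"
   "q\<in>pts (base L1)" "r\<in>sections L2" using z(2) unfolding e12 by blast
  obtain q' r' where 2: "y = (q', jet L2 (pull_section L2 B' r') q')" "w = (fst B' q', jet L3 r' (fst B' q'))" "D = restrict0 (fibre L2 q') (snd B' q')"
   "q'\<in>pts (base L2)" "r'\<in>sections L3" using z(3) unfolding e23 by blast
  have q': "q' = fst B q" and jj: "jet L2 r (fst B q) = jet L2 (pull_section L2 B' r') (fst B q)" using 1(2) 2(1) by auto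
  have r2: "pull_section L2 B' r'\<in>sections L2" by (rule pull_in[OF L(2,3) F(2) 2(5)])
  \<comment> \<open>Both pull-backs are evaluated through \<open>Der_map\<close>, which sees the
    sections over \<open>L2\<close> only through their common jet.\<close>
  have "jet L1 (pull_section L1 B r) q a = jet L1 (pull_section L1 B (pull_section L2 B' r')) q a" for a
  proof (cases "a\<in>Der L1 q")
   case True
   show ?thesis using jet_pi_Der_map[OF L(1,2) F(1) 1(4) True 1(5)] jet_pi_Der_map[OF L(1,2) F(1) 1(4) True r2] jj by simp
  qed (simp add: jet_def restrict0_def)
  hence j1: "jet L1 (pull_section L1 B r) q = jet L1 (pull_section L1 (comp_factor B' B) r') q" unfolding pull_section_comp[OF L F 2(5)] by (rule ext)
  have "z = ((q, jet L1 (pull_section L1 (comp_factor B' B) r') q), (fst (comp_factor B' B) q, jet L3 r' (fst (comp_factor B' B) q)),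
    restrict0 (fibre L1 q) (snd (comp_factor B' B) q))" unfolding z(1) 1(1,3) 2(2,3) q' C[OF 1(4)] j1 by (simp add: comp_factor_def)
  thus "z\<in>jet_lift L1 L3 (comp_factor B' B)" unfolding e13 using 1(4) 2(5) by blast
 qed
qed

section \<open>The jet lift is Legendrian\<close>

text \<open>A diffeomorphism \<open>f\<close> with inverse \<open>g\<close> between coordinate
  domains turns a chart into another chart of the maximal atlas. Slice charts of the jet lift arise
  in this way.\<close>

lemma smooth_chart_compose:
 assumes M: "atlas M" and c: "smooth_chart M (U, ph)" and W: "openin (mtop M) W" "W \<subseteq> U"
  and O': "open O'" "f ` ph ` W = O'" and f: "smooth_on (ph ` W) f" and g: "smooth_on O' g" "!!y. y\<in>ph ` W ==> g (f y) = y"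
  and oW: "open (ph ` W)"
 shows "smooth_chart (M::('m, 'e::findim) manifold) (W, %x. f (ph x))"
proof -
 note cd = chartD[OF c]
 have inj: "inj_on (%x. f (ph x)) W"
 proof (rule inj_onI)
  fix x y assume xy: "x\<in>W" "y\<in>W" "f (ph x) = f (ph y)"
  have "ph x = g (f (ph x))" using g(2) xy(1) by simp
  also have "\<dots> = ph y" unfolding xy(3) using g(2) xy(2) by simp
  finally show "x = y" using inj_onD[OF cd(2)] xy W(2) by blast
 qed
 have "compatible (W, %x. f (ph x)) (V, ps)" if d: "(V, ps)\<in>charts M" for V ps
 proof -
  note dd = chartD[OF atlas_ch[OF M d]]
  have o2: "open (ps ` (W Int V))" using chart_image[OF M d W(1)] by (simp add: Int_commute)
  have o1: "open (ph ` (W Int V))"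
  proof -
   have "openin (mtop M) (W Int V)" using W(1) chart_dom[OF M atlas_ch[OF M d]] by blast
   have "open (ph ` W Int ph ` (U Int V))" using oW cd(4)[OF d] by (rule open_Int)
   moreover have "ph ` W Int ph ` (U Int V) = ph ` (W Int V)" using inj_onD[OF cd(2)] W(2) by (auto 4 4)
   ultimately show ?thesis by simp
  qed
  have cg: "continuous_on O' g" by (rule smooth_continuous[OF g(1)])
  have img: "(%x. f (ph x)) ` (W Int V) = O' Int g -` (ph ` (W Int V))"
  proof (intro equalityI subsetI)
   fix y assume "y\<in>(%x. f (ph x)) ` (W Int V)"
   thus "y\<in>O' Int g -` (ph ` (W Int V))" using O'(2) g(2) by auto
  next
   fix y assume y: "y\<in>O' Int g -` (ph ` (W Int V))"
   then obtain x x' where x: "x\<in>W" "y = f (ph x)" "x'\<in>W Int V" "g y = ph x'" using O'(2) by auto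
   have "ph x = ph x'" using g(2)[of "ph x"] x by simp
   hence "x = x'" using inj_onD[OF cd(2)] x W(2) by blast
   thus "y\<in>(%x. f (ph x)) ` (W Int V)" using x by blast
  qed
  have o3: "open ((%x. f (ph x)) ` (W Int V))" unfolding img using continuous_open_preimage[OF cg O'(1) o1] .
  have gi: "g y\<in>ph ` (W Int V)" if "y\<in>(%x. f (ph x)) ` (W Int V)" for y using that unfolding img by blast
  have o4: "open (ph ` (U Int V))" by (rule cd(4)[OF d])
  have "smooth_on ((%x. f (ph x)) ` (W Int V)) (%y. ps (inv_into U ph (g y)))"
   by (rule smooth_comp[OF o3 o4 smooth_subset[OF g(1)] _ cd(6)[OF d]]) (use gi W(2) img in auto)
  hence s1: "smooth_on ((%x. f (ph x)) ` (W Int V)) (%y. ps (inv_into W (%x. f (ph x)) y))"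
  proof (rule smooth_cong[OF _ o3])
   fix y assume "y\<in>(%x. f (ph x)) ` (W Int V)"
   then obtain x where x: "x\<in>W" "y = f (ph x)" by blast
   have "inv_into W (%x. f (ph x)) y = x" unfolding x(2) by (rule inv_into_f_f[OF inj x(1)])
   moreover have "inv_into U ph (g y) = x" using x g(2)[of "ph x"] inv_into_f_f[OF cd(2), of x] W(2) by auto
   ultimately show "ps (inv_into U ph (g y)) = ps (inv_into W (%x. f (ph x)) y)" by simp
  qed
  have "smooth_on (ps ` (W Int V)) (%y. f (ph (inv_into V ps y)))" by (rule smooth_comp[OF o2 oW smooth_subset[OF cd(7)[OF d]] _ f])
    (use W(2) inv_into_f_f[OF dd(2)] in \<open>auto simp: image_iff\<close>)
  thus ?thesis using o2 o3 s1 unfolding compatible_def o_def by simp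
 qed
 moreover have "open ((%x. f (ph x)) ` W)" using O' by (simp add: image_image)
 ultimately show ?thesis using inj W(2) cd(1) unfolding smooth_chart_def by auto
qed

text \<open>\<open>A\<close> need not be related to a single derivation of \<open>L2\<close>, as the base map is arbitrary.\<close>

definition related where
 "related L1 L2 B A b f \<longleftrightarrow> A\<in>derivations L1 & (ALL c:onb. b c\<in>derivations L2 & f c\<in>Cinf (base L1)) \<and>
  (ALL r:sections L2. A (pull_section L1 B r) = (%x. \<Sum>c\<in>onb. f c x *\<^sub>R pull_section L1 B (b c r) x))"

lemma jet_pull_linear: "linear (jet_pull H \<tau> y)" by (rule linearI)
  (auto simp: jet_pull_def algebra_simps inner_add_left scaleR_sum_right simp flip: sum.distrib intro!: sum.cong)

text \<open>Pull-back acts on 1-jets by the linear map \<open>jet_pull\<close>. Expanding the jet of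
  \<open>r\<close> in \<open>onb\<close> writes the image of a pull-back as a combination of
  pull-backs under derivations \<open>b c\<close> with constant coefficients. The value of
  \<open>A\<close> at \<open>q\<close> remains arbitrary.\<close>

lemma (in factor_triv) related_obtain:
 assumes q: "q\<in>fdom"
 shows "\<exists>A b f. related L1 L2 B A (b :: 'f \<times> real => _) f & (%s. A s q) = t1.der w q"
proof -
 note A1 = lbD(2)[OF t1.L] and A2 = lbD(2)[OF t2.L]
 let ?b = "fst B"
 have bq: "?b q\<in>t2.dm" by (rule fdomD(2)[OF q])
 obtain ka2 W2 Z2 where k2: "ka2\<in>Cinf (base L2)" "openin (mtop (base L2)) W2" "?b q\<in>W2" "W2 \<subseteq> t2.dm" "ALL y:W2. ka2 y = 1"
  "openin (mtop (base L2)) Z2" "t2.dm Un Z2 = pts (base L2)" "ALL y:Z2. ka2 y = 0"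
  using manifold_bump[OF lbD(1)[OF t2.L] t2.opn_dm bq] by (elim bexE exE conjE) (rule that)
 \<comment> \<open>Over \<open>?T\<close> the base map lands where \<open>ka2\<close> is 1. As
   \<open>ka1\<close> is 0 outside \<open>?T\<close>, the cut-off of the derivations
   \<open>b c\<close> leaves no trace in the relation.\<close>
 let ?T = "fdom Int (pts (base L1) Int ?b -` W2)"
 have oT: "openin (mtop (base L1)) ?T" by (intro openin_Int opn_fdom smap_openin[OF A1 A2 factorD(1)[OF F] k2(2)])
 have qT: "q\<in>?T" using q k2(3) t1.dm_pts[OF fdomD(1)[OF q]] by simp
 obtain ka1 W1 Z1 where k1: "ka1\<in>Cinf (base L1)" "openin (mtop (base L1)) W1" "q\<in>W1" "W1 \<subseteq> ?T" "ALL y:W1. ka1 y = 1"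
  "openin (mtop (base L1)) Z1" "?T Un Z1 = pts (base L1)" "ALL y:Z1. ka1 y = 0"
  using manifold_bump[OF lbD(1)[OF t1.L] oT qT] by (elim bexE exE conjE) (rule that)
 let ?S = "ph1 ` ?T"
 have oS: "open ?S"
 proof -
  have "?T = t1.dm Int ?T" using fdomD(1) by blast
  thus ?thesis using t1.open_image[OF oT] by simp
 qed
 have dS: "t1.dm Int ph1 -` ?S = ?T"
 proof (intro equalityI subsetI)
  fix x assume "x\<in>t1.dm Int ph1 -` ?S"
  then obtain y where y: "x\<in>t1.dm" "y\<in>?T" "ph1 x = ph1 y" by auto
  have "y\<in>t1.dm" using y(2) fdomD(1) by blast
  hence "x = y" using t1.pt_phi[OF y(1)] unfolding y(3) by (simp only: t1.pt_phi)
  thus "x\<in>?T" using y(2) by simp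
 qed (use fdomD(1) in auto)
 define A where "A = (%s z. if z\<in>t1.dm Int ph1 -` ?S then ka1 z *\<^sub>R t1.der w z s else 0)"
 have Ad: "A\<in>derivations L1" unfolding A_def by (rule t1.cutoff_derivation[OF oS smooth_const k1(1,6)]) (use k1 dS in auto)
 define b where "b c = (%s z. if z\<in>t2.dm Int ph2 -` UNIV then ka2 z *\<^sub>R t2.der c z s else 0)" for c
 have bd: "b c\<in>derivations L2" for c unfolding b_def by (rule t2.cutoff_derivation[OF open_UNIV smooth_const k2(1,6)]) (use k2 in auto)
 \<comment> \<open>The coefficient of the jet component \<open>c\<close>; the factor
   \<open>inverse (fH (ph1 x))\<close> undoes the factor \<open>fH\<close> that pull-back introduces
   in the frames.\<close>
 define h where "h c x = (w\<bullet>jet_pull fH ftau (ph1 x) c) * inverse (fH (ph1 x))" for c x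
 define f where "f c x = ka1 x * h c x" for c x
 have T0: "ka1 x = 0" if "x \<notin> ?T" for x
 proof (cases "x\<in>pts (base L1)")
  case True thus ?thesis using k1(7,8) that by blast
 qed (rule CinfD(2)[OF k1(1)])
 have fd: "f c\<in>Cinf (base L1)" for c unfolding f_def
 proof (rule cutoff_smooth[OF A1 k1(1) oT k1(6,7)])
  show "ka1 y = 0" if "y\<in>Z1" for y using k1(8) that by blast
  have sp: "smooth_on (ph1 ` fdom) (%y. jet_pull fH ftau y c)"
   by (rule smooth_comp[OF open_fimg _ _ _ smooth_jet_pull[OF open_fimg fH_smooth ftau_smooth], of "%y. (y, c)", simplified])
    (auto intro!: open_Times open_fimg smooth_Pair smooth_ident smooth_const)
  show "smooth_fun_on (base L1) ?T (h c)"
  proof (rule t1.fun_smoothI[OF oT _ open_fimg])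
   show "?T \<subseteq> t1.dm" using fdomD(1) by blast
   show "smooth_on (ph1 ` fdom) (%y. (w\<bullet>jet_pull fH ftau y c) * inverse (fH y))"
    by (intro smooth_on_mult[OF open_fimg] smooth_on_inner[OF open_fimg] smooth_inverse[OF open_fimg] smooth_const fH_smooth sp)
     (use fH_nz in auto)
  qed (auto simp: h_def)
 qed
 have rel: "A (pull_section L1 B r) x = (\<Sum>c\<in>onb. f c x *\<^sub>R pull_section L1 B (b c r) x)" if r: "r\<in>sections L2" for r x
 proof (cases "x\<in>?T")
  case False
  thus ?thesis using T0[OF False] dS by (simp add: A_def f_def)
 next
  case True
  hence x: "x\<in>fdom" "?b x\<in>W2" by auto
  note d = fdomD[OF x(1)]
  have pr: "pull_section L1 B r\<in>sections L1" by (rule pull_in[OF t1.L t2.L F r])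
  have "jet_pull fH ftau (ph1 x) (t2.jr r (?b x)) = (\<Sum>c\<in>onb. (t2.jr r (?b x)\<bullet>c) *\<^sub>R jet_pull fH ftau (ph1 x) c)"
   by (rule linear_onb[OF jet_pull_linear])
  hence "A (pull_section L1 B r) x = (ka1 x * (w\<bullet>(\<Sum>c\<in>onb. (t2.jr r (?b x)\<bullet>c) *\<^sub>R jet_pull fH ftau (ph1 x) c))) *\<^sub>R e1 x"
   using True dS by (simp add: A_def t1.der_sec[OF pr] jr_pull[OF r x(1)] del: fst_jet1 snd_jet1)
  also have "\<dots> = (\<Sum>c\<in>onb. (ka1 x * ((t2.jr r (?b x)\<bullet>c) * (w\<bullet>jet_pull fH ftau (ph1 x) c))) *\<^sub>R e1 x)"
   by (simp add: inner_sum_right sum_distrib_left scaleR_sum_left del: fst_jet1 snd_jet1)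
  also have "\<dots> = (\<Sum>c\<in>onb. f c x *\<^sub>R pull_section L1 B (b c r) x)"
  proof (rule sum.cong[OF refl])
   fix c :: "'f \<times> real"
   have br: "b c r\<in>sections L2" by (rule dersD(1)[OF bd r])
   have "t2.rep (b c r) (ph2 (?b x)) = c\<bullet>t2.jr r (?b x)"
    using d(2) k2(5) x(2) by (simp add: t2.rep_phi[OF d(2)] b_def t2.der_sec[OF r] coord_scale[OF t2.e_nz[OF d(2)]])
   hence "t1.rep (pull_section L1 B (b c r)) (ph1 x) = fH (ph1 x) * (c\<bullet>t2.jr r (?b x))" by (simp only: rep_pull[OF br x(1)] ftau_phi[OF x(1)])
   hence "pull_section L1 B (b c r) x = (fH (ph1 x) * (c\<bullet>t2.jr r (?b x))) *\<^sub>R e1 x"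
    using t1.rep_section[OF d(1) pull_in[OF t1.L t2.L F br]] by metis
   thus "(ka1 x * ((t2.jr r (?b x)\<bullet>c) * (w\<bullet>jet_pull fH ftau (ph1 x) c))) *\<^sub>R e1 x = f c x *\<^sub>R pull_section L1 B (b c r) x"
    using fH_nz[OF x(1)] by (simp add: f_def h_def inner_commute[of c] del: fst_jet1 snd_jet1)
  qed
  finally show ?thesis .
 qed
 have "related L1 L2 B A b f" unfolding related_def using Ad bd fd rel by blast
 moreover have "(%s. A s q) = t1.der w q" unfolding A_def dS using qT k1(3,5) by simp
 ultimately show ?thesis by blast
qed

lemma zero_Der:
 assumes L: "line_bundle L" and x: "x\<in>pts (base L)" shows "(%s. 0)\<in>Der L x"
proof -
 obtain U ph V e where t: "triv L U ph V e" "x\<in>U Int V" using triv_obtain[OF L x] .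
 interpret triv L U ph V e by fact
 show ?thesis using der_Der[of x 0] t(2) by (simp add: der_zero dm_def)
qed

lemma zero_derivation: "line_bundle L ==> (%s x. 0)\<in>derivations L" by (simp add: derivations_def secs_zero zero_Der)

section \<open>Equations of the graph and their brackets\<close>

abbreviation (input) jprod where "jprod L1 L2 \<equiv> line_product (JL L1) (JL L2)"

abbreviation (input) jbr where "jbr L1 L2 \<equiv>
 product_bracket (JL L1) (canonical_bracket L1) (JL L2) (op_bracket (canonical_bracket L2))"

abbreviation (input) jbase where "jbase L1 L2 \<equiv> base_product (JL L1) (JL L2)"

text \<open>The four kinds of generators of the line product of two jet bundles: basic or linear,
  from the first or the second factor.\<close>

definition pi1 where "pi1 L1 L2 s = pl1 (JL L1) (JL L2) (jet_pull_section L1 s)"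
definition la1 where "la1 L1 L2 a = pl1 (JL L1) (JL L2) (jet_linear_section L1 a)"
definition pi2 where "pi2 L1 L2 s = pl2 (JL L1) (JL L2) (jet_pull_section L2 s)"
definition la2 where "la2 L1 L2 a = pl2 (JL L1) (JL L2) (jet_linear_section L2 a)"

definition base_fun where "base_fun L1 L2 f = restrict0 (pts (jbase L1 L2)) (%z. f (fst (fst z)))"

definition lift_pi where
 "lift_pi L1 L2 B r = (%z. pi1 L1 L2 (pull_section L1 B r) z - pi2 L1 L2 r z)"

definition lift_la where
 "lift_la L1 L2 A b f = (%z. la1 L1 L2 A z - (\<Sum>c\<in>onb. base_fun L1 L2 (f c) z *\<^sub>R la2 L1 L2 (b c) z))"

context
 fixes L1 :: "('m, 'e::findim, 'l::real_vector) line_bundle" and L2 :: "('n, 'f::findim, 'k::real_vector) line_bundle"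
  and B :: "('m, 'l, 'n, 'k) bundle_map"
 assumes L1: "line_bundle L1" and L2: "line_bundle L2" and F: "factor L1 L2 B"
begin

lemmas lift_basics = jet_line_bundle[OF L1] jet_line_bundle[OF L2] lp_lb[OF jet_line_bundle[OF L1] jet_line_bundle[OF L2]]
lemmas lift_formed = canonical_loc_formed[OF L1] loc_formed_op[OF jet_line_bundle[OF L2] canonical_loc_formed[OF L2]]
lemmas lift_bracket = product_bracket[OF jet_line_bundle[OF L1] jet_line_bundle[OF L2] lift_formed]
lemmas lift_bd = jacobiD(1)[OF lift_basics(3) lift_bracket(1)]
lemmas jprod_simps = lp_simps[OF jet_line_bundle[OF L1] jet_line_bundle[OF L2]]

lemma lift_in:
 "s\<in>sections L1 ==> pi1 L1 L2 s\<in>sections (jprod L1 L2)" "a\<in>derivations L1 ==> la1 L1 L2 a\<in>sections (jprod L1 L2)"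
 "r\<in>sections L2 ==> pi2 L1 L2 r\<in>sections (jprod L1 L2)" "b\<in>derivations L2 ==> la2 L1 L2 b\<in>sections (jprod L1 L2)"
 unfolding pi1_def la1_def pi2_def la2_def
 by (intro pl1_sections pl2_sections lift_basics(1,2) jet_pull_in jet_linear_in L1 L2; assumption)+

lemma base_fun_Cinf: "f\<in>Cinf (base L1) ==> base_fun L1 L2 f\<in>Cinf (jbase L1 L2)"
proof -
 assume f: "f\<in>Cinf (base L1)"
 have "restrict0 (pts (JM L1)) (%x. f (fst x))\<in>Cinf (JM L1)" using Cinf_pull[OF lift_basics(1) L1 jet_factor[OF L1] f] by simp
 hence "restrict0 (pts (jbase L1 L2)) (%z. restrict0 (pts (JM L1)) (%x. f (fst x)) (fst z))\<in>Cinf (jbase L1 L2)"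
  using Cinf_pull[OF lift_basics(3,1) proj1_factor[OF lift_basics(1,2)], of "restrict0 (pts (JM L1)) (%x. f (fst x))"]
  by (simp add: jprod_simps proj1_eq)
 moreover have "restrict0 (pts (jbase L1 L2)) (%z. restrict0 (pts (JM L1)) (%x. f (fst x)) (fst z)) = base_fun L1 L2 f"
  by (auto simp: base_fun_def restrict0_def bp_simps)
 ultimately show ?thesis by simp
qed

lemma lift_pi_sections: "r\<in>sections L2 ==> lift_pi L1 L2 B r\<in>sections (jprod L1 L2)"
 unfolding lift_pi_def by (intro secs_diff[OF lift_basics(3)] lift_in pull_in[OF L1 L2 F])

lemma relatedD:
 assumes "related L1 L2 B A b f"
 shows "A\<in>derivations L1" "c\<in>onb ==> b c\<in>derivations L2" "c\<in>onb ==> f c\<in>Cinf (base L1)"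
  "r\<in>sections L2 ==> A (pull_section L1 B r) x = (\<Sum>c\<in>onb. f c x *\<^sub>R pull_section L1 B (b c r) x)"
 using assms by (auto simp: related_def)

lemma lift_la_terms:
 assumes R: "related L1 L2 B A b f" and c: "c\<in>onb"
 shows "(%z. base_fun L1 L2 (f c) z *\<^sub>R la2 L1 L2 (b c) z)\<in>sections (jprod L1 L2)"
 by (rule secs_mult[OF lift_basics(3) _ lift_in(4)[OF relatedD(2)[OF R c]]])
  (simp add: jprod_simps base_fun_Cinf[OF relatedD(3)[OF R c]])

lemma lift_la_sections:
 assumes R: "related L1 L2 B A b f"
 shows "(%z. \<Sum>c\<in>onb. base_fun L1 L2 (f c) z *\<^sub>R la2 L1 L2 (b c) z)\<in>sections (jprod L1 L2)"
  "lift_la L1 L2 A b f\<in>sections (jprod L1 L2)"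
proof -
 show 1: "(%z. \<Sum>c\<in>onb. base_fun L1 L2 (f c) z *\<^sub>R la2 L1 L2 (b c) z)\<in>sections (jprod L1 L2)"
  by (rule secs_sum[OF lift_basics(3) lift_la_terms[OF R]])
 show "lift_la L1 L2 A b f\<in>sections (jprod L1 L2)"
  unfolding lift_la_def by (rule secs_diff[OF lift_basics(3) lift_in(2)[OF relatedD(1)[OF R]] 1])
qed

context
 fixes q r0 z
 assumes q: "q\<in>pts (base L1)" and r0: "r0\<in>sections L2"
  and z: "z = ((q, jet L1 (pull_section L1 B r0) q), (fst B q, jet L2 r0 (fst B q)), restrict0 (fibre L1 q) (snd B q))"
begin

abbreviation (input) "pb \<equiv> pull_section L1 B"

lemma pb: "r\<in>sections L2 ==> pb r\<in>sections L1" by (rule pull_in[OF L1 L2 F])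

lemma bq: "fst B q\<in>pts (base L2)" by (rule smooth_mapD(1)[OF factorD(1)[OF F] q])

lemma lift_pt: "z\<in>pts (jbase L1 L2)" "fst z\<in>pts (JM L1)" "fst (snd z)\<in>pts (JM L2)"
proof -
 note i = factorD(2)[OF F q]
 have "bij_betw (restrict0 (fibre L1 q) (snd B q)) (fibre L1 q) (fibre L2 (fst B q))"
  using i unfolding linear_iso_on_def by (auto simp: restrict0_def cong: bij_betw_cong)
 hence "linear_iso_on (fibre L1 q) (fibre L2 (fst B q)) (restrict0 (fibre L1 q) (snd B q))"
  using lin_isoD(5,6)[OF i] lbD(3)[OF L1 q] unfolding linear_iso_on_def by (simp add: restrict0_def subspace_add subspace_scale)
 thus "z\<in>pts (jbase L1 L2)" "fst z\<in>pts (JM L1)" "fst (snd z)\<in>pts (JM L2)"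
  using q bq jet_Jet[OF L1 q pb[OF r0]] jet_Jet[OF L2 bq r0] by (simp_all add: z bp_simps jet_mf_simps zero_off_def restrict0_def)
qed

lemma inv_pull: "inv_into (fibre L1 q) (restrict0 (fibre L1 q) (snd B q)) (r (fst B q)) = pb r q"
proof -
 have "inv_into (fibre L1 q) (restrict0 (fibre L1 q) (snd B q)) v = inv_into (fibre L1 q) (snd B q) v" for v
  unfolding inv_into_def restrict0_def by (rule arg_cong[of _ _ Eps]) auto
 thus ?thesis by (simp add: pull_section_at[OF q])
qed

text \<open>At a point of the graph the generators of both factors are expressed through pull-backs
  along \<open>B\<close> in the one line over \<open>q\<close>. All brackets of generators at this
  point become identities between such vectors.\<close>

lemma lift_at:
 "s\<in>sections L1 ==> pi1 L1 L2 s z = s q" "a\<in>derivations L1 ==> la1 L1 L2 a z = a (pb r0) q"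
 "r\<in>sections L2 ==> pi2 L1 L2 r z = pb r q" "b\<in>derivations L2 ==> la2 L1 L2 b z = pb (b r0) q"
proof -
 note p1 = pl1_at[OF lift_basics(1,2) _ lift_pt(1)] and p2 = pl2_at[OF lift_basics(1,2) lift_pt(1)]
 have s: "fst z = (q, jet L1 (pb r0) q)" "fst (snd z) = (fst B q, jet L2 r0 (fst B q))" "snd (snd z) = restrict0 (fibre L1 q) (snd B q)"
  "fibre (JL L1) (fst z) = fibre L1 q" by (simp_all add: z)
 show "pi1 L1 L2 s z = s q" if "s\<in>sections L1"
  unfolding pi1_def p1[OF jet_pull_in[OF L1 that]] jet_pi_at[OF lift_pt(2)] by (simp add: s)
 show "la1 L1 L2 a z = a (pb r0) q" if "a\<in>derivations L1"
  unfolding la1_def p1[OF jet_linear_in[OF L1 that]] s(1) by (rule jet_linear_at[OF L1 that q pb[OF r0]])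
 show "pi2 L1 L2 r z = pb r q" if "r\<in>sections L2"
  unfolding pi2_def p2 jet_pi_at[OF lift_pt(3)] unfolding s jet_lb_simps fst_conv by (rule inv_pull)
 show "la2 L1 L2 b z = pb (b r0) q" if "b\<in>derivations L2"
  unfolding la2_def p2 s jet_lb_simps fst_conv jet_linear_at[OF L2 that bq r0] by (rule inv_pull)
qed

lemma base_fun_at: "base_fun L1 L2 f z = f q" using lift_pt(1) by (simp add: base_fun_def restrict0_def z)

lemma lift_vanish:
 "r\<in>sections L2 ==> lift_pi L1 L2 B r z = 0" "related L1 L2 B A b f ==> lift_la L1 L2 A b f z = 0"
proof -
 show "r\<in>sections L2 ==> lift_pi L1 L2 B r z = 0" by (simp add: lift_pi_def lift_at pb)
 assume R: "related L1 L2 B A b f"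
 have "(\<Sum>c\<in>onb. base_fun L1 L2 (f c) z *\<^sub>R la2 L1 L2 (b c) z) = A (pb r0) q"
  unfolding relatedD(4)[OF R r0] by (rule sum.cong[OF refl]) (simp add: base_fun_at lift_at(4)[OF relatedD(2)[OF R]])
 thus "lift_la L1 L2 A b f z = 0" by (simp add: lift_la_def lift_at(2)[OF relatedD(1)[OF R]])
qed

abbreviation (input) "brz g h \<equiv> jbr L1 L2 g h z"

lemma zb: "z\<in>pts (base (jprod L1 L2))" using lift_pt(1) by (simp add: jprod_simps)

lemma brz_Der: "g\<in>sections (jprod L1 L2) ==> (%h. brz g h)\<in>Der (jprod L1 L2) z"
 "g\<in>sections (jprod L1 L2) ==> (%h. brz h g)\<in>Der (jprod L1 L2) z" using bidersD(4,5)[OF lift_bd _ zb] by auto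

lemma brz_skew: "brz g h = - brz h g" by (rule fun_cong[OF jacobiD(2)[OF lift_basics(3) lift_bracket(1)]])

lemma brz_mixed:
 assumes "s\<in>sections L1" "a\<in>derivations L1" "r\<in>sections L2" "b\<in>derivations L2"
 shows "brz (pi1 L1 L2 s) (pi2 L1 L2 r) = 0" "brz (pi1 L1 L2 s) (la2 L1 L2 b) = 0" "brz (la1 L1 L2 a) (pi2 L1 L2 r) = 0" "brz (la1 L1 L2 a) (la2 L1 L2 b) = 0"
  "brz (pi2 L1 L2 r) (pi1 L1 L2 s) = 0" "brz (la2 L1 L2 b) (pi1 L1 L2 s) = 0" "brz (pi2 L1 L2 r) (la1 L1 L2 a) = 0" "brz (la2 L1 L2 b) (la1 L1 L2 a) = 0"
 unfolding pi1_def pi2_def la1_def la2_def using lift_bracket(2)[OF prod_gb.intros(3)] lift_bracket(2)[OF prod_gb.intros(4)]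
  jet_pull_in[OF L1 assms(1)] jet_pull_in[OF L2 assms(3)]
  jet_linear_in[OF L1 assms(2)] jet_linear_in[OF L2 assms(4)] by simp_all

lemma brz_1:
 assumes "s\<in>sections L1" "s'\<in>sections L1" "a\<in>derivations L1" "a'\<in>derivations L1"
 shows "brz (pi1 L1 L2 s) (pi1 L1 L2 s') = 0" "brz (pi1 L1 L2 s) (la1 L1 L2 a) = - a s q" "brz (la1 L1 L2 a) (pi1 L1 L2 s) = a s q"
  "brz (la1 L1 L2 a) (la1 L1 L2 a') = a (a' (pb r0)) q - a' (a (pb r0)) q"
proof -
 note P = jet_pull_in[OF L1] and l = jet_linear_in[OF L1]
 note b = lift_bracket(2)[OF prod_gb.intros(1)] and c = canonical_bracket(2)[OF L1]
 note as = dersD(1)[OF assms(3,1)] and cm = comm_ders[OF L1 assms(3,4)]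
 show "brz (pi1 L1 L2 s) (pi1 L1 L2 s') = 0" unfolding pi1_def b[OF P[OF assms(1)] P[OF assms(2)]] c[OF jet_gb.intros(4)[OF assms(1,2)]]
  using pull_linear(6)[OF lift_basics(3,1) proj1_factor[OF lift_basics(1,2)] P[OF assms(1)] P[OF assms(1)]] by simp
 show "brz (pi1 L1 L2 s) (la1 L1 L2 a) = - a s q"
  unfolding pi1_def la1_def b[OF P[OF assms(1)] l[OF assms(3)]] c[OF jet_gb.intros(3)[OF assms(3,1)]]
  by (rule lift_at(1)[OF secs_minus[OF L1 as], unfolded pi1_def])
 show "brz (la1 L1 L2 a) (pi1 L1 L2 s) = a s q"
  unfolding pi1_def la1_def b[OF l[OF assms(3)] P[OF assms(1)]] c[OF jet_gb.intros(2)[OF assms(3,1)]]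
  by (rule lift_at(1)[OF as, unfolded pi1_def])
 show "brz (la1 L1 L2 a) (la1 L1 L2 a') = a (a' (pb r0)) q - a' (a (pb r0)) q"
  unfolding la1_def b[OF l[OF assms(3)] l[OF assms(4)]] c[OF jet_gb.intros(1)[OF assms(3,4)]]
  using lift_at(2)[OF cm] unfolding la1_def by (simp add: commutator_def)
qed

text \<open>The signs are opposite to those of \<open>brz_1\<close>, because the second factor
  carries the opposite bracket.\<close>

lemma brz_2:
 assumes "r\<in>sections L2" "r'\<in>sections L2" "b\<in>derivations L2" "b'\<in>derivations L2"
 shows "brz (pi2 L1 L2 r) (pi2 L1 L2 r') = 0" "brz (pi2 L1 L2 r) (la2 L1 L2 b) = pb (b r) q" "brz (la2 L1 L2 b) (pi2 L1 L2 r) = - pb (b r) q"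
  "brz (la2 L1 L2 b) (la2 L1 L2 b') = pb (b' (b r0)) q - pb (b (b' r0)) q"
proof -
 note P = jet_pull_in[OF L2] and l = jet_linear_in[OF L2]
 note b = lift_bracket(2)[OF prod_gb.intros(2)] and c = canonical_bracket(2)[OF L2]
 note as = dersD(1)[OF assms(3,1)] and cm = comm_ders[OF L2 assms(3,4)]
 have neg: "pl2 (JL L1) (JL L2) (%x. - s x) = (%x. - pl2 (JL L1) (JL L2) s x)"
  if "s\<in>sections (JL L2)" for s by (rule pull_linear(4)[OF lift_basics(3,2) proj2_factor[OF lift_basics(1,2)] that that])
 have op: "op_bracket (canonical_bracket L2) s r = (%x. - canonical_bracket L2 s r x)" for s r by (simp add: op_bracket_def)
 show "brz (pi2 L1 L2 r) (pi2 L1 L2 r') = 0" unfolding pi2_def b[OF P[OF assms(1)] P[OF assms(2)]] op c[OF jet_gb.intros(4)[OF assms(1,2)]]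
  using pull_linear(6)[OF lift_basics(3,2) proj2_factor[OF lift_basics(1,2)] P[OF assms(1)] P[OF assms(1)]] by simp
 have "brz (pi2 L1 L2 r) (la2 L1 L2 b) = - pi2 L1 L2 (%x. - b r x) z"
  unfolding pi2_def la2_def b[OF P[OF assms(1)] l[OF assms(3)]] op c[OF jet_gb.intros(3)[OF assms(3,1)]]
   neg[OF P[OF secs_minus[OF L2 as]]] by (rule refl)
 also have "\<dots> = pb (b r) q" unfolding lift_at(3)[OF secs_minus[OF L2 as]] pull_linear(4)[OF L1 L2 F as as] by simp
 finally show "brz (pi2 L1 L2 r) (la2 L1 L2 b) = pb (b r) q" .
 thus "brz (la2 L1 L2 b) (pi2 L1 L2 r) = - pb (b r) q" using brz_skew[of "la2 L1 L2 b"] by simp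
 have "brz (la2 L1 L2 b) (la2 L1 L2 b') = - la2 L1 L2 (commutator b b') z"
  unfolding la2_def b[OF l[OF assms(3)] l[OF assms(4)]] op c[OF jet_gb.intros(1)[OF assms(3,4)]] neg[OF l[OF cm]] by (rule refl)
 also have "la2 L1 L2 (commutator b b') z = pb (b (b' r0)) q - pb (b' (b r0)) q" unfolding lift_at(4)[OF cm]
  using pull_linear(3)[OF L1 L2 F dersD(1)[OF assms(3) dersD(1)[OF assms(4) r0]] dersD(1)[OF assms(4) dersD(1)[OF assms(3) r0]]]
  by (simp add: commutator_def)
 finally show "brz (la2 L1 L2 b) (la2 L1 L2 b') = pb (b' (b r0)) q - pb (b (b' r0)) q" by simp
qed

text \<open>The coefficients in \<open>lift_la\<close> come from the base of \<open>L1\<close>, so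
  \<open>D\<close> differentiates them with the symbol of the derivation \<open>c\<close> that it
  induces on basic sections. A section \<open>s0\<close> that does not vanish at \<open>q\<close>
  identifies the two symbols.\<close>

lemma Der_base_fun:
 assumes D: "D\<in>Der (jprod L1 L2) z" and c: "c\<in>Der L1 q" and Dc: "ALL s:sections L1. D (pi1 L1 L2 s) = c s"
  and f: "f\<in>Cinf (base L1)" and s: "s\<in>sections (jprod L1 L2)"
 shows "D (%y. base_fun L1 L2 f y *\<^sub>R s y) = f q *\<^sub>R D s + symbol L1 q c f *\<^sub>R s z"
proof -
 have bf: "base_fun L1 L2 f\<in>Cinf (base (jprod L1 L2))" using base_fun_Cinf[OF f] by (simp add: jprod_simps)
 note sD = symbol_Der(2)[OF lift_basics(3) zb D bf]
 obtain U ph V e where t: "triv L1 U ph V e" "q\<in>U Int V" using triv_obtain[OF L1 q] .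
 interpret t: triv L1 U ph V e by fact
 have qd: "q\<in>t.dm" using t(2) by (simp add: t.dm_def)
 obtain s0 where s0: "s0\<in>sections L1" "t.jr s0 q = (0, 1)" using t.jr_obtain[OF qd] .
 have "t.rep s0 (ph q) = 1" using s0(2) by (metis snd_jet1 snd_conv)
 hence nz: "s0 q ~= 0" using t.rep_section[OF qd s0(1)] t.e_nz[OF qd] by auto
 have fs: "(%x. f x *\<^sub>R s0 x)\<in>sections L1" by (rule secs_mult[OF L1 f s0(1)])
 have "pi1 L1 L2 (%x. f x *\<^sub>R s0 x) = (%y. base_fun L1 L2 f y *\<^sub>R pi1 L1 L2 s0 y)"
 proof
  fix y show "pi1 L1 L2 (%x. f x *\<^sub>R s0 x) y = base_fun L1 L2 f y *\<^sub>R pi1 L1 L2 s0 y"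
  proof (cases "y\<in>pts (jbase L1 L2)")
   case True
   hence y: "fst y\<in>pts (JM L1)" by (auto simp: bp_simps)
   note p1 = pl1_at[OF lift_basics(1,2) jet_pull_in[OF L1] True]
   show ?thesis unfolding pi1_def p1[OF fs] p1[OF s0(1)] jet_pi_at[OF y] using True by (simp add: base_fun_def restrict0_def)
  next
   case False
   thus ?thesis unfolding pi1_def using pl_off(1)[OF lift_basics(1,2) False] by simp
  qed
 qed
 hence "D (%y. base_fun L1 L2 f y *\<^sub>R pi1 L1 L2 s0 y) = c (%x. f x *\<^sub>R s0 x)" using Dc fs by metis
 hence "f q *\<^sub>R c s0 + symbol (jprod L1 L2) z D (base_fun L1 L2 f) *\<^sub>R s0 q = f q *\<^sub>R c s0 + symbol L1 q c f *\<^sub>R s0 q"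
  unfolding sD[OF lift_in(1)[OF s0(1)]] symbol_Der(2)[OF L1 q c f s0(1)] base_fun_at lift_at(1)[OF s0(1)] using Dc s0(1) by simp
 hence "symbol (jprod L1 L2) z D (base_fun L1 L2 f) = symbol L1 q c f" using nz by simp
 thus ?thesis unfolding sD[OF s] base_fun_at by simp
qed

lemma symbol_zero: "f\<in>Cinf (base L1) ==> symbol L1 q (%s. 0) f = 0"
proof -
 assume f: "f\<in>Cinf (base L1)"
 have t: "(%f. 0)\<in>tangent (base L1) q" by (simp add: tangent_def point_derivations_def zero_off_def linear_funct_def)
 have "symbol L1 q (%s. 0) = (%f. 0)" by (rule symbol_Der(3)[OF L1 q zero_Der[OF L1 q] t]) simp
 thus ?thesis by simp
qed

lemma Der_base_fun0:
 assumes "D\<in>Der (jprod L1 L2) z" "ALL s:sections L1. D (pi1 L1 L2 s) = 0" "f\<in>Cinf (base L1)" "s\<in>sections (jprod L1 L2)"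
 shows "D (%y. base_fun L1 L2 f y *\<^sub>R s y) = f q *\<^sub>R D s"
 using Der_base_fun[OF assms(1) zero_Der[OF L1 q] assms(2,3,4)] symbol_zero[OF assms(3)] by simp

lemma Der_lift_la:
 assumes D: "D\<in>Der (jprod L1 L2) z" and R: "related L1 L2 B A b f"
 shows "D (lift_la L1 L2 A b f) = D (la1 L1 L2 A) - (\<Sum>c\<in>onb. D (%y. base_fun L1 L2 (f c) y *\<^sub>R la2 L1 L2 (b c) y))"
proof -
 have "D (%z. \<Sum>c\<in>onb. base_fun L1 L2 (f c) z *\<^sub>R la2 L1 L2 (b c) z) = (\<Sum>c\<in>onb. D (%y. base_fun L1 L2 (f c) y *\<^sub>R la2 L1 L2 (b c) y))"
  by (rule Der_sum[OF lift_basics(3) D lift_la_terms[OF R]])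
 thus ?thesis unfolding lift_la_def Der_diff[OF lift_basics(3) D lift_in(2)[OF relatedD(1)[OF R]] lift_la_sections(1)[OF R]] by simp
qed

lemma brz_pi_pi:
 assumes r: "r\<in>sections L2" and r': "r'\<in>sections L2"
 shows "brz (lift_pi L1 L2 B r) (lift_pi L1 L2 B r') = 0"
proof -
 note S = lift_in(1)[OF pb[OF r]] lift_in(3)[OF r] lift_in(1)[OF pb[OF r']] lift_in(3)[OF r']
 note z2 = zero_derivation[OF L2] zero_derivation[OF L1]
 show ?thesis unfolding lift_pi_def[of L1 L2 B r] Der_diff[OF lift_basics(3) brz_Der(2)[OF lift_pi_sections[OF r']] S(1,2)]
  unfolding lift_pi_def Der_diff[OF lift_basics(3) brz_Der(1)[OF S(1)] S(3,4)] Der_diff[OF lift_basics(3) brz_Der(1)[OF S(2)] S(3,4)]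
  using brz_1(1)[OF pb[OF r] pb[OF r'] z2(2,2)] brz_2(1)[OF r r' z2(1,1)] brz_mixed(1)[OF pb[OF r] z2(2) r' z2(1)] brz_mixed(5)[OF pb[OF r'] z2(2) r z2(1)]
  by simp
qed

lemma brz_pi1_la:
 assumes s: "s\<in>sections L1" and R: "related L1 L2 B A b f"
 shows "brz (pi1 L1 L2 s) (lift_la L1 L2 A b f) = - A s q"
proof -
 note A = relatedD(1)[OF R] and b = relatedD(2)[OF R] and f = relatedD(3)[OF R]
 note D = brz_Der(1)[OF lift_in(1)[OF s]]
 have "brz (pi1 L1 L2 s) (%y. base_fun L1 L2 (f c) y *\<^sub>R la2 L1 L2 (b c) y) = 0" if c: "c\<in>onb" for c
  using Der_base_fun0[OF D _ f[OF c] lift_in(4)[OF b[OF c]]] brz_1(1)[OF s _ A A] brz_mixed(2)[OF s A r0 b[OF c]] by simp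
 thus ?thesis unfolding Der_lift_la[OF D R] brz_1(2)[OF s s A A] by simp
qed

text \<open>Basic sections of the first factor have zero bracket with \<open>g\<close>, so the
  coefficients \<open>f c\<close> pass through the bracket undifferentiated.\<close>

lemma brz_2_la:
 assumes g: "g = pi2 L1 L2 r & r\<in>sections L2 | g = la2 L1 L2 b' & b'\<in>derivations L2" and R: "related L1 L2 B A b f"
 shows "brz g (lift_la L1 L2 A b f) = - (\<Sum>c\<in>onb. f c q *\<^sub>R brz g (la2 L1 L2 (b c)))"
proof -
 note A = relatedD(1)[OF R] and b = relatedD(2)[OF R] and f = relatedD(3)[OF R]
 note z2 = zero_derivation[OF L2]
 have gs: "g\<in>sections (jprod L1 L2)" using g lift_in(3,4) by auto
 have g0: "brz g (pi1 L1 L2 s) = 0" if "s\<in>sections L1" for s using g brz_mixed(5)[OF that A _ z2] brz_mixed(6)[OF that A r0] by auto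
 have g1: "brz g (la1 L1 L2 A) = 0" using g brz_mixed(7)[OF pb[OF r0] A _ z2] brz_mixed(8)[OF pb[OF r0] A r0] by auto
 have "brz g (%y. base_fun L1 L2 (f c) y *\<^sub>R la2 L1 L2 (b c) y) = f c q *\<^sub>R brz g (la2 L1 L2 (b c))" if c: "c\<in>onb" for c
  using Der_base_fun0[OF brz_Der(1)[OF gs] _ f[OF c] lift_in(4)[OF b[OF c]]] g0 by simp
 thus ?thesis unfolding Der_lift_la[OF brz_Der(1)[OF gs] R] g1 by simp
qed

text \<open>Each of the two parts of \<open>lift_pi\<close> contributes \<open>- A (pb r) q\<close>,
  the second one by relatedness, and the contributions are subtracted.\<close>

lemma brz_pi_la:
 assumes r: "r\<in>sections L2" and R: "related L1 L2 B A b f"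
 shows "brz (lift_pi L1 L2 B r) (lift_la L1 L2 A b f) = 0"
proof -
 note b = relatedD(2)[OF R]
 have 2: "brz (pi2 L1 L2 r) (lift_la L1 L2 A b f) = - A (pb r) q"
  using brz_2_la[of "pi2 L1 L2 r" r _ A b f] r R brz_2(2)[OF r r b b] relatedD(4)[OF R r, of q] by simp
 show ?thesis
  unfolding lift_pi_def Der_diff[OF lift_basics(3) brz_Der(2)[OF lift_la_sections(2)[OF R]] lift_in(1)[OF pb[OF r]] lift_in(3)[OF r]]
   brz_pi1_la[OF pb[OF r] R] 2 by simp
qed

text \<open>Expanding both orders of \<open>A\<close> and \<open>A'\<close> on the pull-back of
  \<open>r0\<close> by relatedness differentiates the coefficients. These terms match the symbol
  terms from the Leibniz rule for \<open>base_fun\<close>, and the double sums cancel after an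
  exchange of the summations.\<close>

lemma brz_la_la:
 assumes R: "related L1 L2 B A b f" and R': "related L1 L2 B A' b' f'"
 shows "brz (lift_la L1 L2 A b f) (lift_la L1 L2 A' b' f') = 0"
proof -
 note A = relatedD(1)[OF R] and b = relatedD(2)[OF R] and f = relatedD(3)[OF R]
 note A' = relatedD(1)[OF R'] and b' = relatedD(2)[OF R'] and f' = relatedD(3)[OF R']
 let ?g = "lift_la L1 L2 A b f" and ?X = "%A. symbol L1 q (%s. A s q)"
 note gs = lift_la_sections(2)[OF R]
 have AD: "(%s. A s q)\<in>Der L1 q" "(%s. A' s q)\<in>Der L1 q" using dersD(3)[OF A q] dersD(3)[OF A' q] by auto
 have g1: "brz ?g (pi1 L1 L2 s) = A s q" if "s\<in>sections L1" for s using brz_pi1_la[OF that R] brz_skew[of ?g "pi1 L1 L2 s"] by simp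
 have t1: "brz (la1 L1 L2 A') (%y. base_fun L1 L2 (f c) y *\<^sub>R la2 L1 L2 (b c) y) = ?X A' (f c) *\<^sub>R pb (b c r0) q" if c: "c\<in>onb" for c
  using Der_base_fun[OF brz_Der(1)[OF lift_in(2)[OF A']] AD(2) _ f[OF c] lift_in(4)[OF b[OF c]]]
   brz_1(3)[OF _ pb[OF r0] A' A'] brz_mixed(4)[OF pb[OF r0] A' r0 b[OF c]] lift_at(4)[OF b[OF c]] by simp
 have "brz (la1 L1 L2 A') ?g = A' (A (pb r0)) q - A (A' (pb r0)) q - (\<Sum>c\<in>onb. ?X A' (f c) *\<^sub>R pb (b c r0) q)"
  unfolding Der_lift_la[OF brz_Der(1)[OF lift_in(2)[OF A']] R] brz_1(4)[OF pb[OF r0] pb[OF r0] A' A] by (simp add: t1)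
 hence 1: "brz ?g (la1 L1 L2 A') = A (A' (pb r0)) q - A' (A (pb r0)) q + (\<Sum>c\<in>onb. ?X A' (f c) *\<^sub>R pb (b c r0) q)"
  using brz_skew[of ?g "la1 L1 L2 A'"] by simp
 have g2: "brz ?g (la2 L1 L2 (b' d)) = (\<Sum>c\<in>onb. f c q *\<^sub>R (pb (b c (b' d r0)) q - pb (b' d (b c r0)) q))" if d: "d\<in>onb" for d
 proof -
  have "brz (la2 L1 L2 (b' d)) (la2 L1 L2 (b c)) = pb (b c (b' d r0)) q - pb (b' d (b c r0)) q" if c: "c\<in>onb" for c
   by (rule brz_2(4)[OF r0 r0 b'[OF d] b[OF c]])
  thus ?thesis using brz_2_la[of "la2 L1 L2 (b' d)" _ "b' d" A b f] b'[OF d] R brz_skew[of ?g "la2 L1 L2 (b' d)"] by simp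
 qed
 have 2: "brz ?g (%y. base_fun L1 L2 (f' d) y *\<^sub>R la2 L1 L2 (b' d) y) =
   f' d q *\<^sub>R (\<Sum>c\<in>onb. f c q *\<^sub>R (pb (b c (b' d r0)) q - pb (b' d (b c r0)) q)) + ?X A (f' d) *\<^sub>R pb (b' d r0) q" if d: "d\<in>onb" for d
  using Der_base_fun[OF brz_Der(1)[OF gs] AD(1) _ f'[OF d] lift_in(4)[OF b'[OF d]]] g1 g2[OF d] lift_at(4)[OF b'[OF d]] by simp
 have dd: "c\<in>onb ==> r\<in>sections L2 ==> b c r\<in>sections L2" "d\<in>onb ==> r\<in>sections L2 ==> b' d r\<in>sections L2" for c d r
  using dersD(1)[OF b, of c r] dersD(1)[OF b', of d r] by auto
 have AA: "A (A' (pb r0)) q = (\<Sum>d\<in>onb. f' d q *\<^sub>R (\<Sum>c\<in>onb. f c q *\<^sub>R pb (b c (b' d r0)) q) + ?X A (f' d) *\<^sub>R pb (b' d r0) q)"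
 proof -
  have e: "A' (pb r0) = (%x. \<Sum>d\<in>onb. f' d x *\<^sub>R pb (b' d r0) x)" by (rule ext) (rule relatedD(4)[OF R' r0])
  have "A (A' (pb r0)) q = (\<Sum>d\<in>onb. A (%x. f' d x *\<^sub>R pb (b' d r0) x) q)"
   unfolding e by (rule Der_sum[OF L1 AD(1)]) (intro secs_mult[OF L1] f' pb dd r0)
  also have "\<dots> = (\<Sum>d\<in>onb. f' d q *\<^sub>R (\<Sum>c\<in>onb. f c q *\<^sub>R pb (b c (b' d r0)) q) + ?X A (f' d) *\<^sub>R pb (b' d r0) q)"
   by (rule sum.cong[OF refl]) (simp only: symbol_Der(2)[OF L1 q AD(1) f' pb[OF dd(2)]] relatedD(4)[OF R dd(2)] r0)
  finally show ?thesis .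
 qed
 have AA': "A' (A (pb r0)) q = (\<Sum>c\<in>onb. f c q *\<^sub>R (\<Sum>d\<in>onb. f' d q *\<^sub>R pb (b' d (b c r0)) q) + ?X A' (f c) *\<^sub>R pb (b c r0) q)"
 proof -
  have e: "A (pb r0) = (%x. \<Sum>c\<in>onb. f c x *\<^sub>R pb (b c r0) x)" by (rule ext) (rule relatedD(4)[OF R r0])
  have "A' (A (pb r0)) q = (\<Sum>c\<in>onb. A' (%x. f c x *\<^sub>R pb (b c r0) x) q)"
   unfolding e by (rule Der_sum[OF L1 AD(2)]) (intro secs_mult[OF L1] f pb dd r0)
  also have "\<dots> = (\<Sum>c\<in>onb. f c q *\<^sub>R (\<Sum>d\<in>onb. f' d q *\<^sub>R pb (b' d (b c r0)) q) + ?X A' (f c) *\<^sub>R pb (b c r0) q)"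
   by (rule sum.cong[OF refl]) (simp only: symbol_Der(2)[OF L1 q AD(2) f pb[OF dd(1)]] relatedD(4)[OF R' dd(1)] r0)
  finally show ?thesis .
 qed
 have sw: "(\<Sum>c\<in>onb. f c q *\<^sub>R (\<Sum>d\<in>onb. f' d q *\<^sub>R pb (b' d (b c r0)) q)) = (\<Sum>d\<in>onb. f' d q *\<^sub>R (\<Sum>c\<in>onb. f c q *\<^sub>R pb (b' d (b c r0)) q))"
  unfolding scaleR_sum_right by (subst sum.swap) (simp add: mult.commute)
 show ?thesis unfolding Der_lift_la[OF brz_Der(1)[OF gs] R'] 1 by (simp add: 2 AA AA' sum.distrib scaleR_diff_right sum_subtractf sw)
qed

end

end

section \<open>The jet lift as a graph in coordinates\<close>

locale lift_triv = factor_triv L1 U1 ph1 V1 e1 L2 U2 ph2 V2 e2 B +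
 j1: jtriv L1 U1 ph1 V1 e1 + j2: jtriv L2 U2 ph2 V2 e2 +
 p: ptriv "JL L1" "triv.jU L1 U1 V1" "triv.jph L1 U1 ph1 e1" "pts (JM L1) Int fst -` V1" "e1 \<circ> fst"
  "JL L2" "triv.jU L2 U2 V2" "triv.jph L2 U2 ph2 e2" "pts (JM L2) Int fst -` V2" "e2 \<circ> fst"
 for L1 :: "('m, 'e::findim, 'l::real_vector) line_bundle" and U1 ph1 V1 e1
  and L2 :: "('n, 'f::findim, 'k::real_vector) line_bundle" and U2 ph2 V2 e2 and B

lemma factor_triv_lift_triv:
 assumes "factor_triv L1 U1 ph1 V1 e1 L2 U2 ph2 V2 e2 B" shows "lift_triv L1 U1 ph1 V1 e1 L2 U2 ph2 V2 e2 B"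
proof -
 interpret factor_triv L1 U1 ph1 V1 e1 L2 U2 ph2 V2 e2 B by fact
 show ?thesis unfolding lift_triv_def by (intro conjI assms triv_jtriv prod_triv_ptriv t1.triv_axioms t2.triv_axioms)
   (simp add: prod_triv_def t1.jet_triv t2.jet_triv)
qed

definition spt where
 "spt L1 L2 B q r = ((q, jet L1 (pull_section L1 B r) q), (fst B q, jet L2 r (fst B q)), restrict0 (fibre L1 q) (snd B q))"

text \<open>Puts the parameters of the graph into the coordinate slots that \<open>rho\<close> reads
  and 0 elsewhere; its range is the subspace to which the graph will be straightened.\<close>

definition emb :: "'e::findim \<times> 'f::findim \<times> real => ('e \<times> 'e \<times> real) \<times> ('f \<times> 'f \<times> real) \<times> real" where
 "emb u = ((fst u, 0), (0, snd u), 0)"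

definition rho :: "('e::findim \<times> 'e \<times> real) \<times> ('f::findim \<times> 'f \<times> real) \<times> real => 'e \<times> 'f \<times> real" where
 "rho y = (fst (fst y), snd (fst (snd y)))"

lemma linear_emb: "linear emb" and linear_rho: "linear rho" and rho_emb[simp]: "rho (emb u) = u" by (auto intro!: linearI simp: emb_def rho_def)

context lift_triv
begin

text \<open>Coordinates of the jet lift, which is a graph over the base point in \<open>L1\<close> and the jet
  coordinates in \<open>L2\<close>; \<open>rho\<close> is the projection to these.\<close>

definition gam :: "'e \<times> 'f \<times> real => ('e \<times> 'e \<times> real) \<times> ('f \<times> 'f \<times> real) \<times> real" where
 "gam u = ((fst u, jet_pull fH ftau (fst u) (snd u)), (ftau (fst u), snd u), inverse (fH (fst u)))"

abbreviation "gdom \<equiv> ph1 ` fdom \<times> (UNIV :: ('f \<times> real) set)"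
abbreviation "W \<equiv> p.pU Int {z. fst (fst z)\<in>fdom}"
abbreviation "S \<equiv> jet_lift L1 L2 B"
abbreviation "P \<equiv> jprod L1 L2"

lemma rho_gam[simp]: "rho (gam u) = u" by (simp add: rho_def gam_def)

lemma open_gdom: "open gdom" by (intro open_Times open_fimg open_UNIV)

lemma gam_smooth: "smooth_on gdom gam"
proof -
 note o = open_gdom
 have f: "smooth_on gdom (%u. fst u)" by (rule smooth_on_fst[OF o smooth_ident])
 have t: "smooth_on gdom (%u. ftau (fst u))" by (rule smooth_comp[OF o open_fimg f _ ftau_smooth]) auto
 have h: "smooth_on gdom (%u. fH (fst u))" by (rule smooth_comp[OF o open_fimg f _ fH_smooth]) auto
 show ?thesis unfolding gam_def by (intro smooth_Pair[OF o] f t h smooth_inverse[OF o] smooth_on_snd[OF o] smooth_ident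
   smooth_jet_pull[OF open_fimg fH_smooth ftau_smooth]) (use fH_nz in auto)
qed

lemma S_spt: "S = {spt L1 L2 B q r | q r. q\<in>pts (base L1) & r\<in>sections L2}" unfolding jet_lift_eq[OF t1.L t2.L F] spt_def by (rule refl)

lemma spt_pt: "q\<in>pts (base L1) ==> r\<in>sections L2 ==> spt L1 L2 B q r\<in>pts (jbase L1 L2)" by (rule lift_pt(1)[OF t1.L t2.L F _ _ spt_def])

lemma spt_gam:
 assumes q: "q\<in>fdom" and r: "r\<in>sections L2"
 shows "spt L1 L2 B q r\<in>W" "p.pph (spt L1 L2 B q r) = gam (ph1 q, t2.jr r (fst B q))"
  "p.Z.pt (gam (ph1 q, t2.jr r (fst B q))) = spt L1 L2 B q r"
proof -
 note d = fdomD[OF q]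
 have qp: "q\<in>pts (base L1)" by (rule t1.dm_pts[OF d(1)])
 have pr: "pull_section L1 B r\<in>sections L1" by (rule pull_in[OF t1.L t2.L F r])
 let ?z = "spt L1 L2 B q r"
 note pt = lift_pt[OF t1.L t2.L F qp r spt_def]
 have zU: "?z\<in>p.pU" using pt d unfolding p.pU_eq by (auto simp: spt_def t1.jU_def t2.jU_def t1.dm_def t2.dm_def jet_mf_simps)
 thus "?z\<in>W" using q by (simp add: spt_def)
 have "p.pph ?z = ((ph1 q, t1.jr (pull_section L1 B r) q), (ph2 (fst B q), t2.jr r (fst B q)), coord (e2 (fst B q)) (snd B q (e1 q)))"
  using t1.jph_jet[OF d(1) pr] t2.jph_jet[OF d(2) r] t1.e_fib[OF d(1)] by (simp add: p.pph_def spt_def restrict0_def)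
 also have "\<dots> = gam (ph1 q, t2.jr r (fst B q))"
  unfolding gam_def jr_pull[OF r q] B_e[OF q] using coord_scale[OF t2.e_nz[OF d(2)]] ftau_phi[OF q] by simp
 finally show e: "p.pph ?z = gam (ph1 q, t2.jr r (fst B q))" .
 show "p.Z.pt (gam (ph1 q, t2.jr r (fst B q))) = ?z" unfolding e[symmetric] by (rule p.Z.pt_phi) (use zU p.Z_dm in simp)
qed

lemma gdom_spt:
 assumes "u\<in>gdom"
 obtains q r where "q\<in>fdom" "r\<in>sections L2" "u = (ph1 q, t2.jr r (fst B q))"
proof -
 obtain q w where u: "u = (ph1 q, w)" "q\<in>fdom" using assms by auto
 obtain r where "r\<in>sections L2" "t2.jr r (fst B q) = w" using t2.jr_obtain[OF fdomD(2)[OF u(2)]] .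
 thus thesis using that u by blast
qed

lemma gam_pt: "u\<in>gdom ==> p.Z.pt (gam u)\<in>S Int W" "u\<in>gdom ==> p.pph (p.Z.pt (gam u)) = gam u"
proof -
 assume "u\<in>gdom"
 then obtain q r where u: "q\<in>fdom" "r\<in>sections L2" "u = (ph1 q, t2.jr r (fst B q))" by (rule gdom_spt)
 have "spt L1 L2 B q r\<in>S" unfolding S_spt using u(1,2) t1.dm_pts[OF fdomD(1)] by blast
 thus "p.Z.pt (gam u)\<in>S Int W" "p.pph (p.Z.pt (gam u)) = gam u"
  unfolding u(3) spt_gam(3)[OF u(1,2)] spt_gam(2)[OF u(1,2)] using spt_gam(1)[OF u(1,2)] by simp_all
qed

lemma rho_W:
 assumes z: "z\<in>W" shows "rho (p.pph z)\<in>gdom"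
proof -
 have "fst z\<in>t1.jU" using p.pU_fst(1)[OF IntD1[OF z]] unfolding j1.J_dm .
 hence "fst (t1.jph (fst z)) = ph1 (fst (fst z))" by (rule t1.jU_fst(2))
 thus ?thesis using z p.pph_simps(1)[of z] by (simp add: rho_def)
qed

text \<open>A point with the coordinates of a graph point is that graph point, by injectivity of the
  chart. Membership becomes an equation that the slice chart can linearise.\<close>

lemma S_iff:
 assumes z: "z\<in>W" shows "z\<in>S \<longleftrightarrow> p.pph z = gam (rho (p.pph z))"
proof
 assume "z\<in>S"
 then obtain q r where zz: "z = spt L1 L2 B q r" "r\<in>sections L2" unfolding S_spt by blast
 hence "q\<in>fdom" using z by (simp add: spt_def)
 thus "p.pph z = gam (rho (p.pph z))" unfolding zz(1) by (simp only: spt_gam(2) zz(2) rho_gam)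
next
 assume e: "p.pph z = gam (rho (p.pph z))"
 note g = gam_pt[OF rho_W[OF z]]
 have "z = p.Z.pt (gam (rho (p.pph z)))" by (rule inj_onD[OF p.pph_inj trans[OF e g(2)[symmetric]]]) (rule IntD1[OF z], rule IntD1[OF IntD2[OF g(1)]])
 thus "z\<in>S" using g(1) by simp
qed

lemma opn_W: "openin (mtop (jbase L1 L2)) W"
proof -
 note J = lift_basics(1,2)[OF t1.L t2.L F]
 note A = bp_atlas[OF J] and A1 = jet_atlas[OF t1.L] and A0 = lbD(2)[OF t1.L]
 have "openin (mtop (JM L1)) (pts (JM L1) Int fst -` fdom)"
  by (rule smap_openin[OF A1 A0 jet_proj_smooth[OF t1.L] opn_fdom])
 hence "openin (mtop (jbase L1 L2)) (pts (jbase L1 L2) Int fst -` (pts (JM L1) Int fst -` fdom))"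
  using smap_openin[OF A _ bp_proj1[OF J], of "pts (JM L1) Int fst -` fdom"] A1 by simp
 hence "openin (mtop (jbase L1 L2)) (p.pU Int (pts (jbase L1 L2) Int fst -` (pts (JM L1) Int fst -` fdom)))"
  using chart_dom[OF A atlas_ch[OF A p.prod_chart_in]] by blast
 moreover have "p.pU Int (pts (jbase L1 L2) Int fst -` (pts (JM L1) Int fst -` fdom)) = W" using p.pU_pts by (auto simp: bp_simps)
 ultimately show ?thesis by simp
qed

text \<open>A shear moves the graph of \<open>gam\<close> onto the range of \<open>emb\<close>. It
  does not change \<open>rho\<close>, so its inverse is obtained by reversing the two signs.\<close>

lemma slice_chart:
 "smooth_chart (jbase L1 L2) (W, %z. p.pph z - gam (rho (p.pph z)) + emb (rho (p.pph z)))"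
 "(%z. p.pph z - gam (rho (p.pph z)) + emb (rho (p.pph z))) ` (S Int W) =
  (%z. p.pph z - gam (rho (p.pph z)) + emb (rho (p.pph z))) ` W Int range emb"
proof -
 note A = bp_atlas[OF lift_basics(1,2)[OF t1.L t2.L F]]
 note rl = linear_add[OF linear_rho] linear_diff[OF linear_rho]
 let ?f = "%y. y - gam (rho y) + emb (rho y)" and ?g = "%y. y + gam (rho y) - emb (rho y)"
 have rf: "rho (?f y) = rho y" "rho (?g y) = rho y" for y by (simp_all add: rl)
 have gf: "?g (?f y) = y" "?f (?g y) = y" for y using rf[of y] by simp_all
 have bl: "bounded_linear rho" "bounded_linear emb" by (simp_all add: linear_bounded_linear linear_rho linear_emb)
 have oW: "open (p.pph ` W)"
 proof -
  have "p.pph ` W = p.pph ` (p.pU Int W)" by (rule arg_cong[of _ _ "%S. p.pph ` S"]) blast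
  thus ?thesis using chart_image[OF A p.prod_chart_in opn_W] by simp
 qed
 let ?D = "rho -` gdom"
 have oD: "open ?D" by (rule continuous_open_vimage[OF open_gdom]) (rule linear_continuous_at[OF bl(1)])
 have WD: "p.pph ` W \<subseteq> ?D" using rho_W by blast
 have gr: "smooth_on ?D (%y. gam (rho y))" by (rule smooth_comp[OF oD open_gdom smooth_linear[OF bl(1)] _ gam_smooth]) auto
 have er: "smooth_on ?D (%y. emb (rho y))" by (rule smooth_linear_comp[OF oD bl(2) smooth_linear[OF bl(1)]])
 have sf: "smooth_on ?D ?f" and sg: "smooth_on ?D ?g" by (intro smooth_add[OF oD] smooth_diff[OF oD] gr er smooth_ident)+
 have img: "?f ` p.pph ` W = ?D Int ?g -` (p.pph ` W)"
 proof (intro equalityI subsetI)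
  fix y assume "y\<in>?f ` p.pph ` W"
  then obtain x where x: "x\<in>p.pph ` W" "y = ?f x" by blast
  thus "y\<in>?D Int ?g -` (p.pph ` W)" using gf(1)[of x] rf(1)[of x] WD by auto
 next
  fix y assume "y\<in>?D Int ?g -` (p.pph ` W)"
  thus "y\<in>?f ` p.pph ` W" using gf(2)[of y] by (intro image_eqI[of _ ?f "?g y"]) auto
 qed
 have oI: "open (?f ` p.pph ` W)" unfolding img by (rule continuous_open_preimage[OF smooth_continuous[OF sg] oD oW])
 show "smooth_chart (jbase L1 L2) (W, %z. ?f (p.pph z))"
  by (rule smooth_chart_compose[OF A atlas_ch[OF A p.prod_chart_in] opn_W _ oI refl smooth_subset[OF sf WD] smooth_subset[OF sg] gf(1) oW])
   (use img in auto)
 have iff: "z\<in>S \<longleftrightarrow> ?f (p.pph z)\<in>range emb" if z: "z\<in>W" for z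
 proof -
  have "?f y\<in>range emb \<longleftrightarrow> y = gam (rho y)" for y
  proof
   assume "?f y\<in>range emb"
   then obtain u where u: "?f y = emb u" by blast
   have "rho y = u" using rf(1)[of y] u by simp
   thus "y = gam (rho y)" using u by simp
  next
   assume "y = gam (rho y)"
   hence "?f y = emb (rho y)" by (metis (no_types) add.left_neutral diff_self)
   thus "?f y\<in>range emb" by blast
  qed
  thus ?thesis using S_iff[OF z] by blast
 qed
 show "(%z. ?f (p.pph z)) ` (S Int W) = (%z. ?f (p.pph z)) ` W Int range emb" using iff by blast
qed

text \<open>Functions and sections on the jet lift are restrictions of ambient ones only locally.
  This common statement makes the coordinate expressions of both differentiable in the parameter
  \<open>u\<close>.\<close>

lemma differentiable_along_gam:
 assumes T: "openin (mtop (jbase L1 L2)) T" "p.Z.pt (gam u)\<in>T" and sm: "smooth_on (p.pph ` (p.Z.dm Int T)) H"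
  and eq: "ALL y:S Int T. y\<in>p.Z.dm --> H (p.pph y) = h (p.pph y)" and u: "u\<in>gdom"
 shows "(%u. h (gam u)) differentiable (at u)"
proof -
 let ?z = "p.Z.pt (gam u)" and ?O = "p.pph ` (p.Z.dm Int T)"
 have zd: "?z\<in>p.Z.dm" using gam_pt(1)[OF u] unfolding p.Z_dm by blast
 have oO: "open ?O" using p.Z.open_image[of T] T(1) by (simp add: jprod_simps[OF t1.L t2.L F])
 have uO: "gam u\<in>?O" using zd T(2) gam_pt(2)[OF u] by (metis IntI imageI)
 let ?Q = "gdom Int gam -` ?O"
 have uQ: "u\<in>?Q" using u uO by blast
 have oQ: "open ?Q" by (rule continuous_open_preimage[OF smooth_continuous[OF gam_smooth] open_gdom oO])
 have dif: "(%u. H (gam u)) differentiable (at u)"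
  by (rule smooth_diffble[OF smooth_comp[OF oQ oO smooth_subset[OF gam_smooth] _ sm]]) (use u uO in auto)
 have "H (gam v) = h (gam v)" if v: "v\<in>?Q" for v
 proof -
  obtain y where y: "y\<in>p.Z.dm" "y\<in>T" "gam v = p.pph y" using v by auto
  have "p.Z.pt (gam v) = y" unfolding y(3) by (rule p.Z.pt_phi[OF y(1)])
  hence "y\<in>S Int T" using gam_pt(1)[of v] v y(2) by auto
  thus ?thesis unfolding y(3) using eq y(1) by blast
 qed
 thus ?thesis by (rule diffble_cong_open[OF oQ uQ _ dif])
qed

lemma rep_sub:
 assumes s: "s\<in>sections_sub P S" and u: "u\<in>gdom"
 shows "(%u. p.Z.rep s (gam u)) differentiable (at u)"
proof -
 obtain T t where t: "openin (mtop (jbase L1 L2)) T" "p.Z.pt (gam u)\<in>T" "smooth_section_on P T t" "ALL y:S Int T. s y = t y"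
  using s gam_pt(1)[OF u] by (auto simp: sections_sub_def jprod_simps[OF t1.L t2.L F])
 have "smooth_on (p.pph ` (p.Z.dm Int T)) (p.Z.rep t)" using p.Z.rep_smooth_on[OF t(3)] t(1) by (simp add: jprod_simps[OF t1.L t2.L F])
 from differentiable_along_gam[OF t(1,2) this _ u] show ?thesis using t(4) p.Z.rep_phi by simp
qed

lemma fun_sub:
 assumes f: "f\<in>Cinf_sub (jbase L1 L2) S" and u: "u\<in>gdom"
 shows "(%u. f (p.Z.pt (gam u))) differentiable (at u)"
proof -
 obtain T t where t: "openin (mtop (jbase L1 L2)) T" "p.Z.pt (gam u)\<in>T" "smooth_fun_on (jbase L1 L2) T t" "ALL y:S Int T. f y = t y"
  using f gam_pt(1)[OF u] by (auto simp: Cinf_sub_def)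
 have sm: "smooth_on (p.pph ` (p.Z.dm Int T)) (%y. t (p.Z.pt y))" using p.Z.fun_smooth[of T t] t(3) by (simp add: jprod_simps[OF t1.L t2.L F])
 show ?thesis by (rule differentiable_along_gam[OF t(1,2) sm _ u, of "%y. f (p.Z.pt y)"]) (use t(4) p.Z.pt_phi in simp)
qed

end

section \<open>Derivations tangent to the jet lift\<close>

lemma inner_jet1: "(d, t)\<bullet>jet1 F y = grad F y\<bullet>d + t * F y" by (simp add: jet1_def inner_commute)

lemma restrict0_op:
 "restrict0 S (%y. f y + g y) = (%y. restrict0 S f y + restrict0 S (g :: 'a => 'b::monoid_add) y)"
 "restrict0 S (%y. c *\<^sub>R s y) = (%y. c *\<^sub>R restrict0 S (s :: 'a => 'c::real_vector) y)"
 "restrict0 S (%y. h y *\<^sub>R s y) = (%y. restrict0 S h y *\<^sub>R restrict0 S s y)"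
 "restrict0 S (%y. h y * k y) = (%y. restrict0 S h y * restrict0 S (k :: 'a => real) y)" by (auto simp: restrict0_def)

lemma secs_sub_closed:
 assumes L: "line_bundle L" and s: "s\<in>sections_sub L S"
 shows "t\<in>sections_sub L S ==> (%y. s y + t y)\<in>sections_sub L S"
  "f\<in>Cinf_sub (base L) S ==> (%y. f y *\<^sub>R s y)\<in>sections_sub L S"
proof -
 show "(%y. s y + t y)\<in>sections_sub L S" if t: "t\<in>sections_sub L S" unfolding sections_sub_def
 proof (intro CollectI conjI ballI)
  show "zero_off S (%y. s y + t y)" using s t by (simp add: sections_sub_def zero_off_def)
  fix x assume x: "x\<in>S"
  obtain W s' where 1: "openin (mtop (base L)) W" "x\<in>W" "smooth_section_on L W s'" "ALL y:S Int W. s y = s' y" using s x unfolding sections_sub_def by blast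
  obtain V t' where 2: "openin (mtop (base L)) V" "x\<in>V" "smooth_section_on L V t'" "ALL y:S Int V. t y = t' y" using t x unfolding sections_sub_def by blast
  have o: "openin (mtop (base L)) (W Int V)" using 1(1) 2(1) by (rule openin_Int)
  have "smooth_section_on L (W Int V) (%y. s' y + t' y)"
   by (rule ssec_add[OF L o ssec_subset[OF 1(3)] ssec_subset[OF 2(3)]]) auto
  thus "\<exists>W u. openin (mtop (base L)) W & x\<in>W & smooth_section_on L W u & (ALL y:S Int W. s y + t y = u y)"
   using o 1(2,4) 2(2,4) by (intro exI[of _ "W Int V"] exI[of _ "%y. s' y + t' y"]) simp
 qed
 show "(%y. f y *\<^sub>R s y)\<in>sections_sub L S" if f: "f\<in>Cinf_sub (base L) S" unfolding sections_sub_def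
 proof (intro CollectI conjI ballI)
  show "zero_off S (%y. f y *\<^sub>R s y)" using s by (simp add: sections_sub_def zero_off_def)
  fix x assume x: "x\<in>S"
  obtain W s' where 1: "openin (mtop (base L)) W" "x\<in>W" "smooth_section_on L W s'" "ALL y:S Int W. s y = s' y" using s x unfolding sections_sub_def by blast
  obtain V f' where 2: "openin (mtop (base L)) V" "x\<in>V" "smooth_fun_on (base L) V f'" "ALL y:S Int V. f y = f' y" using f x unfolding Cinf_sub_def by blast
  have o: "openin (mtop (base L)) (W Int V)" using 1(1) 2(1) by (rule openin_Int)
  have "smooth_section_on L (W Int V) (%y. f' y *\<^sub>R s' y)"
   by (rule ssec_scale[OF L o sfun_subset[OF 2(3)] ssec_subset[OF 1(3)]]) auto
  thus "\<exists>W u. openin (mtop (base L)) W & x\<in>W & smooth_section_on L W u & (ALL y:S Int W. f y *\<^sub>R s y = u y)"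
   using o 1(2,4) 2(2,4) by (intro exI[of _ "W Int V"] exI[of _ "%y. f' y *\<^sub>R s' y"]) simp
 qed
qed

lemma Cinf_sub_closed:
 assumes M: "atlas M" and f: "f\<in>Cinf_sub M S" and g: "g\<in>Cinf_sub M S"
 shows "(%y. f y + g y)\<in>Cinf_sub M S" "(%y. f y * g y)\<in>Cinf_sub M S"
proof -
 have loc: "\<exists>W f' g'. openin (mtop M) W & x\<in>W & smooth_fun_on M W f' & smooth_fun_on M W g' & (ALL y:S Int W. f y = f' y & g y = g' y)"
  if x: "x\<in>S" for x
 proof -
  obtain W f' where 1: "openin (mtop M) W" "x\<in>W" "smooth_fun_on M W f'" "ALL y:S Int W. f y = f' y" using f x unfolding Cinf_sub_def by blast
  obtain V g' where 2: "openin (mtop M) V" "x\<in>V" "smooth_fun_on M V g'" "ALL y:S Int V. g y = g' y" using g x unfolding Cinf_sub_def by blast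
  show ?thesis by (intro exI[of _ "W Int V"] exI[of _ f'] exI[of _ g'] conjI openin_Int sfun_subset[OF 1(3)] sfun_subset[OF 2(3)])
    (use 1 2 in auto)
 qed
 have z: "zero_off S f" "zero_off S g" using f g by (auto simp: Cinf_sub_def)
 have "\<exists>W h. openin (mtop M) W & x\<in>W & smooth_fun_on M W h & (ALL y:S Int W. f y + g y = h y)" if x: "x\<in>S" for x
 proof -
  obtain W f' g' where W: "openin (mtop M) W" "x\<in>W" "smooth_fun_on M W f'" "smooth_fun_on M W g'" "ALL y:S Int W. f y = f' y & g y = g' y"
   using loc[OF x] by (elim exE conjE)
  show ?thesis by (intro exI[of _ W] exI[of _ "%y. f' y + g' y"] conjI W(1,2) sfun_add[OF M W(1,3,4)]) (use W(5) in simp)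
 qed
 thus "(%y. f y + g y)\<in>Cinf_sub M S" using z by (simp add: Cinf_sub_def zero_off_def)
 have "\<exists>W h. openin (mtop M) W & x\<in>W & smooth_fun_on M W h & (ALL y:S Int W. f y * g y = h y)" if x: "x\<in>S" for x
 proof -
  obtain W f' g' where W: "openin (mtop M) W" "x\<in>W" "smooth_fun_on M W f'" "smooth_fun_on M W g'" "ALL y:S Int W. f y = f' y & g y = g' y"
   using loc[OF x] by (elim exE conjE)
  show ?thesis by (intro exI[of _ W] exI[of _ "%y. f' y * g' y"] conjI W(1,2) sfun_mult[OF M W(1,3,4)]) (use W(5) in simp)
 qed
 thus "(%y. f y * g y)\<in>Cinf_sub M S" using z by (simp add: Cinf_sub_def zero_off_def)
qed

lemma Cinf_sub_const: "atlas M ==> S \<subseteq> pts M ==> restrict0 S (%y. c)\<in>Cinf_sub M S"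
 using opn_pts sfun_const unfolding Cinf_sub_def zero_off_def restrict0_def by fastforce

lemma restrict_sub:
 assumes "atlas M" "S \<subseteq> pts M"
 shows "f\<in>Cinf M ==> restrict0 S f\<in>Cinf_sub M S"
proof -
 assume f: "f\<in>Cinf M"
 show "restrict0 S f\<in>Cinf_sub M S" unfolding Cinf_sub_def
 proof (intro CollectI conjI ballI)
  show "zero_off S (restrict0 S f)" by (simp add: zero_off_def restrict0_def)
  fix x assume "x\<in>S"
  thus "\<exists>W g. openin (mtop M) W & x\<in>W & smooth_fun_on M W g & (ALL y:S Int W. restrict0 S f y = g y)"
   using assms opn_pts[OF assms(1)] CinfD(1)[OF f] by (intro exI[of _ "pts M"] exI[of _ f]) (auto simp: restrict0_def)
 qed
qed

lemma restrict_section_sub: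
 assumes "line_bundle L" "S \<subseteq> pts (base L)" "s\<in>sections L"
 shows "restrict0 S s\<in>sections_sub L S" unfolding sections_sub_def
proof (intro CollectI conjI ballI)
 show "zero_off S (restrict0 S s)" by (simp add: zero_off_def restrict0_def)
 fix x assume "x\<in>S"
 thus "\<exists>W t. openin (mtop (base L)) W & x\<in>W & smooth_section_on L W t & (ALL y:S Int W. restrict0 S s y = t y)"
  using assms opn_pts[OF lbD(2)[OF assms(1)]] sectionsD(1)[OF assms(3)]
  by (intro exI[of _ "pts (base L)"] exI[of _ s]) (auto simp: restrict0_def)
qed

lemma Der_sub_vanish:
 assumes a: "a\<in>Der_sub L S x" and k: "k\<in>sections L" "ALL y:S. k y = 0"
 shows "a k = 0"
proof -
 obtain a' where a': "a = restrict0 (sections L) (%s. a' (restrict0 S s))"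
  "a'\<in>section_derivations (Cinf_sub (base L) S) (sections_sub L S) (fibre L x) x" using a unfolding Der_sub_def by blast
 note D = section_derivationsD[OF a'(2)]
 have r: "restrict0 S k = (%y. 0)" using k(2) by (auto simp: restrict0_def)
 have "a' (%y. 0) = 0"
 proof (cases "(%y. 0)\<in>sections_sub L S")
  case True
  thus ?thesis using linear_functD(2)[OF D(3) True, of 0] by simp
 qed (rule D(1))
 thus ?thesis using a'(1) r k(1) by (simp add: restrict0_def[of "sections L"])
qed

context lift_triv
begin

lemmas basics = lift_basics[OF t1.L t2.L F] jprod_simps[OF t1.L t2.L F]

lemma base_atlas: "atlas (jbase L1 L2)" by (rule bp_atlas[OF basics(1,2)])

lemma S_pts: "S \<subseteq> pts (jbase L1 L2)" unfolding S_spt using spt_pt by blast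

text \<open>Differentiating along \<open>gam\<close> in direction \<open>v\<close> and adding
  \<open>t\<close> times the value uses a section only on the graph, so it is a derivation of the
  restricted line bundle. The work consists in carrying out linearity and the Leibniz rule in terms
  of the parameter.\<close>

lemma graph_Der_sub:
 assumes q: "q\<in>fdom" and r: "r\<in>sections L2"
 defines "z \<equiv> spt L1 L2 B q r" and "u \<equiv> (ph1 q, t2.jr r (fst B q))"
 shows "p.Z.der (frechet_derivative gam (at u) v, t) z\<in>Der_sub P S z"
proof -
 let ?C = "Cinf_sub (jbase L1 L2) S" and ?G = "sections_sub P S"
 have u: "u\<in>gdom" using q by (simp add: u_def)
 have gu: "p.Z.pt (gam u) = z" "p.pph z = gam u" "z\<in>W" unfolding z_def u_def by (rule spt_gam(3)[OF q r], rule spt_gam(2)[OF q r], rule spt_gam(1)[OF q r])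
 have zS: "z\<in>S" using gam_pt(1)[OF u] gu(1) by simp
 have zd: "z\<in>p.Z.dm" using gu(3) unfolding p.Z_dm by blast
 let ?e = "(e1 \<circ> fst \<circ> fst) z"
 have fib: "c *\<^sub>R ?e\<in>fibre P z" for c using p.Z.fibre_scale[OF zd] by (simp add: o_def)
 define h where "h s = (%u. p.Z.rep s (gam u))" for s
 define k where "k f = (%u. f (p.Z.pt (gam u)) :: real)" for f
 have hd: "h s differentiable (at u)" if "s\<in>?G" for s using rep_sub[OF that u] by (simp add: h_def)
 have kd: "k f differentiable (at u)" if "f\<in>?C" for f using fun_sub[OF that u] by (simp add: k_def)
 have fb: "s y\<in>fibre P y" if s: "s\<in>?G" and y: "y\<in>S" for s y
 proof -
  obtain W t where "y\<in>W" "smooth_section_on P W t" "ALL y:S Int W. s y = t y" using s y unfolding sections_sub_def by blast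
  thus ?thesis using y by (auto simp: smooth_section_on_def)
 qed
 have at: "p.Z.pt (gam w)\<in>S" "p.Z.pt (gam w)\<in>p.Z.dm" "p.pph (p.Z.pt (gam w)) = gam w" if "w\<in>gdom" for w
  using gam_pt[OF that] unfolding p.Z_dm by auto
 have hw: "h s w *\<^sub>R (e1 \<circ> fst \<circ> fst) (p.Z.pt (gam w)) = s (p.Z.pt (gam w))" if s: "s\<in>?G" and w: "w\<in>gdom" for s w
  using p.Z.rep_at[where s = s, OF at(2)[OF w] fb[OF s at(1)[OF w]]] at(3)[OF w] by (simp add: h_def o_def)
 have hz: "h s u *\<^sub>R ?e = s z" if "s\<in>?G" for s using hw[OF that u] gu(1) by simp
 have uniq: "h s w = c" if "w\<in>gdom" "s (p.Z.pt (gam w)) = c *\<^sub>R (e1 \<circ> fst \<circ> fst) (p.Z.pt (gam w))" for s w c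
  using p.Z.rep_phi[OF at(2)[OF that(1)], of s] p.Z.e_nz[OF at(2)[OF that(1)]] that(2) at(3)[OF that(1)] by (simp add: h_def o_def)
 have h_add: "h (%y. s y + s' y) w = h s w + h s' w" if "s\<in>?G" "s'\<in>?G" "w\<in>gdom" for s s' w
  by (rule uniq[OF that(3)]) (simp only: scaleR_add_left hw[OF that(1,3)] hw[OF that(2,3)])
 have h_mult: "h (%y. f y *\<^sub>R s y) w = k f w * h s w" if "s\<in>?G" "w\<in>gdom" for s f w
  by (rule uniq[OF that(2)]) (simp only: k_def hw[OF that] flip: scaleR_scaleR)
 have h_scale: "h (%y. c *\<^sub>R s y) w = c * h s w" if "s\<in>?G" "w\<in>gdom" for s c w
  by (rule uniq[OF that(2)]) (simp only: hw[OF that] flip: scaleR_scaleR)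
 define T where "T j = grad j u\<bullet>v" for j
 have T_cong: "T j = T j'" if "!!w. w\<in>gdom ==> j w = j' w" for j j' unfolding T_def using grad_cong[OF open_gdom u that] by simp
 have J: "jet1 j u = (grad j u, j u)" for j by (simp add: jet1_def)
 have T_add: "T (%w. j w + j' w) = T j + T j'" if "j differentiable (at u)" "j' differentiable (at u)" for j j'
  using jet1_add[OF that] by (simp add: T_def J inner_add_left)
 have T_mult: "T (%w. j w * j' w) = j u * T j' + T j * j' u" if "j differentiable (at u)" "j' differentiable (at u)" for j j'
  using jet1_mult[OF that] by (simp add: T_def J inner_add_left)
 have T_scale: "T (%w. c * j w) = c * T j" if "j differentiable (at u)" for j c using jet1_scale[OF that, of c] by (simp add: T_def J)
 note cl = secs_sub_closed[OF basics(3), unfolded basics(4)]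
 note cc = Cinf_sub_closed[OF base_atlas]
 have scl: "(%y. c *\<^sub>R s y)\<in>?G" if s: "s\<in>?G" for s c
 proof -
  have "(%y. restrict0 S (%y. c) y *\<^sub>R s y)\<in>?G" by (rule cl(2)[OF s Cinf_sub_const[OF base_atlas S_pts]])
  moreover have "(%y. restrict0 S (%y. c) y *\<^sub>R s y) = (%y. c *\<^sub>R s y)" using s by (auto simp: sections_sub_def zero_off_def restrict0_def)
  ultimately show ?thesis by simp
 qed
 have fcl: "(%y. c * f y)\<in>?C" if f: "f\<in>?C" for f c
 proof -
  have "(%y. restrict0 S (%y. c) y * f y)\<in>?C" by (rule cc(2)[OF Cinf_sub_const[OF base_atlas S_pts] f])
  moreover have "(%y. restrict0 S (%y. c) y * f y) = (%y. c * f y)" using f by (auto simp: Cinf_sub_def zero_off_def restrict0_def)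
  ultimately show ?thesis by simp
 qed
 define de where "de = restrict0 ?C (%f. T (k f))"
 define a where "a = restrict0 ?G (%s. (T (h s) + t * h s u) *\<^sub>R ?e)"
 have kz: "k f u = f z" for f by (simp add: k_def gu(1))
 have "de\<in>point_derivations ?C z" unfolding point_derivations_def
 proof (intro CollectI conjI ballI)
  show "zero_off ?C de" by (simp add: de_def zero_off_def restrict0_def)
  show "linear_funct ?C de" unfolding linear_funct_def using cc(1) fcl T_add[OF kd kd] T_scale[OF kd] by (simp add: de_def restrict0_def k_def)
  fix f g assume fg: "f\<in>?C" "g\<in>?C"
  show "de (%y. f y * g y) = f z * de g + de f * g z"
   using fg cc(2)[OF fg] T_mult[OF kd[OF fg(1)] kd[OF fg(2)]] kz by (simp add: de_def restrict0_def k_def)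
 qed
 moreover have "a (%y. f y *\<^sub>R s y) = f z *\<^sub>R a s + de f *\<^sub>R s z" if f: "f\<in>?C" and s: "s\<in>?G" for f s
 proof -
  have 1: "T (h (%y. f y *\<^sub>R s y)) = f z * T (h s) + T (k f) * h s u"
   using T_cong[OF h_mult[where f = f, OF s]] T_mult[OF kd[OF f] hd[OF s]] kz by simp
  show ?thesis using f s cl(2)[OF s f] h_mult[OF s u, of f] kz by (simp add: a_def de_def restrict0_def 1 algebra_simps flip: hz[OF s])
 qed
 moreover have "linear_funct ?G a" unfolding linear_funct_def
 proof (intro conjI ballI allI)
  fix s s' assume s: "s\<in>?G" "s'\<in>?G"
  have "T (h (%y. s y + s' y)) = T (h s) + T (h s')" using T_cong[OF h_add[OF s]] T_add[OF hd[OF s(1)] hd[OF s(2)]] by simp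
  thus "a (%y. s y + s' y) = a s + a s'" using s cl(1)[OF s] h_add[OF s u] by (simp add: a_def restrict0_def algebra_simps)
 next
  fix c s assume s: "s\<in>?G"
  have "T (h (%y. c *\<^sub>R s y)) = c * T (h s)" using T_cong[OF h_scale[OF s]] T_scale[OF hd[OF s]] by simp
  thus "a (%y. c *\<^sub>R s y) = c *\<^sub>R a s" using s scl[OF s] h_scale[OF s u] by (simp add: a_def restrict0_def algebra_simps)
 qed
 ultimately have "a\<in>section_derivations ?C ?G (fibre P z) z"
  unfolding section_derivations_def using fib by (auto simp: a_def zero_off_def restrict0_def)
 moreover have "p.Z.der (frechet_derivative gam (at u) v, t) z = restrict0 (sections P) (%s. a (restrict0 S s))"
 proof
  fix s show "p.Z.der (frechet_derivative gam (at u) v, t) z s = restrict0 (sections P) (%s. a (restrict0 S s)) s"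
  proof (cases "s\<in>sections P")
   case True
   have rs: "restrict0 S s\<in>?G" by (rule restrict_section_sub[OF basics(3) _ True]) (simp add: basics(4) S_pts)
   have hr: "h (restrict0 S s) w = p.Z.rep s (gam w)" if "w\<in>gdom" for w
    using at[OF that] p.Z.rep_phi[OF at(2)[OF that]] by (simp add: h_def restrict0_def)
   have d1: "(gam has_derivative frechet_derivative gam (at u)) (at u)" by (rule smooth_has_der[OF gam_smooth u])
   have d2: "(p.Z.rep s has_derivative (%v. grad (p.Z.rep s) (gam u)\<bullet>v)) (at (gam u))"
    using has_grad[OF p.Z.rep_diff[OF True zd]] gu(2) by simp
   have d3: "((%w. p.Z.rep s (gam w)) has_derivative (%v. grad (p.Z.rep s) (gam u)\<bullet>frechet_derivative gam (at u) v)) (at u)"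
    by (rule has_derivative_compose[OF d1 d2])
   have d4: "((%w. p.Z.rep s (gam w)) has_derivative (%v. grad (%w. p.Z.rep s (gam w)) u\<bullet>v)) (at u)"
    by (rule has_grad) (use d3 in \<open>auto simp: differentiable_def\<close>)
   have "T (%w. p.Z.rep s (gam w)) = grad (p.Z.rep s) (gam u)\<bullet>frechet_derivative gam (at u) v"
    unfolding T_def using fun_cong[OF has_derivative_unique[OF d4 d3], of v] .
   hence "T (h (restrict0 S s)) = grad (p.Z.rep s) (gam u)\<bullet>frechet_derivative gam (at u) v" using T_cong[OF hr] by simp
   hence "a (restrict0 S s) = (grad (p.Z.rep s) (gam u)\<bullet>frechet_derivative gam (at u) v + t * p.Z.rep s (gam u)) *\<^sub>R ?e"
    by (simp only: a_def restrict0_def[of ?G] rs if_True hr[OF u])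
   moreover have "p.Z.der (frechet_derivative gam (at u) v, t) z s = ((frechet_derivative gam (at u) v, t)\<bullet>jet1 (p.Z.rep s) (gam u)) *\<^sub>R ?e"
    unfolding gu(2)[symmetric] by (rule p.Z.der_sec[OF True])
   ultimately show ?thesis by (simp only: restrict0_def[of "sections P"] True if_True inner_jet1)
  qed (simp add: p.Z.der_def restrict0_def)
 qed
 ultimately show ?thesis unfolding Der_sub_def basics(4) by blast
qed

lemma gam_derivative:
 assumes "u\<in>gdom"
 shows "rho (frechet_derivative gam (at u) v) = v"
proof -
 have bl: "bounded_linear rho" by (simp add: linear_bounded_linear linear_rho)
 have "((%u. rho (gam u)) has_derivative (%v. rho (frechet_derivative gam (at u) v))) (at u)"
  by (rule bounded_linear.has_derivative[OF bl smooth_has_der[OF gam_smooth assms]])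
 hence "((%u. u) has_derivative (%v. rho (frechet_derivative gam (at u) v))) (at u)" by simp
 from fun_cong[OF has_derivative_unique[OF this has_derivative_ident], of v] show ?thesis .
qed

text \<open>Subtracting the tangential derivation with the same image under \<open>rho\<close>
  leaves a deviation \<open>d\<close> with \<open>rho d = 0\<close>. The equations
  \<open>lift_pi\<close> force its base part \<open>?ze\<close> on the second factor and its part
  \<open>?la\<close> along the matrix entry to vanish; the equations \<open>lift_la\<close> then do
  so for its fibre part \<open>?et\<close> on the first factor.\<close>

lemma Der_sub_I:
 assumes q: "q\<in>fdom" and r: "r\<in>sections L2" and z: "z = spt L1 L2 B q r" and a: "a\<in>Der P z"
  and k1: "!!s. s\<in>sections L2 ==> a (lift_pi L1 L2 B s) = 0"
  and k2: "!!A (b :: 'f \<times> real => _) f. related L1 L2 B A b f ==> a (lift_la L1 L2 A b f) = 0"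
 shows "a\<in>Der_sub P S z"
proof -
 let ?u = "(ph1 q, t2.jr r (fst B q))"
 note qp = t1.dm_pts[OF fdomD(1)[OF q]]
 have u: "?u\<in>gdom" using q by simp
 have zz: "p.pph z = gam ?u" "z\<in>W" unfolding z by (rule spt_gam(2)[OF q r], rule spt_gam(1)[OF q r])
 have zU: "z\<in>p.pU" using zz(2) by blast
 have zd: "z\<in>p.Z.dm" using zz(2) unfolding p.Z_dm by blast
 have fz: "fst z = (q, jet L1 (pull_section L1 B r) q)" "fst (snd z) = (fst B q, jet L2 r (fst B q))" by (simp_all add: z spt_def)
 have z1: "fst z\<in>t1.jU" "fst (snd z)\<in>t2.jU"
  using t1.jU_I[OF fdomD(1)[OF q] pull_in[OF t1.L t2.L F r]] t2.jU_I[OF fdomD(2)[OF q] r] by (simp_all add: fz)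
 obtain w where w: "a = p.Z.der w z" using p.Z.Der_der[OF zd a] by blast
 define v0 where "v0 = frechet_derivative gam (at ?u) (rho (fst w))"
 define d where "d = fst w - v0" \<comment> \<open>deviation of \<open>a\<close> from being tangent to the graph\<close>
 have b0: "p.Z.der (v0, snd w) z\<in>Der_sub P S z" unfolding v0_def z by (rule graph_Der_sub[OF q r])
 have "rho d = 0" unfolding d_def linear_diff[OF linear_rho] v0_def gam_derivative[OF u] by simp
 hence d0: "fst (fst d) = 0" "snd (fst (snd d)) = 0" by (simp_all add: rho_def prod_eq_iff)
 define D where "D = p.Z.der (d, 0) z"
 have D: "D\<in>Der P z" unfolding D_def by (rule p.Z.der_Der[OF zd])
 have D_eq: "D s = a s - p.Z.der (v0, snd w) z s" for s unfolding D_def w p.Z.der_diff[symmetric] d_def by (simp add: minus_prod_def)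
 have S0: "lift_pi L1 L2 B s y = 0" "related L1 L2 B A b f ==> lift_la L1 L2 A b f y = 0"
  if y: "y\<in>S" and s: "s\<in>sections L2" for s A f y and b :: "'f \<times> real => _"
 proof -
  obtain q' r' where y': "y = spt L1 L2 B q' r'" "q'\<in>pts (base L1)" "r'\<in>sections L2" using y unfolding S_spt by blast
  note V = lift_vanish[OF t1.L t2.L F y'(2,3) y'(1)[unfolded spt_def]]
  show "lift_pi L1 L2 B s y = 0" by (rule V(1)[OF s])
  show "related L1 L2 B A b f ==> lift_la L1 L2 A b f y = 0" by (rule V(2))
 qed
 have D1: "D (lift_pi L1 L2 B s) = 0" if s: "s\<in>sections L2" for s
  unfolding D_eq k1[OF s] using Der_sub_vanish[OF b0 lift_pi_sections[OF t1.L t2.L F s]] S0(1)[OF _ s] by simp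
 have D2: "D (lift_la L1 L2 A b f) = 0" if R: "related L1 L2 B A b f" for A f and b :: "'f \<times> real => _"
  unfolding D_eq k2[OF R] using Der_sub_vanish[OF b0 lift_la_sections(2)[OF t1.L t2.L F R]] S0(2)[OF _ r R] by simp
 let ?c = "snd (snd (p.pph z))" and ?e = "(e1 \<circ> fst \<circ> fst) z"
 have c0: "?c ~= 0" by (rule p.pph_simps(3)[OF zU])
 have e0: "?e ~= 0" using p.Z.e_nz[OF zd] by (simp add: o_def)
 let ?et = "snd (fst d)" and ?ze = "fst (fst (snd d))" and ?la = "snd (snd d)"
 have dd: "d = ((0, ?et), (?ze, 0), ?la)" using d0 by (simp add: prod_eq_iff)
 have Dpl1: "D (pl1 (JL L1) (JL L2) s) = (?et\<bullet>snd (fst (j1.J.jr s (fst z)))) *\<^sub>R ?e"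
  if s: "s\<in>sections (JL L1)" for s unfolding D_def p.Z.der_sec[OF pl1_sections[OF basics(1,2) s]] p.Z_jr_pl1[OF s zU]
  by (subst dd) (simp add: inner_prod_def o_def)
 have Dpl2: "D (pl2 (JL L1) (JL L2) s) =
   (inverse ?c * (?ze\<bullet>fst (fst (j2.J.jr s (fst (snd z))))) - ?la * snd (j2.J.jr s (fst (snd z))) / ?c^2) *\<^sub>R ?e"
  if s: "s\<in>sections (JL L2)" for s unfolding D_def p.Z.der_sec[OF pl2_sections[OF basics(1,2) s]] p.Z_jr_pl2[OF s zU refl]
  by (subst dd) (simp add: inner_prod_def o_def)
 have Dpi1: "D (pi1 L1 L2 s) = 0" if s: "s\<in>sections L1" for s
  unfolding pi1_def Dpl1[OF jet_pull_in[OF t1.L s]] j1.J_jr_pi[OF s z1(1)] by simp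
 have Dpi2: "D (pi2 L1 L2 s) = (inverse ?c * (?ze\<bullet>fst (t2.jr s (fst B q))) - ?la * snd (t2.jr s (fst B q)) / ?c^2) *\<^sub>R ?e" if s: "s\<in>sections L2" for s
  unfolding pi2_def Dpl2[OF jet_pull_in[OF t2.L s]] j2.J_jr_pi[OF s z1(2)] by (simp add: fz)
 have "D (pi2 L1 L2 s) = 0" if s: "s\<in>sections L2" for s using D1[OF s] Dpi1[OF pull_in[OF t1.L t2.L F s]]
   Der_diff[OF basics(3) D lift_in(1)[OF t1.L t2.L F pull_in[OF t1.L t2.L F s]] lift_in(3)[OF t1.L t2.L F s]]
  unfolding lift_pi_def by simp
 hence zero: "inverse ?c * (?ze\<bullet>g) - ?la * t / ?c^2 = 0" for g t
 proof -
  obtain s where s: "s\<in>sections L2" "t2.jr s (fst B q) = (g, t)" using t2.jr_obtain[OF fdomD(2)[OF q]] .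
  show ?thesis using Dpi2[OF s(1)] \<open>!!s. s\<in>sections L2 ==> D (pi2 L1 L2 s) = 0\<close>[OF s(1)] e0 unfolding s(2) by simp
 qed
 have lam: "?la = 0" using zero[of 0 1] c0 by simp
 have zeta: "?ze = 0" by (rule onb_eqI) (use zero[of _ 0] c0 in simp)
 have Dla2: "D (la2 L1 L2 b) = 0" if "b\<in>derivations L2" for b
  unfolding la2_def Dpl2[OF jet_linear_in[OF t2.L that]] lam zeta by simp
 have eta: "?et = 0"
 proof (rule onb_eqI)
  fix x :: "'e \<times> real"
  \<comment> \<open>\<open>A\<close> has the prescribed coefficient \<open>x\<close> at
    \<open>q\<close>. As \<open>D\<close> already kills the terms from the second factor, the
    equation of \<open>A\<close> says that \<open>?et\<close> is orthogonal to
    \<open>x\<close>.\<close>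
  obtain A f and b :: "'f \<times> real => _" where R: "related L1 L2 B A b f" "(%s. A s q) = t1.der x q" using related_obtain[OF q] by blast
  note A = relatedD(1)[OF t1.L t2.L F R(1)]
  obtain wA where wA: "smooth_on t1.img wA" "ALL x:t1.dm. (%s. A s x) = t1.der (wA (ph1 x)) x" using t1.ders_field[OF A] by blast
  have wx: "wA (ph1 q) = x" using t1.der_inj[OF fdomD(1)[OF q], of "wA (ph1 q)" x] wA(2) R(2) fdomD(1)[OF q] by simp
  have t0: "D (%y. base_fun L1 L2 (f c) y *\<^sub>R la2 L1 L2 (b c) y) = 0" if c: "c\<in>onb" for c
   using Der_base_fun0[OF t1.L t2.L F qp r z[unfolded spt_def] D _ relatedD(3)[OF t1.L t2.L F R(1) c] lift_in(4)[OF t1.L t2.L F relatedD(2)[OF t1.L t2.L F R(1) c]]]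
    Dpi1 Dla2[OF relatedD(2)[OF t1.L t2.L F R(1) c]] by simp
  have "D (la1 L1 L2 A) = 0" using D2[OF R(1)] unfolding Der_lift_la[OF t1.L t2.L F qp r z[unfolded spt_def] D R(1)] by (simp add: t0)
  hence "?et\<bullet>x = 0"
   using e0 unfolding la1_def Dpl1[OF jet_linear_in[OF t1.L A]] j1.J_jr_lin(1)[OF A wA z1(1)] by (simp add: fz wx)
  thus "?et\<bullet>x = 0\<bullet>x" by simp
 qed
 have "d = 0" by (subst dd) (simp add: lam zeta eta zero_prod_def)
 hence "w = (v0, snd w)" by (simp add: d_def prod_eq_iff)
 thus ?thesis using b0 w by simp
qed

end

text \<open>The push-forwards of \<open>D\<close> along both projections vanish on the generators of
  the jet bundles, hence altogether; then \<open>D\<close> kills all pull-backs along the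
  projections, and these separate derivations.\<close>

lemma (in lift_triv) Der_gens:
 assumes z: "z\<in>pts (jbase L1 L2)" and D: "D\<in>Der P z"
  and G1: "!!s. s\<in>sections L1 ==> D (pi1 L1 L2 s) = 0" "!!a. a\<in>derivations L1 ==> D (la1 L1 L2 a) = 0"
  and G2: "!!r. r\<in>sections L2 ==> D (pi2 L1 L2 r) = 0" "!!b. b\<in>derivations L2 ==> D (la2 L1 L2 b) = 0"
 shows "D = (%s. 0)"
proof -
 have zb: "z\<in>pts (base P)" using z by (simp add: basics(4))
 have p: "fst z\<in>pts (JM L1)" "fst (snd z)\<in>pts (JM L2)"
  and i: "linear_iso_on (fibre (JL L1) (fst z)) (fibre (JL L2) (fst (snd z))) (snd (snd z))"
  using z by (auto simp: bp_simps)
 note F1 = proj1_factor[OF basics(1,2)] and F2 = proj2_factor[OF basics(1,2)]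
 note M1 = Der_map_sec[OF basics(3,1) F1] and M2 = Der_map_sec[OF basics(3,2) F2]
 have i0: "snd (snd z) 0 = 0" using lin_isoD(6)[OF i subspace_0[OF lbD(3)[OF basics(1)]], of 0] p by simp
 have D1: "Der_map P (JL L1) proj1 z D = (%s. 0)"
 proof (rule jet_spanning_eq[OF basics(1) jet_spanning_gens[OF t1.L] _ _ zero_Der[OF basics(1)]])
  show "fst z\<in>pts (base (JL L1))" "fst z\<in>pts (base (JL L1))" using p by simp_all
  show "Der_map P (JL L1) proj1 z D\<in>Der (JL L1) (fst z)"
   using Der_map_Der[OF basics(3,1) F1 zb D] by (simp add: proj1_eq)
  fix g assume "g\<in>jet_gens L1"
  then consider s where "s\<in>sections L1" "g = jet_pull_section L1 s"
   | a where "a\<in>derivations L1" "g = jet_linear_section L1 a" unfolding jet_gens_def by blast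
  thus "Der_map P (JL L1) proj1 z D g = 0"
  proof cases
   case (1 s)
   show ?thesis unfolding 1(2) M1[OF jet_pull_in[OF t1.L 1(1)]] G1(1)[OF 1(1), unfolded pi1_def] by (simp add: proj1_eq)
  next
   case (2 a)
   show ?thesis unfolding 2(2) M1[OF jet_linear_in[OF t1.L 2(1)]] G1(2)[OF 2(1), unfolded la1_def] by (simp add: proj1_eq)
  qed
 qed
 have D2: "Der_map P (JL L2) proj2 z D = (%s. 0)"
 proof (rule jet_spanning_eq[OF basics(2) jet_spanning_gens[OF t2.L] _ _ zero_Der[OF basics(2)]])
  show "fst (snd z)\<in>pts (base (JL L2))" "fst (snd z)\<in>pts (base (JL L2))" using p by simp_all
  show "Der_map P (JL L2) proj2 z D\<in>Der (JL L2) (fst (snd z))"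
   using Der_map_Der[OF basics(3,2) F2 zb D] by (simp add: proj2_eq)
  fix g assume "g\<in>jet_gens L2"
  then consider s where "s\<in>sections L2" "g = jet_pull_section L2 s"
   | a where "a\<in>derivations L2" "g = jet_linear_section L2 a" unfolding jet_gens_def by blast
  thus "Der_map P (JL L2) proj2 z D g = 0"
  proof cases
   case (1 s)
   show ?thesis unfolding 1(2) M2[OF jet_pull_in[OF t2.L 1(1)]] G2(1)[OF 1(1), unfolded pi2_def] by (simp add: proj2_eq i0)
  next
   case (2 a)
   show ?thesis unfolding 2(2) M2[OF jet_linear_in[OF t2.L 2(1)]] G2(2)[OF 2(1), unfolded la2_def] by (simp add: proj2_eq i0)
  qed
 qed
 obtain U1 ph1 V1 e1 U2 ph2 V2 e2 where t: "ptriv (JL L1) U1 ph1 V1 e1 (JL L2) U2 ph2 V2 e2"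
  "z\<in>prod_triv.pU (JL L1) U1 V1 (JL L2) U2 V2" by (rule lp_pt[OF basics(1,2) z])
 show ?thesis
 proof (rule ptriv.gens_separate[OF t D])
  fix s assume s: "s\<in>sections (JL L1)"
  show "D (pl1 (JL L1) (JL L2) s) = 0" using M1[OF s, of z D] fun_cong[OF D1, of s] by (simp add: proj1_eq)
 next
  fix s assume s: "s\<in>sections (JL L2)"
  have "snd (snd z) (D (pl2 (JL L1) (JL L2) s)) = 0" using M2[OF s, of z D] fun_cong[OF D2, of s] by (simp add: proj2_eq)
  moreover have "D (pl2 (JL L1) (JL L2) s)\<in>fibre (JL L1) (fst z)"
   using DerD(2)[OF D pl2_sections[OF basics(1,2) s]] by (simp add: basics(5))
  ultimately show "D (pl2 (JL L1) (JL L2) s) = 0"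
   using lin_isoD(2)[OF i] lin_isoD(2)[OF i subspace_0[OF lbD(3)[OF basics(1)]]] p i0 by (metis jet_lb_simps(1))
 qed
qed

section \<open>Hyperplane condition and coisotropy\<close>

text \<open>Its linear section sends a jet to its value. In the canonical bracket that section
  reproduces basic sections and has zero bracket with linear ones, which makes it an ingredient of
  the section whose bracket is the identity at a point.\<close>

definition id_derivation where "id_derivation L = (%s x. if s\<in>sections L then s x else 0)"

lemma id_derivation: "line_bundle L ==> id_derivation L\<in>derivations L"
proof -
 assume L: "line_bundle L"
 have "(%s. id_derivation L s x)\<in>Der L x" if x: "x\<in>pts (base L)" for x
 proof -
  obtain U ph V e where t: "triv L U ph V e" "x\<in>U Int V" using triv_obtain[OF L x] .
  interpret triv L U ph V e by fact
  have xd: "x\<in>dm" using t(2) by (simp add: dm_def)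
  have "(%s. id_derivation L s x) = der (0, 1) x" using rep_section[OF xd] by (auto simp: id_derivation_def der_def restrict0_def inner_prod_def)
  thus ?thesis using der_Der[OF xd] by simp
 qed
 moreover have "id_derivation L s = s" if "s\<in>sections L" for s using that by (simp add: id_derivation_def)
 ultimately show ?thesis by (auto simp: derivations_def) (auto simp: id_derivation_def)
qed

lemma id_ders_at: "s\<in>sections L ==> id_derivation L s = s" by (simp add: id_derivation_def)

lemma canonical_op_surjective:
 assumes L: "line_bundle L"
 shows "ALL x:pts (base (JL L)). ALL a:Der (JL L) x. EX s:sections (JL L). a = (%r. canonical_bracket L s r x)"
  "ALL x:pts (base (JL L)). ALL a:Der (JL L) x. EX s:sections (JL L). a = (%r. op_bracket (canonical_bracket L) s r x)"
proof -
 show 1: "ALL x:pts (base (JL L)). ALL a:Der (JL L) x. EX s:sections (JL L). a = (%r. canonical_bracket L s r x)"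
  using canonical_Der[OF L] by simp
 note J = jet_line_bundle[OF L]
 show "ALL x:pts (base (JL L)). ALL a:Der (JL L) x. EX s:sections (JL L). a = (%r. op_bracket (canonical_bracket L) s r x)"
 proof (intro ballI)
  fix x a assume x: "x\<in>pts (base (JL L))" and a: "a\<in>Der (JL L) x"
  have "(%s. -1 *\<^sub>R a s)\<in>Der (JL L) x" by (rule Der_closed(2)[OF J x a a])
  then obtain s where s: "s\<in>sections (JL L)" "(%s. -1 *\<^sub>R a s) = (%r. canonical_bracket L s r x)" using 1 x by blast
  have "a r = op_bracket (canonical_bracket L) s r x" for r using fun_cong[OF s(2), of r] by (simp add: op_bracket_def) (metis minus_minus)
  thus "EX s:sections (JL L). a = (%r. op_bracket (canonical_bracket L) s r x)" using s(1) by blast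
 qed
qed

lemma (in lift_triv) tangent_hyperplane:
 assumes q: "q\<in>fdom" and r: "r\<in>sections L2" and z: "z = spt L1 L2 B q r"
  and d: "de\<in>tangent_sub (jbase L1 L2) S z"
 shows "de\<in>hyperplane P (jbr L1 L2) z"
proof -
 let ?M = "jbase L1 L2" and ?br = "jbr L1 L2"
 note qp = t1.dm_pts[OF fdomD(1)[OF q]] and zs = z[unfolded spt_def]
 note ctx = t1.L t2.L F qp r zs
 note A = base_atlas and bd = lift_bd[OF t1.L t2.L F]
 have zW: "z\<in>W" unfolding z by (rule spt_gam(1)[OF q r])
 have zd: "z\<in>p.Z.dm" using zW unfolding p.Z_dm by blast
 have zS: "z\<in>S" unfolding S_spt using z qp r by blast
 have zp: "z\<in>pts ?M" using zS S_pts by blast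
 hence zb: "z\<in>pts (base P)" by (simp add: basics(4))
 obtain de' where de': "de = restrict0 (Cinf ?M) (%f. de' (restrict0 S f))" "de'\<in>point_derivations (Cinf_sub ?M S) z"
  using d unfolding tangent_sub_def by blast
 note rs = restrict_sub[OF A S_pts]
 have lin: "linear_funct (Cinf_sub ?M S) de'" and leib: "!!f g. f\<in>Cinf_sub ?M S ==> g\<in>Cinf_sub ?M S ==> de' (%y. f y * g y) = f z * de' g + de' f * g z"
  using de'(2) by (auto simp: point_derivations_def)
 have rz: "restrict0 S f z = f z" for f :: "_ => real" using zS by (simp add: restrict0_def)
 have "de\<in>tangent ?M z" unfolding tangent_def point_derivations_def
 proof (intro CollectI conjI ballI)
  show "zero_off (Cinf ?M) de" by (simp add: de'(1) zero_off_def restrict0_def[of "Cinf ?M"])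
  show "linear_funct (Cinf ?M) de" unfolding linear_funct_def
  proof (intro conjI ballI allI)
   fix f g assume fg: "f\<in>Cinf ?M" "g\<in>Cinf ?M"
   show "de (%y. f y + g y) = de f + de g" using fg Cinf_add[OF A fg] linear_functD(1)[OF lin rs[OF fg(1)] rs[OF fg(2)]]
    by (simp add: de'(1) restrict0_def[of "Cinf ?M"] restrict0_op(1))
  next
   fix c f assume f: "f\<in>Cinf ?M"
   show "de (%y. c *\<^sub>R f y) = c *\<^sub>R de f"
    using f Cinf_scale[OF A f, of c] linear_functD(2)[OF lin rs[OF f], of c] restrict0_op(2)[of S c f]
    by (simp add: de'(1) restrict0_def[of "Cinf ?M"])
  qed
  fix f g assume fg: "f\<in>Cinf ?M" "g\<in>Cinf ?M"
  show "de (%y. f y * g y) = f z * de g + de f * g z" using fg Cinf_mult[OF A fg] leib[OF rs[OF fg(1)] rs[OF fg(2)]]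
   by (simp add: de'(1) restrict0_def[of "Cinf ?M"] restrict0_op(4) rz)
 qed
 hence "de\<in>tangent (base P) z" by (simp add: basics(4))
 then obtain v where v: "de = p.Z.tan v z" using p.Z.tangent_eq[OF zd] by blast
 have d0: "de f = 0" if f: "f\<in>Cinf ?M" "!!y. y\<in>S ==> f y = 0" for f
 proof -
  have "restrict0 S f = (%y. 0 *\<^sub>R restrict0 S f y)" using f(2) by (auto simp: restrict0_def)
  hence "de' (restrict0 S f) = 0" using linear_functD(2)[OF lin rs[OF f(1)], of 0] by simp
  thus ?thesis by (simp add: de'(1) restrict0_def[of "Cinf ?M"])
 qed
 \<comment> \<open>A lift of the tangent vector to a derivation; any lift has symbol
   \<open>de\<close>, and the zero vertical part makes it kill sections vanishing on the
   graph.\<close>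
 define a where "a = p.Z.der (v, 0) z"
 have aD: "a\<in>Der P z" unfolding a_def by (rule p.Z.der_Der[OF zd])
 have sym: "symbol P z a = de" unfolding a_def v by (simp add: p.Z.symbol_der[OF zd])
 \<comment> \<open>The coefficient of \<open>k\<close> in the frame, cut off, is a global function
   vanishing on the graph, so \<open>de\<close> kills it; the vertical part of \<open>a\<close> is
   0.\<close>
 have a0: "a k = 0" if k: "k\<in>sections P" "!!y. y\<in>S ==> k y = 0" for k
 proof -
  have oD: "openin (mtop ?M) p.Z.dm" using p.Z.opn_dm by (simp add: basics(4))
  obtain ka W' Z where K: "ka\<in>Cinf ?M" "openin (mtop ?M) W'" "z\<in>W'" "W' \<subseteq> p.Z.dm" "ALL y:W'. ka y = 1"
   "openin (mtop ?M) Z" "p.Z.dm Un Z = pts ?M" "ALL y:Z. ka y = 0"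
   using manifold_bump[OF bp_mfd[OF basics(1,2)] oD zd] by (elim bexE exE conjE) (rule that)
  let ?g = "%y. coord ((e1 \<circ> fst \<circ> fst) y) (k y)"
  have "smooth_fun_on (base P) p.Z.dm ?g" by (rule p.Z.fun_smoothI[OF p.Z.opn_dm subset_refl p.Z.open_img p.Z.rep_smooth[OF k(1)]])
    (rule conjI[OF p.Z.phi_img p.Z.rep_phi[symmetric]])
  hence "(%y. ka y * ?g y)\<in>Cinf ?M" by (intro cutoff_smooth[OF A K(1) oD K(6,7)]) (use K(8) in \<open>simp_all add: basics(4)\<close>)
  note f = this
  have "ka y * ?g y = 0" if y: "y\<in>S" for y
  proof (cases "y\<in>p.Z.dm")
   case True
   thus ?thesis using k(2)[OF y] p.Z.e_nz[OF True] by (simp add: o_def)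
  next
   case False
   hence "y\<in>Z" using K(7) y S_pts by blast
   thus ?thesis using K(8) by simp
  qed
  from d0[OF f this] have "v\<bullet>grad (%y. ka (p.Z.pt y) * ?g (p.Z.pt y)) (p.pph z) = 0"
   using f unfolding v p.Z.tan_def restrict0_def basics(4) by (simp only: if_True)
  moreover have "grad (%y. ka (p.Z.pt y) * ?g (p.Z.pt y)) (p.pph z) = grad (p.Z.rep k) (p.pph z)"
  proof (rule grad_cong)
   show "open (p.pph ` (p.Z.dm Int W'))" using p.Z.open_image[of W'] K(2) by (simp add: basics(4))
   show "p.pph z\<in>p.pph ` (p.Z.dm Int W')" using zd K(3) by blast
   fix y assume "y\<in>p.pph ` (p.Z.dm Int W')"
   then obtain x where x: "x\<in>p.Z.dm" "x\<in>W'" "y = p.pph x" by blast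
   show "ka (p.Z.pt y) * ?g (p.Z.pt y) = p.Z.rep k y" unfolding x(3) p.Z.pt_phi[OF x(1)] p.Z.rep_phi[OF x(1)] using K(5) x(2) by simp
  qed
  ultimately have "v\<bullet>grad (p.Z.rep k) (p.pph z) = 0" by simp
  thus ?thesis unfolding a_def p.Z.der_sec[OF k(1)] inner_jet1 by (simp only: inner_commute) simp
 qed
 obtain s where s: "s\<in>sections P" "a = (%h. ?br s h z)"
  using product_Der[OF basics(1,2) lift_formed[OF t1.L t2.L F] canonical_op_surjective(1)[OF t1.L] canonical_op_surjective(2)[OF t2.L] zp aD] by blast
 let ?i1 = "id_derivation L1" and ?i2 = "id_derivation L2"
 note i1 = id_derivation[OF t1.L] and i2 = id_derivation[OF t2.L]
 note ls = lift_in[OF t1.L t2.L F] and at = lift_at[OF ctx]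
 let ?pb = "pull_section L1 B"
 have pr: "?pb r\<in>sections L1" by (rule pull_in[OF t1.L t2.L F r])
 \<comment> \<open>\<open>?h\<close> gives the right bracket with basic sections of both factors;
   the difference appears since the second bracket is opposite. With linear sections it gives 0, and
   \<open>- lift_pi L1 L2 B r\<close> supplies their values at \<open>z\<close>, where their jets
   are evaluated on \<open>r\<close>. All parts vanish on the graph.\<close>
 let ?h = "%y. la1 L1 L2 ?i1 y - la2 L1 L2 ?i2 y"
 let ?k = "%y. ?h y - lift_pi L1 L2 B r y"
 have hs: "?h\<in>sections P" by (rule secs_diff[OF basics(3) ls(2)[OF i1] ls(4)[OF i2]])
 have ks: "?k\<in>sections P" by (rule secs_diff[OF basics(3) hs lift_pi_sections[OF t1.L t2.L F r]])
 have kS: "?k y = 0" if y: "y\<in>S" for y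
 proof -
  obtain q' r' where y': "y = spt L1 L2 B q' r'" "q'\<in>pts (base L1)" "r'\<in>sections L2" using y unfolding S_spt by blast
  note c' = t1.L t2.L F y'(2,3) y'(1)[unfolded spt_def]
  show ?thesis using lift_vanish(1)[OF c' r] lift_at(2)[OF c' i1] lift_at(4)[OF c' i2]
   by (simp add: id_ders_at[OF pull_in[OF t1.L t2.L F y'(3)]] id_ders_at[OF y'(3)])
 qed
 have "a ?k = 0" by (rule a0[OF ks kS])
 hence "?br s ?k z = 0" unfolding s(2) .
 hence ks0: "?br ?k s z = 0" using brz_skew[OF ctx, of ?k s] by simp
 note bD = brz_Der[OF ctx] and m = brz_mixed[OF ctx] and b1 = brz_1[OF ctx] and b2 = brz_2[OF ctx]
 have ev: "p.Z.der (0, 1) z g = g z" if "g\<in>sections P" for g using p.Z.rep_section[OF zd that] unfolding p.Z.der_sec[OF that] inner_jet1 by simp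
 have kk: "?br ?k g z = ?br (la1 L1 L2 ?i1) g z - ?br (la2 L1 L2 ?i2) g z - (?br (pi1 L1 L2 (?pb r)) g z - ?br (pi2 L1 L2 r) g z)"
  if g: "g\<in>sections P" for g
 proof -
  have 1: "?br ?k g z = ?br ?h g z - ?br (lift_pi L1 L2 B r) g z" by (rule Der_diff[OF basics(3) bD(2)[OF g] hs lift_pi_sections[OF t1.L t2.L F r]])
  have 2: "?br ?h g z = ?br (la1 L1 L2 ?i1) g z - ?br (la2 L1 L2 ?i2) g z" by (rule Der_diff[OF basics(3) bD(2)[OF g] ls(2)[OF i1] ls(4)[OF i2]])
  have 3: "?br (lift_pi L1 L2 B r) g z = ?br (pi1 L1 L2 (?pb r)) g z - ?br (pi2 L1 L2 r) g z"
   unfolding lift_pi_def by (rule Der_diff[OF basics(3) bD(2)[OF g] ls(1)[OF pr] ls(3)[OF r]])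
  show ?thesis unfolding 1 2 3 by (rule refl)
 qed
 define E where "E = (%g. ?br ?k g z - p.Z.der (0, 1) z g)"
 have ED: "E\<in>Der P z" unfolding E_def by (rule Der_closed(3)[OF basics(3) zb bD(1)[OF ks] p.Z.der_Der[OF zd]])
 have Eg: "E g = ?br (la1 L1 L2 ?i1) g z - ?br (la2 L1 L2 ?i2) g z - (?br (pi1 L1 L2 (?pb r)) g z - ?br (pi2 L1 L2 r) g z) - g z"
  if "g\<in>sections P" for g unfolding E_def kk[OF that] ev[OF that] by (rule refl)
 have "E = (%g. 0)"
 proof (rule Der_gens[OF zp ED])
  fix t assume t: "t\<in>sections L1"
  show "E (pi1 L1 L2 t) = 0"
   unfolding Eg[OF ls(1)[OF t]] b1(3)[OF t t i1 i1] m(6)[OF t i1 r i2] b1(1)[OF pr t i1 i1] m(5)[OF t i1 r i2] at(1)[OF t] by (simp add: id_ders_at[OF t])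
 next
  fix A assume A: "A\<in>derivations L1"
  show "E (la1 L1 L2 A) = 0" unfolding Eg[OF ls(2)[OF A]] b1(4)[OF pr pr i1 A] m(8)[OF pr A r i2] b1(2)[OF pr pr A A] m(7)[OF pr A r i2] at(2)[OF A]
   by (simp add: id_ders_at[OF pr] id_ders_at[OF dersD(1)[OF A pr]])
 next
  fix t assume t: "t\<in>sections L2"
  show "E (pi2 L1 L2 t) = 0"
   unfolding Eg[OF ls(3)[OF t]] m(3)[OF pr i1 t i2] b2(3)[OF t t i2 i2] m(1)[OF pr i1 t i2] b2(1)[OF r t i2 i2] at(3)[OF t] by (simp add: id_ders_at[OF t])
 next
  fix b assume b: "b\<in>derivations L2"
  show "E (la2 L1 L2 b) = 0" unfolding Eg[OF ls(4)[OF b]] m(4)[OF pr i1 r b] b2(4)[OF r r i2 b] m(2)[OF pr i1 r b] b2(2)[OF r r b b] at(4)[OF b]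
   by (simp add: id_ders_at[OF r] id_ders_at[OF dersD(1)[OF b r]])
 qed
 hence "E s = 0" by simp
 hence sz: "s z = 0" unfolding E_def using ks0 ev[OF s(1)] by simp
 have r0: "p.Z.rep s (p.pph z) = 0" unfolding p.Z.rep_phi[OF zd] sz by (rule coord_zero[OF p.Z.e_nz[OF zd]])
 \<comment> \<open>Near \<open>z\<close> the section \<open>s\<close> is a function \<open>f\<close>
   times a unit section \<open>e\<close>, with \<open>f\<close> zero at \<open>z\<close>. The
   Hamiltonian field of \<open>s\<close> thereby takes the form that defines the hyperplane.\<close>
 obtain e T1 where e: "e\<in>sections P" "open T1" "p.pph z\<in>T1" "T1 \<subseteq> UNIV Int p.Z.img" "ALL y:T1. p.Z.rep e y = 1"
  using p.Z.rep_extend[OF open_UNIV smooth_const zd UNIV_I, of 1] by (elim bexE exE conjE) (rule that)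
 obtain f T2 where f: "f\<in>Cinf (base P)" "open T2" "p.pph z\<in>T2" "T2 \<subseteq> p.Z.img Int p.Z.img" "ALL y:T2. f (p.Z.pt y) = p.Z.rep s y"
  using p.Z.Cinf_extend_chart[OF p.Z.open_img p.Z.rep_smooth[OF s(1)] zd p.Z.phi_img[OF zd]] by (elim bexE exE conjE) (rule that)
 have fe: "(%y. f y *\<^sub>R e y)\<in>sections P" by (rule secs_mult[OF basics(3) f(1) e(1)])
 let ?T = "p.Z.dm Int p.pph -` (T1 Int T2)"
 have loc: "(f y *\<^sub>R e y) = s y" if y: "y\<in>?T" for y
 proof -
  have yd: "y\<in>p.Z.dm" "p.pph y\<in>T1" "p.pph y\<in>T2" using y by auto
  have "f y = p.Z.rep s (p.pph y)" using f(5) yd p.Z.pt_phi[OF yd(1)] by metis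
  moreover have "e y = 1 *\<^sub>R (e1 \<circ> fst \<circ> fst) y" using p.Z.rep_section[OF yd(1) e(1)] e(5) yd(2) by (simp add: o_def)
  ultimately show ?thesis using p.Z.rep_section[OF yd(1) s(1)] by (simp add: o_def)
 qed
 have brfe: "?br (%y. f y *\<^sub>R e y) g z = ?br s g z" for g
 proof (cases "g\<in>sections P")
  case True
  show ?thesis by (rule Der_local[OF basics(3) bD(2)[OF True] fe s(1) p.Z.open_preimage[OF open_Int[OF e(2) f(2)]] _ loc]) (use zd e(3) f(3) in auto)
 qed (use bidersD(1)[OF bd] in simp)
 have fz: "f z = 0" using f(3,5) r0 p.Z.pt_phi[OF zd] by metis
 have "ham_field P ?br (%y. f y *\<^sub>R e y) z = de" unfolding ham_field_def brfe s(2)[symmetric] by (rule sym)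
 hence "de = (%g. ham_field P ?br (%y. f y *\<^sub>R e y) z g - f z * ham_field P ?br e z g)" by (simp add: fz)
 thus ?thesis unfolding hyperplane_def using f(1) e(1) by blast
qed

text \<open>The brackets with the equations are tangent, as the equations have zero mutual brackets
  on the graph. If the jet of \<open>s\<close> annihilates all tangent derivations, it annihilates
  these; so each equation has zero bracket with \<open>s\<close> at \<open>z\<close>. By skew
  symmetry the derivation given by \<open>s\<close> kills every equation, hence is tangent.\<close>

lemma (in lift_triv) coisotropic_at:
 assumes q: "q\<in>fdom" and r: "r\<in>sections L2" and z: "z = spt L1 L2 B q r"
  and al: "al\<in>Jet P z" "ALL a:Der_sub P S z. al a = 0"
 shows "Pi_sharp P (jbr L1 L2) z al\<in>Der_sub P S z"
proof -
 let ?br = "jbr L1 L2"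
 note qp = t1.dm_pts[OF fdomD(1)[OF q]] and zs = z[unfolded spt_def]
 note ctx = t1.L t2.L F qp r zs
 note bD = brz_Der[OF ctx] and skew = brz_skew[OF ctx]
 have "z\<in>pts (jbase L1 L2)" unfolding z by (rule spt_pt[OF qp r])
 hence zb: "z\<in>pts (base P)" by (simp add: basics(4))
 obtain s where s: "s\<in>sections P" "al = jet P s z" using Jet_eq[OF basics(3) zb] al(1) by blast
 have zero: "?br s g z = 0" if g: "g\<in>sections P" "(%h. ?br g h z)\<in>Der_sub P S z" for g
 proof -
  have "al (%h. ?br g h z) = 0" using al(2) g(2) by blast
  hence "?br g s z = 0" using bD(1)[OF g(1)] by (simp add: s(2) jet_def restrict0_def)
  thus ?thesis using skew[of s g] by simp
 qed
 note ps = lift_pi_sections[OF t1.L t2.L F] and las = lift_la_sections(2)[OF t1.L t2.L F]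
 have 1: "(%h. ?br (lift_pi L1 L2 B t) h z)\<in>Der_sub P S z" if t: "t\<in>sections L2" for t
  by (rule Der_sub_I[OF q r z bD(1)[OF ps[OF t]]]) (rule brz_pi_pi[OF ctx t], assumption, rule brz_pi_la[OF ctx t], assumption)
 have 2: "(%h. ?br (lift_la L1 L2 A b f) h z)\<in>Der_sub P S z" if R: "related L1 L2 B A b f" for A f and b :: "'f \<times> real => _"
 proof (rule Der_sub_I[OF q r z bD(1)[OF las[OF R]]])
  show "?br (lift_la L1 L2 A b f) (lift_pi L1 L2 B t) z = 0" if "t\<in>sections L2" for t
   using skew[of "lift_la L1 L2 A b f"] brz_pi_la[OF ctx that R] by simp
 qed (rule brz_la_la[OF ctx R])
 have "Pi_sharp P ?br z al = (%h. ?br s h z)" unfolding s(2) by (rule Pi_sharp_jet[OF basics(3) lift_bd[OF t1.L t2.L F] zb s(1)])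
 thus ?thesis using Der_sub_I[OF q r z bD(1)[OF s(1)] zero[OF ps 1] zero[OF las 2]] by simp
qed

lemma lift_triv_obtain:
 fixes L1 :: "('m, 'e::findim, 'l::real_vector) line_bundle" and L2 :: "('n, 'f::findim, 'k::real_vector) line_bundle"
 assumes "line_bundle L1" "line_bundle L2" "factor L1 L2 B" "z\<in>jet_lift L1 L2 B"
 obtains U1 ph1 V1 e1 U2 ph2 V2 e2 q r where "lift_triv L1 U1 ph1 V1 e1 L2 U2 ph2 V2 e2 B"
  "q\<in>factor_triv.fdom U1 V1 U2 V2 B" "r\<in>sections L2" "z = spt L1 L2 B q r"
proof -
 obtain q r where z: "z = spt L1 L2 B q r" "q\<in>pts (base L1)" "r\<in>sections L2"
  using assms(4) unfolding jet_lift_eq[OF assms(1-3)] spt_def by blast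
 obtain U1 ph1 V1 e1 U2 ph2 V2 e2 where t: "factor_triv L1 U1 ph1 V1 e1 L2 U2 ph2 V2 e2 B"
  "q\<in>U1 Int V1" "fst B q\<in>U2 Int V2" using factor_triv_obtain[OF assms(1-3) z(2)] .
 interpret factor_triv L1 U1 ph1 V1 e1 L2 U2 ph2 V2 e2 B by fact
 have "q\<in>fdom" using t(2,3) by (simp add: fdom_def t1.dm_def t2.dm_def)
 thus thesis by (rule that[OF factor_triv_lift_triv[OF t(1)] _ z(3,1)])
qed

lemma jet_lift_legendrian:
 fixes L1 :: "('m, 'e::findim, 'l::real_vector) line_bundle" and L2 :: "('n, 'f::findim, 'k::real_vector) line_bundle"
 assumes L: "line_bundle L1" "line_bundle L2" "factor L1 L2 B"
 shows "legendrian (jprod L1 L2) (jbr L1 L2) (jet_lift L1 L2 B)" unfolding legendrian_def coisotropic_def jprod_simps[OF L]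
proof (intro conjI ballI)
 let ?S = "jet_lift L1 L2 B"
 show "submanifold (jbase L1 L2) ?S" unfolding submanifold_def
 \<comment> \<open>The slice is the same subspace in all trivialisations, so its dimension serves as
   the common one.\<close>
 proof (intro conjI exI[of _ "dim (range (emb :: 'e \<times> 'f \<times> real => _))"] ballI)
  show "?S \<subseteq> pts (jbase L1 L2)"
  proof
   fix z assume "z\<in>?S"
   then obtain U1 ph1 V1 e1 U2 ph2 V2 e2 q r where t: "lift_triv L1 U1 ph1 V1 e1 L2 U2 ph2 V2 e2 B"
    "q\<in>factor_triv.fdom U1 V1 U2 V2 B" "r\<in>sections L2" "z = spt L1 L2 B q r" by (rule lift_triv_obtain[OF L])
   thus "z\<in>pts (jbase L1 L2)" using lift_triv.S_pts[OF t(1)] \<open>z\<in>?S\<close> by blast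
  qed
  fix z assume "z\<in>?S"
  then obtain U1 ph1 V1 e1 U2 ph2 V2 e2 q r where t: "lift_triv L1 U1 ph1 V1 e1 L2 U2 ph2 V2 e2 B"
   "q\<in>factor_triv.fdom U1 V1 U2 V2 B" "r\<in>sections L2" "z = spt L1 L2 B q r" by (rule lift_triv_obtain[OF L])
  interpret lift_triv L1 U1 ph1 V1 e1 L2 U2 ph2 V2 e2 B by fact
  have "z\<in>W" unfolding t(4) by (rule spt_gam(1)[OF t(2,3)])
  moreover have "subspace (range (emb :: 'e \<times> 'f \<times> real => _))" by (rule linear_subspace_image[OF linear_emb subspace_UNIV])
  ultimately show "\<exists>W ps V. smooth_chart (jbase L1 L2) (W, ps) & z\<in>W & subspace V & dim V = dim (range (emb :: 'e \<times> 'f \<times> real => _)) \<and>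
    ps ` (?S Int W) = ps ` W Int V"
   using slice_chart by (intro exI[of _ W] exI[of _ "%z. p.pph z - gam (rho (p.pph z)) + emb (rho (p.pph z))"] exI[of _ "range emb"] conjI refl)
 qed
 fix z assume "z\<in>?S"
 then obtain U1 ph1 V1 e1 U2 ph2 V2 e2 q r where t: "lift_triv L1 U1 ph1 V1 e1 L2 U2 ph2 V2 e2 B"
  "q\<in>factor_triv.fdom U1 V1 U2 V2 B" "r\<in>sections L2" "z = spt L1 L2 B q r" by (rule lift_triv_obtain[OF L])
 show "tangent_sub (jbase L1 L2) ?S z \<subseteq> hyperplane (jprod L1 L2) (jbr L1 L2) z" using lift_triv.tangent_hyperplane[OF t] by blast
 show "Pi_sharp (jprod L1 L2) (jbr L1 L2) z ` {al\<in>Jet (jprod L1 L2) z. ALL a:Der_sub (jprod L1 L2) ?S z. al a = 0}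
   \<subseteq> Der_sub (jprod L1 L2) ?S z" using lift_triv.coisotropic_at[OF t] by blast
qed

theorem proposition4p3p4:
  fixes L :: "('m, 'e::findim, 'l::real_vector) line_bundle"
    and L\<^sub>1 :: "('m1, 'e1::findim, 'l1::real_vector) line_bundle"
    and L\<^sub>2 :: "('m2, 'e2::findim, 'l2::real_vector) line_bundle"
    and L\<^sub>3 :: "('m3, 'e3::findim, 'l3::real_vector) line_bundle"
    and B :: "('m1, 'l1, 'm2, 'l2) bundle_map"
    and B' :: "('m2, 'l2, 'm3, 'l3) bundle_map"
  shows "(line_bundle L \<longrightarrow> contact_object (jet_line_bundle L) (canonical_bracket L)) \<and>
    (line_bundle L\<^sub>1 \<and> line_bundle L\<^sub>2 \<and> factor L\<^sub>1 L\<^sub>2 B \<longrightarrow>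
       legendrian_relation (jet_line_bundle L\<^sub>1) (canonical_bracket L\<^sub>1)
         (jet_line_bundle L\<^sub>2) (canonical_bracket L\<^sub>2) (jet_lift L\<^sub>1 L\<^sub>2 B)) \<and>
    (line_bundle L \<longrightarrow> jet_lift L L id_factor = diagonal_relation (jet_line_bundle L)) \<and>
    (line_bundle L\<^sub>1 \<and> line_bundle L\<^sub>2 \<and> line_bundle L\<^sub>3 \<and> factor L\<^sub>1 L\<^sub>2 B \<and> factor L\<^sub>2 L\<^sub>3 B' \<longrightarrow>
       jet_lift L\<^sub>1 L\<^sub>3 (comp_factor B' B) =
         relation_comp (jet_lift L\<^sub>1 L\<^sub>2 B) (jet_lift L\<^sub>2 L\<^sub>3 B'))"
proof (intro conjI impI)
  show "line_bundle L \<Longrightarrow> contact_object (jet_line_bundle L) (canonical_bracket L)" by (rule canonical_contact)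
  show "line_bundle L \<Longrightarrow> jet_lift L L id_factor = diagonal_relation (jet_line_bundle L)" by (rule jet_lift_id)
  assume "line_bundle L\<^sub>1 \<and> line_bundle L\<^sub>2 \<and> factor L\<^sub>1 L\<^sub>2 B"
  then show "legendrian_relation (jet_line_bundle L\<^sub>1) (canonical_bracket L\<^sub>1) (jet_line_bundle L\<^sub>2) (canonical_bracket L\<^sub>2) (jet_lift L\<^sub>1 L\<^sub>2 B)"
    unfolding legendrian_relation_def by (intro conjI canonical_contact jet_lift_legendrian) auto
next
  assume "line_bundle L\<^sub>1 \<and> line_bundle L\<^sub>2 \<and> line_bundle L\<^sub>3 \<and> factor L\<^sub>1 L\<^sub>2 B \<and> factor L\<^sub>2 L\<^sub>3 B'"
  then show "jet_lift L\<^sub>1 L\<^sub>3 (comp_factor B' B) = relation_comp (jet_lift L\<^sub>1 L\<^sub>2 B) (jet_lift L\<^sub>2 L\<^sub>3 B')" by (intro jet_lift_comp) auto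
qed

end
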